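(* Let $p$ be a prime, $C_p$ the cyclic group with $p$ elements and $k$ a field of characteristic $p$. Let $\mathscr{F}=\mathrm{Stab}(kC_p)$ be the stable module category of $kC_p$-modules modulo projectives. Then: (a) Any object of $\mathrm{Stab}(kC_p)$ is a coproduct of compact ones. (b) Any non-zero compact object $x$ of $\mathrm{Stab}(kC_p)$ is $\otimes$-faithful, i.e. $x\otimes-\colon\mathscr{F}\to\mathscr{F}$ is faithful. (c) Any non-zero coproduct-preserving tt-functor $F\colon\mathscr{F}\to\mathscr{S}$ into a big tt-category $\mathscr{S}$ is faithful. (d) Every object of $\mathscr{F}$ is pure-injective, i.e. $\mathscr{F}$ is pure-semisimple. Moreover, every indecomposable object of $\mathscr{F}$ is endofinite.
   Context: $\mathrm{Stab}(kC_p)$ is the additive quotient of the category of all (not necessarily finitely generated) $kC_p$-modules by the subcategory of projective modules, with its usual triangulated structure and tensor product $\otimes=\otimes_k$ with diagonal group action. A big tt-category is a rigidly-compactly generated tensor-triangulated category $\mathscr{T}$: a triangulated category with all small coproducts and a closed symmetric monoidal structure $\otimes$ (unit $1$), exact and coproduct-preserving in each variable, such that the compact objects and the rigid (i.e. strongly dualizable) objects coincide, and the full subcategory $\mathscr{T}^c$ of compact-rigid objects is essentially small and generates $\mathscr{T}$ as a localizing subcategory. A tt-functor is an exact strong symmetric monoidal functor. For $X\in\mathscr{F}$ write $\hat X=\mathrm{Hom}_{\mathscr{F}}(-,X)|_{\mathscr{F}^c}$. A morphism $Y\to Z$ is a pure mono if $\hat Y\to\hat Z$ is a monomorphism of functors;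 $Y$ is pure-injective if every pure mono $Y\to Z$ splits. An object $X$ is endofinite if for every compact $c$ the $\mathrm{End}_{\mathscr{F}}(X)$-module $\mathrm{Hom}_{\mathscr{F}}(c,X)$ has finite length. *)

theory Defs
  imports "HOL-Algebra.Module" "HOL-Algebra.Elementary_Groups" "HOL-Algebra.Multiplicative_Group" "HOL-Computational_Algebra.Primes"
begin

unbundle cardinal_syntax

section \<open>Smallness\<close>

text \<open>
  The role of a universe of sets is played by a type \<open>'u\<close>: a set is small if it has fewer elements
  than \<open>'u\<close>. If the cardinality of \<open>'u\<close> is inaccessible, this is smallness with respect to a
  Grothendieck universe. In general only an infinite regular cardinality is assumed, so that small
  unions of small sets are small; then the modules below are all modules of cardinality less than
  that of \<open>'u\<close>. Taking successor cardinals, every module (and every small family) is covered.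
\<close>

definition small :: "'u itself \<Rightarrow> 'a set \<Rightarrow> bool" where
  "small U A \<longleftrightarrow> |A| <o |UNIV :: 'u set|"

definition universe_type :: "'u itself \<Rightarrow> bool" where
  "universe_type U \<longleftrightarrow> infinite (UNIV :: 'u set) \<and> regularCard |UNIV :: 'u set|"


section \<open>Additive categories\<close>

text \<open>Composition \<open>g \<bullet> f\<close> means: first \<open>f\<close>, then \<open>g\<close>.\<close>

record ('o, 'm) cat =
  Ob :: "'o set"
  Mor :: "'o \<Rightarrow> 'o \<Rightarrow> 'm set"
  idm :: "'o \<Rightarrow> 'm"
  cmp :: "'m \<Rightarrow> 'm \<Rightarrow> 'm"  (infixr \<open>\<bullet>\<index>\<close> 55)
  addm :: "'m \<Rightarrow> 'm \<Rightarrow> 'm"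
  zerom :: "'o \<Rightarrow> 'o \<Rightarrow> 'm"

text \<open>Hom-groups are abelian groups in the sense of \<^locale>\<open>comm_group\<close>, whose operation is written
  multiplicatively in HOL-Algebra.\<close>

definition hom_group :: "('o, 'm, 'x) cat_scheme \<Rightarrow> 'o \<Rightarrow> 'o \<Rightarrow> 'm monoid" where
  "hom_group C X Y = \<lparr>carrier = Mor C X Y, monoid.mult = addm C, one = zerom C X Y\<rparr>"

locale preadditive_category =
  fixes C (structure)
  assumes idm_closed: "X \<in> Ob C \<Longrightarrow> idm C X \<in> Mor C X X"
    and cmp_closed: "\<lbrakk>X \<in> Ob C; Y \<in> Ob C; Z \<in> Ob C; f \<in> Mor C X Y; g \<in> Mor C Y Z\<rbrakk>
      \<Longrightarrow> g \<bullet> f \<in> Mor C X Z"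
    and idm_right: "\<lbrakk>X \<in> Ob C; Y \<in> Ob C; f \<in> Mor C X Y\<rbrakk> \<Longrightarrow> f \<bullet> idm C X = f"
    and idm_left: "\<lbrakk>X \<in> Ob C; Y \<in> Ob C; f \<in> Mor C X Y\<rbrakk> \<Longrightarrow> idm C Y \<bullet> f = f"
    and cmp_assoc: "\<lbrakk>W \<in> Ob C; X \<in> Ob C; Y \<in> Ob C; Z \<in> Ob C;
        f \<in> Mor C W X; g \<in> Mor C X Y; h \<in> Mor C Y Z\<rbrakk> \<Longrightarrow> (h \<bullet> g) \<bullet> f = h \<bullet> (g \<bullet> f)"
    and comm_group_hom: "\<lbrakk>X \<in> Ob C; Y \<in> Ob C\<rbrakk> \<Longrightarrow> comm_group (hom_group C X Y)"
    and cmp_add_right: "\<lbrakk>X \<in> Ob C; Y \<in> Ob C; Z \<in> Ob C;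
        f \<in> Mor C X Y; f' \<in> Mor C X Y; g \<in> Mor C Y Z\<rbrakk>
      \<Longrightarrow> g \<bullet> addm C f f' = addm C (g \<bullet> f) (g \<bullet> f')"
    and cmp_add_left: "\<lbrakk>X \<in> Ob C; Y \<in> Ob C; Z \<in> Ob C;
        f \<in> Mor C X Y; g \<in> Mor C Y Z; g' \<in> Mor C Y Z\<rbrakk>
      \<Longrightarrow> addm C g g' \<bullet> f = addm C (g \<bullet> f) (g' \<bullet> f)"

definition inverse_mors :: "('o, 'm, 'x) cat_scheme \<Rightarrow> 'o \<Rightarrow> 'o \<Rightarrow> 'm \<Rightarrow> 'm \<Rightarrow> bool" where
  "inverse_mors C X Y f g \<longleftrightarrow> f \<in> Mor C X Y \<and> g \<in> Mor C Y X \<and>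
     g \<bullet>\<^bsub>C\<^esub> f = idm C X \<and> f \<bullet>\<^bsub>C\<^esub> g = idm C Y"

definition iso_mor :: "('o, 'm, 'x) cat_scheme \<Rightarrow> 'o \<Rightarrow> 'o \<Rightarrow> 'm \<Rightarrow> bool" where
  "iso_mor C X Y f \<longleftrightarrow> (\<exists>g. inverse_mors C X Y f g)"

definition inv_mor :: "('o, 'm, 'x) cat_scheme \<Rightarrow> 'o \<Rightarrow> 'o \<Rightarrow> 'm \<Rightarrow> 'm" where
  "inv_mor C X Y f = (THE g. inverse_mors C X Y f g)"

definition isomorphic :: "('o, 'm, 'x) cat_scheme \<Rightarrow> 'o \<Rightarrow> 'o \<Rightarrow> bool" where
  "isomorphic C X Y \<longleftrightarrow> (\<exists>f. iso_mor C X Y f)"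

definition zero_object :: "('o, 'm, 'x) cat_scheme \<Rightarrow> 'o \<Rightarrow> bool" where
  "zero_object C X \<longleftrightarrow> X \<in> Ob C \<and>
     (\<forall>Y\<in>Ob C. (\<exists>!f. f \<in> Mor C X Y) \<and> (\<exists>!f. f \<in> Mor C Y X))"

definition is_biproduct ::
  "('o, 'm, 'x) cat_scheme \<Rightarrow> 'o \<Rightarrow> 'o \<Rightarrow> 'o \<Rightarrow> 'm \<Rightarrow> 'm \<Rightarrow> 'm \<Rightarrow> 'm \<Rightarrow> bool" where
  "is_biproduct C A B X i j p q \<longleftrightarrow> A \<in> Ob C \<and> B \<in> Ob C \<and> X \<in> Ob C \<and>
     i \<in> Mor C A X \<and> j \<in> Mor C B X \<and> p \<in> Mor C X A \<and> q \<in> Mor C X B \<and>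
     p \<bullet>\<^bsub>C\<^esub> i = idm C A \<and> q \<bullet>\<^bsub>C\<^esub> j = idm C B \<and>
     q \<bullet>\<^bsub>C\<^esub> i = zerom C A B \<and> p \<bullet>\<^bsub>C\<^esub> j = zerom C B A \<and>
     addm C (i \<bullet>\<^bsub>C\<^esub> p) (j \<bullet>\<^bsub>C\<^esub> q) = idm C X"

definition indecomposable :: "('o, 'm, 'x) cat_scheme \<Rightarrow> 'o \<Rightarrow> bool" where
  "indecomposable C X \<longleftrightarrow> X \<in> Ob C \<and> \<not> zero_object C X \<and>
     (\<forall>A B i j p q. is_biproduct C A B X i j p q \<longrightarrow> zero_object C A \<or> zero_object C B)"

locale additive_category = preadditive_category +
  assumes ex_zero: "\<exists>X. zero_object C X"
    and ex_biproduct: "\<lbrakk>A \<in> Ob C; B \<in> Ob C\<rbrakk> \<Longrightarrow> \<exists>X i j p q. is_biproduct C A B X i j p q"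


subsection \<open>Coproducts and compact objects\<close>

definition is_coproduct ::
  "('o, 'm, 'x) cat_scheme \<Rightarrow> 'i set \<Rightarrow> ('i \<Rightarrow> 'o) \<Rightarrow> 'o \<Rightarrow> ('i \<Rightarrow> 'm) \<Rightarrow> bool" where
  "is_coproduct C I A X \<iota> \<longleftrightarrow> X \<in> Ob C \<and> (\<forall>i\<in>I. A i \<in> Ob C \<and> \<iota> i \<in> Mor C (A i) X) \<and>
     (\<forall>Y\<in>Ob C. \<forall>\<phi>. (\<forall>i\<in>I. \<phi> i \<in> Mor C (A i) Y) \<longrightarrow>
        (\<exists>!f. f \<in> Mor C X Y \<and> (\<forall>i\<in>I. f \<bullet>\<^bsub>C\<^esub> \<iota> i = \<phi> i)))"

definition has_small_coproducts :: "'u itself \<Rightarrow> ('o, 'm, 'x) cat_scheme \<Rightarrow> bool" where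
  "has_small_coproducts U C \<longleftrightarrow> (\<forall>(I :: 'u set) A. small U I \<and> (\<forall>i\<in>I. A i \<in> Ob C) \<longrightarrow>
     (\<exists>X \<iota>. is_coproduct C I A X \<iota>))"

text \<open>\<open>c\<close> is compact if for all small coproducts \<open>X = \<Coprod>\<^sub>i A\<^sub>i\<close> the canonical map
  \<open>\<Oplus>\<^sub>i Hom(c, A\<^sub>i) \<rightarrow> Hom(c, X)\<close> is bijective. An element of the left-hand side is a family in the
  product with finite support.\<close>

definition compact_object :: "'u itself \<Rightarrow> ('o, 'm, 'x) cat_scheme \<Rightarrow> 'o \<Rightarrow> bool" where
  "compact_object U C c \<longleftrightarrow> c \<in> Ob C \<and>
     (\<forall>(I :: 'u set) A X \<iota>. small U I \<and> is_coproduct C I A X \<iota> \<longrightarrow>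
        bij_betw
          (\<lambda>\<phi>. finprod (hom_group C c X) (\<lambda>i. \<iota> i \<bullet>\<^bsub>C\<^esub> \<phi> i) {i\<in>I. \<phi> i \<noteq> zerom C c (A i)})
          {\<phi> \<in> (\<Pi>\<^sub>E i\<in>I. Mor C c (A i)). finite {i\<in>I. \<phi> i \<noteq> zerom C c (A i)}}
          (Mor C c X))"


subsection \<open>Purity\<close>

text \<open>A morphism of abelian-group-valued functors is a monomorphism if and only if all its components
  are injective.\<close>

definition pure_mono ::
  "'u itself \<Rightarrow> ('o, 'm, 'x) cat_scheme \<Rightarrow> 'o \<Rightarrow> 'o \<Rightarrow> 'm \<Rightarrow> bool" where
  "pure_mono U C Y Z f \<longleftrightarrow> f \<in> Mor C Y Z \<and>
     (\<forall>c. compact_object U C c \<longrightarrow> inj_on (\<lambda>g. f \<bullet>\<^bsub>C\<^esub> g) (Mor C c Y))"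

definition pure_injective :: "'u itself \<Rightarrow> ('o, 'm, 'x) cat_scheme \<Rightarrow> 'o \<Rightarrow> bool" where
  "pure_injective U C Y \<longleftrightarrow> Y \<in> Ob C \<and>
     (\<forall>Z\<in>Ob C. \<forall>f. pure_mono U C Y Z f \<longrightarrow> (\<exists>r\<in>Mor C Z Y. r \<bullet>\<^bsub>C\<^esub> f = idm C Y))"

text \<open>The submodules of the left \<open>End(X)\<close>-module \<open>Hom(c, X)\<close>; finite length means that there is a
  composition series.\<close>

definition end_submodule :: "('o, 'm, 'x) cat_scheme \<Rightarrow> 'o \<Rightarrow> 'o \<Rightarrow> 'm set \<Rightarrow> bool" where
  "end_submodule C c X H \<longleftrightarrow> subgroup H (hom_group C c X) \<and>
     (\<forall>h\<in>H. \<forall>e\<in>Mor C X X. e \<bullet>\<^bsub>C\<^esub> h \<in> H)"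

definition hom_finite_length :: "('o, 'm, 'x) cat_scheme \<Rightarrow> 'o \<Rightarrow> 'o \<Rightarrow> bool" where
  "hom_finite_length C c X \<longleftrightarrow> (\<exists>n H. H 0 = {zerom C c X} \<and> H n = Mor C c X \<and>
     (\<forall>i\<le>n::nat. end_submodule C c X (H i)) \<and>
     (\<forall>i<n. H i \<subset> H (Suc i) \<and>
        (\<forall>L. end_submodule C c X L \<and> H i \<subseteq> L \<and> L \<subseteq> H (Suc i) \<longrightarrow> L = H i \<or> L = H (Suc i))))"

definition endofinite :: "'u itself \<Rightarrow> ('o, 'm, 'x) cat_scheme \<Rightarrow> 'o \<Rightarrow> bool" where
  "endofinite U C X \<longleftrightarrow> X \<in> Ob C \<and> (\<forall>c. compact_object U C c \<longrightarrow> hom_finite_length C c X)"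


subsection \<open>Functors\<close>

record ('o, 'm, 'p, 'n) fctr =
  fob :: "'o \<Rightarrow> 'p"
  fmo :: "'m \<Rightarrow> 'n"

definition additive_functor ::
  "('o, 'm, 'x) cat_scheme \<Rightarrow> ('p, 'n, 'y) cat_scheme \<Rightarrow> ('o, 'm, 'p, 'n) fctr \<Rightarrow> bool" where
  "additive_functor C D F \<longleftrightarrow>
     (\<forall>X\<in>Ob C. fob F X \<in> Ob D \<and> fmo F (idm C X) = idm D (fob F X)) \<and>
     (\<forall>X\<in>Ob C. \<forall>Y\<in>Ob C. \<forall>f\<in>Mor C X Y. fmo F f \<in> Mor D (fob F X) (fob F Y)) \<and>
     (\<forall>X\<in>Ob C. \<forall>Y\<in>Ob C. \<forall>Z\<in>Ob C. \<forall>f\<in>Mor C X Y. \<forall>g\<in>Mor C Y Z.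
        fmo F (g \<bullet>\<^bsub>C\<^esub> f) = fmo F g \<bullet>\<^bsub>D\<^esub> fmo F f) \<and>
     (\<forall>X\<in>Ob C. \<forall>Y\<in>Ob C. \<forall>f\<in>Mor C X Y. \<forall>g\<in>Mor C X Y.
        fmo F (addm C f g) = addm D (fmo F f) (fmo F g))"

definition faithful_functor :: "('o, 'm, 'x) cat_scheme \<Rightarrow> ('o, 'm, 'p, 'n) fctr \<Rightarrow> bool" where
  "faithful_functor C F \<longleftrightarrow> (\<forall>X\<in>Ob C. \<forall>Y\<in>Ob C. inj_on (fmo F) (Mor C X Y))"

definition equivalence_functor ::
  "('o, 'm, 'x) cat_scheme \<Rightarrow> ('p, 'n, 'y) cat_scheme \<Rightarrow> ('o, 'm, 'p, 'n) fctr \<Rightarrow> bool" where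
  "equivalence_functor C D F \<longleftrightarrow> additive_functor C D F \<and>
     (\<forall>X\<in>Ob C. \<forall>Y\<in>Ob C. bij_betw (fmo F) (Mor C X Y) (Mor D (fob F X) (fob F Y))) \<and>
     (\<forall>Z\<in>Ob D. \<exists>X\<in>Ob C. isomorphic D (fob F X) Z)"

definition preserves_coproducts ::
  "'u itself \<Rightarrow> ('o, 'm, 'x) cat_scheme \<Rightarrow> ('p, 'n, 'y) cat_scheme \<Rightarrow>
   ('o, 'm, 'p, 'n) fctr \<Rightarrow> bool" where
  "preserves_coproducts U C D F \<longleftrightarrow>
     (\<forall>(I :: 'u set) A X \<iota>. small U I \<and> is_coproduct C I A X \<iota> \<longrightarrow>
        is_coproduct D I (\<lambda>i. fob F (A i)) (fob F X) (\<lambda>i. fmo F (\<iota> i)))"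

definition nonzero_functor ::
  "('o, 'm, 'x) cat_scheme \<Rightarrow> ('p, 'n, 'y) cat_scheme \<Rightarrow> ('o, 'm, 'p, 'n) fctr \<Rightarrow> bool" where
  "nonzero_functor C D F \<longleftrightarrow> (\<exists>X\<in>Ob C. \<not> zero_object D (fob F X))"


section \<open>Triangulated categories\<close>

text \<open>\<open>(X, Y, Z, f, g, h) \<in> tri C\<close> stands for a distinguished triangle
  \<open>X \<rightarrow> Y \<rightarrow> Z \<rightarrow> \<Sigma>X\<close> with maps \<open>f, g, h\<close>.\<close>

record ('o, 'm) tricat = "('o, 'm) cat" +
  sho :: "'o \<Rightarrow> 'o"
  shm :: "'m \<Rightarrow> 'm"
  tri :: "('o \<times> 'o \<times> 'o \<times> 'm \<times> 'm \<times> 'm) set"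

definition shift_functor :: "('o, 'm, 'x) tricat_scheme \<Rightarrow> ('o, 'm, 'o, 'm) fctr" where
  "shift_functor C = \<lparr>fob = sho C, fmo = shm C\<rparr>"

text \<open>The shift is passed separately, since this notion is also used before \<open>tri\<close> is available.\<close>

definition triangle ::
  "('o, 'm, 'x) cat_scheme \<Rightarrow> ('o \<Rightarrow> 'o) \<Rightarrow> 'o \<times> 'o \<times> 'o \<times> 'm \<times> 'm \<times> 'm \<Rightarrow> bool" where
  "triangle C S = (\<lambda>(X, Y, Z, f, g, h). X \<in> Ob C \<and> Y \<in> Ob C \<and> Z \<in> Ob C \<and>
     f \<in> Mor C X Y \<and> g \<in> Mor C Y Z \<and> h \<in> Mor C Z (S X))"

definition triangle_iso ::
  "('o, 'm, 'x) cat_scheme \<Rightarrow> ('m \<Rightarrow> 'm) \<Rightarrow>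
   'o \<times> 'o \<times> 'o \<times> 'm \<times> 'm \<times> 'm \<Rightarrow> 'o \<times> 'o \<times> 'o \<times> 'm \<times> 'm \<times> 'm \<Rightarrow> bool" where
  "triangle_iso C s = (\<lambda>(X, Y, Z, f, g, h) (X', Y', Z', f', g', h').
     \<exists>a b c. iso_mor C X X' a \<and> iso_mor C Y Y' b \<and> iso_mor C Z Z' c \<and>
       b \<bullet>\<^bsub>C\<^esub> f = f' \<bullet>\<^bsub>C\<^esub> a \<and> c \<bullet>\<^bsub>C\<^esub> g = g' \<bullet>\<^bsub>C\<^esub> b \<and> s a \<bullet>\<^bsub>C\<^esub> h = h' \<bullet>\<^bsub>C\<^esub> c)"

locale triangulated_category = additive_category +
  assumes shift_equivalence: "equivalence_functor C C (shift_functor C)"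
    and tri_triangle: "t \<in> tri C \<Longrightarrow> triangle C (sho C) t"
    and tri_iso: "\<lbrakk>t \<in> tri C; triangle C (sho C) t'; triangle_iso C (shm C) t t'\<rbrakk> \<Longrightarrow> t' \<in> tri C"
    and tri_id: "\<lbrakk>X \<in> Ob C; zero_object C Z\<rbrakk>
      \<Longrightarrow> (X, X, Z, idm C X, zerom C X Z, zerom C Z (sho C X)) \<in> tri C"
    and tri_ex: "\<lbrakk>X \<in> Ob C; Y \<in> Ob C; f \<in> Mor C X Y\<rbrakk> \<Longrightarrow> \<exists>Z g h. (X, Y, Z, f, g, h) \<in> tri C"
    and tri_rotate: "triangle C (sho C) (X, Y, Z, f, g, h) \<Longrightarrow>
      (X, Y, Z, f, g, h) \<in> tri C \<longleftrightarrow>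
      (Y, Z, sho C X, g, h, inv\<^bsub>hom_group C (sho C X) (sho C Y)\<^esub> (shm C f)) \<in> tri C"
    and tri_mor: "\<lbrakk>(X, Y, Z, f, g, h) \<in> tri C; (X', Y', Z', f', g', h') \<in> tri C;
        a \<in> Mor C X X'; b \<in> Mor C Y Y'; b \<bullet> f = f' \<bullet> a\<rbrakk>
      \<Longrightarrow> \<exists>c\<in>Mor C Z Z'. c \<bullet> g = g' \<bullet> b \<and> shm C a \<bullet> h = h' \<bullet> c"
    and tri_octahedron: "\<lbrakk>(X, Y, Z', u, j, k) \<in> tri C; (Y, Z, X', v, l, i) \<in> tri C;
        (X, Z, Y', v \<bullet> u, m, n) \<in> tri C\<rbrakk>
      \<Longrightarrow> \<exists>f g. (Z', Y', X', f, g, shm C j \<bullet> i) \<in> tri C \<and>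
            l = g \<bullet> m \<and> k = n \<bullet> f \<and> i \<bullet> g = shm C u \<bullet> n \<and> f \<bullet> j = m \<bullet> v"

definition exact_functor ::
  "('o, 'm, 'x) tricat_scheme \<Rightarrow> ('p, 'n, 'y) tricat_scheme \<Rightarrow> ('o, 'm, 'p, 'n) fctr \<Rightarrow> bool" where
  "exact_functor C D F \<longleftrightarrow> additive_functor C D F \<and>
     (\<exists>\<phi>. (\<forall>X\<in>Ob C. iso_mor D (fob F (sho C X)) (sho D (fob F X)) (\<phi> X)) \<and>
          (\<forall>X\<in>Ob C. \<forall>Y\<in>Ob C. \<forall>f\<in>Mor C X Y.
             \<phi> Y \<bullet>\<^bsub>D\<^esub> fmo F (shm C f) = shm D (fmo F f) \<bullet>\<^bsub>D\<^esub> \<phi> X) \<and>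
          (\<forall>X Y Z f g h. (X, Y, Z, f, g, h) \<in> tri C \<longrightarrow>
             (fob F X, fob F Y, fob F Z, fmo F f, fmo F g, \<phi> X \<bullet>\<^bsub>D\<^esub> fmo F h) \<in> tri D))"

definition localizing_subcategory ::
  "'u itself \<Rightarrow> ('o, 'm, 'x) tricat_scheme \<Rightarrow> 'o set \<Rightarrow> bool" where
  "localizing_subcategory U C L \<longleftrightarrow> L \<subseteq> Ob C \<and> (\<forall>Z. zero_object C Z \<longrightarrow> Z \<in> L) \<and>
     (\<forall>X\<in>L. \<forall>Y\<in>Ob C. isomorphic C X Y \<longrightarrow> Y \<in> L) \<and>
     (\<forall>X\<in>Ob C. sho C X \<in> L \<longleftrightarrow> X \<in> L) \<and>
     (\<forall>X Y Z f g h. (X, Y, Z, f, g, h) \<in> tri C \<and> X \<in> L \<and> Y \<in> L \<longrightarrow> Z \<in> L) \<and>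
     (\<forall>(I :: 'u set) A X \<iota>. small U I \<and> is_coproduct C I A X \<iota> \<and> (\<forall>i\<in>I. A i \<in> L) \<longrightarrow> X \<in> L)"


section \<open>Tensor triangulated categories\<close>

record ('o, 'm) ttcat = "('o, 'm) tricat" +
  tob :: "'o \<Rightarrow> 'o \<Rightarrow> 'o"  (infixr \<open>\<boxtimes>\<index>\<close> 70)
  tmo :: "'m \<Rightarrow> 'm \<Rightarrow> 'm"  (infixr \<open>\<boxdot>\<index>\<close> 70)
  unt :: "'o"
  assoc :: "'o \<Rightarrow> 'o \<Rightarrow> 'o \<Rightarrow> 'm"
  luni :: "'o \<Rightarrow> 'm"
  runi :: "'o \<Rightarrow> 'm"
  braid :: "'o \<Rightarrow> 'o \<Rightarrow> 'm"

locale symmetric_monoidal =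
  fixes C :: "('o, 'm, 'x) ttcat_scheme" (structure)
  assumes unt_closed: "unt C \<in> Ob C"
    and tob_closed: "\<lbrakk>X \<in> Ob C; Y \<in> Ob C\<rbrakk> \<Longrightarrow> X \<boxtimes> Y \<in> Ob C"
    and tmo_closed: "\<lbrakk>X \<in> Ob C; X' \<in> Ob C; Y \<in> Ob C; Y' \<in> Ob C; f \<in> Mor C X X'; g \<in> Mor C Y Y'\<rbrakk>
      \<Longrightarrow> f \<boxdot> g \<in> Mor C (X \<boxtimes> Y) (X' \<boxtimes> Y')"
    and tmo_id: "\<lbrakk>X \<in> Ob C; Y \<in> Ob C\<rbrakk> \<Longrightarrow> idm C X \<boxdot> idm C Y = idm C (X \<boxtimes> Y)"
    and tmo_cmp: "\<lbrakk>X \<in> Ob C; X' \<in> Ob C; X'' \<in> Ob C; Y \<in> Ob C; Y' \<in> Ob C; Y'' \<in> Ob C;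
        f \<in> Mor C X X'; f' \<in> Mor C X' X''; g \<in> Mor C Y Y'; g' \<in> Mor C Y' Y''\<rbrakk>
      \<Longrightarrow> (f' \<bullet> f) \<boxdot> (g' \<bullet> g) = (f' \<boxdot> g') \<bullet> (f \<boxdot> g)"
    and assoc_iso: "\<lbrakk>X \<in> Ob C; Y \<in> Ob C; Z \<in> Ob C\<rbrakk>
      \<Longrightarrow> iso_mor C ((X \<boxtimes> Y) \<boxtimes> Z) (X \<boxtimes> (Y \<boxtimes> Z)) (assoc C X Y Z)"
    and luni_iso: "X \<in> Ob C \<Longrightarrow> iso_mor C (unt C \<boxtimes> X) X (luni C X)"
    and runi_iso: "X \<in> Ob C \<Longrightarrow> iso_mor C (X \<boxtimes> unt C) X (runi C X)"
    and braid_iso: "\<lbrakk>X \<in> Ob C; Y \<in> Ob C\<rbrakk> \<Longrightarrow> iso_mor C (X \<boxtimes> Y) (Y \<boxtimes> X) (braid C X Y)"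
    and assoc_natural: "\<lbrakk>X \<in> Ob C; X' \<in> Ob C; Y \<in> Ob C; Y' \<in> Ob C; Z \<in> Ob C; Z' \<in> Ob C;
        f \<in> Mor C X X'; g \<in> Mor C Y Y'; h \<in> Mor C Z Z'\<rbrakk>
      \<Longrightarrow> assoc C X' Y' Z' \<bullet> ((f \<boxdot> g) \<boxdot> h) = (f \<boxdot> (g \<boxdot> h)) \<bullet> assoc C X Y Z"
    and luni_natural: "\<lbrakk>X \<in> Ob C; X' \<in> Ob C; f \<in> Mor C X X'\<rbrakk>
      \<Longrightarrow> luni C X' \<bullet> (idm C (unt C) \<boxdot> f) = f \<bullet> luni C X"
    and runi_natural: "\<lbrakk>X \<in> Ob C; X' \<in> Ob C; f \<in> Mor C X X'\<rbrakk>
      \<Longrightarrow> runi C X' \<bullet> (f \<boxdot> idm C (unt C)) = f \<bullet> runi C X"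
    and braid_natural: "\<lbrakk>X \<in> Ob C; X' \<in> Ob C; Y \<in> Ob C; Y' \<in> Ob C; f \<in> Mor C X X'; g \<in> Mor C Y Y'\<rbrakk>
      \<Longrightarrow> braid C X' Y' \<bullet> (f \<boxdot> g) = (g \<boxdot> f) \<bullet> braid C X Y"
    and pentagon: "\<lbrakk>W \<in> Ob C; X \<in> Ob C; Y \<in> Ob C; Z \<in> Ob C\<rbrakk>
      \<Longrightarrow> assoc C W X (Y \<boxtimes> Z) \<bullet> assoc C (W \<boxtimes> X) Y Z =
          (idm C W \<boxdot> assoc C X Y Z) \<bullet> assoc C W (X \<boxtimes> Y) Z \<bullet> (assoc C W X Y \<boxdot> idm C Z)"
    and unit_triangle: "\<lbrakk>X \<in> Ob C; Y \<in> Ob C\<rbrakk>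
      \<Longrightarrow> (idm C X \<boxdot> luni C Y) \<bullet> assoc C X (unt C) Y = runi C X \<boxdot> idm C Y"
    and hexagon: "\<lbrakk>X \<in> Ob C; Y \<in> Ob C; Z \<in> Ob C\<rbrakk>
      \<Longrightarrow> assoc C Y Z X \<bullet> braid C X (Y \<boxtimes> Z) \<bullet> assoc C X Y Z =
          (idm C Y \<boxdot> braid C X Z) \<bullet> assoc C Y X Z \<bullet> (braid C X Y \<boxdot> idm C Z)"
    and braid_symmetric: "\<lbrakk>X \<in> Ob C; Y \<in> Ob C\<rbrakk>
      \<Longrightarrow> braid C Y X \<bullet> braid C X Y = idm C (X \<boxtimes> Y)"

definition ltensor :: "('o, 'm, 'x) ttcat_scheme \<Rightarrow> 'o \<Rightarrow> ('o, 'm, 'o, 'm) fctr" where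
  "ltensor C X = \<lparr>fob = (\<lambda>Y. X \<boxtimes>\<^bsub>C\<^esub> Y), fmo = (\<lambda>f. idm C X \<boxdot>\<^bsub>C\<^esub> f)\<rparr>"

definition rtensor :: "('o, 'm, 'x) ttcat_scheme \<Rightarrow> 'o \<Rightarrow> ('o, 'm, 'o, 'm) fctr" where
  "rtensor C X = \<lparr>fob = (\<lambda>Y. Y \<boxtimes>\<^bsub>C\<^esub> X), fmo = (\<lambda>f. f \<boxdot>\<^bsub>C\<^esub> idm C X)\<rparr>"

text \<open>Internal hom objects: every functor \<open>- \<otimes> X\<close> has a right adjoint.\<close>

definition closed_monoidal :: "('o, 'm, 'x) ttcat_scheme \<Rightarrow> bool" where
  "closed_monoidal C \<longleftrightarrow> (\<forall>X\<in>Ob C. \<forall>Z\<in>Ob C. \<exists>H\<in>Ob C. \<exists>ev\<in>Mor C (H \<boxtimes>\<^bsub>C\<^esub> X) Z.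
     \<forall>W\<in>Ob C. \<forall>f\<in>Mor C (W \<boxtimes>\<^bsub>C\<^esub> X) Z. \<exists>!g. g \<in> Mor C W H \<and> ev \<bullet>\<^bsub>C\<^esub> (g \<boxdot>\<^bsub>C\<^esub> idm C X) = f)"

definition rigid :: "('o, 'm, 'x) ttcat_scheme \<Rightarrow> 'o \<Rightarrow> bool" where
  "rigid C X \<longleftrightarrow> X \<in> Ob C \<and>
     (\<exists>D\<in>Ob C. \<exists>\<eta>\<in>Mor C (unt C) (X \<boxtimes>\<^bsub>C\<^esub> D). \<exists>\<epsilon>\<in>Mor C (D \<boxtimes>\<^bsub>C\<^esub> X) (unt C).
        runi C X \<bullet>\<^bsub>C\<^esub> (idm C X \<boxdot>\<^bsub>C\<^esub> \<epsilon>) \<bullet>\<^bsub>C\<^esub> assoc C X D X \<bullet>\<^bsub>C\<^esub> (\<eta> \<boxdot>\<^bsub>C\<^esub> idm C X) = luni C X \<and>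
        luni C D \<bullet>\<^bsub>C\<^esub> (\<epsilon> \<boxdot>\<^bsub>C\<^esub> idm C D) \<bullet>\<^bsub>C\<^esub>
          inv_mor C ((D \<boxtimes>\<^bsub>C\<^esub> X) \<boxtimes>\<^bsub>C\<^esub> D) (D \<boxtimes>\<^bsub>C\<^esub> (X \<boxtimes>\<^bsub>C\<^esub> D)) (assoc C D X D) \<bullet>\<^bsub>C\<^esub>
          (idm C D \<boxdot>\<^bsub>C\<^esub> \<eta>) = runi C D)"

definition locally_small :: "'u itself \<Rightarrow> ('o, 'm, 'x) cat_scheme \<Rightarrow> bool" where
  "locally_small U C \<longleftrightarrow> (\<forall>X\<in>Ob C. \<forall>Y\<in>Ob C. small U (Mor C X Y))"

text \<open>
  Ordinary categories are locally small. This is not assumed here, and correspondingly closedness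
  is only required of those categories that are locally small: if the cardinality of \<open>'u\<close> is not a
  strong limit, a non-zero category with small coproducts is never locally small, and categories
  such as that of all modules of cardinality less than that of \<open>'u\<close> need not have all internal hom
  objects. For inaccessible \<open>'u\<close> and locally small \<open>C\<close> this is the usual notion.
\<close>

locale big_tt_category = triangulated_category C + symmetric_monoidal C
  for U :: "'u itself" and C :: "('o, 'm, 'x) ttcat_scheme" (structure) +
  assumes small_coproducts: "has_small_coproducts U C"
    and closed: "locally_small U C \<Longrightarrow> closed_monoidal C"
    and ltensor_exact: "X \<in> Ob C \<Longrightarrow> exact_functor C C (ltensor C X)"
    and rtensor_exact: "X \<in> Ob C \<Longrightarrow> exact_functor C C (rtensor C X)"
    and ltensor_coproducts: "X \<in> Ob C \<Longrightarrow> preserves_coproducts U C C (ltensor C X)"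
    and rtensor_coproducts: "X \<in> Ob C \<Longrightarrow> preserves_coproducts U C C (rtensor C X)"
    and compact_iff_rigid: "compact_object U C X \<longleftrightarrow> rigid C X"
    and compacts_small_skeleton:
      "\<exists>R. small U R \<and> R \<subseteq> Collect (compact_object U C) \<and> (\<forall>c. compact_object U C c \<longrightarrow> (\<exists>r\<in>R. isomorphic C c r))"
    and compacts_small_homs: "\<lbrakk>compact_object U C c; compact_object U C d\<rbrakk> \<Longrightarrow> small U (Mor C c d)"
    and compacts_generate: "\<lbrakk>localizing_subcategory U C L; Collect (compact_object U C) \<subseteq> L\<rbrakk> \<Longrightarrow> L = Ob C"

definition strong_symmetric_monoidal_functor ::
  "('o, 'm, 'x) ttcat_scheme \<Rightarrow> ('p, 'n, 'y) ttcat_scheme \<Rightarrow> ('o, 'm, 'p, 'n) fctr \<Rightarrow> bool" where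
  "strong_symmetric_monoidal_functor C D F \<longleftrightarrow> (\<exists>\<mu> \<upsilon>.
     (\<forall>X\<in>Ob C. \<forall>Y\<in>Ob C.
        iso_mor D (fob F X \<boxtimes>\<^bsub>D\<^esub> fob F Y) (fob F (X \<boxtimes>\<^bsub>C\<^esub> Y)) (\<mu> X Y)) \<and>
     iso_mor D (unt D) (fob F (unt C)) \<upsilon> \<and>
     (\<forall>X\<in>Ob C. \<forall>X'\<in>Ob C. \<forall>Y\<in>Ob C. \<forall>Y'\<in>Ob C. \<forall>f\<in>Mor C X X'. \<forall>g\<in>Mor C Y Y'.
        fmo F (f \<boxdot>\<^bsub>C\<^esub> g) \<bullet>\<^bsub>D\<^esub> \<mu> X Y = \<mu> X' Y' \<bullet>\<^bsub>D\<^esub> (fmo F f \<boxdot>\<^bsub>D\<^esub> fmo F g)) \<and>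
     (\<forall>X\<in>Ob C. \<forall>Y\<in>Ob C. \<forall>Z\<in>Ob C.
        fmo F (assoc C X Y Z) \<bullet>\<^bsub>D\<^esub> \<mu> (X \<boxtimes>\<^bsub>C\<^esub> Y) Z \<bullet>\<^bsub>D\<^esub> (\<mu> X Y \<boxdot>\<^bsub>D\<^esub> idm D (fob F Z)) =
        \<mu> X (Y \<boxtimes>\<^bsub>C\<^esub> Z) \<bullet>\<^bsub>D\<^esub> (idm D (fob F X) \<boxdot>\<^bsub>D\<^esub> \<mu> Y Z) \<bullet>\<^bsub>D\<^esub>
          assoc D (fob F X) (fob F Y) (fob F Z)) \<and>
     (\<forall>X\<in>Ob C. fmo F (luni C X) \<bullet>\<^bsub>D\<^esub> \<mu> (unt C) X \<bullet>\<^bsub>D\<^esub> (\<upsilon> \<boxdot>\<^bsub>D\<^esub> idm D (fob F X)) = luni D (fob F X)) \<and>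
     (\<forall>X\<in>Ob C. fmo F (runi C X) \<bullet>\<^bsub>D\<^esub> \<mu> X (unt C) \<bullet>\<^bsub>D\<^esub> (idm D (fob F X) \<boxdot>\<^bsub>D\<^esub> \<upsilon>) = runi D (fob F X)) \<and>
     (\<forall>X\<in>Ob C. \<forall>Y\<in>Ob C.
        fmo F (braid C X Y) \<bullet>\<^bsub>D\<^esub> \<mu> X Y = \<mu> Y X \<bullet>\<^bsub>D\<^esub> braid D (fob F X) (fob F Y)))"

definition tt_functor ::
  "('o, 'm, 'x) ttcat_scheme \<Rightarrow> ('p, 'n, 'y) ttcat_scheme \<Rightarrow> ('o, 'm, 'p, 'n) fctr \<Rightarrow> bool" where
  "tt_functor C D F \<longleftrightarrow> exact_functor C D F \<and> strong_symmetric_monoidal_functor C D F"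


section \<open>Modules over group algebras\<close>

text \<open>The additive order of the unit; it is \<open>0\<close> if that order is infinite.\<close>

definition ring_char :: "('a, 'x) ring_scheme \<Rightarrow> nat" where
  "ring_char R = group.ord (add_monoid R) \<one>\<^bsub>R\<^esub>"

text \<open>A \<open>kG\<close>-module is a \<open>k\<close>-module with an action of \<open>G\<close> by \<open>k\<close>-linear maps. (The ring
  multiplication and unit that the record \<open>module\<close> inherits are irrelevant.)\<close>

record ('g, 'k, 'u) gmod = "('k, 'u) module" +
  act :: "'g \<Rightarrow> 'u \<Rightarrow> 'u"

definition lin_maps ::
  "('k, 'x) ring_scheme \<Rightarrow> ('k, 'a, 'y) module_scheme \<Rightarrow> ('k, 'b, 'z) module_scheme \<Rightarrow> ('a \<Rightarrow> 'b) set" where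
  "lin_maps K M N = {f \<in> carrier M \<rightarrow>\<^sub>E carrier N.
     (\<forall>x\<in>carrier M. \<forall>y\<in>carrier M. f (x \<oplus>\<^bsub>M\<^esub> y) = f x \<oplus>\<^bsub>N\<^esub> f y) \<and>
     (\<forall>a\<in>carrier K. \<forall>x\<in>carrier M. f (a \<odot>\<^bsub>M\<^esub> x) = a \<odot>\<^bsub>N\<^esub> f x)}"

definition kG_module ::
  "('g, 'w) monoid_scheme \<Rightarrow> ('k, 'x) ring_scheme \<Rightarrow> ('g, 'k, 'u) gmod \<Rightarrow> bool" where
  "kG_module G K M \<longleftrightarrow> module K M \<and>
     (\<forall>g\<in>carrier G. restrict (act M g) (carrier M) \<in> lin_maps K M M) \<and>
     (\<forall>x\<in>carrier M. act M \<one>\<^bsub>G\<^esub> x = x) \<and>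
     (\<forall>g\<in>carrier G. \<forall>h\<in>carrier G. \<forall>x\<in>carrier M. act M (g \<otimes>\<^bsub>G\<^esub> h) x = act M g (act M h x))"

definition kG_mods ::
  "('g, 'w) monoid_scheme \<Rightarrow> ('k, 'x) ring_scheme \<Rightarrow> ('g, 'k, 'u) gmod set" where
  "kG_mods G K = {M. kG_module G K M \<and> small TYPE('u) (carrier M)}"

definition kG_hom ::
  "('g, 'w) monoid_scheme \<Rightarrow> ('k, 'x) ring_scheme \<Rightarrow> ('g, 'k, 'u) gmod \<Rightarrow> ('g, 'k, 'u) gmod \<Rightarrow> ('u \<Rightarrow> 'u) set" where
  "kG_hom G K M N = {f \<in> lin_maps K M N.
     \<forall>g\<in>carrier G. \<forall>x\<in>carrier M. f (act M g x) = act N g (f x)}"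

definition projective_mod ::
  "('g, 'w) monoid_scheme \<Rightarrow> ('k, 'x) ring_scheme \<Rightarrow> ('g, 'k, 'u) gmod \<Rightarrow> bool" where
  "projective_mod G K P \<longleftrightarrow> P \<in> kG_mods G K \<and>
     (\<forall>M\<in>kG_mods G K. \<forall>N\<in>kG_mods G K. \<forall>q\<in>kG_hom G K M N. \<forall>f\<in>kG_hom G K P N.
        q ` carrier M = carrier N \<longrightarrow> (\<exists>h\<in>kG_hom G K P M. compose (carrier P) q h = f))"

definition injective_mod ::
  "('g, 'w) monoid_scheme \<Rightarrow> ('k, 'x) ring_scheme \<Rightarrow> ('g, 'k, 'u) gmod \<Rightarrow> bool" where
  "injective_mod G K J \<longleftrightarrow> J \<in> kG_mods G K \<and>
     (\<forall>M\<in>kG_mods G K. \<forall>N\<in>kG_mods G K. \<forall>i\<in>kG_hom G K M N. \<forall>f\<in>kG_hom G K M J.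
        inj_on i (carrier M) \<longrightarrow> (\<exists>h\<in>kG_hom G K N J. compose (carrier M) h i = f))"

definition short_exact ::
  "('g, 'w) monoid_scheme \<Rightarrow> ('k, 'x) ring_scheme \<Rightarrow> ('g, 'k, 'u) gmod \<Rightarrow> ('g, 'k, 'u) gmod \<Rightarrow>
   ('g, 'k, 'u) gmod \<Rightarrow> ('u \<Rightarrow> 'u) \<Rightarrow> ('u \<Rightarrow> 'u) \<Rightarrow> bool" where
  "short_exact G K A B C f g \<longleftrightarrow> A \<in> kG_mods G K \<and> B \<in> kG_mods G K \<and> C \<in> kG_mods G K \<and>
     f \<in> kG_hom G K A B \<and> g \<in> kG_hom G K B C \<and>
     inj_on f (carrier A) \<and> g ` carrier B = carrier C \<and>
     f ` carrier A = {y \<in> carrier B. g y = \<zero>\<^bsub>C\<^esub>}"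


subsection \<open>Tensor products over \<open>k\<close> with diagonal action\<close>

definition bilinear_map ::
  "('k, 'x) ring_scheme \<Rightarrow> ('k, 'a, 'y) module_scheme \<Rightarrow> ('k, 'b, 'z) module_scheme \<Rightarrow>
   ('k, 'c, 'v) module_scheme \<Rightarrow> ('a \<Rightarrow> 'b \<Rightarrow> 'c) \<Rightarrow> bool" where
  "bilinear_map K M N V \<beta> \<longleftrightarrow>
     (\<forall>x\<in>carrier M. restrict (\<beta> x) (carrier N) \<in> lin_maps K N V) \<and>
     (\<forall>y\<in>carrier N. (\<lambda>x\<in>carrier M. \<beta> x y) \<in> lin_maps K M V)"

definition is_tensor_product ::
  "('g, 'w) monoid_scheme \<Rightarrow> ('k, 'x) ring_scheme \<Rightarrow> ('g, 'k, 'u) gmod \<Rightarrow> ('g, 'k, 'u) gmod \<Rightarrow>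
   ('g, 'k, 'u) gmod \<Rightarrow> ('u \<Rightarrow> 'u \<Rightarrow> 'u) \<Rightarrow> bool" where
  "is_tensor_product G K M N T \<tau> \<longleftrightarrow> T \<in> kG_mods G K \<and> bilinear_map K M N T \<tau> \<and>
     (\<forall>g\<in>carrier G. \<forall>x\<in>carrier M. \<forall>y\<in>carrier N. act T g (\<tau> x y) = \<tau> (act M g x) (act N g y)) \<and>
     (\<forall>V :: ('k, 'u) module. \<forall>\<beta>. module K V \<and> bilinear_map K M N V \<beta> \<longrightarrow>
        (\<exists>!h. h \<in> lin_maps K T V \<and> (\<forall>x\<in>carrier M. \<forall>y\<in>carrier N. h (\<tau> x y) = \<beta> x y)))"

definition tensor_pair ::
  "('g, 'w) monoid_scheme \<Rightarrow> ('k, 'x) ring_scheme \<Rightarrow> ('g, 'k, 'u) gmod \<Rightarrow> ('g, 'k, 'u) gmod \<Rightarrow>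
   ('g, 'k, 'u) gmod \<times> ('u \<Rightarrow> 'u \<Rightarrow> 'u)" where
  "tensor_pair G K M N = (SOME (T, \<tau>). is_tensor_product G K M N T \<tau>)"

definition tensor_mod ::
  "('g, 'w) monoid_scheme \<Rightarrow> ('k, 'x) ring_scheme \<Rightarrow> ('g, 'k, 'u) gmod \<Rightarrow> ('g, 'k, 'u) gmod \<Rightarrow>
   ('g, 'k, 'u) gmod" where
  "tensor_mod G K M N = fst (tensor_pair G K M N)"

definition pure_tensor ::
  "('g, 'w) monoid_scheme \<Rightarrow> ('k, 'x) ring_scheme \<Rightarrow> ('g, 'k, 'u) gmod \<Rightarrow> ('g, 'k, 'u) gmod \<Rightarrow>
   'u \<Rightarrow> 'u \<Rightarrow> 'u" where
  "pure_tensor G K M N = snd (tensor_pair G K M N)"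

definition tensor_map ::
  "('g, 'w) monoid_scheme \<Rightarrow> ('k, 'x) ring_scheme \<Rightarrow> ('g, 'k, 'u) gmod \<Rightarrow> ('g, 'k, 'u) gmod \<Rightarrow>
   ('g, 'k, 'u) gmod \<Rightarrow> ('g, 'k, 'u) gmod \<Rightarrow> ('u \<Rightarrow> 'u) \<Rightarrow> ('u \<Rightarrow> 'u) \<Rightarrow> 'u \<Rightarrow> 'u" where
  "tensor_map G K M M' N N' f g =
     (THE h. h \<in> kG_hom G K (tensor_mod G K M N) (tensor_mod G K M' N') \<and>
        (\<forall>x\<in>carrier M. \<forall>y\<in>carrier N.
           h (pure_tensor G K M N x y) = pure_tensor G K M' N' (f x) (g y)))"

text \<open>The trivial module \<open>k\<close>, together with a basis vector.\<close>

definition unit_pair ::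
  "('g, 'w) monoid_scheme \<Rightarrow> ('k, 'x) ring_scheme \<Rightarrow> ('g, 'k, 'u) gmod \<times> 'u" where
  "unit_pair G K = (SOME (E, e). E \<in> kG_mods G K \<and> e \<in> carrier E \<and>
     bij_betw (\<lambda>a. a \<odot>\<^bsub>E\<^esub> e) (carrier K) (carrier E) \<and>
     (\<forall>g\<in>carrier G. \<forall>x\<in>carrier E. act E g x = x))"

definition unit_mod :: "('g, 'w) monoid_scheme \<Rightarrow> ('k, 'x) ring_scheme \<Rightarrow> ('g, 'k, 'u) gmod" where
  "unit_mod G K = fst (unit_pair G K)"

definition assoc_map ::
  "('g, 'w) monoid_scheme \<Rightarrow> ('k, 'x) ring_scheme \<Rightarrow> ('g, 'k, 'u) gmod \<Rightarrow> ('g, 'k, 'u) gmod \<Rightarrow>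
   ('g, 'k, 'u) gmod \<Rightarrow> 'u \<Rightarrow> 'u" where
  "assoc_map G K L M N =
     (THE h. h \<in> kG_hom G K (tensor_mod G K (tensor_mod G K L M) N) (tensor_mod G K L (tensor_mod G K M N)) \<and>
        (\<forall>x\<in>carrier L. \<forall>y\<in>carrier M. \<forall>z\<in>carrier N.
           h (pure_tensor G K (tensor_mod G K L M) N (pure_tensor G K L M x y) z) =
           pure_tensor G K L (tensor_mod G K M N) x (pure_tensor G K M N y z)))"

definition luni_map ::
  "('g, 'w) monoid_scheme \<Rightarrow> ('k, 'x) ring_scheme \<Rightarrow> ('g, 'k, 'u) gmod \<Rightarrow> 'u \<Rightarrow> 'u" where
  "luni_map G K M = (case unit_pair G K of (E, e) \<Rightarrow>
     THE h. h \<in> kG_hom G K (tensor_mod G K E M) M \<and>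
       (\<forall>x\<in>carrier M. h (pure_tensor G K E M e x) = x))"

definition runi_map ::
  "('g, 'w) monoid_scheme \<Rightarrow> ('k, 'x) ring_scheme \<Rightarrow> ('g, 'k, 'u) gmod \<Rightarrow> 'u \<Rightarrow> 'u" where
  "runi_map G K M = (case unit_pair G K of (E, e) \<Rightarrow>
     THE h. h \<in> kG_hom G K (tensor_mod G K M E) M \<and>
       (\<forall>x\<in>carrier M. h (pure_tensor G K M E x e) = x))"

definition braid_map ::
  "('g, 'w) monoid_scheme \<Rightarrow> ('k, 'x) ring_scheme \<Rightarrow> ('g, 'k, 'u) gmod \<Rightarrow> ('g, 'k, 'u) gmod \<Rightarrow>
   'u \<Rightarrow> 'u" where
  "braid_map G K M N =
     (THE h. h \<in> kG_hom G K (tensor_mod G K M N) (tensor_mod G K N M) \<and>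
        (\<forall>x\<in>carrier M. \<forall>y\<in>carrier N. h (pure_tensor G K M N x y) = pure_tensor G K N M y x))"


section \<open>The stable module category\<close>

text \<open>A morphism \<open>M \<rightarrow> N\<close> of the stable category is recorded as \<open>(M, c, N)\<close>, where \<open>c\<close> is a class of
  module homomorphisms modulo those that factor through a projective module. Operations on classes
  are unions over representatives.\<close>

type_synonym ('g, 'k, 'u) stab_mor = "('g, 'k, 'u) gmod \<times> ('u \<Rightarrow> 'u) set \<times> ('g, 'k, 'u) gmod"

definition stably_zero ::
  "('g, 'w) monoid_scheme \<Rightarrow> ('k, 'x) ring_scheme \<Rightarrow> ('g, 'k, 'u) gmod \<Rightarrow> ('g, 'k, 'u) gmod \<Rightarrow>
   ('u \<Rightarrow> 'u) \<Rightarrow> bool" where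
  "stably_zero G K M N f \<longleftrightarrow> (\<exists>P a b. projective_mod G K P \<and> a \<in> kG_hom G K M P \<and> b \<in> kG_hom G K P N \<and>
     f = compose (carrier M) b a)"

definition stab_class ::
  "('g, 'w) monoid_scheme \<Rightarrow> ('k, 'x) ring_scheme \<Rightarrow> ('g, 'k, 'u) gmod \<Rightarrow> ('g, 'k, 'u) gmod \<Rightarrow>
   ('u \<Rightarrow> 'u) \<Rightarrow> ('u \<Rightarrow> 'u) set" where
  "stab_class G K M N f =
     {h \<in> kG_hom G K M N. stably_zero G K M N (\<lambda>x\<in>carrier M. h x \<ominus>\<^bsub>N\<^esub> f x)}"

definition stab_of ::
  "('g, 'w) monoid_scheme \<Rightarrow> ('k, 'x) ring_scheme \<Rightarrow> ('g, 'k, 'u) gmod \<Rightarrow> ('g, 'k, 'u) gmod \<Rightarrow>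
   ('u \<Rightarrow> 'u) \<Rightarrow> ('g, 'k, 'u) stab_mor" where
  "stab_of G K M N f = (M, stab_class G K M N f, N)"

definition stab_cat ::
  "('g, 'w) monoid_scheme \<Rightarrow> ('k, 'x) ring_scheme \<Rightarrow>
   (('g, 'k, 'u) gmod, ('g, 'k, 'u) stab_mor) cat" where
  "stab_cat G K = \<lparr>
     Ob = kG_mods G K,
     Mor = (\<lambda>M N. stab_of G K M N ` kG_hom G K M N),
     idm = (\<lambda>M. stab_of G K M M (\<lambda>x\<in>carrier M. x)),
     cmp = (\<lambda>(_, d, N) (L, c, _).
        (L, \<Union>g\<in>d. \<Union>f\<in>c. stab_class G K L N (compose (carrier L) g f), N)),
     addm = (\<lambda>(M, c, N) (_, d, _).
        (M, \<Union>f\<in>c. \<Union>g\<in>d. stab_class G K M N (\<lambda>x\<in>carrier M. f x \<oplus>\<^bsub>N\<^esub> g x), N)),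
     zerom = (\<lambda>M N. stab_of G K M N (\<lambda>x\<in>carrier M. \<zero>\<^bsub>N\<^esub>))\<rparr>"

text \<open>A chosen exact sequence \<open>0 \<rightarrow> M \<rightarrow> I \<rightarrow> \<Sigma>M \<rightarrow> 0\<close> with \<open>I\<close> injective.\<close>

definition inj_seq ::
  "('g, 'w) monoid_scheme \<Rightarrow> ('k, 'x) ring_scheme \<Rightarrow> ('g, 'k, 'u) gmod \<Rightarrow>
   ('g, 'k, 'u) gmod \<times> ('u \<Rightarrow> 'u) \<times> ('g, 'k, 'u) gmod \<times> ('u \<Rightarrow> 'u)" where
  "inj_seq G K M = (SOME (J, i, S, q). injective_mod G K J \<and> short_exact G K M J S i q)"

definition susp ::
  "('g, 'w) monoid_scheme \<Rightarrow> ('k, 'x) ring_scheme \<Rightarrow> ('g, 'k, 'u) gmod \<Rightarrow> ('g, 'k, 'u) gmod" where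
  "susp G K M = (case inj_seq G K M of (J, i, S, q) \<Rightarrow> S)"

text \<open>\<open>\<Sigma>f\<close> is induced by any extension \<open>t\<close> of \<open>f\<close> to the chosen injective modules; the set of all
  maps obtained in this way from representatives of a class is again a class.\<close>

definition susp_mor ::
  "('g, 'w) monoid_scheme \<Rightarrow> ('k, 'x) ring_scheme \<Rightarrow> ('g, 'k, 'u) stab_mor \<Rightarrow> ('g, 'k, 'u) stab_mor" where
  "susp_mor G K = (\<lambda>(M, c, N). case (inj_seq G K M, inj_seq G K N) of
     ((J, i, S, q), (J', i', S', q')) \<Rightarrow>
       (S, {s \<in> kG_hom G K S S'. \<exists>f\<in>c. \<exists>t\<in>kG_hom G K J J'.
              compose (carrier M) t i = compose (carrier M) i' f \<and>
              compose (carrier J) s q = compose (carrier J) q' t}, S'))"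

text \<open>The triangle of a short exact sequence \<open>0 \<rightarrow> A \<rightarrow> B \<rightarrow> C \<rightarrow> 0\<close>; its last map \<open>w\<close> is obtained from an
  extension \<open>t : B \<rightarrow> J\<close> of the chosen embedding \<open>A \<rightarrow> J\<close>. (The opposite sign convention for \<open>w\<close>
  gives an isomorphic triangulated structure.)\<close>

definition standard_triangles ::
  "('g, 'w) monoid_scheme \<Rightarrow> ('k, 'x) ring_scheme \<Rightarrow>
   (('g, 'k, 'u) gmod \<times> ('g, 'k, 'u) gmod \<times> ('g, 'k, 'u) gmod \<times>
    ('g, 'k, 'u) stab_mor \<times> ('g, 'k, 'u) stab_mor \<times> ('g, 'k, 'u) stab_mor) set" where
  "standard_triangles G K =
     {(A, B, C, stab_of G K A B f, stab_of G K B C g, stab_of G K C S w) | A B C f g w J i S q t.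
        short_exact G K A B C f g \<and> inj_seq G K A = (J, i, S, q) \<and>
        t \<in> kG_hom G K B J \<and> w \<in> kG_hom G K C S \<and>
        compose (carrier A) t f = i \<and>
        compose (carrier B) w g = compose (carrier B) q t}"

definition Stab ::
  "('g, 'w) monoid_scheme \<Rightarrow> ('k, 'x) ring_scheme \<Rightarrow>
   (('g, 'k, 'u) gmod, ('g, 'k, 'u) stab_mor) ttcat" where
  "Stab G K = \<lparr>
     Ob = Ob (stab_cat G K),
     Mor = Mor (stab_cat G K),
     idm = idm (stab_cat G K),
     cmp = cmp (stab_cat G K),
     addm = addm (stab_cat G K),
     zerom = zerom (stab_cat G K),
     sho = susp G K,
     shm = susp_mor G K,
     tri = {t. triangle (stab_cat G K) (susp G K) t \<and>
              (\<exists>t'\<in>standard_triangles G K. triangle_iso (stab_cat G K) (susp_mor G K) t' t)},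
     tob = tensor_mod G K,
     tmo = (\<lambda>(M, c, M') (N, d, N').
        (tensor_mod G K M N,
         \<Union>f\<in>c. \<Union>g\<in>d. stab_class G K (tensor_mod G K M N) (tensor_mod G K M' N') (tensor_map G K M M' N N' f g),
         tensor_mod G K M' N')),
     unt = unit_mod G K,
     assoc = (\<lambda>L M N. stab_of G K (tensor_mod G K (tensor_mod G K L M) N) (tensor_mod G K L (tensor_mod G K M N))
        (assoc_map G K L M N)),
     luni = (\<lambda>M. stab_of G K (tensor_mod G K (unit_mod G K) M) M (luni_map G K M)),
     runi = (\<lambda>M. stab_of G K (tensor_mod G K M (unit_mod G K)) M (runi_map G K M)),
     braid = (\<lambda>M N. stab_of G K (tensor_mod G K M N) (tensor_mod G K N M) (braid_map G K M N))\<rparr>"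

end

(* Nilpotency of g - 1 splits every kC_p-module into cyclic blocks k[t]/t^n with n <= p; the blocks of
   dimension p are projective, so stably only blocks A of dimension prime to p remain. These are
   finite dimensional, which gives (a) and (d). For (b), the trace of the identity of A is nonzero, so f
   is recovered up to a scalar from A \<otimes> f through a coevaluation and an evaluation.
   For (c), if F kills f : X -> Y then it kills a map from the unit to D \<otimes> Y that is not stably zero,
   hence it kills the class of the self-extension V of the unit, and F q is a split epimorphism for
   the projection q of V to the unit. So is F applied to the (p-1)-fold tensor power of q, but this power
   is stably zero: it is a trace, because power sums over F_p vanish in degrees below p - 1. Hence F
   kills the unit, and F = 0. *)
theory Submission
 imports Defs "HOL-Algebra.Free_Abelian_Groups" "HOL-Number_Theory.Residues"
begin

\<comment> \<open>The common currency is the trace of a linear map h, the sum of its conjugates g h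
  g^-1. Projective and injective modules are those whose identity is a trace, and homomorphisms are
  stably equal exactly if they differ by a trace. Stable questions thus become questions about
  linear maps, where sections, retractions and functionals exist because the scalars form a field,
  and linear witnesses on the summands of an infinite direct sum glue without any finiteness. For
  (c) the obstacle is to reach the unit from an arbitrary f. Duality turns f into an invariant v of
  D \<otimes> Y. If v were a norm, then f would be a trace; so some functional kills all norms but
  not v. Vanishing on norms is what lets this functional twist the action on the sum of the unit and
  D \<otimes> Y into an extension, from which V is pulled back along v. In V the generator
  translates a coordinate s by q. Hence along an orbit the (p-1)-fold product of s is a polynomial
  of degree p - 1 whose leading coefficient is the (p-1)-fold product of q; this is where the
  exponent p - 1 comes from.\<close>
syntax "_index" :: "id_position => index"  (\<open>\<^sub>_\<close>)

abbreviation in_carrier  (infix \<open>\<in>.\<close> 50)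
 where "x \<in>. M \<equiv> x \<in> carrier M"

lemmas (in module) modl = module_axioms

section \<open>Small sets\<close>

lemma small_subset: "small U B ==> A \<subseteq> B ==> small U A"
 unfolding small_def using card_of_mono1 ordLeq_ordLess_trans by blast

lemma small_image: "small U A ==> small U (f ` A)"
 unfolding small_def using card_of_image ordLeq_ordLess_trans by blast

lemma small_inj:
 assumes "inj_on f A" "f ` A \<subseteq> B" "small U B" shows "small U A"
proof -
 have "|A| \<le>o |B|" using assms(1,2) card_of_ordLeq by blast
 thus ?thesis using assms(3) unfolding small_def using ordLeq_ordLess_trans by blast
qed

lemma small_finite:
 assumes "infinite (UNIV :: 'u set)" "finite A" shows "small TYPE('u) A"
 unfolding small_def using assms finite_ordLess_infinite2 by blast

lemma small_into_type:
 assumes "small TYPE('u) A" shows "\<exists>f :: 'a => 'u. inj_on f A"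
proof -
 have "|A| \<le>o |UNIV :: 'u set|" using assms unfolding small_def using ordLess_imp_ordLeq by blast
 thus ?thesis by (metis card_of_ordLeq)
qed

lemma small_Times:
 assumes "infinite (UNIV :: 'u set)" "small TYPE('u) A" "small TYPE('u) B"
 shows "small TYPE('u) (A \<times> B)" using assms card_of_Times_ordLess_infinite unfolding small_def by blast

text \<open>Here regularity of the cardinal of the universe type enters: a small union of small sets
  stays below it.\<close>

lemma small_UNION:
 assumes "universe_type TYPE('u)" "small TYPE('u) I" "\<And>i. i \<in> I ==> small TYPE('u) (A i)"
 shows "small TYPE('u) (\<Union>i\<in>I. A i)" unfolding small_def
proof (rule card_of_UNION_ordLess_infinite_Field_regularCard)
 show "regularCard |UNIV :: 'u set|" using assms(1) by (simp add: universe_type_def)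
 show "Cinfinite |UNIV :: 'u set|" using assms(1) by (simp add: universe_type_def cinfinite_def Field_card_of)
qed (use assms in \<open>auto simp: small_def\<close>)

lemma small_Fpow:
 assumes "infinite (UNIV :: 'u set)" "small TYPE('u) A"
 shows "small TYPE('u) (Fpow A)"
proof (cases "finite A")
 case True
 thus ?thesis using assms(1) by (intro small_finite finite_subset[of "Fpow A" "Pow A"]) (auto simp: Fpow_def)
next
 case False
 hence "|Fpow A| =o |A|" by (rule card_of_Fpow_infinite)
 thus ?thesis using assms(2) unfolding small_def using ordIso_ordLess_trans by blast
qed

text \<open>A function of finite support is determined by its graph over the support.\<close>

lemma small_finsupp:
 assumes "universe_type TYPE('u)" "small TYPE('u) I" "\<And>i. i \<in> I ==> small TYPE('u) (A i)"
 shows "small TYPE('u) {f \<in> (\<Pi>\<^sub>E i\<in>I. A i). finite {i \<in> I. f i \<noteq> z i}}"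
proof (rule small_inj)
 have inf: "infinite (UNIV :: 'u set)" using assms(1) by (simp add: universe_type_def)
 let ?S = "{f \<in> (\<Pi>\<^sub>E i\<in>I. A i). finite {i \<in> I. f i \<noteq> z i}}"
 let ?\<Phi> = "\<lambda>f. (\<lambda>i. (i, f i)) ` {i \<in> I. f i \<noteq> z i}"
 show "small TYPE('u) (Fpow (I \<times> (\<Union>i\<in>I. A i)))"
  using small_Fpow[OF inf small_Times[OF inf assms(2) small_UNION[OF assms]]] .
 show "?\<Phi> ` ?S \<subseteq> Fpow (I \<times> (\<Union>i\<in>I. A i))" by (auto simp: Fpow_def PiE_def Pi_def)
 show "inj_on ?\<Phi> ?S"
 proof (rule inj_onI)
  fix f f' assume f: "f \<in> ?S" and f': "f' \<in> ?S" and eq: "?\<Phi> f = ?\<Phi> f'"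
  show "f = f'"
  proof (rule PiE_ext)
   show "f \<in> (\<Pi>\<^sub>E i\<in>I. A i)" "f' \<in> (\<Pi>\<^sub>E i\<in>I. A i)" using f f' by auto
   fix i assume i: "i \<in> I"
   show "f i = f' i"
   proof (cases "f i = z i \<and> f' i = z i")
    case False
    hence "(i, f i) \<in> ?\<Phi> f \<or> (i, f' i) \<in> ?\<Phi> f'" using i by auto
    hence "(i, f i) \<in> ?\<Phi> f' \<or> (i, f' i) \<in> ?\<Phi> f" by (simp only: eq)
    thus ?thesis by auto
   qed auto
  qed
 qed
qed

lemma small_PiE_finite:
 assumes "universe_type TYPE('u)" "finite I" "\<And>i. i \<in> I ==> small TYPE('u) (A i)"
 shows "small TYPE('u) (\<Pi>\<^sub>E i\<in>I. A i)"
proof -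
 have "small TYPE('u) I" using assms by (intro small_finite) (auto simp: universe_type_def)
 from small_finsupp[OF assms(1) this assms(3)] show ?thesis using assms(2) by (auto elim!: small_subset)
qed

section \<open>Linear maps\<close>

context module
begin

text \<open>Subspaces are plain sets, so kernels, intersections and unions of chains are set
  operations; the module structure is put on by \<open>sub_module\<close> when it is wanted.\<close>

definition subsp where
 "subsp H \<longleftrightarrow> H \<subseteq> carrier M \<and> \<zero>\<^sub>M \<in> H \<and> (\<forall>x\<in>H. \<forall>y\<in>H. x \<oplus>\<^sub>M y \<in> H) \<and>
  (\<forall>a\<in>carrier R. \<forall>x\<in>H. a \<odot>\<^sub>M x \<in> H)"

lemma subspI:
 assumes "H \<subseteq> carrier M" "\<zero>\<^sub>M \<in> H" "\<And>x y. x \<in> H ==> y \<in> H ==> x \<oplus>\<^sub>M y \<in> H"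
  "\<And>a x. a \<in>. R ==> x \<in> H ==> a \<odot>\<^sub>M x \<in> H"
 shows "subsp H" using assms by (auto simp: subsp_def)

lemma sub_carrier: "subsp H ==> x \<in> H ==> x \<in>. M"
 and sub_zero: "subsp H ==> \<zero>\<^sub>M \<in> H"
 and sub_add: "subsp H ==> x \<in> H ==> y \<in> H ==> x \<oplus>\<^sub>M y \<in> H"
 and sub_smult: "subsp H ==> a \<in>. R ==> x \<in> H ==> a \<odot>\<^sub>M x \<in> H" by (auto simp: subsp_def)

lemma neg_smult: "x \<in>. M ==> \<ominus>\<^sub>M x = (\<ominus> \<one>) \<odot>\<^sub>M x"
 by (simp add: smult_l_minus)

lemma sub_neg: "subsp H ==> x \<in> H ==> \<ominus>\<^sub>M x \<in> H"
 using neg_smult[OF sub_carrier] by (simp add: sub_smult)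

lemma sub_minus: "subsp H ==> x \<in> H ==> y \<in> H ==> x \<ominus>\<^sub>M y \<in> H"
 by (simp add: a_minus_def sub_neg sub_add)

lemma sub_finsum: "subsp H ==> f \<in> A \<rightarrow> H ==> finsum M f A \<in> H"
proof (induction A rule: infinite_finite_induct)
 case (insert x F)
 hence "f \<in> F \<rightarrow> carrier M" "f x \<in>. M" using sub_carrier by auto
 thus ?case using insert by (simp add: sub_add)
qed (auto simp: sub_zero)

lemma sub_module:
 assumes "subsp H" shows "module R (M\<lparr>carrier := H\<rparr>)"
proof (rule moduleI)
 show "cring R" by (rule R.is_cring)
 show "abelian_group (M\<lparr>carrier := H\<rparr>)"
 proof (rule abelian_groupI)
  fix x assume "x \<in>. (M\<lparr>carrier := H\<rparr>)"
  hence "\<ominus>\<^sub>M x \<in> H" "x \<in>. M" using sub_neg[OF assms] sub_carrier[OF assms] by auto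
  thus "\<exists>y\<in>carrier (M\<lparr>carrier := H\<rparr>). y \<oplus>\<^bsub>M\<lparr>carrier := H\<rparr>\<^esub> x = \<zero>\<^bsub>M\<lparr>carrier := H\<rparr>\<^esub>"
   by (auto simp: M.l_neg intro: bexI[of _ "\<ominus>\<^sub>M x"])
 qed (use assms in \<open>auto simp: M.a_ac subsp_def subset_iff\<close>)
qed (use assms in \<open>auto simp: smult_l_distr smult_r_distr smult_assoc1 subsp_def subset_iff\<close>)

end

text \<open>\<open>lin_maps\<close> without extensionality: values outside the carrier are free, so
  composites, sums and constant maps are bare lambda terms.\<close>

definition lin ::
 "('k, 'x) ring_scheme => ('k, 'a, 'y) module_scheme => ('k, 'b, 'z) module_scheme => ('a => 'b) => bool" where
 "lin K M N f \<longleftrightarrow> f \<in> carrier M \<rightarrow> carrier N \<and>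
   (\<forall>x\<in>carrier M. \<forall>y\<in>carrier M. f (x \<oplus>\<^sub>M y) = f x \<oplus>\<^sub>N f y) \<and>
   (\<forall>a\<in>carrier K. \<forall>x\<in>carrier M. f (a \<odot>\<^sub>M x) = a \<odot>\<^sub>N f x)"

lemma linI:
 assumes "\<And>x. x \<in>. M ==> f x \<in>. N"
  "\<And>x y. x \<in>. M ==> y \<in>. M ==> f (x \<oplus>\<^sub>M y) = f x \<oplus>\<^sub>N f y"
  "\<And>a x. a \<in>. K ==> x \<in>. M ==> f (a \<odot>\<^sub>M x) = a \<odot>\<^sub>N f x"
 shows "lin K M N f" using assms by (auto simp: lin_def)

lemma lin_in: "lin K M N f ==> x \<in>. M ==> f x \<in>. N"
 and lin_add: "lin K M N f ==> x \<in>. M ==> y \<in>. M ==> f (x \<oplus>\<^sub>M y) = f x \<oplus>\<^sub>N f y"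
 and lin_smult: "lin K M N f ==> a \<in>. K ==> x \<in>. M ==> f (a \<odot>\<^sub>M x) = a \<odot>\<^sub>N f x"
 by (auto simp: lin_def)

lemma lin_cong:
 assumes "lin K M N f" "\<And>x. x \<in>. M ==> f x = g x" "module K M"
 shows "lin K M N g"
proof -
 interpret M: module K M by fact
 show ?thesis using assms(1) by (intro linI) (simp_all add: lin_in lin_add lin_smult flip: assms(2))
qed

lemma lin_zero: "lin K M N f ==> module K M ==> module K N ==> f \<zero>\<^sub>M = \<zero>\<^sub>N"
proof -
 assume f: "lin K M N f" and "module K M" "module K N"
 interpret M: module K M by fact
 interpret N: module K N by fact
 have "f (\<zero>\<^sub>K \<odot>\<^sub>M \<zero>\<^sub>M) = \<zero>\<^sub>K \<odot>\<^sub>N f \<zero>\<^sub>M" using f by (intro lin_smult) auto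
 thus ?thesis using f by (simp add: lin_in)
qed

lemma lin_neg:
 assumes "lin K M N f" "module K M" "module K N" "x \<in>. M"
 shows "f (\<ominus>\<^sub>M x) = \<ominus>\<^sub>N f x"
proof -
 interpret M: module K M by fact
 interpret N: module K N by fact
 show ?thesis using assms by (simp add: M.neg_smult N.neg_smult lin_smult lin_in)
qed

lemma lin_minus:
 assumes "lin K M N f" "module K M" "module K N" "x \<in>. M" "y \<in>. M"
 shows "f (x \<ominus>\<^sub>M y) = f x \<ominus>\<^sub>N f y"
proof -
 interpret M: module K M by fact
 show ?thesis using assms by (simp add: a_minus_def lin_add lin_neg)
qed

lemma lin_finsum:
 assumes "lin K M N f" "module K M" "module K N" "g \<in> A \<rightarrow> carrier M"
 shows "f (finsum M g A) = finsum N (\<lambda>i. f (g i)) A"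
proof -
 interpret M: module K M by fact
 interpret N: module K N by fact
 show ?thesis using assms(4)
 proof (induction A rule: infinite_finite_induct)
  case (insert x F)
  hence "g \<in> F \<rightarrow> carrier M" "g x \<in>. M" by auto
  moreover have "(\<lambda>i. f (g i)) \<in> F \<rightarrow> carrier N" using assms(1) calculation by (auto simp: lin_in Pi_iff)
  ultimately show ?case using insert assms(1) by (simp add: lin_add lin_in)
 qed (use assms in \<open>simp_all add: lin_zero\<close>)
qed

lemma lin_comp: "lin K M N f ==> lin K N L g ==> lin K M L (\<lambda>x. g (f x))"
 by (auto simp: lin_def Pi_def)

lemma lin_id: "lin K M M (\<lambda>x. x)"
 by (auto simp: lin_def)

lemma lin_const0: "module K N ==> lin K M N (\<lambda>x. \<zero>\<^sub>N)"
proof -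
 assume "module K N"
 then interpret N: module K N .
 show ?thesis by (auto simp: lin_def)
qed

lemma lin_plus:
 assumes "lin K M N f" "lin K M N g" "module K N"
 shows "lin K M N (\<lambda>x. f x \<oplus>\<^sub>N g x)"
proof -
 interpret N: module K N by fact
 show ?thesis using assms by (intro linI) (simp_all add: lin_in lin_add lin_smult N.smult_r_distr N.a_ac)
qed

lemma lin_scale:
 assumes "lin K M N f" "a \<in>. K" "module K N"
 shows "lin K M N (\<lambda>x. a \<odot>\<^sub>N f x)"
proof -
 interpret N: module K N by fact
 show ?thesis using assms
  by (intro linI) (simp_all add: lin_in lin_add lin_smult N.smult_r_distr N.R.m_comm flip: N.smult_assoc1)
qed

lemma lin_uminus:
 assumes "lin K M N f" "module K N"
 shows "lin K M N (\<lambda>x. \<ominus>\<^sub>N f x)"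
proof -
 interpret N: module K N by fact
 show ?thesis using assms by (intro linI) (simp_all add: lin_in lin_add lin_smult N.minus_add N.smult_r_minus)
qed

lemma lin_diff:
 assumes "lin K M N f" "lin K M N g" "module K N"
 shows "lin K M N (\<lambda>x. f x \<ominus>\<^sub>N g x)"
 using lin_plus[OF assms(1) lin_uminus[OF assms(2,3)] assms(3)] by (simp add: a_minus_def)

lemma lin_finsum_fun:
 assumes "\<And>i. i \<in> A ==> lin K M N (f i)" "module K M" "module K N"
 shows "lin K M N (\<lambda>x. finsum N (\<lambda>i. f i x) A)"
proof -
 interpret N: module K N by fact
 show ?thesis using assms(1)
 proof (induction A rule: infinite_finite_induct)
  case (insert j F)
  have l: "lin K M N (\<lambda>x. f j x \<oplus>\<^sub>N finsum N (\<lambda>i. f i x) F)"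
   by (rule lin_plus[OF _ _ assms(3)]) (use insert in auto)
  have e: "finsum N (\<lambda>i. f i x) (insert j F) = f j x \<oplus>\<^sub>N finsum N (\<lambda>i. f i x) F" if "x \<in>. M" for x
  proof -
   have "f i x \<in>. N" if "i \<in> insert j F" for i
    using lin_in[OF insert.prems[OF that]] \<open>x \<in>. M\<close> by simp
   thus ?thesis using insert(1,2) by (simp add: Pi_iff)
  qed
  show ?case by (rule lin_cong[OF l _ assms(2)]) (simp only: e)
 qed (simp_all add: lin_const0 assms)
qed

lemma lin_sub_dom: "lin K M N f ==> H \<subseteq> carrier M ==> lin K (M\<lparr>carrier := H\<rparr>) N f"
 by (intro linI) (auto simp: lin_in lin_add lin_smult subset_iff)

lemma lin_sub_cod: "lin K M N f ==> (\<And>x. x \<in>. M ==> f x \<in> H) ==> lin K M (N\<lparr>carrier := H\<rparr>) f"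
 by (auto simp: lin_def Pi_def)

definition Kmod :: "('k, 'x) ring_scheme => ('g, 'k, 'k) gmod" where
 "Kmod K = \<lparr>carrier = carrier K, monoid.mult = monoid.mult K, one = \<one>\<^sub>K, ring.zero = \<zero>\<^sub>K,
   ring.add = ring.add K, smult = monoid.mult K, act = (\<lambda>_ x. x)\<rparr>"

lemma Kmod_simps [simp]:
 "carrier (Kmod K) = carrier K" "\<zero>\<^bsub>Kmod K\<^esub> = \<zero>\<^sub>K" "x \<oplus>\<^bsub>Kmod K\<^esub> y = x \<oplus>\<^sub>K y"
 "x \<odot>\<^bsub>Kmod K\<^esub> y = x \<otimes>\<^sub>K y" "act (Kmod K) g x = x" by (simp_all add: Kmod_def)

lemma module_Kmod: "cring K ==> module K (Kmod K)"
proof -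
 assume "cring K"
 then interpret K: cring K .
 show ?thesis by (rule moduleI[OF K.is_cring])
   (auto simp: K.l_distr K.r_distr K.m_assoc K.a_ac intro!: abelian_groupI K.l_neg bexI[of _ "\<ominus>\<^sub>K _"])
qed

text \<open>Functionals only see the vector space; fixing the group type of \<open>Kmod\<close> to
  \<open>unit\<close> keeps a free type variable out of their statements.\<close>

abbreviation Kv where "Kv K \<equiv> Kmod K :: (unit, _, _) gmod"

abbreviation functional where "functional K M \<equiv> lin K M (Kv K)"

lemma lin_functional_smult:
 assumes "functional K M f" "y \<in>. N" "module K N"
 shows "lin K M N (\<lambda>x. f x \<odot>\<^sub>N y)"
proof -
 interpret N: module K N by fact
 show ?thesis using assms(1,2) lin_in[OF assms(1)]
  by (intro linI) (simp_all add: lin_add lin_smult N.smult_l_distr N.smult_assoc1)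
qed

lemma lin_smult_vec:
 assumes "y \<in>. N" "module K N"
 shows "lin K (Kmod K :: ('g, _, _) gmod) N (\<lambda>a. a \<odot>\<^sub>N y)"
proof -
 interpret N: module K N by fact
 show ?thesis using assms(1) by (intro linI) (simp_all add: N.smult_l_distr N.smult_assoc1)
qed

section \<open>Subspaces, functionals and bases\<close>

context abelian_group
begin

lemma minus_zero_iff: "x \<in>. G ==> y \<in>. G ==> x \<ominus> y = \<zero> \<longleftrightarrow> x = y"
 by (metis minus_eq r_neg minus_equality minus_minus a_inv_closed)

lemma add_minus_cancel_left: "x \<in>. G ==> y \<in>. G ==> (x \<oplus> y) \<ominus> x = y"
 by (metis minus_eq a_comm r_neg2 a_inv_closed add.m_closed r_neg1)

lemma minus_add_cancel: "x \<in>. G ==> y \<in>. G ==> (x \<ominus> y) \<oplus> y = x"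
 by (simp add: minus_eq a_assoc l_neg)

end

context module
begin

lemma subsp_vimage:
 assumes "lin R M N f" "module R N" "module.subsp R N H"
 shows "subsp {x \<in> carrier M. f x \<in> H}"
proof -
 interpret N: module R N by fact
 show ?thesis using assms(1) N.sub_zero[OF assms(3)] N.sub_add[OF assms(3)] N.sub_smult[OF assms(3)]
  by (intro subspI) (auto simp: lin_zero[OF _ module_axioms assms(2)] lin_add lin_smult)
qed

lemma subsp_zero: "subsp {\<zero>\<^sub>M}"
 by (rule subspI) auto

lemma subsp_carrier: "subsp (carrier M)"
 by (rule subspI) auto

text \<open>Equality of linear maps on generators spreads to the whole module through this
  subspace.\<close>

lemma subsp_equalizer:
 assumes "lin R M N f" "lin R M N g" "module R N"
 shows "subsp {x \<in> carrier M. f x = g x}"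
proof -
 interpret N: module R N by fact
 show ?thesis using assms by (intro subspI) (auto simp: lin_zero[OF _ module_axioms assms(3)] lin_add lin_smult)
qed

lemma finsum_Kmod: "finsum (Kmod K) f A = finsum K f A"
 by (simp add: finsum_def finprod_def Kmod_def)

lemma functional_finsum:
 "functional R M f ==> g \<in> A \<rightarrow> carrier M ==> f (\<Oplus>\<^sub>M i\<in>A. g i) = (\<Oplus>i\<in>A. f (g i))"
 using lin_finsum[OF _ module_axioms module_Kmod[OF R.is_cring], of f g A] by (simp add: finsum_Kmod)

lemma finsum_smult_vec:
 assumes "y \<in>. M" "c \<in> A \<rightarrow> carrier R" shows "(\<Oplus>\<^sub>M i\<in>A. c i \<odot>\<^sub>M y) = (\<Oplus>i\<in>A. c i) \<odot>\<^sub>M y"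
 using lin_finsum[OF lin_smult_vec[OF assms(1) module_axioms] module_Kmod[OF R.is_cring] module_axioms, of c A] assms(2)
 by (simp add: finsum_Kmod)

lemma subsp_kernel:
 assumes "lin R M N f" "module R N"
 shows "subsp {x \<in> carrier M. f x = \<zero>\<^sub>N}"
 by (rule subsp_equalizer[OF assms(1) lin_const0[OF assms(2)] assms(2)])

lemma subsp_image:
 assumes "lin R N M f" "module R N" "module.subsp R N H"
 shows "subsp (f ` H)"
proof -
 interpret N: module R N by fact
 note H = N.sub_zero[OF assms(3)] N.sub_add[OF assms(3)] N.sub_smult[OF assms(3)] N.sub_carrier[OF assms(3)]
 show ?thesis
 proof (rule subspI)
  show "f ` H \<subseteq> carrier M" using assms(1) H by (auto simp: lin_in)
  show "\<zero>\<^sub>M \<in> f ` H" using H lin_zero[OF assms(1,2) module_axioms] by force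
  fix x y assume "x \<in> f ` H" "y \<in> f ` H"
  then obtain u v where "x = f u" "y = f v" "u \<in> H" "v \<in> H" by blast
  thus "x \<oplus>\<^sub>M y \<in> f ` H" using H(2)[of u v] H(4) lin_add[OF assms(1), of u v] by (metis imageI)
 next
  fix a x assume a: "a \<in>. R" and "x \<in> f ` H"
  then obtain u where "x = f u" "u \<in> H" by blast
  thus "a \<odot>\<^sub>M x \<in> f ` H" using H(3)[OF a, of u] H(4) lin_smult[OF assms(1) a, of u] by (metis imageI)
 qed
qed

lemma subsp_range:
 "lin R N M f ==> module R N ==> subsp (f ` carrier N)" using subsp_image module.subsp_carrier by blast

lemma subsp_Inter: "S \<noteq> {} ==> (\<And>H. H \<in> S ==> subsp H) ==> subsp (\<Inter>S)"
proof (rule subspI)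
 assume S: "S \<noteq> {}" "\<And>H. H \<in> S ==> subsp H"
 show "\<Inter>S \<subseteq> carrier M" using S sub_carrier by blast
qed (auto simp: sub_zero sub_add sub_smult)

lemma subsp_line: "x \<in>. M ==> subsp ((\<lambda>a. a \<odot>\<^sub>M x) ` carrier R)"
proof -
 assume x: "x \<in>. M"
 have "subsp ((\<lambda>a. a \<odot>\<^sub>M x) ` carrier (Kv R))"
  using lin_smult_vec[OF x module_axioms] module_Kmod[OF R.is_cring] by (rule subsp_range)
 thus ?thesis by simp
qed

lemma subsp_sum:
 assumes "subsp H" "subsp L"
 shows "subsp {x \<oplus>\<^sub>M y | x y. x \<in> H \<and> y \<in> L}" (is "subsp ?S")
proof (rule subspI)
 note c = sub_carrier[OF assms(1)] sub_carrier[OF assms(2)]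
 show "?S \<subseteq> carrier M" using c by auto
 show "\<zero>\<^sub>M \<in> ?S" using sub_zero[OF assms(1)] sub_zero[OF assms(2)] by force
next
 note c = sub_carrier[OF assms(1)] sub_carrier[OF assms(2)]
 fix x y assume "x \<in> ?S" "y \<in> ?S"
 then obtain h l h' l' where "x = h \<oplus>\<^sub>M l" "y = h' \<oplus>\<^sub>M l'" "h \<in> H" "h' \<in> H" "l \<in> L" "l' \<in> L"
  by auto
 moreover from this have "x \<oplus>\<^sub>M y = (h \<oplus>\<^sub>M h') \<oplus>\<^sub>M (l \<oplus>\<^sub>M l')"
  using c by (simp add: M.a_ac)
 ultimately show "x \<oplus>\<^sub>M y \<in> ?S" using sub_add[OF assms(1)] sub_add[OF assms(2)] by blast
next
 fix a x assume "a \<in>. R" "x \<in> ?S"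
 thus "a \<odot>\<^sub>M x \<in> ?S"
  using sub_carrier[OF assms(1)] sub_carrier[OF assms(2)] sub_smult[OF assms(1)] sub_smult[OF assms(2)]
  by (fastforce simp: smult_r_distr)
qed

section \<open>Spans, complements, functionals and bases\<close>

definition spn where "spn S = \<Inter>{H. subsp H \<and> S \<subseteq> H}"

lemma subsp_spn: "S \<subseteq> carrier M ==> subsp (spn S)"
 unfolding spn_def using subsp_carrier by (intro subsp_Inter) auto

lemma spn_superset: "S \<subseteq> spn S"
 unfolding spn_def by auto

lemma spn_minimal: "subsp H ==> S \<subseteq> H ==> spn S \<subseteq> H"
 unfolding spn_def by auto

lemma spn_mono: "S \<subseteq> T ==> spn S \<subseteq> spn T"
 unfolding spn_def by auto

lemma lin_eq_on_spn:
 assumes "lin R M N f" "lin R M N g" "module R N" "S \<subseteq> carrier M" "\<And>x. x \<in> S ==> f x = g x" "x \<in> spn S"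
 shows "f x = g x" using spn_minimal[OF subsp_equalizer[OF assms(1-3)], of S] assms(4-) by auto

text \<open>Zorn provides a maximal subspace H' above H that meets L only in zero; maximality forces
  H' + L to be everything, and e is the projection onto L along H'. Retractions, functionals and
  sections below rest on this.\<close>

lemma ex_projection:
 assumes F: "field R" and H: "subsp H" and L: "subsp L" and HL: "H \<inter> L = {\<zero>\<^sub>M}"
 obtains e where "lin R M M e" "\<And>x. x \<in>. M ==> e x \<in> L" "\<And>x. x \<in> L ==> e x = x"
  "\<And>x. x \<in> H ==> e x = \<zero>\<^sub>M"
proof -
 interpret F: field R by fact
 define \<A> where "\<A> = {H'. subsp H' \<and> H \<subseteq> H' \<and> H' \<inter> L = {\<zero>\<^sub>M}}"
 have "\<exists>H'\<in>\<A>. \<forall>X\<in>\<A>. H' \<subseteq> X --> X = H'"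
 proof (rule subset_Zorn_nonempty)
  show "\<A> \<noteq> {}" using H HL unfolding \<A>_def by blast
  fix C assume C: "C \<noteq> {}" "subset.chain \<A> C"
  have CA: "C \<subseteq> \<A>" using C(2) by (auto simp: subset_chain_def)
  have "subsp (\<Union>C)"
  proof (rule subspI)
   show "\<Union>C \<subseteq> carrier M" using CA sub_carrier unfolding \<A>_def by blast
   show "\<zero>\<^sub>M \<in> \<Union>C" using CA C(1) sub_zero unfolding \<A>_def by blast
   fix x y assume "x \<in> \<Union>C" "y \<in> \<Union>C"
   then obtain Z where "Z \<in> C" "x \<in> Z" "y \<in> Z" using C(2) unfolding subset_chain_def by blast
   thus "x \<oplus>\<^sub>M y \<in> \<Union>C" using CA sub_add unfolding \<A>_def by blast
  next
   fix a x assume "a \<in>. R" "x \<in> \<Union>C"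
   thus "a \<odot>\<^sub>M x \<in> \<Union>C" using CA sub_smult unfolding \<A>_def by blast
  qed
  moreover have "H \<subseteq> \<Union>C" "\<Union>C \<inter> L = {\<zero>\<^sub>M}" using CA C(1) unfolding \<A>_def by blast+
  ultimately show "\<Union>C \<in> \<A>" unfolding \<A>_def by blast
 qed
 then obtain H' where H': "subsp H'" "H \<subseteq> H'" "H' \<inter> L = {\<zero>\<^sub>M}"
  and max: "\<And>X. subsp X ==> X \<inter> L = {\<zero>\<^sub>M} ==> H' \<subseteq> X ==> X = H'"
  unfolding \<A>_def by auto
 note c = sub_carrier[OF H'(1)] sub_carrier[OF L]
 \<comment> \<open>Otherwise adjoining x to H' would give a larger subspace that still meets L
   trivially.\<close>
 have ex: "\<exists>h\<in>H'. \<exists>l\<in>L. x = h \<oplus>\<^sub>M l" if x: "x \<in>. M" for x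
 proof (rule ccontr)
  assume neg: "\<not> ?thesis"
  let ?X = "{h \<oplus>\<^sub>M y | h y. h \<in> H' \<and> y \<in> (\<lambda>a. a \<odot>\<^sub>M x) ` carrier R}"
  have X: "subsp ?X" by (rule subsp_sum[OF H'(1) subsp_line[OF x]])
  have XI: "h \<oplus>\<^sub>M a \<odot>\<^sub>M x \<in> ?X" if "h \<in> H'" "a \<in>. R" for h a using that by blast
  have "l = \<zero>\<^sub>M" if "l \<in> ?X" and l: "l \<in> L" for l
  proof -
   obtain h a where ha: "l = h \<oplus>\<^sub>M a \<odot>\<^sub>M x" "h \<in> H'" "a \<in>. R" using \<open>l \<in> ?X\<close> by blast
   show ?thesis
   \<comment> \<open>A vector of L with nonzero x-coefficient a can be solved for x, which
     contradicts the choice of x.\<close>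
   proof (cases "a = \<zero>")
    case True thus ?thesis using ha x l c H'(3) by auto
   next
    case False
    hence a: "inv a \<in>. R" "inv a \<otimes> a = \<one>" using ha(3) F.field_Units by auto
    have "inv a \<odot>\<^sub>M l = inv a \<odot>\<^sub>M h \<oplus>\<^sub>M x" using ha a x c by (simp add: smult_r_distr flip: smult_assoc1)
    hence "x = (\<ominus>\<^sub>M (inv a \<odot>\<^sub>M h)) \<oplus>\<^sub>M inv a \<odot>\<^sub>M l" using a ha x c by (simp add: M.r_neg1)
    moreover have "\<ominus>\<^sub>M (inv a \<odot>\<^sub>M h) \<in> H'" using sub_neg[OF H'(1)] sub_smult[OF H'(1)] ha a by blast
    ultimately show ?thesis using neg sub_smult[OF L a(1) l] by blast
   qed
  qed
  hence "?X \<inter> L = {\<zero>\<^sub>M}" using sub_zero[OF X] sub_zero[OF L] by blast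
  moreover have "h \<in> ?X" if "h \<in> H'" for h using XI[of h \<zero>] x c that by simp
  ultimately have "?X = H'" using max[OF X] by blast
  hence "x \<in> H'" using XI[of "\<zero>\<^sub>M" \<one>] sub_zero[OF H'(1)] x by simp
  thus False using neg sub_zero[OF L] x c by (metis M.r_zero)
 qed
 define e where "e x = (THE l. l \<in> L \<and> (\<exists>h\<in>H'. x = h \<oplus>\<^sub>M l))" for x
 \<comment> \<open>The L-component is unique because the difference of two choices lies both in H'
   and in L.\<close>
 have e: "e (h \<oplus>\<^sub>M l) = l" if "h \<in> H'" "l \<in> L" for h l unfolding e_def
 proof (rule the_equality)
  fix l' assume "l' \<in> L \<and> (\<exists>h'\<in>H'. h \<oplus>\<^sub>M l = h' \<oplus>\<^sub>M l')"
  then obtain h' where l': "l' \<in> L" "h' \<in> H'" "h \<oplus>\<^sub>M l = h' \<oplus>\<^sub>M l'" by blast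
  have "(h \<ominus>\<^sub>M h') \<oplus>\<^sub>M (h' \<oplus>\<^sub>M l) = (l' \<ominus>\<^sub>M l) \<oplus>\<^sub>M (h' \<oplus>\<^sub>M l)"
  proof -
   have "(h \<ominus>\<^sub>M h') \<oplus>\<^sub>M (h' \<oplus>\<^sub>M l) = h \<oplus>\<^sub>M l"
    using that l' c by (simp add: M.minus_eq M.a_assoc M.r_neg1)
   also have "... = (l' \<ominus>\<^sub>M l) \<oplus>\<^sub>M (l \<oplus>\<^sub>M h')"
    using that l' c by (simp add: M.minus_eq M.a_assoc M.r_neg1) (simp add: M.a_comm)
   finally show ?thesis using that l' c by (simp add: M.a_comm)
  qed
  hence "h \<ominus>\<^sub>M h' = l' \<ominus>\<^sub>M l" using that l' c by simp
  hence "l' \<ominus>\<^sub>M l \<in> H' \<inter> L"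
   using sub_minus[OF H'(1) that(1) l'(2)] sub_minus[OF L l'(1) that(2)] by simp
  hence "l' \<ominus>\<^sub>M l = \<zero>\<^sub>M" using H'(3) by simp
  thus "l' = l" using c that l' by (simp add: M.minus_zero_iff)
 qed (use that in auto)
 show thesis
 proof (rule that[of e])
  show "lin R M M e"
  proof (rule linI)
   fix x assume x: "x \<in>. M"
   obtain h l where hl: "h \<in> H'" "l \<in> L" "x = h \<oplus>\<^sub>M l" using ex[OF x] by blast
   show "e x \<in>. M" using e[OF hl(1,2)] hl c(2) by simp
   { fix y assume y: "y \<in>. M"
    obtain h' l' where hl': "h' \<in> H'" "l' \<in> L" "y = h' \<oplus>\<^sub>M l'" using ex[OF y] by blast
    have "x \<oplus>\<^sub>M y = (h \<oplus>\<^sub>M h') \<oplus>\<^sub>M (l \<oplus>\<^sub>M l')"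
     using c hl hl' by (simp add: M.a_ac)
    thus "e (x \<oplus>\<^sub>M y) = e x \<oplus>\<^sub>M e y" using hl hl' e sub_add[OF H'(1)] sub_add[OF L] by simp }
   fix a assume a: "a \<in>. R"
   have "a \<odot>\<^sub>M x = a \<odot>\<^sub>M h \<oplus>\<^sub>M a \<odot>\<^sub>M l" using hl c a by (simp add: smult_r_distr)
   thus "e (a \<odot>\<^sub>M x) = a \<odot>\<^sub>M e x" using hl e a sub_smult[OF H'(1)] sub_smult[OF L] by simp
  qed
  show "e x \<in> L" if "x \<in>. M" for x using ex[OF that] e by auto
  show "e x = x" if "x \<in> L" for x using e[OF sub_zero[OF H'(1)] that] c(2)[OF that] by simp
  show "e x = \<zero>\<^sub>M" if "x \<in> H" for x
   using e[of x "\<zero>\<^sub>M"] sub_zero[OF L] that H'(2) c(1)[of x] by (simp add: subsetD)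
 qed
qed

lemma ex_retraction:
 assumes "field R" "subsp L"
 obtains e where "lin R M M e" "\<And>x. x \<in>. M ==> e x \<in> L" "\<And>x. x \<in> L ==> e x = x"
proof -
 have "{\<zero>\<^sub>M} \<inter> L = {\<zero>\<^sub>M}" using sub_zero[OF assms(2)] by simp
 thus thesis by (rule ex_projection[OF assms(1) subsp_zero assms(2)]) (rule that)
qed

text \<open>Project onto the line through b along H and read off the coefficient of b.\<close>

lemma ex_functional:
 assumes F: "field R" and H: "subsp H" and b: "b \<in>. M" "b \<notin> H"
 obtains f where "functional R M f" "\<And>x. x \<in> H ==> f x = \<zero>" "f b = \<one>"
proof -
 interpret F: field R by fact
 let ?L = "(\<lambda>a. a \<odot>\<^sub>M b) ` carrier R"
 have scale: "a = \<zero>" if "a \<in>. R" "a \<odot>\<^sub>M b \<in> H" for a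
 proof (rule ccontr)
  assume "a \<noteq> \<zero>"
  hence "inv a \<in>. R" "inv a \<otimes> a = \<one>" using that F.field_Units by auto
  moreover from this have "inv a \<odot>\<^sub>M (a \<odot>\<^sub>M b) = b" using that b by (simp flip: smult_assoc1)
  ultimately show False using sub_smult[OF H _ that(2)] b by metis
 qed
 have "H \<inter> ?L = {\<zero>\<^sub>M}"
 proof
  show "H \<inter> ?L \<subseteq> {\<zero>\<^sub>M}" using scale b by fastforce
  show "{\<zero>\<^sub>M} \<subseteq> H \<inter> ?L" using sub_zero[OF H] sub_zero[OF subsp_line[OF b(1)]] by simp
 qed
 then obtain e where e: "lin R M M e" "\<And>x. x \<in>. M ==> e x \<in> ?L" "\<And>x. x \<in> ?L ==> e x = x"
  "\<And>x. x \<in> H ==> e x = \<zero>\<^sub>M" by (rule ex_projection[OF F H subsp_line[OF b(1)]]) (rule that)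
 have inj: "a = a'" if "a \<in>. R" "a' \<in>. R" "a \<odot>\<^sub>M b = a' \<odot>\<^sub>M b" for a a'
 proof -
  have "(a \<ominus> a') \<odot>\<^sub>M b = \<zero>\<^sub>M"
   using that b by (simp add: R.minus_eq smult_l_distr smult_l_minus M.r_neg)
  hence "a \<ominus> a' = \<zero>" using scale that sub_zero[OF H] by simp
  thus ?thesis using that by simp
 qed
 define f where "f x = (THE a. a \<in>. R \<and> e x = a \<odot>\<^sub>M b)" for x
 have f: "f x = a" if "a \<in>. R" "e x = a \<odot>\<^sub>M b" for x a
  unfolding f_def using that inj by (intro the_equality) auto
 have ex: "\<exists>a\<in>carrier R. e x = a \<odot>\<^sub>M b" if "x \<in>. M" for x using e(2)[OF that] by auto
 show thesis
 proof (rule that[of f])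
  show "functional R M f"
  proof (rule linI)
   fix x assume x: "x \<in>. M"
   obtain a where a: "a \<in>. R" "e x = a \<odot>\<^sub>M b" using ex[OF x] by blast
   show "f x \<in>. (Kmod R)" using f[OF a] a by simp
   { fix y assume y: "y \<in>. M"
    obtain a' where a': "a' \<in>. R" "e y = a' \<odot>\<^sub>M b" using ex[OF y] by blast
    have "e (x \<oplus>\<^sub>M y) = (a \<oplus> a') \<odot>\<^sub>M b" using a a' x y b by (simp add: lin_add[OF e(1)] smult_l_distr)
    thus "f (x \<oplus>\<^sub>M y) = f x \<oplus>\<^bsub>Kmod R\<^esub> f y" using f a a' by simp }
   fix c assume c: "c \<in>. R"
   have "e (c \<odot>\<^sub>M x) = (c \<otimes> a) \<odot>\<^sub>M b" using a c x b by (simp add: lin_smult[OF e(1)] smult_assoc1)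
   thus "f (c \<odot>\<^sub>M x) = c \<odot>\<^bsub>Kmod R\<^esub> f x" using f a c by simp
  qed
  show "f x = \<zero>" if "x \<in> H" for x using f[of \<zero> x] e(4)[OF that] b by simp
  have "b \<in> ?L" using b by (intro image_eqI[of _ _ \<one>]) auto
  thus "f b = \<one>" using f[of \<one> b] e(3) b by simp
 qed
qed

text \<open>The sum of the span of S and the line through x is a subspace that contains S and
  x.\<close>

lemma spn_insert:
 assumes "S \<subseteq> carrier M" "x \<in>. M" "y \<in> spn (insert x S)"
 shows "\<exists>s\<in>spn S. \<exists>a\<in>carrier R. y = s \<oplus>\<^sub>M a \<odot>\<^sub>M x"
proof -
 let ?T = "{u \<oplus>\<^sub>M v | u v. u \<in> spn S \<and> v \<in> (\<lambda>a. a \<odot>\<^sub>M x) ` carrier R}"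
 have "subsp ?T" by (rule subsp_sum[OF subsp_spn[OF assms(1)] subsp_line[OF assms(2)]])
 moreover have "insert x S \<subseteq> ?T"
 proof
  fix y assume "y \<in> insert x S"
  thus "y \<in> ?T"
  proof
   assume "y = x"
   moreover have "x \<in> (\<lambda>a. a \<odot>\<^sub>M x) ` carrier R" using assms by (intro image_eqI[of _ _ \<one>]) auto
   moreover have "y = \<zero>\<^sub>M \<oplus>\<^sub>M x" using \<open>y = x\<close> assms by simp
   ultimately show ?thesis using sub_zero[OF subsp_spn[OF assms(1)]] by blast
  next
   assume "y \<in> S"
   hence "y \<in> spn S" "y = y \<oplus>\<^sub>M \<zero>\<^sub>M" using assms(1) spn_superset[of S] by auto
   thus ?thesis using sub_zero[OF subsp_line[OF assms(2)]] by blast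
  qed
 qed
 ultimately have "spn (insert x S) \<subseteq> ?T" by (rule spn_minimal)
 hence "y \<in> ?T" using assms(3) by (rule subsetD)
 thus ?thesis by auto
qed

text \<open>B is a maximal set in which no element lies in the span of the others; the coordinate of
  b is a functional that kills the span of B - {b} and is 1 at b.\<close>

lemma ex_basis:
 assumes F: "field R"
 obtains B \<chi> where "B \<subseteq> carrier M" "spn B = carrier M" "\<And>b. b \<in> B ==> functional R M (\<chi> b)"
  "\<And>b b'. b \<in> B ==> b' \<in> B ==> \<chi> b b' = (if b = b' then \<one> else \<zero>)"
proof -
 interpret F: field R by fact
 define \<A> where "\<A> = {B. B \<subseteq> carrier M \<and> (\<forall>b\<in>B. b \<notin> spn (B - {b}))}"
 have "\<exists>B\<in>\<A>. \<forall>X\<in>\<A>. B \<subseteq> X --> X = B"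
 proof (rule subset_Zorn_nonempty)
  show "\<A> \<noteq> {}" unfolding \<A>_def by blast
  fix C assume C: "C \<noteq> {}" "subset.chain \<A> C"
  have CA: "C \<subseteq> \<A>" using C(2) by (auto simp: subset_chain_def)
  have lin: "X \<subseteq> Y \<or> Y \<subseteq> X" if "X \<in> C" "Y \<in> C" for X Y
   using C(2) that by (auto simp: subset_chain_def)
  have "b \<notin> spn (\<Union>C - {b})" if b: "b \<in> \<Union>C" for b
  proof
   assume bs: "b \<in> spn (\<Union>C - {b})"
   \<comment> \<open>The union of the spans of the members of the chain without b. It is a subspace
     since the chain is directed, so b already depends on the other elements of a single member,
     which is impossible.\<close>
   define T where "T = (\<Union>X\<in>C. spn (X - {b}))"
   have XM: "X \<subseteq> carrier M" if "X \<in> C" for X using that CA unfolding \<A>_def by blast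
   have sX: "subsp (spn (X - {b}))" if "X \<in> C" for X using XM[OF that] by (intro subsp_spn) auto
   have "subsp T"
   proof (rule subspI)
    show "T \<subseteq> carrier M" using sX sub_carrier unfolding T_def by blast
    show "\<zero>\<^sub>M \<in> T" using sX C(1) sub_zero unfolding T_def by blast
   next
    fix x y assume "x \<in> T" "y \<in> T"
    then obtain X Y where X: "x \<in> spn (X - {b})" "X \<in> C" and Y: "y \<in> spn (Y - {b})" "Y \<in> C"
     unfolding T_def by blast
    obtain Z where Z: "Z \<in> C" "X \<subseteq> Z" "Y \<subseteq> Z" using lin[OF X(2) Y(2)] X Y by blast
    have "x \<in> spn (Z - {b})" "y \<in> spn (Z - {b})"
     using X Y Z spn_mono[of "X - {b}" "Z - {b}"] spn_mono[of "Y - {b}" "Z - {b}"] by auto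
    hence "x \<oplus>\<^sub>M y \<in> spn (Z - {b})" by (rule sub_add[OF sX[OF Z(1)]])
    thus "x \<oplus>\<^sub>M y \<in> T" using Z(1) unfolding T_def by (rule UN_I[rotated])
   next
    fix a x assume a: "a \<in>. R" and "x \<in> T"
    then obtain X where X: "x \<in> spn (X - {b})" "X \<in> C" unfolding T_def by blast
    from sub_smult[OF sX[OF X(2)] a X(1)] show "a \<odot>\<^sub>M x \<in> T" using X(2) unfolding T_def by blast
   qed
   moreover have "\<Union>C - {b} \<subseteq> T"
   proof
    fix x assume "x \<in> \<Union>C - {b}"
    then obtain X where "X \<in> C" "x \<in> X - {b}" by blast
    thus "x \<in> T" using spn_superset[of "X - {b}"] unfolding T_def by blast
   qed
   ultimately have "spn (\<Union>C - {b}) \<subseteq> T" by (rule spn_minimal)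
   hence "b \<in> T" using bs by (rule subsetD)
   then obtain X where X: "b \<in> spn (X - {b})" "X \<in> C" by (auto simp: T_def)
   obtain Y where Y: "b \<in> Y" "Y \<in> C" using b by blast
   obtain Z where Z: "Z \<in> C" "X \<subseteq> Z" "b \<in> Z" using lin[OF X(2) Y(2)] X Y by blast
   have "b \<in> spn (Z - {b})" using X Z spn_mono[of "X - {b}" "Z - {b}"] by auto
   moreover have "Z \<in> \<A>" using Z CA by auto
   ultimately show False using Z(3) by (auto simp: \<A>_def)
  qed
  moreover have "\<Union>C \<subseteq> carrier M" using CA by (auto simp: \<A>_def)
  ultimately show "\<Union>C \<in> \<A>" by (simp add: \<A>_def)
 qed
 then obtain B where B: "B \<subseteq> carrier M" "\<And>b. b \<in> B ==> b \<notin> spn (B - {b})"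
  and max: "\<And>X. X \<in> \<A> ==> B \<subseteq> X ==> X = B" by (auto simp: \<A>_def)
 have "carrier M \<subseteq> spn B"
 proof (rule ccontr)
  assume "\<not> ?thesis"
  then obtain x where x: "x \<in>. M" "x \<notin> spn B" by blast
  have "b \<notin> spn (insert x B - {b})" if b: "b \<in> insert x B" for b
  proof (cases "b = x")
   case True
   thus ?thesis using x spn_mono[of "insert x B - {b}" B] by auto
  next
   case False
   hence bB: "b \<in> B" and eq: "insert x B - {b} = insert x (B - {b})" using b by auto
   show ?thesis unfolding eq
   proof
    \<comment> \<open>Exchange: b depends on B - {b} and x. If the coefficient of x is nonzero, then
      x lies in the span of B; if it is zero, then b was dependent before.\<close>
    assume "b \<in> spn (insert x (B - {b}))"
    then obtain s a where sa: "s \<in> spn (B - {b})" "a \<in>. R" "b = s \<oplus>\<^sub>M a \<odot>\<^sub>M x"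
     using spn_insert[of "B - {b}" x b] B(1) x(1) by auto
    have "subsp (spn (B - {b}))" using B(1) by (intro subsp_spn) auto
    hence s: "s \<in>. M" using sa(1) by (rule sub_carrier)
    have ss: "subsp (spn B)" using B(1) by (rule subsp_spn)
    show False
    proof (cases "a = \<zero>")
     case True thus False using sa x s B(2)[OF bB] by simp
    next
     case False
     hence a: "inv a \<in>. R" "inv a \<otimes> a = \<one>" using sa F.field_Units by auto
     have "x = inv a \<odot>\<^sub>M (b \<ominus>\<^sub>M s)"
     proof -
      have "b \<ominus>\<^sub>M s = a \<odot>\<^sub>M x" using sa s x by (simp add: M.minus_eq M.a_ac M.r_neg1 M.r_neg2)
      thus ?thesis using a sa x by (simp flip: smult_assoc1)
     qed
     moreover have "s \<in> spn B" using sa(1) spn_mono[of "B - {b}" B] by auto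
     moreover have "b \<in> spn B" using bB spn_superset[of B] by auto
     ultimately have "x \<in> spn B" using sub_smult[OF ss a(1)] sub_minus[OF ss] by simp
     thus False using x by simp
    qed
   qed
  qed
  hence "insert x B \<in> \<A>" using B(1) x(1) by (simp add: \<A>_def)
  from max[OF this] have "x \<in> B" by auto
  thus False using x(2) spn_superset[of B] by auto
 qed
 hence span: "spn B = carrier M" using sub_carrier[OF subsp_spn[OF B(1)]] by auto
 have "\<exists>f. functional R M f \<and> (\<forall>x\<in>spn (B - {b}). f x = \<zero>) \<and> f b = \<one>" if "b \<in> B" for b
 proof -
  have "subsp (spn (B - {b}))" "b \<in>. M" using B(1) that by (auto intro: subsp_spn)
  thus ?thesis by (rule ex_functional[OF F _ _ B(2)[OF that]]) auto
 qed
 then obtain \<chi> where \<chi>: "\<And>b. b \<in> B ==> functional R M (\<chi> b) \<and> (\<forall>x\<in>spn (B - {b}). \<chi> b x = \<zero>) \<and> \<chi> b b = \<one>"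
  by metis
 show thesis
 proof (rule that[OF B(1) span])
  show "functional R M (\<chi> b)" if "b \<in> B" for b using \<chi> that by blast
  show "\<chi> b b' = (if b = b' then \<one> else \<zero>)" if "b \<in> B" "b' \<in> B" for b b'
   using \<chi>[OF that(1)] that spn_superset[of "B - {b}"] by auto
 qed
qed

end

section \<open>Direct sums\<close>

text \<open>An internal direct sum. The last assumption, that the summands generate, serves as an
  induction principle; the expansion of a vector as a finite sum is derived from it
  (\<open>finite_supp\<close>, \<open>expand\<close>).\<close>

locale lsum = M: module K M for K :: "('k, 'x) ring_scheme" and M :: "('k, 'b, 'z) module_scheme" +
 fixes I :: "'i set" and A :: "'i => ('k, 'a, 'y) module_scheme"
  and inc :: "'i => 'a => 'b" and prj :: "'i => 'b => 'a"
 assumes summand_module: "i \<in> I ==> module K (A i)"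
  and lin_inc: "i \<in> I ==> lin K (A i) M (inc i)"
  and lin_prj: "i \<in> I ==> lin K M (A i) (prj i)"
  and prj_inc: "i \<in> I ==> x \<in>. (A i) ==> prj i (inc i x) = x"
  and prj_inc_zero: "i \<in> I ==> j \<in> I ==> i \<noteq> j ==> x \<in>. (A i) ==> prj j (inc i x) = \<zero>\<^bsub>A j\<^esub>"
  and generated: "M.subsp H ==> (\<And>i x. i \<in> I ==> x \<in>. (A i) ==> inc i x \<in> H) ==>
   y \<in>. M ==> y \<in> H"
begin

lemma lin_ext:
 assumes "lin K M N f" "lin K M N g" "module K N"
  "\<And>i x. i \<in> I ==> x \<in>. (A i) ==> f (inc i x) = g (inc i x)" "x \<in>. M"
 shows "f x = g x" using generated[OF M.subsp_equalizer[OF assms(1-3)] _ assms(5)] assms(4) lin_in[OF lin_inc] by auto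

definition supp where "supp x = {i \<in> I. prj i x \<noteq> \<zero>\<^bsub>A i\<^esub>}"

lemma supp_inc: "i \<in> I ==> x \<in>. (A i) ==> supp (inc i x) \<subseteq> {i}"
 unfolding supp_def using prj_inc_zero by blast

lemma supp_add: "x \<in>. M ==> y \<in>. M ==> supp (x \<oplus>\<^sub>M y) \<subseteq> supp x \<union> supp y"
proof
 fix i assume xy: "x \<in>. M" "y \<in>. M" and i: "i \<in> supp (x \<oplus>\<^sub>M y)"
 interpret A: module K "A i" using summand_module i by (simp add: supp_def)
 show "i \<in> supp x \<union> supp y" using i xy lin_add[OF lin_prj] by (auto simp: supp_def)
qed

lemma supp_smult: "a \<in>. K ==> x \<in>. M ==> supp (a \<odot>\<^sub>M x) \<subseteq> supp x"
proof
 fix i assume xy: "a \<in>. K" "x \<in>. M" and i: "i \<in> supp (a \<odot>\<^sub>M x)"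
 interpret A: module K "A i" using summand_module i by (simp add: supp_def)
 show "i \<in> supp x" using i xy lin_smult[OF lin_prj] by (auto simp: supp_def)
qed

lemma supp_zero: "supp \<zero>\<^sub>M = {}"
 using lin_zero[OF lin_prj M.modl summand_module] by (auto simp: supp_def)

text \<open>The vectors of finite support form a subspace that contains every summand.\<close>

lemma finite_supp:
 assumes "x \<in>. M" shows "finite (supp x)"
proof -
 have "M.subsp {x \<in> carrier M. finite (supp x)}"
 proof (rule M.subspI)
  fix x y assume "x \<in> {x \<in> carrier M. finite (supp x)}" "y \<in> {x \<in> carrier M. finite (supp x)}"
  thus "x \<oplus>\<^sub>M y \<in> {x \<in> carrier M. finite (supp x)}"
   using finite_subset[OF supp_add, of x y] by simp
 next
  fix a x assume "a \<in>. K" "x \<in> {x \<in> carrier M. finite (supp x)}"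
  thus "a \<odot>\<^sub>M x \<in> {x \<in> carrier M. finite (supp x)}"
   using finite_subset[OF supp_smult, of a x] by simp
 qed (auto simp: supp_zero)
 hence "x \<in> {x \<in> carrier M. finite (supp x)}"
  by (rule generated[OF _ _ assms]) (use lin_in[OF lin_inc] finite_subset[OF supp_inc] in auto)
 thus ?thesis by simp
qed

text \<open>The linear map out of the direct sum whose component on the i-th summand is
  \<open>h i\<close>.\<close>

definition gather where
 "gather N h x = finsum N (\<lambda>i. h i (prj i x)) (supp x)"

context
 fixes N :: "('k, 'c, 'w) module_scheme" and h
 assumes N: "module K N" and h: "\<And>i. i \<in> I ==> lin K (A i) N (h i)"
begin

text \<open>Enlarging the support to a common finite index set is what makes the sums for different
  vectors comparable.\<close>

lemma gather_eq:
 assumes "x \<in>. M" "finite F" "F \<subseteq> I" "supp x \<subseteq> F"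
 shows "gather N h x = finsum N (\<lambda>i. h i (prj i x)) F"
proof -
 interpret N: module K N by (rule N)
 have c: "h i (prj i x) \<in>. N" if "i \<in> I" for i using lin_in[OF h lin_in[OF lin_prj]] that assms(1) by blast
 show ?thesis unfolding gather_def
 proof (rule N.add.finprod_mono_neutral_cong_left)
  fix i assume "i \<in> F - supp x"
  hence i: "i \<in> I" "prj i x = \<zero>\<^bsub>A i\<^esub>" using assms(3) by (auto simp: supp_def)
  thus "h i (prj i x) = \<zero>\<^sub>N" using lin_zero[OF h summand_module N] by simp
 qed (use assms c in \<open>auto simp: supp_def\<close>)
qed

lemma lin_gather: "lin K M N (gather N h)"
proof (rule linI)
 interpret N: module K N by (rule N)
 have c: "h i (prj i x) \<in>. N" if "i \<in> I" "x \<in>. M" for i x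
  using lin_in[OF h lin_in[OF lin_prj]] that by blast
 have s: "supp x \<subseteq> I" for x by (auto simp: supp_def)
 fix x assume x: "x \<in>. M"
 show "gather N h x \<in>. N" unfolding gather_def using c x s by (intro N.finsum_closed) auto
 { fix y assume y: "y \<in>. M"
  let ?F = "supp x \<union> supp y"
  have F: "finite ?F" "?F \<subseteq> I" using x y finite_supp s by auto
  have e: "h i (prj i (x \<oplus>\<^sub>M y)) = h i (prj i x) \<oplus>\<^sub>N h i (prj i y)" if "i \<in> I" for i
   using x y that by (simp add: lin_add[OF lin_prj] lin_add[OF h] lin_in[OF lin_prj])
  have "gather N h (x \<oplus>\<^sub>M y) = finsum N (\<lambda>i. h i (prj i (x \<oplus>\<^sub>M y))) ?F"
   using x y supp_add by (intro gather_eq F) auto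
  also have "... = finsum N (\<lambda>i. h i (prj i x) \<oplus>\<^sub>N h i (prj i y)) ?F"
   using F(2) c x y e by (intro N.finsum_cong') auto
  also have "... = finsum N (\<lambda>i. h i (prj i x)) ?F \<oplus>\<^sub>N finsum N (\<lambda>i. h i (prj i y)) ?F"
   using c x y F(2) by (intro N.finsum_addf) auto
  also have "... = gather N h x \<oplus>\<^sub>N gather N h y" using gather_eq[OF x F] gather_eq[OF y F] by simp
  finally show "gather N h (x \<oplus>\<^sub>M y) = gather N h x \<oplus>\<^sub>N gather N h y" . }
 fix a assume a: "a \<in>. K"
 have F: "finite (supp x)" "supp x \<subseteq> I" using x finite_supp s by auto
 have "gather N h (a \<odot>\<^sub>M x) = finsum N (\<lambda>i. a \<odot>\<^sub>N h i (prj i x)) (supp x)"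
  using x a F c supp_smult[OF a x] by (subst gather_eq[OF _ F])
   (auto intro!: N.finsum_cong' simp: lin_smult[OF lin_prj] lin_smult[OF h] lin_in[OF lin_prj] subset_iff)
 also have "... = a \<odot>\<^sub>N gather N h x"
  unfolding gather_def using a c x F by (intro N.finsum_smult_ldistr[symmetric]) auto
 finally show "gather N h (a \<odot>\<^sub>M x) = a \<odot>\<^sub>N gather N h x" .
qed

lemma gather_inc:
 assumes "i \<in> I" "x \<in>. (A i)" shows "gather N h (inc i x) = h i x"
proof -
 interpret N: module K N by (rule N)
 have "gather N h (inc i x) = finsum N (\<lambda>j. h j (prj j (inc i x))) {i}"
  using assms supp_inc lin_in[OF lin_inc] by (intro gather_eq) auto
 thus ?thesis using assms lin_in[OF h] by (simp add: prj_inc)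
qed

end

lemma expand:
 assumes "x \<in>. M" "finite F" "F \<subseteq> I" "supp x \<subseteq> F"
 shows "x = finsum M (\<lambda>i. inc i (prj i x)) F"
proof -
 have "gather M inc x = x" by (rule lin_ext[OF lin_gather[OF M.modl lin_inc] lin_id M.modl _ assms(1)])
   (simp_all add: gather_inc[OF M.modl lin_inc])
 thus ?thesis using gather_eq[OF M.modl lin_inc assms] by simp
qed

end

text \<open>Families with pointwise operations on a set C of functions. Different C give direct sums
  (finite support) and coinduced modules (all functions on the group); the action is left open as a
  parameter.\<close>

definition fmod ::
 "'i set => ('i => ('k, 'a, 'y) module_scheme) => ('i => 'a) set =>
  ('g => ('i => 'a) => 'i => 'a) => ('g, 'k, 'i => 'a) gmod" where
 "fmod I A C r = \<lparr>carrier = C, monoid.mult = undefined, one = undefined,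
   ring.zero = (\<lambda>i\<in>I. \<zero>\<^bsub>A i\<^esub>), ring.add = (\<lambda>x y. \<lambda>i\<in>I. x i \<oplus>\<^bsub>A i\<^esub> y i),
   smult = (\<lambda>a x. \<lambda>i\<in>I. a \<odot>\<^bsub>A i\<^esub> x i), act = r\<rparr>"

lemma fmod_simps [simp]:
 "carrier (fmod I A C r) = C" "\<zero>\<^bsub>fmod I A C r\<^esub> = (\<lambda>i\<in>I. \<zero>\<^bsub>A i\<^esub>)"
 "x \<oplus>\<^bsub>fmod I A C r\<^esub> y = (\<lambda>i\<in>I. x i \<oplus>\<^bsub>A i\<^esub> y i)"
 "a \<odot>\<^bsub>fmod I A C r\<^esub> x = (\<lambda>i\<in>I. a \<odot>\<^bsub>A i\<^esub> x i)" "act (fmod I A C r) = r"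
 by (simp_all add: fmod_def)

lemma module_fmod:
 assumes K: "cring K" and A: "\<And>i. i \<in> I ==> module K (A i)"
  and C: "C \<subseteq> (\<Pi>\<^sub>E i\<in>I. carrier (A i))" "(\<lambda>i\<in>I. \<zero>\<^bsub>A i\<^esub>) \<in> C"
   "\<And>x y. x \<in> C ==> y \<in> C ==> (\<lambda>i\<in>I. x i \<oplus>\<^bsub>A i\<^esub> y i) \<in> C"
   "\<And>a x. a \<in>. K ==> x \<in> C ==> (\<lambda>i\<in>I. a \<odot>\<^bsub>A i\<^esub> x i) \<in> C"
 shows "module K (fmod I A C r)"
proof -
 interpret K: cring K by fact
 have Cc: "x i \<in>. (A i)" if "x \<in> C" "i \<in> I" for x i using C(1) that by auto
 have Ce: "x \<in> extensional I" if "x \<in> C" for x using C(1) that by (auto simp: PiE_def)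
 have ag: "abelian_group (A i)" if "i \<in> I" for i using A[OF that] by (simp add: module_def)
 note agm = abelian_group.axioms(1)[OF ag]
 show ?thesis
 proof (rule moduleI[OF K])
  show "abelian_group (fmod I A C r)"
  proof (rule abelian_groupI)
   fix x assume x: "x \<in>. (fmod I A C r)"
   \<comment> \<open>Closure of C under scalars supplies negatives, as multiples by -1.\<close>
   have "(\<lambda>i\<in>I. (\<ominus>\<^sub>K \<one>\<^sub>K) \<odot>\<^bsub>A i\<^esub> x i) \<in> C" using C(4) x by simp
   moreover have "(\<ominus>\<^sub>K \<one>\<^sub>K) \<odot>\<^bsub>A i\<^esub> x i \<oplus>\<^bsub>A i\<^esub> x i = \<zero>\<^bsub>A i\<^esub>" if "i \<in> I" for i
   proof -
    interpret A: module K "A i" using A that by simp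
    show ?thesis using Cc[of x i] x that by (simp add: A.l_neg flip: A.neg_smult)
   qed
   ultimately show "\<exists>y\<in>carrier (fmod I A C r). y \<oplus>\<^bsub>fmod I A C r\<^esub> x = \<zero>\<^bsub>fmod I A C r\<^esub>"
    by (intro bexI[of _ "\<lambda>i\<in>I. (\<ominus>\<^sub>K \<one>\<^sub>K) \<odot>\<^bsub>A i\<^esub> x i"]) (auto intro!: restrict_ext)
   show "\<zero>\<^bsub>fmod I A C r\<^esub> \<oplus>\<^bsub>fmod I A C r\<^esub> x = x"
    using x Cc Ce ag by (auto simp: abelian_monoid.l_zero[OF agm] intro!: extensionalityI[of _ I])
   fix y assume y: "y \<in>. (fmod I A C r)"
   show "x \<oplus>\<^bsub>fmod I A C r\<^esub> y = y \<oplus>\<^bsub>fmod I A C r\<^esub> x"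
    using x y Cc by (auto simp: abelian_monoid.a_comm[OF agm] intro!: restrict_ext)
   fix z assume z: "z \<in>. (fmod I A C r)"
   show "x \<oplus>\<^bsub>fmod I A C r\<^esub> y \<oplus>\<^bsub>fmod I A C r\<^esub> z = x \<oplus>\<^bsub>fmod I A C r\<^esub> (y \<oplus>\<^bsub>fmod I A C r\<^esub> z)"
    using x y z Cc by (auto simp: abelian_monoid.a_assoc[OF agm] intro!: restrict_ext)
  qed (use C in auto)
 next
  fix x assume x: "x \<in>. (fmod I A C r)"
  show "\<one>\<^sub>K \<odot>\<^bsub>fmod I A C r\<^esub> x = x"
   using x Cc Ce by (auto simp: module.smult_one[OF A] intro!: extensionalityI[of _ I])
  fix a assume a: "a \<in>. K"
  show "a \<odot>\<^bsub>fmod I A C r\<^esub> x \<in>. (fmod I A C r)" using C(4) a x by simp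
  { fix y assume y: "y \<in>. (fmod I A C r)"
   show "a \<odot>\<^bsub>fmod I A C r\<^esub> (x \<oplus>\<^bsub>fmod I A C r\<^esub> y) =
    a \<odot>\<^bsub>fmod I A C r\<^esub> x \<oplus>\<^bsub>fmod I A C r\<^esub> a \<odot>\<^bsub>fmod I A C r\<^esub> y"
    using a x y Cc by (auto simp: module.smult_r_distr[OF A] intro!: restrict_ext) }
  fix b assume b: "b \<in>. K"
  show "(a \<oplus>\<^sub>K b) \<odot>\<^bsub>fmod I A C r\<^esub> x = a \<odot>\<^bsub>fmod I A C r\<^esub> x \<oplus>\<^bsub>fmod I A C r\<^esub> b \<odot>\<^bsub>fmod I A C r\<^esub> x"
   using a b x Cc by (auto simp: module.smult_l_distr[OF A] intro!: restrict_ext)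
  show "(a \<otimes>\<^sub>K b) \<odot>\<^bsub>fmod I A C r\<^esub> x = a \<odot>\<^bsub>fmod I A C r\<^esub> (b \<odot>\<^bsub>fmod I A C r\<^esub> x)"
   using a b x Cc by (auto simp: module.smult_assoc1[OF A] intro!: restrict_ext)
 qed
qed

lemma lin_fmod_eval: "i \<in> I ==> C \<subseteq> (\<Pi>\<^sub>E i\<in>I. carrier (A i)) ==> lin K (fmod I A C r) (A i) (\<lambda>x. x i)"
 by (rule linI) auto

definition fsum_carrier where
 "fsum_carrier I A = {x \<in> (\<Pi>\<^sub>E i\<in>I. carrier (A i)). finite {i \<in> I. x i \<noteq> \<zero>\<^bsub>A i\<^esub>}}"

lemma lsum_fmod:
 assumes K: "cring K" and A: "\<And>i. i \<in> I ==> module K (A i)"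
 shows "lsum K (fmod I A (fsum_carrier I A) r) I A (\<lambda>i x. \<lambda>j\<in>I. if j = i then x else \<zero>\<^bsub>A j\<^esub>) (\<lambda>i x. x i)"
proof -
 let ?C = "fsum_carrier I A"
 let ?M = "fmod I A ?C r"
 let ?inc = "\<lambda>i x. \<lambda>j\<in>I. if j = i then x else \<zero>\<^bsub>A j\<^esub>"
 have ag: "abelian_group (A i)" if "i \<in> I" for i using A[OF that] by (simp add: module_def)
 note agm = abelian_group.axioms(1)[OF ag]
 note A0 = abelian_monoid.zero_closed[OF agm] and Ap = abelian_monoid.a_closed[OF agm]
  and Al = abelian_monoid.l_zero[OF agm] and Ar = abelian_monoid.r_zero[OF agm]
  and As = module.smult_closed[OF A] and As0 = module.smult_r_null[OF A]
 have C1: "?C \<subseteq> (\<Pi>\<^sub>E i\<in>I. carrier (A i))" by (auto simp: fsum_carrier_def)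
 have Cc: "x i \<in>. (A i)" if "x \<in> ?C" "i \<in> I" for x i using C1 that by auto
 have mod: "module K ?M"
 proof (rule module_fmod[OF K A C1])
  show "(\<lambda>i\<in>I. \<zero>\<^bsub>A i\<^esub>) \<in> ?C" by (auto simp: fsum_carrier_def A0)
  fix x y assume x: "x \<in> ?C" and y: "y \<in> ?C"
  have "{i \<in> I. (\<lambda>i\<in>I. x i \<oplus>\<^bsub>A i\<^esub> y i) i \<noteq> \<zero>\<^bsub>A i\<^esub>} \<subseteq> {i \<in> I. x i \<noteq> \<zero>\<^bsub>A i\<^esub>} \<union> {i \<in> I. y i \<noteq> \<zero>\<^bsub>A i\<^esub>}"
   by (auto simp: Al A0)
  moreover have "finite ({i \<in> I. x i \<noteq> \<zero>\<^bsub>A i\<^esub>} \<union> {i \<in> I. y i \<noteq> \<zero>\<^bsub>A i\<^esub>})"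
   using x y by (simp add: fsum_carrier_def)
  ultimately have "finite {i \<in> I. (\<lambda>i\<in>I. x i \<oplus>\<^bsub>A i\<^esub> y i) i \<noteq> \<zero>\<^bsub>A i\<^esub>}" by (rule finite_subset)
  thus "(\<lambda>i\<in>I. x i \<oplus>\<^bsub>A i\<^esub> y i) \<in> ?C" using Cc[OF x] Cc[OF y] by (auto simp: fsum_carrier_def Ap)
 next
  fix a x assume a: "a \<in>. K" and x: "x \<in> ?C"
  have "{i \<in> I. (\<lambda>i\<in>I. a \<odot>\<^bsub>A i\<^esub> x i) i \<noteq> \<zero>\<^bsub>A i\<^esub>} \<subseteq> {i \<in> I. x i \<noteq> \<zero>\<^bsub>A i\<^esub>}"
   using a by (auto simp: As0)
  moreover have "finite {i \<in> I. x i \<noteq> \<zero>\<^bsub>A i\<^esub>}" using x by (simp add: fsum_carrier_def)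
  ultimately have "finite {i \<in> I. (\<lambda>i\<in>I. a \<odot>\<^bsub>A i\<^esub> x i) i \<noteq> \<zero>\<^bsub>A i\<^esub>}" by (rule finite_subset)
  thus "(\<lambda>i\<in>I. a \<odot>\<^bsub>A i\<^esub> x i) \<in> ?C" using Cc[OF x] a by (auto simp: fsum_carrier_def As)
 qed
 interpret M: module K ?M by (rule mod)
 have incC: "?inc i x \<in> ?C" if "i \<in> I" "x \<in>. (A i)" for i x
 proof -
  have "{j \<in> I. ?inc i x j \<noteq> \<zero>\<^bsub>A j\<^esub>} \<subseteq> {i}" by auto
  hence "finite {j \<in> I. ?inc i x j \<noteq> \<zero>\<^bsub>A j\<^esub>}" by (rule finite_subset) simp
  thus ?thesis using that by (auto simp: fsum_carrier_def A0)
 qed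
 show ?thesis
 proof (rule lsum.intro[OF mod lsum_axioms.intro])
  fix i assume i: "i \<in> I"
  show "module K (A i)" by (rule A[OF i])
  show "lin K (A i) ?M (?inc i)"
   by (rule linI) (use i incC in \<open>auto intro!: restrict_ext simp: Al A0 As0\<close>)
  show "lin K ?M (A i) (\<lambda>x. x i)" by (rule lin_fmod_eval[OF i C1])
  fix x assume "x \<in>. (A i)"
  show "?inc i x i = x" using i by simp
  fix j assume "j \<in> I" "i \<noteq> j" thus "?inc i x j = \<zero>\<^bsub>A j\<^esub>" by simp
 next
  fix H x assume H: "M.subsp H" and inc: "\<And>i x. i \<in> I ==> x \<in>. (A i) ==> ?inc i x \<in> H"
   and x: "x \<in>. ?M"
  \<comment> \<open>Induction on a finite set containing the support: the coordinate at k is split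
    off, and the rest has its support in F.\<close>
  have "\<forall>x\<in>?C. {i \<in> I. x i \<noteq> \<zero>\<^bsub>A i\<^esub>} \<subseteq> F --> x \<in> H" if "finite F" for F
   using that
  proof (induction F)
   case empty
   show ?case
   proof (intro ballI impI)
    fix x assume "x \<in> ?C" "{i \<in> I. x i \<noteq> \<zero>\<^bsub>A i\<^esub>} \<subseteq> {}"
    hence "x = \<zero>\<^bsub>?M\<^esub>" using C1 by (auto simp: PiE_def intro!: extensionalityI[of _ I])
    thus "x \<in> H" using M.sub_zero[OF H] by simp
   qed
  next
   case (insert k F)
   show ?case
   proof (intro ballI impI)
    fix x assume x: "x \<in> ?C" "{i \<in> I. x i \<noteq> \<zero>\<^bsub>A i\<^esub>} \<subseteq> insert k F"
    let ?y = "\<lambda>i\<in>I. if i = k then \<zero>\<^bsub>A i\<^esub> else x i"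
    have ys: "{i \<in> I. ?y i \<noteq> \<zero>\<^bsub>A i\<^esub>} \<subseteq> F" using x(2) by auto
    have y: "?y \<in> ?C" using Cc[OF x(1)] finite_subset[OF ys insert(1)] by (auto simp: fsum_carrier_def A0)
    have yH: "?y \<in> H" using insert.IH y ys by blast
    show "x \<in> H"
    proof (cases "k \<in> I")
     case True
     have "x = ?y \<oplus>\<^bsub>?M\<^esub> ?inc k (x k)"
      using C1 x(1) True by (auto simp: PiE_def Al Ar Cc A0 intro!: extensionalityI[of _ I])
     thus ?thesis using M.sub_add[OF H yH inc[OF True Cc[OF x(1) True]]] by simp
    next
     case False
     hence "x = ?y" using C1 x(1) by (auto simp: PiE_def intro!: extensionalityI[of _ I])
     thus ?thesis using yH by simp
    qed
   qed
  qed
  thus "x \<in> H" using x by (auto simp: fsum_carrier_def)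
 qed
qed

section \<open>Modules over group algebras of finite groups\<close>

text \<open>The equivariant counterpart of \<open>lin\<close>, again without extensionality, and
  between modules whose carrier types may differ.\<close>

definition ghom ::
 "('g, 'w) monoid_scheme => ('k, 'x) ring_scheme => ('g, 'k, 'a) gmod => ('g, 'k, 'b) gmod => ('a => 'b) => bool" where
 "ghom G K M N f \<longleftrightarrow> lin K M N f \<and> (\<forall>g\<in>carrier G. \<forall>x\<in>carrier M. f (act M g x) = act N g (f x))"

lemma ghom_lin: "ghom G K M N f ==> lin K M N f"
 and ghom_act: "ghom G K M N f ==> g \<in>. G ==> x \<in>. M ==> f (act M g x) = act N g (f x)"
 by (auto simp: ghom_def)

lemmas ghom_in = lin_in[OF ghom_lin]

lemma ghomI: "lin K M N f ==> (\<And>g x. g \<in>. G ==> x \<in>. M ==> f (act M g x) = act N g (f x)) ==> ghom G K M N f"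
 by (simp add: ghom_def)

lemma ghom_comp: "ghom G K M N f ==> ghom G K N L g ==> ghom G K M L (\<lambda>x. g (f x))"
 by (auto simp: ghom_def lin_comp lin_in)

lemma ghom_id: "ghom G K M M (\<lambda>x. x)"
 by (auto simp: ghom_def lin_id)

definition giso where
 "giso G K M N f f' \<longleftrightarrow> ghom G K M N f \<and> ghom G K N M f' \<and>
   (\<forall>x\<in>carrier M. f' (f x) = x) \<and> (\<forall>y\<in>carrier N. f (f' y) = y)"

lemma kmod_mod: "kG_module G K M ==> module K M"
 by (simp add: kG_module_def)

lemma act_lin:
 assumes "kG_module G K M" "g \<in>. G" shows "lin K M M (act M g)"
proof -
 interpret M: module K M using assms(1) by (rule kmod_mod)
 have "restrict (act M g) (carrier M) \<in> lin_maps K M M" using assms by (simp add: kG_module_def)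
 thus ?thesis by (auto simp: lin_maps_def lin_def PiE_def Pi_def)
qed

lemmas act_in = lin_in[OF act_lin]

lemma act_one: "kG_module G K M ==> x \<in>. M ==> act M \<one>\<^sub>G x = x"
 and act_mult: "kG_module G K M ==> g \<in>. G ==> h \<in>. G ==> x \<in>. M ==>
  act M (g \<otimes>\<^sub>G h) x = act M g (act M h x)" by (auto simp: kG_module_def)

lemma kG_moduleI:
 assumes M: "module K M" and "\<And>g. g \<in>. G ==> lin K M M (act M g)"
  "\<And>x. x \<in>. M ==> act M \<one>\<^sub>G x = x"
  "\<And>g h x. g \<in>. G ==> h \<in>. G ==> x \<in>. M ==> act M (g \<otimes>\<^sub>G h) x = act M g (act M h x)"
 shows "kG_module G K M"
proof -
 interpret M: module K M by fact
 have "restrict (act M g) (carrier M) \<in> lin_maps K M M" if "g \<in>. G" for g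
  using assms(2)[OF that] by (auto simp: lin_maps_def lin_in lin_add lin_smult)
 thus ?thesis using assms by (simp add: kG_module_def)
qed

lemma kG_module_sub:
 assumes M: "kG_module G K M" and H: "module.subsp K M H"
  and act: "\<And>g x. g \<in>. G ==> x \<in> H ==> act M g x \<in> H"
 shows "kG_module G K (M\<lparr>carrier := H\<rparr>)"
proof (rule kG_moduleI)
 interpret M: module K M using M by (rule kmod_mod)
 note c = M.sub_carrier[OF H]
 show "module K (M\<lparr>carrier := H\<rparr>)" by (rule M.sub_module[OF H])
 show "lin K (M\<lparr>carrier := H\<rparr>) (M\<lparr>carrier := H\<rparr>) (act (M\<lparr>carrier := H\<rparr>) g)" if g: "g \<in>. G" for g
  using act[OF g] c lin_add[OF act_lin[OF M g]] lin_smult[OF act_lin[OF M g]] by (intro linI) auto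
qed (use act_one[OF M] act_mult[OF M] module.sub_carrier[OF kmod_mod[OF M] H] in auto)

text \<open>Constructions live on types of functions; an injection of a small carrier into
  \<open>'u\<close> carries them to objects of the category.\<close>

lemma transport:
 fixes M :: "('g, 'k, 'a) gmod"
 assumes M: "kG_module G K M" and small: "small TYPE('u) (carrier M)"
 obtains N :: "('g, 'k, 'u) gmod" and f f' where "N \<in> kG_mods G K" "giso G K M N f f'"
proof -
 interpret M: module K M using M by (rule kmod_mod)
 obtain f :: "'a => 'u" where f: "inj_on f (carrier M)" using small_into_type[OF small] by blast
 define f' where "f' = the_inv_into (carrier M) f"
 have ff: "f' (f x) = x" if "x \<in>. M" for x using f that by (simp add: f'_def the_inv_into_f_f)
 define N :: "('g, 'k, 'u) gmod" where "N = \<lparr>carrier = f ` carrier M, monoid.mult = undefined, one = undefined,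
   ring.zero = f \<zero>\<^sub>M, ring.add = (\<lambda>x y. f (f' x \<oplus>\<^sub>M f' y)),
   smult = (\<lambda>a x. f (a \<odot>\<^sub>M f' x)), act = (\<lambda>g x. f (act M g (f' x)))\<rparr>"
 have N: "carrier N = f ` carrier M" "\<zero>\<^sub>N = f \<zero>\<^sub>M" "\<And>x y. x \<oplus>\<^sub>N y = f (f' x \<oplus>\<^sub>M f' y)"
  "\<And>a x. a \<odot>\<^sub>N x = f (a \<odot>\<^sub>M f' x)" "\<And>g x. act N g x = f (act M g (f' x))"
  by (simp_all add: N_def)
 have mod: "module K N"
 proof (rule moduleI[OF M.R.is_cring])
  show "abelian_group N"
  proof (rule abelian_groupI)
   fix x assume "x \<in>. N"
   then obtain u where u: "x = f u" "u \<in>. M" by (auto simp: N)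
   show "\<exists>y\<in>carrier N. y \<oplus>\<^sub>N x = \<zero>\<^sub>N"
    using u by (intro bexI[of _ "f (\<ominus>\<^sub>M u)"]) (auto simp: N ff M.l_neg)
  qed (auto simp: N ff M.a_ac)
 qed (auto simp: N ff M.smult_l_distr M.smult_r_distr M.smult_assoc1)
 have kN: "kG_module G K N" by (rule kG_moduleI[OF mod])
   (auto intro!: linI simp: N ff act_in[OF M] act_one[OF M] act_mult[OF M] lin_add[OF act_lin[OF M]] lin_smult[OF act_lin[OF M]])
 have "N \<in> kG_mods G K" using kN small_image[OF small] by (simp add: kG_mods_def N)
 moreover have "giso G K M N f f'" unfolding giso_def by (auto intro!: ghomI linI simp: N ff act_in[OF M])
 ultimately show thesis by (rule that)
qed

context module
begin

text \<open>With e a retraction onto the kernel of q, the map t = id - e is constant on the fibres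
  of q and satisfies q t = q. Hence applying t to any chosen preimage gives a linear
  section.\<close>

lemma ex_section:
 assumes F: "field R" and q: "lin R M N q" and N: "module R N" and surj: "q ` carrier M = carrier N"
 obtains s where "lin R N M s" "\<And>y. y \<in>. N ==> q (s y) = y"
proof -
 interpret N: module R N by fact
 obtain e where e: "lin R M M e" "\<And>x. x \<in>. M ==> e x \<in> {x \<in> carrier M. q x = \<zero>\<^sub>N}"
  "\<And>x. x \<in> {x \<in> carrier M. q x = \<zero>\<^sub>N} ==> e x = x"
  by (rule ex_retraction[OF F subsp_kernel[OF q N]]) (rule that)
 define t where "t x = x \<ominus>\<^sub>M e x" for x
 have t: "lin R M M t" unfolding t_def by (rule lin_diff[OF lin_id e(1) module_axioms])
 note tc = lin_in[OF t]
 have qt: "q (t x) = q x" if "x \<in>. M" for x using that e(2)[OF that] lin_in[OF q that]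
  by (simp add: t_def lin_minus[OF q module_axioms N] N.minus_eq)
 have teq: "t x = t y" if "x \<in>. M" "y \<in>. M" "q x = q y" for x y
 proof -
  have "q (x \<ominus>\<^sub>M y) = \<zero>\<^sub>N"
   using that lin_in[OF q] by (simp add: lin_minus[OF q module_axioms N] N.minus_zero_iff)
  hence "t (x \<ominus>\<^sub>M y) = \<zero>\<^sub>M" using e(3)[of "x \<ominus>\<^sub>M y"] that by (simp add: t_def M.minus_zero_iff)
  thus ?thesis using that tc by (simp add: lin_minus[OF t module_axioms module_axioms] M.minus_zero_iff)
 qed
 define s where "s y = t (SOME x. x \<in>. M \<and> q x = y)" for y
 have s: "s (q x) = t x" if "x \<in>. M" for x
 proof -
  have "(SOME x'. x' \<in>. M \<and> q x' = q x) \<in>. M \<and> q (SOME x'. x' \<in>. M \<and> q x' = q x) = q x"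
   by (rule someI[of _ x]) (simp add: that)
  thus ?thesis unfolding s_def by (intro teq) (simp_all add: that)
 qed
 have ex: "\<exists>x\<in>carrier M. y = q x" if "y \<in>. N" for y using that surj by (auto simp: image_iff)
 show thesis
 proof (rule that[of s])
  show "lin R N M s"
  proof (rule linI)
   fix y assume "y \<in>. N"
   then obtain x where x: "x \<in>. M" "y = q x" using ex by blast
   show "s y \<in>. M" using x s tc by simp
   { fix y' assume "y' \<in>. N"
    then obtain x' where x': "x' \<in>. M" "y' = q x'" using ex by blast
    show "s (y \<oplus>\<^sub>N y') = s y \<oplus>\<^sub>M s y'"
     using s[of "x \<oplus>\<^sub>M x'"] x x' by (simp add: lin_add[OF q] lin_add[OF t] s) }
   fix a assume "a \<in>. R"
   thus "s (a \<odot>\<^sub>N y) = a \<odot>\<^sub>M s y"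
    using s[of "a \<odot>\<^sub>M x"] x by (simp add: lin_smult[OF q] lin_smult[OF t] s)
  qed
  fix y assume "y \<in>. N"
  then obtain x where x: "x \<in>. M" "y = q x" using ex by blast
  show "q (s y) = y" using x s qt by simp
 qed
qed

text \<open>Retract onto the image of i, then invert i there.\<close>

lemma ex_left_inverse:
 assumes F: "field R" and i: "lin R N M i" and N: "module R N" and inj: "inj_on i (carrier N)"
 obtains r where "lin R M N r" "\<And>x. x \<in>. N ==> r (i x) = x"
proof -
 interpret N: module R N by fact
 obtain e where e: "lin R M M e" "\<And>x. x \<in>. M ==> e x \<in> i ` carrier N"
  "\<And>x. x \<in> i ` carrier N ==> e x = x" by (rule ex_retraction[OF F subsp_range[OF i N]]) (rule that)
 define r where "r y = the_inv_into (carrier N) i (e y)" for y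
 have r: "r y = x" if "x \<in>. N" "e y = i x" for x y using that inj by (simp add: r_def the_inv_into_f_f)
 have ex: "\<exists>x\<in>carrier N. e y = i x" if "y \<in>. M" for y using e(2)[OF that] by blast
 show thesis
 proof (rule that[of r])
  show "lin R M N r"
  proof (rule linI)
   fix y assume y: "y \<in>. M"
   then obtain x where x: "x \<in>. N" "e y = i x" using ex by blast
   show "r y \<in>. N" using r[OF x] x by simp
   { fix y' assume y': "y' \<in>. M"
    then obtain x' where x': "x' \<in>. N" "e y' = i x'" using ex by blast
    show "r (y \<oplus>\<^sub>M y') = r y \<oplus>\<^sub>N r y'"
     using r[of "x \<oplus>\<^sub>N x'" "y \<oplus>\<^sub>M y'"] r[OF x] r[OF x'] x x' y y'
     by (simp add: lin_add[OF i] lin_add[OF e(1)]) }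
   fix a assume a: "a \<in>. R"
   show "r (a \<odot>\<^sub>M y) = a \<odot>\<^sub>N r y"
    using r[of "a \<odot>\<^sub>N x" "a \<odot>\<^sub>M y"] r[OF x] x y a by (simp add: lin_smult[OF i] lin_smult[OF e(1)])
  qed
  fix x assume "x \<in>. N"
  thus "r (i x) = x" using r e(3) by simp
 qed
qed

end

section \<open>The trace map\<close>

locale galg = G: group G + K: field K
 for G :: "('g, 'w) monoid_scheme" and K :: "('k, 'x) ring_scheme" +
 assumes fin: "finite (carrier G)"
begin

abbreviation "ghm \<equiv> ghom G K"
abbreviation "invG \<equiv> m_inv G"

lemmas mKmod = module_Kmod[OF K.is_cring]

abbreviation kmod where "kmod M \<equiv> kG_module G K M"

text \<open>The transfer from the trivial subgroup: the conjugates g h g^-1 of a linear map, summed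
  over G.\<close>

definition Tr :: "('g, 'k, 'a) gmod => ('g, 'k, 'b) gmod => ('a => 'b) => 'a => 'b" where
 "Tr M N h x = (\<Oplus>\<^sub>N g\<in>carrier G. act N g (h (act M (invG g) x)))"

lemma lin_Tr_term:
 assumes "kmod M" "kmod N" "lin K M N h" "g \<in>. G"
 shows "lin K M N (\<lambda>x. act N g (h (act M (invG g) x)))"
 using assms by (intro lin_comp[OF lin_comp[OF act_lin[OF assms(1)] assms(3)] act_lin[OF assms(2)]]) auto

lemma lin_Tr: "kmod M ==> kmod N ==> lin K M N h ==> lin K M N (Tr M N h)"
 unfolding Tr_def by (intro lin_finsum_fun lin_Tr_term) (auto simp: kmod_mod)

lemma Tr_cong:
 assumes "kmod M" "kmod N" "lin K M N h" "\<And>x. x \<in>. M ==> h' x = h x" "x \<in>. M"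
 shows "Tr M N h' x = Tr M N h x"
proof -
 interpret N: module K N using assms(2) by (rule kmod_mod)
 show ?thesis unfolding Tr_def using assms lin_in[OF lin_Tr_term[OF assms(1-3)]]
  by (intro N.finsum_cong') (auto simp: act_in)
qed

text \<open>Acting by k only permutes the summands, by left translation of the index.\<close>

lemma ghom_Tr:
 assumes M: "kmod M" and N: "kmod N" and h: "lin K M N h" shows "ghm M N (Tr M N h)"
proof (rule ghomI[OF lin_Tr[OF assms]])
 fix k x assume k: "k \<in>. G" and x: "x \<in>. M"
 interpret M: module K M using M by (rule kmod_mod)
 interpret N: module K N using N by (rule kmod_mod)
 note tc = lin_in[OF lin_Tr_term[OF assms]]
 have bij: "(\<lambda>g. k \<otimes>\<^sub>G g) ` carrier G = carrier G" "inj_on (\<lambda>g. k \<otimes>\<^sub>G g) (carrier G)"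
  using G.surj_const_mult[OF k] G.inj_on_cmult[OF k] by auto
 have "Tr M N h (act M k x) = (\<Oplus>\<^sub>N g\<in>(\<lambda>g. k \<otimes>\<^sub>G g) ` carrier G. act N g (h (act M (invG g) (act M k x))))"
  unfolding Tr_def bij ..
 also have "... = (\<Oplus>\<^sub>N g\<in>carrier G. act N (k \<otimes>\<^sub>G g) (h (act M (invG (k \<otimes>\<^sub>G g)) (act M k x))))"
  by (rule N.finsum_reindex) (use bij k x tc act_in[OF M] in auto)
 also have "... = (\<Oplus>\<^sub>N g\<in>carrier G. act N k (act N g (h (act M (invG g) x))))"
 proof (rule N.finsum_cong')
  fix g assume g: "g \<in>. G"
  have "act M (invG (k \<otimes>\<^sub>G g)) (act M k x) = act M (invG g) x"
  proof -
   have "invG (k \<otimes>\<^sub>G g) \<otimes>\<^sub>G k = invG g" using k g by (simp add: G.inv_mult_group G.m_assoc)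
   thus ?thesis using act_mult[OF M, of "invG (k \<otimes>\<^sub>G g)" k x] k g x by simp
  qed
  thus "act N (k \<otimes>\<^sub>G g) (h (act M (invG (k \<otimes>\<^sub>G g)) (act M k x))) = act N k (act N g (h (act M (invG g) x)))"
   using act_mult[OF N k g] lin_in[OF h] act_in[OF M] x g by simp
 qed (use act_in[OF N] k x tc in auto)
 also have "... = act N k (Tr M N h x)" unfolding Tr_def
  using x tc by (intro lin_finsum[OF act_lin[OF N k] N.modl N.modl, symmetric]) auto
 finally show "Tr M N h (act M k x) = act N k (Tr M N h x)" .
qed

text \<open>Together with \<open>Tr_right\<close>: equivariant maps move through the trace, so
  traces form a two-sided ideal among the homomorphisms.\<close>

lemma Tr_left:
 assumes M: "kmod M" and N: "kmod N" and L: "kmod L" and h: "lin K M N h" and f: "ghm N L f"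
  and x: "x \<in>. M"
 shows "f (Tr M N h x) = Tr M L (\<lambda>x. f (h x)) x"
proof -
 interpret N: module K N using N by (rule kmod_mod)
 interpret L: module K L using L by (rule kmod_mod)
 have "f (Tr M N h x) = (\<Oplus>\<^sub>L g\<in>carrier G. f (act N g (h (act M (invG g) x))))" unfolding Tr_def
  using lin_in[OF lin_Tr_term[OF M N h]] x by (intro lin_finsum[OF ghom_lin[OF f] N.modl L.modl]) auto
 also have "... = Tr M L (\<lambda>x. f (h x)) x" unfolding Tr_def
  using x lin_in[OF lin_Tr_term[OF M L lin_comp[OF h ghom_lin[OF f]]]] act_in[OF M] lin_in[OF h]
  by (intro L.finsum_cong') (auto simp: ghom_act[OF f])
 finally show ?thesis .
qed

lemma Tr_right:
 assumes M: "kmod M" and N: "kmod N" and L: "kmod L" and h: "lin K M N h" and f: "ghm L M f"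
  and x: "x \<in>. L"
 shows "Tr M N h (f x) = Tr L N (\<lambda>x. h (f x)) x"
proof -
 interpret N: module K N using N by (rule kmod_mod)
 show ?thesis unfolding Tr_def using x lin_in[OF lin_Tr_term[OF L N lin_comp[OF ghom_lin[OF f] h]]]
  by (intro N.finsum_cong') (auto simp: ghom_act[OF f])
qed

lemma Tr_plus:
 assumes M: "kmod M" and N: "kmod N" and h: "lin K M N h" "lin K M N h'" and x: "x \<in>. M"
 shows "Tr M N (\<lambda>x. h x \<oplus>\<^sub>N h' x) x = Tr M N h x \<oplus>\<^sub>N Tr M N h' x"
proof -
 interpret N: module K N using N by (rule kmod_mod)
 note c = lin_in[OF h(1)] lin_in[OF h(2)] lin_in[OF lin_Tr_term[OF M N h(1)]]
  lin_in[OF lin_Tr_term[OF M N h(2)]] act_in[OF M]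
 have "Tr M N (\<lambda>x. h x \<oplus>\<^sub>N h' x) x = (\<Oplus>\<^sub>N g\<in>carrier G.
   act N g (h (act M (invG g) x)) \<oplus>\<^sub>N act N g (h' (act M (invG g) x)))" unfolding Tr_def
  using c x by (intro N.finsum_cong') (auto simp: lin_add[OF act_lin[OF N]])
 also have "... = Tr M N h x \<oplus>\<^sub>N Tr M N h' x" unfolding Tr_def using c x by (intro N.finsum_addf) auto
 finally show ?thesis .
qed

lemma ghom_uminus: "kmod N ==> ghm N N (\<lambda>x. \<ominus>\<^sub>N x)"
 by (rule ghomI[OF lin_uminus[OF lin_id]]) (simp_all add: kmod_mod lin_neg[OF act_lin])

lemma ghom_plus:
 assumes N: "kmod N" and f: "ghm M N f" and g: "ghm M N g"
 shows "ghm M N (\<lambda>x. f x \<oplus>\<^sub>N g x)"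
 using lin_plus[OF ghom_lin[OF f] ghom_lin[OF g] kmod_mod[OF N]]
 by (rule ghomI) (simp add: ghom_act[OF f] ghom_act[OF g] lin_add[OF act_lin[OF N]] ghom_in[OF f] ghom_in[OF g])

lemma ghom_diff:
 assumes N: "kmod N" and f: "ghm M N f" and g: "ghm M N g"
 shows "ghm M N (\<lambda>x. f x \<ominus>\<^sub>N g x)"
 using ghom_plus[OF N f ghom_comp[OF g ghom_uminus[OF N]]] by (simp add: a_minus_def)

lemma ghom_zero:
 assumes N: "kmod N" shows "ghm M N (\<lambda>x. \<zero>\<^sub>N)" using lin_const0[OF kmod_mod[OF N]]
 by (rule ghomI) (simp add: lin_zero[OF act_lin[OF N]] kmod_mod[OF N])

lemma Tr_uminus:
 assumes M: "kmod M" and N: "kmod N" and h: "lin K M N h" and x: "x \<in>. M"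
 shows "Tr M N (\<lambda>x. \<ominus>\<^sub>N h x) x = \<ominus>\<^sub>N Tr M N h x"
 using Tr_left[OF M N N h ghom_uminus[OF N] x] by simp

lemma Tr_zero:
 assumes M: "kmod M" and N: "kmod N" and x: "x \<in>. M"
 shows "Tr M N (\<lambda>x. \<zero>\<^sub>N) x = \<zero>\<^sub>N"
 using Tr_left[OF M N N lin_const0[OF kmod_mod[OF N]] ghom_zero[OF N] x] by simp

text \<open>Higman's criterion, taken as definition of relative projectivity. It makes sense over
  any carrier type and speaks only of linear maps of P to itself.\<close>

definition rel_proj where
 "rel_proj P \<longleftrightarrow> (\<exists>e. lin K P P e \<and> (\<forall>x\<in>carrier P. Tr P P e x = x))"

text \<open>The coinduced module: G acts by right translation of the argument, and the action of G
  on M itself is forgotten.\<close>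

definition funG :: "('g, 'k, 'a) gmod => ('g, 'k, 'g => 'a) gmod" where
 "funG M = fmod (carrier G) (\<lambda>_. M) (\<Pi>\<^sub>E g\<in>carrier G. carrier M) (\<lambda>h x. \<lambda>g\<in>carrier G. x (g \<otimes>\<^sub>G h))"

lemma carrier_funG: "carrier (funG M) = (\<Pi>\<^sub>E g\<in>carrier G. carrier M)"
 by (simp add: funG_def)

lemma kmod_funG:
 assumes M: "kmod M" shows "kmod (funG M)"
proof (rule kG_moduleI)
 interpret M: module K M using M by (rule kmod_mod)
 show "module K (funG M)" unfolding funG_def by (rule module_fmod) (auto simp: K.is_cring M.modl)
 show "lin K (funG M) (funG M) (act (funG M) g)" if "g \<in>. G" for g
  unfolding funG_def using that by (intro linI) (auto simp: fun_eq_iff)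
 show "act (funG M) \<one>\<^sub>G x = x" if "x \<in>. (funG M)" for x
  using that by (auto simp: funG_def PiE_def intro!: extensionalityI[of _ "carrier G"])
 show "act (funG M) (g \<otimes>\<^sub>G h) x = act (funG M) g (act (funG M) h x)"
  if "g \<in>. G" "h \<in>. G" "x \<in>. (funG M)" for g h x
  using that by (auto simp: funG_def G.m_assoc intro!: restrict_ext)
qed

text \<open>The linear map \<open>?e\<close> keeps only the value at 1. Its conjugates keep the
  values at the other group elements, so they add up to the identity.\<close>

lemma rel_proj_funG:
 assumes M: "kmod M" shows "rel_proj (funG M)"
proof -
 interpret M: module K M using M by (rule kmod_mod)
 note F = kmod_funG[OF M]
 interpret F: module K "funG M" using F by (rule kmod_mod)
 let ?e = "\<lambda>x. \<lambda>g\<in>carrier G. if g = \<one>\<^sub>G then x \<one>\<^sub>G else \<zero>\<^sub>M"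
 have e: "lin K (funG M) (funG M) ?e" unfolding funG_def by (intro linI) (auto simp: fun_eq_iff)
 have "Tr (funG M) (funG M) ?e x = x" if x: "x \<in>. (funG M)" for x
 proof (rule extensionalityI[of _ "carrier G"])
  have "Tr (funG M) (funG M) ?e x \<in>. (funG M)" by (rule lin_in[OF lin_Tr[OF F F e] x])
  thus "Tr (funG M) (funG M) ?e x \<in> extensional (carrier G)" by (auto simp: carrier_funG PiE_def)
  show "x \<in> extensional (carrier G)" using x by (auto simp: carrier_funG PiE_def)
  fix k assume k: "k \<in>. G"
  have evk: "lin K (funG M) M (\<lambda>x. x k)" unfolding funG_def by (rule lin_fmod_eval[OF k]) simp
  have xc: "\<And>g. g \<in>. G ==> x g \<in>. M" using x by (auto simp: carrier_funG)
  have "Tr (funG M) (funG M) ?e x k =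
    (\<Oplus>\<^sub>M g\<in>carrier G. act (funG M) g (?e (act (funG M) (invG g) x)) k)" unfolding Tr_def
   using lin_in[OF lin_Tr_term[OF F F e] x] by (intro lin_finsum[OF evk F.modl M.modl]) auto
  also have "... = (\<Oplus>\<^sub>M g\<in>carrier G. if invG k = g then x (invG g) else \<zero>\<^sub>M)"
  proof (rule M.finsum_cong')
   fix g assume g: "g \<in>. G"
   have "k \<otimes>\<^sub>G g = \<one>\<^sub>G \<longleftrightarrow> invG k = g"
    using k g by (metis G.inv_equality G.inv_inv G.l_inv G.r_inv G.inv_closed)
   thus "act (funG M) g (?e (act (funG M) (invG g) x)) k = (if invG k = g then x (invG g) else \<zero>\<^sub>M)"
    using k g by (simp add: funG_def)
  qed (use xc in auto)
  also have "... = x k" using k xc fin by (subst M.add.finprod_singleton) auto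
  finally show "Tr (funG M) (funG M) ?e x k = x k" .
 qed
 thus ?thesis using e by (auto simp: rel_proj_def)
qed

text \<open>The homomorphism into the coinduced module that corresponds to a linear map h by
  Frobenius reciprocity.\<close>

definition coind :: "('g, 'k, 'a) gmod => ('a => 'b) => 'a => 'g => 'b" where
 "coind M h x = (\<lambda>g\<in>carrier G. h (act M g x))"

lemma ghom_coind:
 assumes M: "kmod M" and N: "kmod N" and h: "lin K M N h" shows "ghm M (funG N) (coind M h)"
proof (rule ghomI[OF linI])
 note c = act_in[OF M] lin_in[OF h]
 show "coind M h x \<in>. (funG N)" if "x \<in>. M" for x using that c by (auto simp: coind_def carrier_funG)
 show "coind M h (x \<oplus>\<^sub>M y) = coind M h x \<oplus>\<^bsub>funG N\<^esub> coind M h y" if "x \<in>. M" "y \<in>. M" for x y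
  using that c by (auto simp: coind_def funG_def lin_add[OF act_lin[OF M]] lin_add[OF h] intro!: restrict_ext)
 show "coind M h (a \<odot>\<^sub>M x) = a \<odot>\<^bsub>funG N\<^esub> coind M h x" if "a \<in>. K" "x \<in>. M" for a x
  using that c by (auto simp: coind_def funG_def lin_smult[OF act_lin[OF M]] lin_smult[OF h] intro!: restrict_ext)
 show "coind M h (act M g x) = act (funG N) g (coind M h x)" if "g \<in>. G" "x \<in>. M" for g x
  using that c by (auto simp: coind_def funG_def act_mult[OF M] intro!: restrict_ext)
qed

text \<open>For finite G the coinduced module is also induced; this is the counit of the
  induction.\<close>

definition ev :: "('g, 'k, 'a) gmod => ('g => 'a) => 'a" where
 "ev N x = (\<Oplus>\<^sub>N g\<in>carrier G. act N (invG g) (x g))"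

lemma ghom_ev:
 assumes N: "kmod N" shows "ghm (funG N) N (ev N)"
proof (rule ghomI)
 interpret N: module K N using N by (rule kmod_mod)
 interpret F: module K "funG N" using kmod_funG[OF N] by (rule kmod_mod)
 have "lin K (funG N) N (\<lambda>x. act N (invG g) (x g))" if g: "g \<in>. G" for g
 proof -
  have "lin K (funG N) N (\<lambda>x. x g)" unfolding funG_def by (rule lin_fmod_eval[OF g]) simp
  thus ?thesis using g by (intro lin_comp[OF _ act_lin[OF N]]) auto
 qed
 thus "lin K (funG N) N (ev N)" unfolding ev_def by (intro lin_finsum_fun F.modl N.modl) auto
 fix k x assume k: "k \<in>. G" and x: "x \<in>. (funG N)"
 have xc: "\<And>g. g \<in>. G ==> x g \<in>. N" using x by (auto simp: carrier_funG)
 have bij: "(\<lambda>g. g \<otimes>\<^sub>G k) ` carrier G = carrier G" "inj_on (\<lambda>g. g \<otimes>\<^sub>G k) (carrier G)"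
 proof -
  show "(\<lambda>g. g \<otimes>\<^sub>G k) ` carrier G = carrier G"
  proof (intro equalityI subsetI)
   fix g assume g: "g \<in>. G"
   have "g = (g \<otimes>\<^sub>G invG k) \<otimes>\<^sub>G k" using g k by (simp add: G.m_assoc)
   thus "g \<in> (\<lambda>g. g \<otimes>\<^sub>G k) ` carrier G" by (rule image_eqI) (use g k in simp)
  qed (use k in auto)
  show "inj_on (\<lambda>g. g \<otimes>\<^sub>G k) (carrier G)" using k by (intro inj_onI) simp
 qed
 have "act N k (ev N x) = (\<Oplus>\<^sub>N g\<in>carrier G. act N k (act N (invG g) (x g)))" unfolding ev_def
  using act_in[OF N] xc by (intro lin_finsum[OF act_lin[OF N k] N.modl N.modl]) auto
 also have "... = (\<Oplus>\<^sub>N g\<in>(\<lambda>g. g \<otimes>\<^sub>G k) ` carrier G. act N k (act N (invG g) (x g)))"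
  unfolding bij ..
 also have "... = (\<Oplus>\<^sub>N g\<in>carrier G. act N k (act N (invG (g \<otimes>\<^sub>G k)) (x (g \<otimes>\<^sub>G k))))"
  by (rule N.finsum_reindex) (use bij k xc act_in[OF N] in auto)
 also have "... = (\<Oplus>\<^sub>N g\<in>carrier G. act N (invG g) (act (funG N) k x g))"
 proof (rule N.finsum_cong')
  fix g assume g: "g \<in>. G"
  have "k \<otimes>\<^sub>G invG (g \<otimes>\<^sub>G k) = invG g"
   using k g by (simp add: G.inv_mult_group flip: G.m_assoc)
  thus "act N k (act N (invG (g \<otimes>\<^sub>G k)) (x (g \<otimes>\<^sub>G k))) = act N (invG g) (act (funG N) k x g)"
   using act_mult[OF N, of k "invG (g \<otimes>\<^sub>G k)" "x (g \<otimes>\<^sub>G k)"] k g xc by (simp add: funG_def)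
 qed (use act_in[OF N] xc k in \<open>auto simp: funG_def\<close>)
 finally show "ev N (act (funG N) k x) = act N k (ev N x)" by (simp add: ev_def)
qed

text \<open>Every trace factors through a coinduced module; this gives the converse half of
  \<open>stably_zero_iff\<close>.\<close>

lemma ev_coind:
 assumes M: "kmod M" and N: "kmod N" and h: "lin K M N h" and x: "x \<in>. M"
 shows "ev N (coind M h x) = Tr M N h x"
proof -
 interpret N: module K N using N by (rule kmod_mod)
 note tc = lin_in[OF lin_Tr_term[OF M N h] x]
 have "inj_on (\<lambda>g. invG g) (carrier G)" by (rule inj_onI) (use G.inv_inv in force)
 moreover have "(\<lambda>g. invG g) ` carrier G = carrier G" by (auto intro!: image_eqI[of _ _ "invG _"])
 ultimately have "Tr M N h x = (\<Oplus>\<^sub>N g\<in>carrier G. act N (invG g) (h (act M (invG (invG g)) x)))"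
  unfolding Tr_def using tc
  by (subst N.finsum_reindex[symmetric, of "\<lambda>g. act N g (h (act M (invG g) x))" "\<lambda>g. invG g"]) auto
 also have "... = ev N (coind M h x)" unfolding ev_def coind_def
  using act_in[OF N] act_in[OF M] lin_in[OF h] x by (intro N.finsum_cong') auto
 finally show ?thesis ..
qed

lemma kG_hom_iff: "f \<in> kG_hom G K M N \<longleftrightarrow> ghm M N f \<and> f \<in> extensional (carrier M)"
 by (auto simp: kG_hom_def lin_maps_def ghom_def lin_def PiE_def)

lemma ghom_restrict: "kmod M ==> ghm M N f ==> restrict f (carrier M) \<in> kG_hom G K M N"
proof -
 assume M: "kmod M" and f: "ghm M N f"
 interpret M: module K M using M by (rule kmod_mod)
 show ?thesis using f act_in[OF M] by (auto simp: kG_hom_iff ghom_def intro!: linI dest: lin_in lin_add lin_smult)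
qed

text \<open>A linear section s of q gives the linear map s f e, and averaging repairs equivariance:
  q Tr(s f e) = Tr(f e) = f Tr(e) = f.\<close>

lemma rel_proj_lift:
 assumes P: "kmod P" "rel_proj P" and M: "kmod M" and N: "kmod N"
  and q: "ghm M N q" "q ` carrier M = carrier N" and f: "ghm P N f"
 obtains h where "ghm P M h" "\<And>x. x \<in>. P ==> q (h x) = f x"
proof -
 interpret M: module K M using M by (rule kmod_mod)
 obtain e where e: "lin K P P e" "\<And>x. x \<in>. P ==> Tr P P e x = x" using P(2) by (auto simp: rel_proj_def)
 obtain s where s: "lin K N M s" "\<And>y. y \<in>. N ==> q (s y) = y"
  by (rule M.ex_section[OF K.field_axioms ghom_lin[OF q(1)] kmod_mod[OF N] q(2)]) (rule that)
 have h: "lin K P M (\<lambda>x. s (f (e x)))" by (rule lin_comp[OF lin_comp[OF e(1) ghom_lin[OF f]] s(1)])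
 show thesis
 proof (rule that[OF ghom_Tr[OF P(1) M h]])
  fix x assume x: "x \<in>. P"
  have "q (Tr P M (\<lambda>x. s (f (e x))) x) = Tr P N (\<lambda>x. q (s (f (e x)))) x"
   by (rule Tr_left[OF P(1) M N h q(1) x])
  also have "... = Tr P N (\<lambda>x. f (e x)) x" by (rule Tr_cong[OF P(1) N lin_comp[OF e(1) ghom_lin[OF f]] _ x])
    (simp add: s(2) ghom_in[OF f] lin_in[OF e(1)])
  also have "... = f x" using Tr_left[OF P(1) P(1) N e(1) f x] e(2)[OF x] by simp
  finally show "q (Tr P M (\<lambda>x. s (f (e x))) x) = f x" .
 qed
qed

text \<open>Dual to \<open>rel_proj_lift\<close>, with a linear left inverse of i in place of a
  section.\<close>

lemma rel_proj_extend:
 assumes P: "kmod P" "rel_proj P" and M: "kmod M" and N: "kmod N"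
  and i: "ghm M N i" "inj_on i (carrier M)" and f: "ghm M P f"
 obtains h where "ghm N P h" "\<And>x. x \<in>. M ==> h (i x) = f x"
proof -
 interpret N: module K N using N by (rule kmod_mod)
 obtain e where e: "lin K P P e" "\<And>x. x \<in>. P ==> Tr P P e x = x" using P(2) by (auto simp: rel_proj_def)
 obtain r where r: "lin K N M r" "\<And>x. x \<in>. M ==> r (i x) = x"
  by (rule N.ex_left_inverse[OF K.field_axioms ghom_lin[OF i(1)] kmod_mod[OF M] i(2)]) (rule that)
 have h: "lin K N P (\<lambda>x. e (f (r x)))" by (rule lin_comp[OF lin_comp[OF r(1) ghom_lin[OF f]] e(1)])
 show thesis
 proof (rule that[OF ghom_Tr[OF N P(1) h]])
  fix x assume x: "x \<in>. M"
  have "Tr N P (\<lambda>x. e (f (r x))) (i x) = Tr M P (\<lambda>x. e (f (r (i x)))) x"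
   by (rule Tr_right[OF N P(1) M h i(1) x])
  also have "... = Tr M P (\<lambda>x. e (f x)) x"
   by (rule Tr_cong[OF M P(1) lin_comp[OF ghom_lin[OF f] e(1)] _ x]) (simp add: r(2))
  also have "... = f x" using Tr_right[OF P(1) P(1) M e(1) f x] e(2) ghom_in[OF f x] by simp
  finally show "Tr N P (\<lambda>x. e (f (r x))) (i x) = f x" .
 qed
qed

text \<open>If the identity of Q is the trace of e, then that of its retract P is the trace of g e
  f.\<close>

lemma rel_proj_retract:
 assumes P: "kmod P" and Q: "kmod Q" "rel_proj Q" and f: "ghm P Q f" and g: "ghm Q P g"
  and gf: "\<And>x. x \<in>. P ==> g (f x) = x"
 shows "rel_proj P"
proof -
 obtain e where e: "lin K Q Q e" "\<And>x. x \<in>. Q ==> Tr Q Q e x = x" using Q(2) by (auto simp: rel_proj_def)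
 have l: "lin K Q P (\<lambda>x. g (e x))" by (rule lin_comp[OF e(1) ghom_lin[OF g]])
 have "Tr P P (\<lambda>x. g (e (f x))) x = x" if x: "x \<in>. P" for x
  using Tr_right[OF Q(1) P P l f x] Tr_left[OF Q(1) Q(1) P e(1) g ghom_in[OF f x]]
   e(2) ghom_in[OF f x] gf x by simp
 thus ?thesis using lin_comp[OF ghom_lin[OF f] l] by (auto simp: rel_proj_def)
qed

end

section \<open>The stable category\<close>

text \<open>The parameter \<open>u\<^sub>0\<close> only serves to fix the type that plays the role of the universe.\<close>

locale stab = galg G K
 for G :: "('g, 'w) monoid_scheme" and K :: "('k, 'x) ring_scheme" +
 fixes u\<^sub>0 :: 'u
 assumes univ: "universe_type TYPE('u)" and small_field: "small TYPE('u) (carrier K)"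
begin

abbreviation Md :: "('g, 'k, 'u) gmod set" where "Md \<equiv> kG_mods G K"

lemma infinite_univ: "infinite (UNIV :: 'u set)"
 using univ by (simp add: universe_type_def)

lemma Md_kmod: "M \<in> Md ==> kmod M" and Md_small: "M \<in> Md ==> small TYPE('u) (carrier M)"
 and Md_mod: "M \<in> Md ==> module K M" by (auto simp: kG_mods_def kmod_mod)

lemma Md_sub:
 assumes "M \<in> Md" "module.subsp K M H" "\<And>g x. g \<in>. G ==> x \<in> H ==> act M g x \<in> H"
 shows "M\<lparr>carrier := H\<rparr> \<in> Md"
 using kG_module_sub[OF Md_kmod assms(2,3)] small_subset[OF Md_small, of M H]
  module.sub_carrier[OF Md_mod assms(2)] assms(1) by (auto simp: kG_mods_def)

lemma small_funG: "M \<in> Md ==> small TYPE('u) (carrier (funG M))"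
 unfolding carrier_funG by (intro small_PiE_finite[OF univ fin] Md_small)

lemma ex_cofree:
 assumes M: "M \<in> Md"
 obtains P :: "('g, 'k, 'u) gmod" and f f' where "P \<in> Md" "giso G K (funG M) P f f'" "rel_proj P"
proof -
 obtain P :: "('g, 'k, 'u) gmod" and f f' where P: "P \<in> Md" "giso G K (funG M) P f f'"
  by (rule transport[OF kmod_funG[OF Md_kmod[OF M]] small_funG[OF M]]) (rule that)
 have "rel_proj P"
  by (rule rel_proj_retract[OF Md_kmod[OF P(1)] kmod_funG[OF Md_kmod[OF M]] rel_proj_funG[OF Md_kmod[OF M]], of f' f])
   (use P(2) in \<open>auto simp: giso_def\<close>)
 thus thesis by (rule that[OF P])
qed

section \<open>Projective and injective modules over the group algebra\<close>

lemma rel_proj_imp_projective: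
 assumes "P \<in> Md" "rel_proj P" shows "projective_mod G K P" unfolding projective_mod_def
proof (intro conjI assms ballI impI)
 fix M N q f assume M: "M \<in> Md" and N: "N \<in> Md" and q: "q \<in> kG_hom G K M N" and f: "f \<in> kG_hom G K P N"
  and s: "q ` carrier M = carrier N"
 have "ghm M N q" "ghm P N f" using q f by (simp_all add: kG_hom_iff)
 then obtain h where h: "ghm P M h" "\<And>x. x \<in>. P ==> q (h x) = f x"
  by (rule rel_proj_lift[OF Md_kmod[OF assms(1)] assms(2) Md_kmod[OF M] Md_kmod[OF N] _ s]) (rule that)
 show "\<exists>h\<in>kG_hom G K P M. compose (carrier P) q h = f"
 proof (rule bexI[OF _ ghom_restrict[OF Md_kmod[OF assms(1)] h(1)]])
  show "compose (carrier P) q (restrict h (carrier P)) = f"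
   using f h(2) by (auto simp: kG_hom_iff compose_def intro!: extensionalityI[of _ "carrier P"])
 qed
qed

lemma rel_proj_imp_injective:
 assumes "P \<in> Md" "rel_proj P" shows "injective_mod G K P" unfolding injective_mod_def
proof (intro conjI assms ballI impI)
 fix M N i f assume M: "M \<in> Md" and N: "N \<in> Md" and i: "i \<in> kG_hom G K M N" and f: "f \<in> kG_hom G K M P"
  and s: "inj_on i (carrier M)"
 have "ghm M N i" "ghm M P f" using i f by (simp_all add: kG_hom_iff)
 then obtain h where h: "ghm N P h" "\<And>x. x \<in>. M ==> h (i x) = f x"
  by (rule rel_proj_extend[OF Md_kmod[OF assms(1)] assms(2) Md_kmod[OF M] Md_kmod[OF N] _ s]) (rule that)
 show "\<exists>h\<in>kG_hom G K N P. compose (carrier M) h i = f"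
 proof (rule bexI[OF _ ghom_restrict[OF Md_kmod[OF N] h(1)]])
  show "compose (carrier M) (restrict h (carrier N)) i = f"
   using f h(2) i by (auto simp: kG_hom_iff compose_def ghom_in intro!: extensionalityI[of _ "carrier M"])
 qed
qed

text \<open>Q is a copy of the coinduced module of P. The linear surjection at the end of the
  conclusion is kept because it transfers finite generation from P to Q.\<close>

lemma ex_cover:
 assumes P: "P \<in> Md"
 obtains Q q f where "Q \<in> Md" "rel_proj Q" "ghm Q P q" "q ` carrier Q = carrier P"
  "lin K (funG P) Q f" "f ` carrier (funG P) = carrier Q"
proof -
 note kP = Md_kmod[OF P]
 interpret P: module K P by (rule Md_mod[OF P])
 obtain Q :: "('g, 'k, 'u) gmod" and f f' where Q: "Q \<in> Md" "giso G K (funG P) Q f f'" "rel_proj Q"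
  by (rule ex_cofree[OF P]) (rule that)
 have f: "ghm (funG P) Q f" "ghm Q (funG P) f'" "\<And>x. x \<in>. (funG P) ==> f' (f x) = x"
  "\<And>y. y \<in>. Q ==> f (f' y) = y" using Q(2) by (auto simp: giso_def)
 let ?q = "\<lambda>x. ev P (f' x)"
 have q: "ghm Q P ?q" by (rule ghom_comp[OF f(2) ghom_ev[OF kP]])
 have "y \<in> ?q ` carrier Q" if y: "y \<in>. P" for y
 proof -
  \<comment> \<open>A function supported at 1 is mapped to its value there.\<close>
  let ?x = "\<lambda>g\<in>carrier G. if \<one>\<^sub>G = g then y else \<zero>\<^sub>P"
  have x: "?x \<in>. (funG P)" using y by (auto simp: carrier_funG)
  have "ev P ?x = (\<Oplus>\<^sub>P g\<in>carrier G. if \<one>\<^sub>G = g then act P (invG g) y else \<zero>\<^sub>P)" unfolding ev_def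
   using y act_in[OF kP] lin_zero[OF act_lin[OF kP] P.modl P.modl] by (intro P.finsum_cong') auto
  also have "... = y" using fin y act_in[OF kP] by (subst P.add.finprod_singleton) (auto simp: act_one[OF kP])
  finally have "y = ?q (f ?x)" using f(3)[OF x] by simp
  thus ?thesis using ghom_in[OF f(1) x] by (rule image_eqI)
 qed
 hence s: "?q ` carrier Q = carrier P" using ghom_in[OF q] by blast
 have "y \<in> f ` carrier (funG P)" if "y \<in>. Q" for y
  using f(4)[OF that] ghom_in[OF f(2) that] by (intro image_eqI[of _ _ "f' y"]) simp_all
 hence "f ` carrier (funG P) = carrier Q" using ghom_in[OF f(1)] by blast
 with Q(1,3) q s ghom_lin[OF f(1)] show thesis by (rule that)
qed

text \<open>Projectivity splits the surjection of \<open>ex_cover\<close>, and relative projectivity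
  passes to retracts.\<close>

lemma projective_imp_rel_proj:
 assumes P: "projective_mod G K (P :: ('g, 'k, 'u) gmod)" shows "rel_proj P"
proof -
 have PM: "P \<in> Md" using P by (simp add: projective_mod_def)
 note kP = Md_kmod[OF PM]
 obtain Q q where Q: "Q \<in> Md" "rel_proj Q" and q: "ghm Q P q" and s: "q ` carrier Q = carrier P"
  by (rule ex_cover[OF PM]) (rule that)
 have "restrict q (carrier Q) \<in> kG_hom G K Q P" by (rule ghom_restrict[OF Md_kmod[OF Q(1)] q])
 moreover have "restrict (\<lambda>x. x) (carrier P) \<in> kG_hom G K P P" by (rule ghom_restrict[OF kP ghom_id])
 moreover have "restrict q (carrier Q) ` carrier Q = carrier P" using s by simp
 ultimately obtain h where h: "h \<in> kG_hom G K P Q"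
  "compose (carrier P) (restrict q (carrier Q)) h = restrict (\<lambda>x. x) (carrier P)"
  using P Q(1) PM unfolding projective_mod_def by blast
 have hg: "ghm P Q h" using h(1) by (simp add: kG_hom_iff)
 have "q (h x) = x" if "x \<in>. P" for x
  using fun_cong[OF h(2), of x] that ghom_in[OF hg that] by (simp add: compose_def)
 thus ?thesis by (rule rel_proj_retract[OF kP Md_kmod[OF Q(1)] Q(2) hg q])
qed

text \<open>An element is recovered from its orbit map by evaluation at 1, so sending elements to
  orbit maps embeds M into its coinduced module.\<close>

lemma ex_embedding:
 assumes M: "M \<in> Md"
 obtains P i where "P \<in> Md" "rel_proj P" "ghm M P i" "inj_on i (carrier M)"
proof -
 note kM = Md_kmod[OF M]
 obtain P :: "('g, 'k, 'u) gmod" and f f' where P: "P \<in> Md" "giso G K (funG M) P f f'" "rel_proj P"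
  by (rule ex_cofree[OF M]) (rule that)
 have f: "ghm (funG M) P f" "\<And>x. x \<in>. (funG M) ==> f' (f x) = x" using P(2) by (auto simp: giso_def)
 note c = ghom_coind[OF kM kM lin_id]
 have "f' (f (coind M (\<lambda>x. x) x)) \<one>\<^sub>G = x" if "x \<in>. M" for x
  using f(2)[OF ghom_in[OF c that]] that act_one[OF kM] by (simp add: coind_def)
 hence "inj_on (\<lambda>x. f (coind M (\<lambda>x. x) x)) (carrier M)" by (metis (no_types, lifting) inj_onI)
 thus thesis by (rule that[OF P(1,3) ghom_comp[OF c f(1)]])
qed

text \<open>Injectivity splits the embedding of \<open>ex_embedding\<close>.\<close>

lemma injective_imp_rel_proj:
 assumes J: "injective_mod G K (J :: ('g, 'k, 'u) gmod)" shows "rel_proj J"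
proof -
 have JM: "J \<in> Md" using J by (simp add: injective_mod_def)
 obtain P i where P: "P \<in> Md" "rel_proj P" "ghm J P i" "inj_on i (carrier J)"
  by (rule ex_embedding[OF JM]) (rule that)
 have "restrict i (carrier J) \<in> kG_hom G K J P" by (rule ghom_restrict[OF Md_kmod[OF JM] P(3)])
 moreover have "restrict (\<lambda>x. x) (carrier J) \<in> kG_hom G K J J" by (rule ghom_restrict[OF Md_kmod[OF JM] ghom_id])
 moreover have "inj_on (restrict i (carrier J)) (carrier J)" using P(4) by simp
 ultimately obtain h where h: "h \<in> kG_hom G K P J"
  "compose (carrier J) h (restrict i (carrier J)) = restrict (\<lambda>x. x) (carrier J)"
  using J P(1) JM unfolding injective_mod_def by blast
 have "h (i x) = x" if "x \<in>. J" for x using fun_cong[OF h(2), of x] that by (simp add: compose_def)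
 moreover have "ghm P J h" using h(1) by (simp add: kG_hom_iff)
 ultimately show ?thesis by (intro rel_proj_retract[OF Md_kmod[OF JM] Md_kmod[OF P(1)] P(2,3)])
qed

text \<open>For a factorization through P, the identity of P is a trace, and this trace absorbs the
  maps before and after it. Conversely a trace factors through the coinduced module of N.\<close>

lemma stably_zero_iff:
 assumes M: "M \<in> Md" and N: "N \<in> Md" and f: "f \<in> kG_hom G K M N"
 shows "stably_zero G K M N f \<longleftrightarrow> (\<exists>h. lin K M N h \<and> (\<forall>x\<in>carrier M. f x = Tr M N h x))"
proof
 note kM = Md_kmod[OF M] and kN = Md_kmod[OF N]
 assume "stably_zero G K M N f"
 then obtain P a b where P: "projective_mod G K P" "a \<in> kG_hom G K M P" "b \<in> kG_hom G K P N"
  "f = compose (carrier M) b a" by (auto simp: stably_zero_def)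
 have PM: "P \<in> Md" using P by (simp add: projective_mod_def)
 note kP = Md_kmod[OF PM]
 have ab: "ghm M P a" "ghm P N b" using P by (simp_all add: kG_hom_iff)
 obtain e where e: "lin K P P e" "\<And>x. x \<in>. P ==> Tr P P e x = x"
  using projective_imp_rel_proj[OF P(1)] by (auto simp: rel_proj_def)
 have l: "lin K P N (\<lambda>x. b (e x))" by (rule lin_comp[OF e(1) ghom_lin[OF ab(2)]])
 have "f x = Tr M N (\<lambda>x. b (e (a x))) x" if x: "x \<in>. M" for x
  using Tr_right[OF kP kN kM l ab(1) x] Tr_left[OF kP kP kN e(1) ab(2) ghom_in[OF ab(1) x]]
   e(2)[OF ghom_in[OF ab(1) x]] P(4) x by (simp add: compose_def)
 thus "\<exists>h. lin K M N h \<and> (\<forall>x\<in>carrier M. f x = Tr M N h x)" using lin_comp[OF ghom_lin[OF ab(1)] l] by auto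
next
 note kM = Md_kmod[OF M] and kN = Md_kmod[OF N]
 assume "\<exists>h. lin K M N h \<and> (\<forall>x\<in>carrier M. f x = Tr M N h x)"
 then obtain h where h: "lin K M N h" "\<And>x. x \<in>. M ==> f x = Tr M N h x" by blast
 obtain P :: "('g, 'k, 'u) gmod" and j j' where P: "P \<in> Md" "giso G K (funG N) P j j'" "rel_proj P"
  by (rule ex_cofree[OF N]) (rule that)
 have j: "ghm (funG N) P j" "ghm P (funG N) j'" "\<And>x. x \<in>. (funG N) ==> j' (j x) = x"
  using P(2) by (auto simp: giso_def)
 note c = ghom_coind[OF kM kN h(1)]
 let ?a = "restrict (\<lambda>x. j (coind M h x)) (carrier M)" and ?b = "restrict (\<lambda>x. ev N (j' x)) (carrier P)"
 have "?a \<in> kG_hom G K M P" by (rule ghom_restrict[OF kM ghom_comp[OF c j(1)]])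
 moreover have "?b \<in> kG_hom G K P N" by (rule ghom_restrict[OF Md_kmod[OF P(1)] ghom_comp[OF j(2) ghom_ev[OF kN]]])
 moreover have "f = compose (carrier M) ?b ?a"
 proof (rule extensionalityI[of _ "carrier M"])
  show "f \<in> extensional (carrier M)" using f by (simp add: kG_hom_iff)
  fix x assume x: "x \<in>. M"
  thus "f x = compose (carrier M) ?b ?a x"
   using h(2)[OF x] ev_coind[OF kM kN h(1) x] ghom_in[OF c x] ghom_in[OF j(1)] j(3) by (simp add: compose_def)
 qed (simp add: compose_def)
 ultimately show "stably_zero G K M N f" using rel_proj_imp_projective[OF P(1,3)] unfolding stably_zero_def by blast
qed

section \<open>Stable equality, morphism classes and their operations\<close>

definition steq :: "('g, 'k, 'u) gmod => ('g, 'k, 'u) gmod => ('u => 'u) => ('u => 'u) => bool" where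
 "steq M N f g \<longleftrightarrow> (\<exists>h. lin K M N h \<and> (\<forall>x\<in>carrier M. f x = g x \<oplus>\<^sub>N Tr M N h x))"

text \<open>Restricting first lets any function that is a homomorphism on the carrier serve as a
  representative.\<close>

definition cls :: "('g, 'k, 'u) gmod => ('g, 'k, 'u) gmod => ('u => 'u) => ('g, 'k, 'u) stab_mor" where
 "cls M N f = stab_of G K M N (restrict f (carrier M))"

context
 fixes M N :: "('g, 'k, 'u) gmod"
 assumes M: "M \<in> Md" and N: "N \<in> Md"
begin

interpretation M: module K M by (rule Md_mod[OF M])
interpretation N: module K N by (rule Md_mod[OF N])

lemma steqI_eq:
 assumes "ghm M N g" "\<And>x. x \<in>. M ==> f x = g x" shows "steq M N f g"
 unfolding steq_def using assms(2) ghom_in[OF assms(1)]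
 by (intro exI[of _ "\<lambda>x. \<zero>\<^sub>N"]) (auto simp: lin_const0 N.modl Tr_zero[OF Md_kmod[OF M] Md_kmod[OF N]])

lemma steq_refl: "ghm M N f ==> steq M N f f"
 by (rule steqI_eq) auto

lemma steq_sym:
 assumes f: "ghm M N f" and g: "ghm M N g" and fg: "steq M N f g" shows "steq M N g f"
proof -
 obtain h where h: "lin K M N h" "\<And>x. x \<in>. M ==> f x = g x \<oplus>\<^sub>N Tr M N h x"
  using fg by (auto simp: steq_def)
 have "g x = f x \<oplus>\<^sub>N Tr M N (\<lambda>x. \<ominus>\<^sub>N h x) x" if x: "x \<in>. M" for x
  using h(2)[OF x] ghom_in[OF g x] lin_in[OF lin_Tr[OF Md_kmod[OF M] Md_kmod[OF N] h(1)] x]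
  by (simp add: Tr_uminus[OF Md_kmod[OF M] Md_kmod[OF N] h(1) x] N.a_assoc N.r_neg)
 thus ?thesis using lin_uminus[OF h(1) N.modl] by (auto simp: steq_def)
qed

lemma steq_trans:
 assumes g: "ghm M N g" and fe: "steq M N e f" and fg: "steq M N f g" shows "steq M N e g"
proof -
 obtain h where h: "lin K M N h" "\<And>x. x \<in>. M ==> e x = f x \<oplus>\<^sub>N Tr M N h x"
  using fe by (auto simp: steq_def)
 obtain k where k: "lin K M N k" "\<And>x. x \<in>. M ==> f x = g x \<oplus>\<^sub>N Tr M N k x"
  using fg by (auto simp: steq_def)
 have "e x = g x \<oplus>\<^sub>N Tr M N (\<lambda>x. k x \<oplus>\<^sub>N h x) x" if x: "x \<in>. M" for x
  using h(2)[OF x] k(2)[OF x] ghom_in[OF g x] lin_in[OF lin_Tr[OF Md_kmod[OF M] Md_kmod[OF N] h(1)] x]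
   lin_in[OF lin_Tr[OF Md_kmod[OF M] Md_kmod[OF N] k(1)] x]
  by (simp add: Tr_plus[OF Md_kmod[OF M] Md_kmod[OF N] k(1) h(1) x] N.a_assoc)
 thus ?thesis using lin_plus[OF k(1) h(1) N.modl] by (auto simp: steq_def)
qed

lemma steq_plus:
 assumes g: "ghm M N g" "ghm M N g'" and fg: "steq M N f g" "steq M N f' g'"
 shows "steq M N (\<lambda>x. f x \<oplus>\<^sub>N f' x) (\<lambda>x. g x \<oplus>\<^sub>N g' x)"
proof -
 obtain h where h: "lin K M N h" "\<And>x. x \<in>. M ==> f x = g x \<oplus>\<^sub>N Tr M N h x"
  using fg by (auto simp: steq_def)
 obtain k where k: "lin K M N k" "\<And>x. x \<in>. M ==> f' x = g' x \<oplus>\<^sub>N Tr M N k x"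
  using fg by (auto simp: steq_def)
 have "f x \<oplus>\<^sub>N f' x = (g x \<oplus>\<^sub>N g' x) \<oplus>\<^sub>N Tr M N (\<lambda>x. h x \<oplus>\<^sub>N k x) x" if x: "x \<in>. M" for x
  using h(2)[OF x] k(2)[OF x] ghom_in[OF g(1) x] ghom_in[OF g(2) x]
   lin_in[OF lin_Tr[OF Md_kmod[OF M] Md_kmod[OF N] h(1)] x]
   lin_in[OF lin_Tr[OF Md_kmod[OF M] Md_kmod[OF N] k(1)] x]
  by (simp add: Tr_plus[OF Md_kmod[OF M] Md_kmod[OF N] h(1) k(1) x] N.a_ac)
 thus ?thesis using lin_plus[OF h(1) k(1) N.modl] by (auto simp: steq_def)
qed

lemma stab_class_eq:
 assumes f: "ghm M N f"
 shows "stab_class G K M N (restrict f (carrier M)) = {k \<in> kG_hom G K M N. steq M N k f}"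
proof -
 have "stably_zero G K M N (\<lambda>x\<in>carrier M. k x \<ominus>\<^sub>N restrict f (carrier M) x) \<longleftrightarrow> steq M N k f"
  if k: "k \<in> kG_hom G K M N" for k
 proof -
  have kg: "ghm M N k" using k by (simp add: kG_hom_iff)
  have "(\<lambda>x\<in>carrier M. k x \<ominus>\<^sub>N f x) \<in> kG_hom G K M N"
   by (rule ghom_restrict[OF Md_kmod[OF M] ghom_diff[OF Md_kmod[OF N] kg f]])
  moreover have "(\<lambda>x\<in>carrier M. k x \<ominus>\<^sub>N restrict f (carrier M) x) = (\<lambda>x\<in>carrier M. k x \<ominus>\<^sub>N f x)"
   by (rule restrict_ext) simp
  moreover have "(k x \<ominus>\<^sub>N f x = Tr M N h x) = (k x = f x \<oplus>\<^sub>N Tr M N h x)"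
   if h: "lin K M N h" and x: "x \<in>. M" for h x
   using ghom_in[OF kg x] ghom_in[OF f x] lin_in[OF lin_Tr[OF Md_kmod[OF M] Md_kmod[OF N] h] x]
   by (metis N.add_minus_cancel_left N.minus_add_cancel N.a_comm N.minus_closed)
  ultimately show ?thesis using stably_zero_iff[OF M N, of "\<lambda>x\<in>carrier M. k x \<ominus>\<^sub>N f x"]
   by (auto simp: steq_def)
 qed
 thus ?thesis by (auto simp: stab_class_def)
qed

lemma cls_eq: "ghm M N f ==> cls M N f = (M, {k \<in> kG_hom G K M N. steq M N k f}, N)"
 by (simp add: cls_def stab_of_def stab_class_eq)

lemma restrict_mem:
 assumes f: "ghm M N f" and g: "ghm M N g" and s: "steq M N f g"
 shows "restrict f (carrier M) \<in> {k \<in> kG_hom G K M N. steq M N k g}"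
proof -
 have "steq M N (restrict f (carrier M)) f" by (rule steqI_eq[OF f]) simp
 thus ?thesis using ghom_restrict[OF Md_kmod[OF M] f] steq_trans[OF g _ s] by auto
qed

lemma cls_eq_iff:
 assumes f: "ghm M N f" and g: "ghm M N g"
 shows "cls M N f = cls M N g \<longleftrightarrow> steq M N f g"
proof
 assume "cls M N f = cls M N g"
 hence "restrict f (carrier M) \<in> {k \<in> kG_hom G K M N. steq M N k g}"
  using restrict_mem[OF f f steq_refl[OF f]] by (simp add: cls_eq[OF f] cls_eq[OF g])
 hence r: "steq M N (restrict f (carrier M)) g" "restrict f (carrier M) \<in> kG_hom G K M N" by auto
 have "steq M N f (restrict f (carrier M))" using r(2) by (intro steqI_eq) (auto simp: kG_hom_iff)
 thus "steq M N f g" using r(1) by (rule steq_trans[OF g])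
next
 assume s: "steq M N f g"
 have "steq M N k f \<longleftrightarrow> steq M N k g" for k
  using steq_trans[OF g _ s, of k] steq_trans[OF f _ steq_sym[OF f g s], of k] by blast
 thus "cls M N f = cls M N g" by (simp add: cls_eq f g)
qed

lemma cls_cong: "ghm M N f ==> (\<And>x. x \<in>. M ==> f x = g x) ==> cls M N g = cls M N f"
 by (metis (no_types, lifting) cls_def restrict_ext)

lemma mor_cls: "Mor (Stab G K) M N = {cls M N f | f. ghm M N f}"
proof -
 have "Mor (Stab G K) M N = stab_of G K M N ` kG_hom G K M N" by (simp add: Stab_def stab_cat_def)
 also have "... = {cls M N f | f. ghm M N f}"
 proof (intro equalityI subsetI)
  fix m assume "m \<in> stab_of G K M N ` kG_hom G K M N"
  then obtain f where f: "f \<in> kG_hom G K M N" "m = stab_of G K M N f" by blast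
  have "m = cls M N f" "ghm M N f" using f by (simp_all add: kG_hom_iff cls_def extensional_restrict)
  thus "m \<in> {cls M N f | f. ghm M N f}" by blast
 next
  fix m assume "m \<in> {cls M N f | f. ghm M N f}"
  then obtain f where f: "ghm M N f" "m = cls M N f" by blast
  show "m \<in> stab_of G K M N ` kG_hom G K M N"
   unfolding f(2) cls_def by (rule imageI[OF ghom_restrict[OF Md_kmod[OF M] f(1)]])
 qed
 finally show ?thesis .
qed

lemma cls_mor: "ghm M N f ==> cls M N f \<in> Mor (Stab G K) M N"
 by (auto simp: mor_cls)

lemma morE:
 assumes "m \<in> Mor (Stab G K) M N" obtains f where "ghm M N f" "m = cls M N f" using assms by (auto simp: mor_cls)

text \<open>The union over representatives collapses: it is not empty, and all its members are the
  same class. Composition and tensor product follow the same pattern.\<close>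

lemma addm_cls:
 assumes f: "ghm M N f" and g: "ghm M N g"
 shows "addm (Stab G K) (cls M N f) (cls M N g) = cls M N (\<lambda>x. f x \<oplus>\<^sub>N g x)"
proof -
 let ?C = "\<lambda>f. {k \<in> kG_hom G K M N. steq M N k f}"
 note fg = ghom_plus[OF Md_kmod[OF N] f g]
 have "stab_class G K M N (\<lambda>x\<in>carrier M. a x \<oplus>\<^sub>N b x) = ?C (\<lambda>x. f x \<oplus>\<^sub>N g x)"
  if "a \<in> ?C f" "b \<in> ?C g" for a b
 proof -
  have ab: "ghm M N a" "ghm M N b" "steq M N a f" "steq M N b g" using that by (auto simp: kG_hom_iff)
  have h: "ghm M N (\<lambda>x. a x \<oplus>\<^sub>N b x)" by (rule ghom_plus[OF Md_kmod[OF N] ab(1,2)])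
  have "cls M N (\<lambda>x. a x \<oplus>\<^sub>N b x) = cls M N (\<lambda>x. f x \<oplus>\<^sub>N g x)"
   using steq_plus[OF f g ab(3,4)] cls_eq_iff[OF h fg] by simp
  thus ?thesis using stab_class_eq[OF h] by (simp add: cls_eq[OF h] cls_eq[OF fg])
 qed
 moreover have "restrict f (carrier M) \<in> ?C f" "restrict g (carrier M) \<in> ?C g"
  using restrict_mem f g steq_refl by blast+
 ultimately have "(\<Union>a\<in>?C f. \<Union>b\<in>?C g. stab_class G K M N (\<lambda>x\<in>carrier M. a x \<oplus>\<^sub>N b x)) = ?C (\<lambda>x. f x \<oplus>\<^sub>N g x)"
  by blast
 thus ?thesis by (simp add: Stab_def stab_cat_def cls_eq f g fg)
qed

end

lemma idm_cls: "M \<in> Md ==> idm (Stab G K) M = cls M M (\<lambda>x. x)"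
 by (simp add: Stab_def stab_cat_def cls_def)

lemma zerom_cls: "zerom (Stab G K) M N = cls M N (\<lambda>x. \<zero>\<^sub>N)"
 by (simp add: Stab_def stab_cat_def cls_def)

lemma Ob_Stab [simp]: "Ob (Stab G K) = kG_mods G K"
 by (simp add: Stab_def stab_cat_def)

text \<open>g f = g f' + Tr(g h) and g f' = g' f' + Tr(e f'), where h and e are the linear witnesses
  for f and g.\<close>

lemma steq_comp:
 assumes L: "L \<in> Md" and M: "M \<in> Md" and N: "N \<in> Md"
  and f: "ghom G K L M f" "ghom G K L M f'" "steq L M f f'" and g: "ghom G K M N g" "ghom G K M N g'" "steq M N g g'"
 shows "steq L N (\<lambda>x. g (f x)) (\<lambda>x. g' (f' x))"
proof -
 interpret N: module K N by (rule Md_mod[OF N])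
 note k = Md_kmod[OF L] Md_kmod[OF M] Md_kmod[OF N]
 obtain h where h: "lin K L M h" "\<And>x. x \<in>. L ==> f x = f' x \<oplus>\<^sub>M Tr L M h x"
  using f(3) by (auto simp: steq_def)
 obtain e where e: "lin K M N e" "\<And>x. x \<in>. M ==> g x = g' x \<oplus>\<^sub>N Tr M N e x"
  using g(3) by (auto simp: steq_def)
 have l: "lin K L N (\<lambda>x. e (f' x))" "lin K L N (\<lambda>x. g (h x))"
  using lin_comp[OF ghom_lin[OF f(2)] e(1)] lin_comp[OF h(1) ghom_lin[OF g(1)]] .
 have "g (f x) = g' (f' x) \<oplus>\<^sub>N Tr L N (\<lambda>x. e (f' x) \<oplus>\<^sub>N g (h x)) x" if x: "x \<in>. L" for x
 proof -
  note c = ghom_in[OF f(2) x] lin_in[OF lin_Tr[OF k(1,2) h(1)] x]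
  have "g (f x) = g (f' x) \<oplus>\<^sub>N Tr L N (\<lambda>x. g (h x)) x"
   using h(2)[OF x] c by (simp add: lin_add[OF ghom_lin[OF g(1)]] Tr_left[OF k h(1) g(1) x])
  also have "g (f' x) = g' (f' x) \<oplus>\<^sub>N Tr L N (\<lambda>x. e (f' x)) x"
   using e(2)[OF c(1)] by (simp add: Tr_right[OF k(2,3,1) e(1) f(2) x])
  finally show ?thesis
   using ghom_in[OF g(2) c(1)] lin_in[OF lin_Tr[OF k(1,3) l(1)] x] lin_in[OF lin_Tr[OF k(1,3) l(2)] x]
   by (simp add: Tr_plus[OF k(1,3) l x] N.a_assoc)
 qed
 thus ?thesis using lin_plus[OF l N.modl] by (auto simp: steq_def)
qed

lemma cmp_cls:
 assumes L: "L \<in> Md" and M: "M \<in> Md" and N: "N \<in> Md" and f: "ghom G K L M f" and g: "ghom G K M N g"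
 shows "cmp (Stab G K) (cls M N g) (cls L M f) = cls L N (\<lambda>x. g (f x))"
proof -
 let ?C = "\<lambda>M N f. {k \<in> kG_hom G K M N. steq M N k f}"
 note fg = ghom_comp[OF f g]
 have "stab_class G K L N (compose (carrier L) b a) = ?C L N (\<lambda>x. g (f x))"
  if "a \<in> ?C L M f" "b \<in> ?C M N g" for a b
 proof -
  have ab: "ghom G K L M a" "ghom G K M N b" "steq L M a f" "steq M N b g" using that by (auto simp: kG_hom_iff)
  note h = ghom_comp[OF ab(1,2)]
  have "cls L N (\<lambda>x. b (a x)) = cls L N (\<lambda>x. g (f x))"
   using steq_comp[OF L M N ab(1) f ab(3) ab(2) g ab(4)] cls_eq_iff[OF L N h fg] by simp
  thus ?thesis using stab_class_eq[OF L N h] by (simp add: cls_eq[OF L N h] cls_eq[OF L N fg] compose_def)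
 qed
 moreover have "restrict f (carrier L) \<in> ?C L M f" "restrict g (carrier M) \<in> ?C M N g"
  using restrict_mem[OF L M f f steq_refl[OF L M f]] restrict_mem[OF M N g g steq_refl[OF M N g]] .
 ultimately have "(\<Union>b\<in>?C M N g. \<Union>a\<in>?C L M f. stab_class G K L N (compose (carrier L) b a)) = ?C L N (\<lambda>x. g (f x))"
  by blast
 thus ?thesis by (simp add: Stab_def stab_cat_def cls_eq[OF L M f] cls_eq[OF M N g] cls_eq[OF L N fg])
qed

lemma hom_group_simps:
 "carrier (hom_group C X Y) = Mor C X Y" "x \<otimes>\<^bsub>hom_group C X Y\<^esub> y = addm C x y" "\<one>\<^bsub>hom_group C X Y\<^esub> = zerom C X Y"
 by (simp_all add: hom_group_def)

lemma preadditive_Stab: "preadditive_category (Stab G K :: (('g, 'k, 'u) gmod, ('g, 'k, 'u) stab_mor) ttcat)"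
proof (rule preadditive_category.intro)
 let ?S = "Stab G K :: (('g, 'k, 'u) gmod, ('g, 'k, 'u) stab_mor) ttcat"
 fix X assume X: "X \<in> Ob ?S"
 show "idm ?S X \<in> Mor ?S X X" using X by (simp add: idm_cls cls_mor ghom_id)
 fix Y assume Y: "Y \<in> Ob ?S"
 have XM: "X \<in> Md" and YM: "Y \<in> Md" using X Y by simp_all
 interpret Y: module K Y by (rule Md_mod[OF YM])
 note kX = Md_kmod[OF XM] and kY = Md_kmod[OF YM]
 { fix f assume "f \<in> Mor ?S X Y"
  then obtain a where a: "ghom G K X Y a" "f = cls X Y a" using morE[OF XM YM] by blast
  show "cmp ?S f (idm ?S X) = f" "cmp ?S (idm ?S Y) f = f"
   unfolding a(2) idm_cls[OF XM] idm_cls[OF YM] cmp_cls[OF XM XM YM ghom_id a(1)] cmp_cls[OF XM YM YM a(1) ghom_id]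
   by (rule refl)+ }
 show "comm_group (hom_group ?S X Y)"
 proof (rule comm_groupI; (unfold hom_group_simps)?)
  show "zerom ?S X Y \<in> Mor ?S X Y" by (simp add: zerom_cls cls_mor XM YM ghom_zero kY)
  fix x assume "x \<in> Mor ?S X Y"
  then obtain a where a: "ghom G K X Y a" "x = cls X Y a" using morE[OF XM YM] by blast
  note ac = ghom_in[OF a(1)]
  show "addm ?S (zerom ?S X Y) x = x" unfolding a(2) zerom_cls addm_cls[OF XM YM ghom_zero[OF kY] a(1)] using ac
   by (intro cls_cong[OF XM YM a(1)]) simp
  have n: "ghom G K X Y (\<lambda>x. \<ominus>\<^sub>Y a x)" by (rule ghom_comp[OF a(1) ghom_uminus[OF kY]])
  have "addm ?S (cls X Y (\<lambda>x. \<ominus>\<^sub>Y a x)) x = zerom ?S X Y"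
   unfolding a(2) zerom_cls addm_cls[OF XM YM n a(1)] using ac
   by (intro cls_cong[OF XM YM ghom_zero[OF kY]]) (simp add: Y.l_neg)
  thus "\<exists>y\<in>Mor ?S X Y. addm ?S y x = zerom ?S X Y" using cls_mor[OF XM YM n] by blast
  fix y assume "y \<in> Mor ?S X Y"
  then obtain b where b: "ghom G K X Y b" "y = cls X Y b" using morE[OF XM YM] by blast
  note bc = ghom_in[OF b(1)]
  show "addm ?S x y \<in> Mor ?S X Y" using a b by (simp add: addm_cls XM YM cls_mor ghom_plus kY)
  show "addm ?S x y = addm ?S y x" unfolding a b addm_cls[OF XM YM a(1) b(1)] addm_cls[OF XM YM b(1) a(1)]
   using ac bc by (intro cls_cong[OF XM YM ghom_plus[OF kY b(1) a(1)]]) (simp add: Y.a_comm)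
  fix z assume "z \<in> Mor ?S X Y"
  then obtain c where c: "ghom G K X Y c" "z = cls X Y c" using morE[OF XM YM] by blast
  note cc = ghom_in[OF c(1)]
  show "addm ?S (addm ?S x y) z = addm ?S x (addm ?S y z)"
   unfolding a b c addm_cls[OF XM YM a(1) b(1)] addm_cls[OF XM YM b(1) c(1)]
    addm_cls[OF XM YM a(1) ghom_plus[OF kY b(1) c(1)]] addm_cls[OF XM YM ghom_plus[OF kY a(1) b(1)] c(1)]
   using ac bc cc by (intro cls_cong[OF XM YM ghom_plus[OF kY a(1) ghom_plus[OF kY b(1) c(1)]]]) (simp add: Y.a_assoc)
 qed
 fix Z assume Z: "Z \<in> Ob ?S"
 hence ZM: "Z \<in> Md" by simp
 note kZ = Md_kmod[OF ZM]
 { fix f g assume "f \<in> Mor ?S X Y" "g \<in> Mor ?S Y Z"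
  then obtain a b where a: "ghom G K X Y a" "f = cls X Y a" and b: "ghom G K Y Z b" "g = cls Y Z b"
   using morE[OF XM YM] morE[OF YM ZM] by metis
  show "cmp ?S g f \<in> Mor ?S X Z" using a b by (simp add: cmp_cls XM YM ZM cls_mor ghom_comp)
  { fix f' assume "f' \<in> Mor ?S X Y"
   then obtain c where c: "ghom G K X Y c" "f' = cls X Y c" using morE[OF XM YM] by blast
   show "cmp ?S g (addm ?S f f') = addm ?S (cmp ?S g f) (cmp ?S g f')"
    unfolding a b c addm_cls[OF XM YM a(1) c(1)] cmp_cls[OF XM YM ZM a(1) b(1)] cmp_cls[OF XM YM ZM c(1) b(1)]
     cmp_cls[OF XM YM ZM ghom_plus[OF kY a(1) c(1)] b(1)] addm_cls[OF XM ZM ghom_comp[OF a(1) b(1)] ghom_comp[OF c(1) b(1)]]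
    using ghom_in[OF a(1)] ghom_in[OF c(1)]
    by (intro cls_cong[OF XM ZM ghom_plus[OF kZ ghom_comp[OF a(1) b(1)] ghom_comp[OF c(1) b(1)]]])
     (simp add: lin_add[OF ghom_lin[OF b(1)]]) }
  fix g' assume "g' \<in> Mor ?S Y Z"
  then obtain c where c: "ghom G K Y Z c" "g' = cls Y Z c" using morE[OF YM ZM] by blast
  show "cmp ?S (addm ?S g g') f = addm ?S (cmp ?S g f) (cmp ?S g' f)"
   unfolding a b c addm_cls[OF YM ZM b(1) c(1)] cmp_cls[OF XM YM ZM a(1) b(1)] cmp_cls[OF XM YM ZM a(1) c(1)]
    cmp_cls[OF XM YM ZM a(1) ghom_plus[OF kZ b(1) c(1)]] addm_cls[OF XM ZM ghom_comp[OF a(1) b(1)] ghom_comp[OF a(1) c(1)]] .. }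
 fix W f g h assume W: "W \<in> Ob ?S" and fgh: "f \<in> Mor ?S W X" "g \<in> Mor ?S X Y" "h \<in> Mor ?S Y Z"
 have WM: "W \<in> Md" using W by simp
 obtain a b c where a: "ghom G K W X a" "f = cls W X a" and b: "ghom G K X Y b" "g = cls X Y b" and c: "ghom G K Y Z c" "h = cls Y Z c"
  using fgh morE[OF WM XM] morE[OF XM YM] morE[OF YM ZM] by metis
 show "cmp ?S (cmp ?S h g) f = cmp ?S h (cmp ?S g f)"
  unfolding a b c cmp_cls[OF WM XM YM a(1) b(1)] cmp_cls[OF XM YM ZM b(1) c(1)]
   cmp_cls[OF WM XM ZM a(1) ghom_comp[OF b(1) c(1)]] cmp_cls[OF WM YM ZM ghom_comp[OF a(1) b(1)] c(1)] ..
qed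

end

section \<open>Zero morphisms and a compactness criterion in preadditive categories\<close>

context preadditive_category
begin

lemma zerom_closed: "X \<in> Ob C ==> Y \<in> Ob C ==> zerom C X Y \<in> Mor C X Y"
 using comm_group.axioms(1)[OF comm_group_hom, of X Y] comm_monoid.axioms(1) monoid.one_closed
 by (fastforce simp: hom_group_def)

lemma addm_cancel_zero:
 assumes "X \<in> Ob C" "Y \<in> Ob C" "f \<in> Mor C X Y" "addm C f f = f" shows "f = zerom C X Y"
proof -
 interpret H: comm_group "hom_group C X Y" by (rule comm_group_hom[OF assms(1,2)])
 show ?thesis using H.l_cancel_one[of f f] assms by (simp add: hom_group_def)
qed

lemma addm_zero: "X \<in> Ob C ==> Y \<in> Ob C ==> addm C (zerom C X Y) (zerom C X Y) = zerom C X Y"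
proof -
 assume "X \<in> Ob C" "Y \<in> Ob C"
 then interpret H: comm_group "hom_group C X Y" by (rule comm_group_hom)
 show ?thesis using H.l_one[OF H.one_closed] by (simp add: hom_group_def)
qed

lemma cmp_zero_right:
 assumes "X \<in> Ob C" "Y \<in> Ob C" "Z \<in> Ob C" "g \<in> Mor C Y Z"
 shows "g \<bullet> zerom C X Y = zerom C X Z"
proof (rule addm_cancel_zero[OF assms(1,3)])
 note z = zerom_closed[OF assms(1,2)]
 show "g \<bullet> zerom C X Y \<in> Mor C X Z" by (rule cmp_closed[OF assms(1-3) z assms(4)])
 show "addm C (g \<bullet> zerom C X Y) (g \<bullet> zerom C X Y) = g \<bullet> zerom C X Y"
  using cmp_add_right[OF assms(1-3) z z assms(4)] by (simp add: addm_zero assms)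
qed

lemma cmp_zero_left:
 assumes "X \<in> Ob C" "Y \<in> Ob C" "Z \<in> Ob C" "f \<in> Mor C X Y"
 shows "zerom C Y Z \<bullet> f = zerom C X Z"
proof (rule addm_cancel_zero[OF assms(1,3)])
 note z = zerom_closed[OF assms(2,3)]
 show "zerom C Y Z \<bullet> f \<in> Mor C X Z" by (rule cmp_closed[OF assms(1-4) z])
 show "addm C (zerom C Y Z \<bullet> f) (zerom C Y Z \<bullet> f) = zerom C Y Z \<bullet> f"
  using cmp_add_left[OF assms(1-4) z z] by (simp add: addm_zero assms)
qed

lemma cmp_finprod:
 assumes "X \<in> Ob C" "Y \<in> Ob C" "Z \<in> Ob C" "g \<in> Mor C Y Z" "f \<in> A \<rightarrow> Mor C X Y"
 shows "g \<bullet> finprod (hom_group C X Y) f A = finprod (hom_group C X Z) (\<lambda>i. g \<bullet> f i) A"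
proof -
 interpret Y: comm_group "hom_group C X Y" by (rule comm_group_hom[OF assms(1,2)])
 interpret Z: comm_group "hom_group C X Z" by (rule comm_group_hom[OF assms(1,3)])
 have [simp]: "carrier (hom_group C X Y) = Mor C X Y" "carrier (hom_group C X Z) = Mor C X Z"
  "\<one>\<^bsub>hom_group C X Y\<^esub> = zerom C X Y" "\<one>\<^bsub>hom_group C X Z\<^esub> = zerom C X Z"
  by (simp_all add: hom_group_def)
 show ?thesis using assms(5)
 proof (induction A rule: infinite_finite_induct)
  case (insert i F)
  have f: "f i \<in> Mor C X Y" "f \<in> F \<rightarrow> Mor C X Y" using insert.prems by auto
  have fin: "finprod (hom_group C X Y) f F \<in> Mor C X Y" using Y.finprod_closed[of f F] f by simp
  have "g \<bullet> finprod (hom_group C X Y) f (insert i F) = g \<bullet> addm C (f i) (finprod (hom_group C X Y) f F)"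
   using insert f by (subst Y.finprod_insert) (auto simp: hom_group_def)
  also have "... = addm C (g \<bullet> f i) (finprod (hom_group C X Z) (\<lambda>i. g \<bullet> f i) F)"
   using cmp_add_right[OF assms(1-3) f(1) fin assms(4)] insert.IH[OF f(2)] by simp
  also have "... = finprod (hom_group C X Z) (\<lambda>i. g \<bullet> f i) (insert i F)"
   using insert f cmp_closed[OF assms(1-3) _ assms(4)] by (subst Z.finprod_insert) (auto simp: hom_group_def)
  finally show ?case .
 qed (simp_all add: cmp_zero_right[OF assms(1-4)])
qed

text \<open>Compactness can be tested with coproducts that have projections: it suffices that every
 morphism into the coproduct is a finite sum through the summands.\<close>

lemma compact_objectI:
 assumes c: "c \<in> Ob C"
  and proj: "\<And>(I :: 'u set) A X \<iota>. small TYPE('u) I ==> is_coproduct C I A X \<iota> ==>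
   \<exists>\<pi>. (\<forall>j\<in>I. \<pi> j \<in> Mor C X (A j) \<and> \<pi> j \<bullet> \<iota> j = idm C (A j) \<and>
    (\<forall>i\<in>I. i \<noteq> j --> \<pi> j \<bullet> \<iota> i = zerom C (A i) (A j)))"
  and fin: "\<And>(I :: 'u set) A X \<iota> m. small TYPE('u) I ==> is_coproduct C I A X \<iota> ==> m \<in> Mor C c X ==>
   \<exists>F \<phi>. finite F \<and> F \<subseteq> I \<and> (\<forall>i\<in>F. \<phi> i \<in> Mor C c (A i)) \<and>
    m = finprod (hom_group C c X) (\<lambda>i. \<iota> i \<bullet> \<phi> i) F"
 shows "compact_object TYPE('u) C c" unfolding compact_object_def
proof (intro conjI allI impI c)
 fix I :: "'u set" and A X \<iota>
 assume "small TYPE('u) I \<and> is_coproduct C I A X \<iota>"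
 hence I: "small TYPE('u) I" and X: "is_coproduct C I A X \<iota>" by auto
 have XO: "X \<in> Ob C" and AO: "\<And>i. i \<in> I ==> A i \<in> Ob C" and \<iota>: "\<And>i. i \<in> I ==> \<iota> i \<in> Mor C (A i) X"
  using X by (auto simp: is_coproduct_def)
 interpret H: comm_group "hom_group C c X" by (rule comm_group_hom[OF c XO])
 have [simp]: "carrier (hom_group C c Y) = Mor C c Y" "\<one>\<^bsub>hom_group C c Y\<^esub> = zerom C c Y" for Y
  by (simp_all add: hom_group_def)
 let ?s = "\<lambda>\<phi>. {i \<in> I. \<phi> i \<noteq> zerom C c (A i)}"
 let ?D = "{\<phi> \<in> (\<Pi>\<^sub>E i\<in>I. Mor C c (A i)). finite (?s \<phi>)}"
 let ?\<Phi> = "\<lambda>\<phi>. finprod (hom_group C c X) (\<lambda>i. \<iota> i \<bullet> \<phi> i) (?s \<phi>)"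
 obtain \<pi> where \<pi>: "\<And>j. j \<in> I ==> \<pi> j \<in> Mor C X (A j)" "\<And>j. j \<in> I ==> \<pi> j \<bullet> \<iota> j = idm C (A j)"
  "\<And>i j. i \<in> I ==> j \<in> I ==> i \<noteq> j ==> \<pi> j \<bullet> \<iota> i = zerom C (A i) (A j)"
  using proj[OF I X] by blast
 have trm: "\<iota> i \<bullet> \<phi> i \<in> Mor C c X" if "\<phi> \<in> ?D" "i \<in> I" for \<phi> i
  using that by (intro cmp_closed[OF c AO XO _ \<iota>]) auto
 \<comment> \<open>The projections recover the components of the sum, which gives
   injectivity.\<close>
 have coord: "\<pi> j \<bullet> ?\<Phi> \<phi> = \<phi> j" if \<phi>: "\<phi> \<in> ?D" and j: "j \<in> I" for \<phi> j
 proof -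
  interpret Hj: comm_group "hom_group C c (A j)" by (rule comm_group_hom[OF c AO[OF j]])
  have \<phi>c: "\<phi> i \<in> Mor C c (A i)" if "i \<in> I" for i using \<phi> that by auto
  have e: "\<pi> j \<bullet> \<iota> i \<bullet> \<phi> i = (if j = i then \<phi> i else zerom C c (A j))" if i: "i \<in> I" for i
   using cmp_assoc[OF c AO[OF i] XO AO[OF j] \<phi>c[OF i] \<iota>[OF i] \<pi>(1)[OF j]] \<pi>(2)[OF j] \<pi>(3)[OF i j]
    idm_left[OF c AO[OF i] \<phi>c[OF i]] cmp_zero_left[OF c AO[OF i] AO[OF j] \<phi>c[OF i]] by auto
  have "\<pi> j \<bullet> ?\<Phi> \<phi> = finprod (hom_group C c (A j)) (\<lambda>i. \<pi> j \<bullet> \<iota> i \<bullet> \<phi> i) (?s \<phi>)"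
   using trm[OF \<phi>] by (intro cmp_finprod[OF c XO AO[OF j] \<pi>(1)[OF j]]) auto
  also have "... = finprod (hom_group C c (A j)) (\<lambda>i. if j = i then \<phi> j else \<one>\<^bsub>hom_group C c (A j)\<^esub>) (?s \<phi>)"
   using e \<phi>c[OF j] zerom_closed[OF c AO[OF j]] by (intro Hj.finprod_cong') auto
  also have "... = \<phi> j"
  proof (cases "j \<in> ?s \<phi>")
   case True thus ?thesis using \<phi> \<phi>c[OF j] by (subst Hj.finprod_singleton) auto
  next
   case False
   hence "finprod (hom_group C c (A j)) (\<lambda>i. if j = i then \<phi> j else \<one>\<^bsub>hom_group C c (A j)\<^esub>) (?s \<phi>) =
    \<one>\<^bsub>hom_group C c (A j)\<^esub>" by (intro Hj.finprod_one_eqI) auto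
   thus ?thesis using False j by simp
  qed
  finally show ?thesis .
 qed
 show "bij_betw ?\<Phi> ?D (Mor C c X)"
 proof (rule bij_betw_imageI)
  show "inj_on ?\<Phi> ?D"
  proof (rule inj_onI)
   fix \<phi> \<phi>' assume \<phi>: "\<phi> \<in> ?D" "\<phi>' \<in> ?D" and eq: "?\<Phi> \<phi> = ?\<Phi> \<phi>'"
   show "\<phi> = \<phi>'"
   proof (rule PiE_ext)
    show "\<phi> \<in> (\<Pi>\<^sub>E i\<in>I. Mor C c (A i))" "\<phi>' \<in> (\<Pi>\<^sub>E i\<in>I. Mor C c (A i))" using \<phi> by simp_all
    fix j assume j: "j \<in> I"
    have "\<phi> j = \<pi> j \<bullet> ?\<Phi> \<phi>" by (rule coord[OF \<phi>(1) j, symmetric])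
    also have "... = \<pi> j \<bullet> ?\<Phi> \<phi>'" by (simp only: eq)
    also have "... = \<phi>' j" by (rule coord[OF \<phi>(2) j])
    finally show "\<phi> j = \<phi>' j" .
   qed
  qed
  show "?\<Phi> ` ?D = Mor C c X"
  proof (intro equalityI subsetI)
   fix m assume "m \<in> ?\<Phi> ` ?D"
   then obtain \<phi> where \<phi>: "\<phi> \<in> ?D" "m = ?\<Phi> \<phi>" by blast
   have "?\<Phi> \<phi> \<in>. (hom_group C c X)" using trm[OF \<phi>(1)] by (intro H.finprod_closed) auto
   thus "m \<in> Mor C c X" using \<phi> by simp
  next
   fix m assume m: "m \<in> Mor C c X"
   then obtain F \<psi> where F: "finite F" "F \<subseteq> I" "\<And>i. i \<in> F ==> \<psi> i \<in> Mor C c (A i)"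
    "m = finprod (hom_group C c X) (\<lambda>i. \<iota> i \<bullet> \<psi> i) F" using fin[OF I X] by meson
   \<comment> \<open>Extended by zero to all of I. Some of the given components may vanish, so the
     support of the extension can be smaller than F.\<close>
   define \<phi> where "\<phi> = (\<lambda>i\<in>I. if i \<in> F then \<psi> i else zerom C c (A i))"
   have s: "?s \<phi> \<subseteq> F" by (auto simp: \<phi>_def)
   have "\<phi> \<in> (\<Pi>\<^sub>E i\<in>I. Mor C c (A i))" using F(2,3) zerom_closed[OF c AO] by (auto simp: \<phi>_def)
   hence \<phi>: "\<phi> \<in> ?D" using finite_subset[OF s F(1)] by simp
   have "?\<Phi> \<phi> = finprod (hom_group C c X) (\<lambda>i. \<iota> i \<bullet> \<phi> i) F"
   proof (rule H.finprod_mono_neutral_cong_left[OF F(1) s])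
    fix i assume i: "i \<in> F - ?s \<phi>"
    hence "\<phi> i = zerom C c (A i)" "i \<in> I" using F(2) by auto
    thus "\<iota> i \<bullet> \<phi> i = \<one>\<^bsub>hom_group C c X\<^esub>" using cmp_zero_right[OF c AO XO \<iota>] by simp
   qed (use trm[OF \<phi>] F(2) in auto)
   also have "... = m" unfolding F(4) using F(2,3) \<iota> cmp_closed[OF c AO XO _ \<iota>]
    by (intro H.finprod_cong') (auto simp: \<phi>_def subset_iff)
   finally show "m \<in> ?\<Phi> ` ?D" using \<phi> by blast
  qed
 qed
qed

end

section \<open>Zero objects, coproducts and compact objects of the stable category\<close>

context stab
begin

interpretation S: preadditive_category "Stab G K :: (('g, 'k, 'u) gmod, ('g, 'k, 'u) stab_mor) ttcat"
 by (rule preadditive_Stab)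

abbreviation "St \<equiv> Stab G K :: (('g, 'k, 'u) gmod, ('g, 'k, 'u) stab_mor) ttcat"

text \<open>Vanishing of the identity in the stable category says that the identity is a trace; this
  trace then absorbs every map to or from M.\<close>

lemma zero_object_iff:
 assumes M: "M \<in> Md" shows "zero_object St M \<longleftrightarrow> rel_proj M"
proof
 interpret M: module K M by (rule Md_mod[OF M])
 note kM = Md_kmod[OF M]
 assume "zero_object St M"
 hence "cls M M (\<lambda>x. x) = cls M M (\<lambda>x. \<zero>\<^sub>M)"
  using M cls_mor[OF M M ghom_id] cls_mor[OF M M ghom_zero[OF kM]] by (auto simp: zero_object_def)
 then obtain h where h: "lin K M M h" "\<And>x. x \<in>. M ==> x = \<zero>\<^sub>M \<oplus>\<^sub>M Tr M M h x"
  using cls_eq_iff[OF M M ghom_id ghom_zero[OF kM]] by (auto simp: steq_def)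
 show "rel_proj M" unfolding rel_proj_def
  using h lin_in[OF lin_Tr[OF kM kM h(1)]] by (intro exI[of _ h]) (metis M.l_zero)
next
 note kM = Md_kmod[OF M]
 assume "rel_proj M"
 then obtain e where e: "lin K M M e" "\<And>x. x \<in>. M ==> Tr M M e x = x" by (auto simp: rel_proj_def)
 show "zero_object St M" unfolding zero_object_def
 proof (intro conjI ballI)
  fix Y assume "Y \<in> Ob St"
  hence Y: "Y \<in> Md" by simp
  note kY = Md_kmod[OF Y]
  interpret Y: module K Y by (rule Md_mod[OF Y])
  interpret M: module K M by (rule Md_mod[OF M])
  have to: "m = cls M Y (\<lambda>x. \<zero>\<^sub>Y)" if m: "m \<in> Mor St M Y" for m
  proof -
   obtain f where f: "ghm M Y f" "m = cls M Y f" using morE[OF M Y m] by blast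
   have l: "lin K M Y (\<lambda>x. f (e x))" by (rule lin_comp[OF e(1) ghom_lin[OF f(1)]])
   have "f x = \<zero>\<^sub>Y \<oplus>\<^sub>Y Tr M Y (\<lambda>x. f (e x)) x" if "x \<in>. M" for x
    using Tr_left[OF kM kM kY e(1) f(1) that] e(2)[OF that] ghom_in[OF f(1) that] by simp
   hence "steq M Y f (\<lambda>x. \<zero>\<^sub>Y)" using l by (auto simp: steq_def)
   thus ?thesis using cls_eq_iff[OF M Y f(1) ghom_zero[OF kY]] f(2) by simp
  qed
  thus "\<exists>!f. f \<in> Mor St M Y" using cls_mor[OF M Y ghom_zero[OF kY]] by blast
  have "m = cls Y M (\<lambda>x. \<zero>\<^sub>M)" if m: "m \<in> Mor St Y M" for m
  proof -
   obtain f where f: "ghm Y M f" "m = cls Y M f" using morE[OF Y M m] by blast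
   have l: "lin K Y M (\<lambda>x. e (f x))" by (rule lin_comp[OF ghom_lin[OF f(1)] e(1)])
   have "f x = \<zero>\<^sub>M \<oplus>\<^sub>M Tr Y M (\<lambda>x. e (f x)) x" if "x \<in>. Y" for x
    using Tr_right[OF kM kM kY e(1) f(1) that] e(2) ghom_in[OF f(1) that] by simp
   hence "steq Y M f (\<lambda>x. \<zero>\<^sub>M)" using l by (auto simp: steq_def)
   thus ?thesis using cls_eq_iff[OF Y M f(1) ghom_zero[OF kM]] f(2) by simp
  qed
  thus "\<exists>!f. f \<in> Mor St Y M" using cls_mor[OF Y M ghom_zero[OF kM]] by blast
 qed (use M in simp)
qed

definition dsum ::
 "('g, 'k, 'u) gmod => 'i set => ('i => ('g, 'k, 'u) gmod) => ('i => 'u => 'u) => ('i => 'u => 'u) => bool" where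
 "dsum M I A inc prj \<longleftrightarrow> lsum K M I A inc prj \<and> M \<in> Md \<and>
   (\<forall>i\<in>I. A i \<in> Md \<and> ghm (A i) M (inc i) \<and> ghm M (A i) (prj i))"

lemma dsumD:
 assumes "dsum M I A inc prj"
 shows "lsum K M I A inc prj" "M \<in> Md" "\<And>i. i \<in> I ==> A i \<in> Md"
  "\<And>i. i \<in> I ==> ghm (A i) M (inc i)" "\<And>i. i \<in> I ==> ghm M (A i) (prj i)"
 using assms by (auto simp: dsum_def)

lemma dsum_gather:
 assumes D: "dsum M I A inc prj" and N: "kmod N" and h: "\<And>i. i \<in> I ==> ghm (A i) N (h i)"
 shows "ghm M N (lsum.gather I A prj N h)"
proof -
 interpret lsum K M I A inc prj by (rule dsumD(1)[OF D])
 note d = dsumD[OF D]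
 have hl: "\<And>i. i \<in> I ==> lin K (A i) N (h i)" using h ghom_lin by blast
 have g: "lin K M N (gather N h)" by (rule lin_gather[OF kmod_mod[OF N]]) (rule hl)
 have gi: "gather N h (inc i y) = h i y" if "i \<in> I" "y \<in>. (A i)" for i y
  by (rule gather_inc[OF kmod_mod[OF N] _ that]) (rule hl)
 show ?thesis
 proof (rule ghomI[OF g])
  fix k x assume k: "k \<in>. G" and x: "x \<in>. M"
  show "gather N h (act M k x) = act N k (gather N h x)"
  proof (rule lin_ext[OF lin_comp[OF act_lin[OF Md_kmod[OF d(2)] k] g] lin_comp[OF g act_lin[OF N k]]
    kmod_mod[OF N] _ x])
   fix i y assume i: "i \<in> I" and y: "y \<in>. (A i)"
   have "gather N h (act M k (inc i y)) = gather N h (inc i (act (A i) k y))"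
    using ghom_act[OF d(4)[OF i] k y] by simp
   also have "... = act N k (gather N h (inc i y))"
    using gi[OF i y] gi[OF i act_in[OF Md_kmod[OF d(3)[OF i]] k y]] ghom_act[OF h[OF i] k y] by simp
   finally show "gather N h (act M k (inc i y)) = act N k (gather N h (inc i y))" .
  qed
 qed
qed

text \<open>Uniqueness is the point: a map that is stably prescribed on each summand comes with
  linear witnesses \<open>e i\<close>, and these glue to one linear map on M even when I is
  infinite.\<close>

lemma dsum_coproduct:
 assumes D: "dsum M I A inc prj"
 shows "is_coproduct St I A M (\<lambda>i. cls (A i) M (inc i))" unfolding is_coproduct_def
proof (intro conjI ballI allI impI)
 interpret lsum K M I A inc prj by (rule dsumD(1)[OF D])
 note d = dsumD[OF D]
 show "M \<in> Ob St" using d(2) by simp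
 show "A i \<in> Ob St" if "i \<in> I" for i using d(3)[OF that] by simp
 show "cls (A i) M (inc i) \<in> Mor St (A i) M" if "i \<in> I" for i using d that by (intro cls_mor)
 fix Y \<phi> assume "Y \<in> Ob St" and \<phi>: "\<forall>i\<in>I. \<phi> i \<in> Mor St (A i) Y"
 hence Y: "Y \<in> Md" by simp
 note kY = Md_kmod[OF Y] and kM = Md_kmod[OF d(2)]
 interpret Y: module K Y by (rule Md_mod[OF Y])
 have "\<forall>i\<in>I. \<exists>h. ghm (A i) Y h \<and> \<phi> i = cls (A i) Y h"
 proof
  fix i assume i: "i \<in> I"
  from \<phi> i have "\<phi> i \<in> Mor St (A i) Y" by blast
  thus "\<exists>h. ghm (A i) Y h \<and> \<phi> i = cls (A i) Y h" by (rule morE[OF d(3)[OF i] Y]) blast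
 qed
 then obtain h where h: "\<And>i. i \<in> I ==> ghm (A i) Y (h i)" "\<And>i. i \<in> I ==> \<phi> i = cls (A i) Y (h i)"
  using bchoice[of I "\<lambda>i h. ghm (A i) Y h \<and> \<phi> i = cls (A i) Y h"] by blast
 have hl: "\<And>i. i \<in> I ==> lin K (A i) Y (h i)" using h ghom_lin by blast
 have g: "ghm M Y (gather Y h)" by (rule dsum_gather[OF D kY]) (rule h(1))
 have gi: "gather Y h (inc i y) = h i y" if "i \<in> I" "y \<in>. (A i)" for i y
  by (rule gather_inc[OF Y.modl _ that]) (rule hl)
 show "\<exists>!f. f \<in> Mor St M Y \<and> (\<forall>i\<in>I. f \<bullet>\<^sub>St cls (A i) M (inc i) = \<phi> i)"
 proof (rule ex1I[of _ "cls M Y (gather Y h)"], intro conjI ballI)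
  show "cls M Y (gather Y h) \<in> Mor St M Y" by (rule cls_mor[OF d(2) Y g])
  fix i assume i: "i \<in> I"
  show "cls M Y (gather Y h) \<bullet>\<^sub>St cls (A i) M (inc i) = \<phi> i"
   unfolding h(2)[OF i] cmp_cls[OF d(3)[OF i] d(2) Y d(4)[OF i] g]
   by (rule cls_cong[OF d(3)[OF i] Y h(1)[OF i]]) (simp add: gi[OF i])
 next
  fix f assume f: "f \<in> Mor St M Y \<and> (\<forall>i\<in>I. f \<bullet>\<^sub>St cls (A i) M (inc i) = \<phi> i)"
  then obtain a where a: "ghm M Y a" "f = cls M Y a" using morE[OF d(2) Y] by blast
  have "\<forall>i\<in>I. \<exists>e. lin K (A i) Y e \<and> (\<forall>x\<in>carrier (A i). a (inc i x) = h i x \<oplus>\<^sub>Y Tr (A i) Y e x)"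
  proof
   fix i assume i: "i \<in> I"
   have "cls (A i) Y (\<lambda>x. a (inc i x)) = cls (A i) Y (h i)"
    using f i h(2)[OF i] cmp_cls[OF d(3)[OF i] d(2) Y d(4)[OF i] a(1)] a(2) by metis
   thus "\<exists>e. lin K (A i) Y e \<and> (\<forall>x\<in>carrier (A i). a (inc i x) = h i x \<oplus>\<^sub>Y Tr (A i) Y e x)"
    using cls_eq_iff[OF d(3)[OF i] Y ghom_comp[OF d(4)[OF i] a(1)] h(1)[OF i]] by (simp add: steq_def)
  qed
  then obtain e where e: "\<And>i. i \<in> I ==> lin K (A i) Y (e i)"
   "\<And>i x. i \<in> I ==> x \<in>. (A i) ==> a (inc i x) = h i x \<oplus>\<^sub>Y Tr (A i) Y (e i) x"
   using bchoice[of I "\<lambda>i e. lin K (A i) Y e \<and> (\<forall>x\<in>carrier (A i). a (inc i x) = h i x \<oplus>\<^sub>Y Tr (A i) Y e x)"]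
   by blast
  have E: "lin K M Y (gather Y e)" by (rule lin_gather[OF Y.modl]) (rule e(1))
  have ei: "gather Y e (inc i y) = e i y" if "i \<in> I" "y \<in>. (A i)" for i y
   by (rule gather_inc[OF Y.modl _ that]) (rule e(1))
  have "a x = gather Y h x \<oplus>\<^sub>Y Tr M Y (gather Y e) x" if x: "x \<in>. M" for x
  proof (rule lin_ext[OF ghom_lin[OF a(1)] lin_plus[OF ghom_lin[OF g] lin_Tr[OF kM kY E] Y.modl] Y.modl _ x])
   fix i x assume i: "i \<in> I" and x: "x \<in>. (A i)"
   have "Tr M Y (gather Y e) (inc i x) = Tr (A i) Y (\<lambda>x. gather Y e (inc i x)) x"
    by (rule Tr_right[OF kM kY Md_kmod[OF d(3)[OF i]] E d(4)[OF i] x])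
   also have "... = Tr (A i) Y (e i) x"
    by (rule Tr_cong[OF Md_kmod[OF d(3)[OF i]] kY e(1)[OF i] _ x]) (simp add: ei[OF i])
   finally show "a (inc i x) = gather Y h (inc i x) \<oplus>\<^sub>Y Tr M Y (gather Y e) (inc i x)"
    using e(2)[OF i x] gi[OF i x] by simp
  qed
  hence "steq M Y a (gather Y h)" using E by (auto simp: steq_def)
  thus "f = cls M Y (gather Y h)" using cls_eq_iff[OF d(2) Y a(1) g] a(2) by simp
 qed
qed

lemma lsum_transport:
 assumes D: "lsum K M I A inc prj" and N: "module K N" and f: "lin K M N f" "lin K N M f'"
  "\<And>x. x \<in>. M ==> f' (f x) = x" "\<And>y. y \<in>. N ==> f (f' y) = y"
 shows "lsum K N I A (\<lambda>i x. f (inc i x)) (\<lambda>i y. prj i (f' y))"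
proof -
 interpret D: lsum K M I A inc prj by (rule D)
 interpret N: module K N by (rule N)
 show ?thesis
 proof (rule lsum.intro[OF N lsum_axioms.intro])
  fix H y assume H: "N.subsp H" and inc: "\<And>i x. i \<in> I ==> x \<in>. (A i) ==> f (inc i x) \<in> H" and y: "y \<in>. N"
  have "f' y \<in> {x \<in> carrier M. f x \<in> H}"
   by (rule D.generated[OF D.M.subsp_vimage[OF f(1) N H] _ lin_in[OF f(2) y]])
    (simp add: inc lin_in[OF D.lin_inc])
  thus "y \<in> H" using f(4)[OF y] by simp
 qed (use D.summand_module D.prj_inc D.prj_inc_zero f(3) lin_in[OF D.lin_inc] lin_comp[OF D.lin_inc f(1)]
   lin_comp[OF f(2) D.lin_prj] in auto)
qed

text \<open>Finite support keeps the direct sum of a small family small, so it can be moved into the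
  universe.\<close>

lemma ex_dsum:
 fixes I :: "'i set"
 assumes I: "small TYPE('u) I" and A: "\<And>i. i \<in> I ==> A i \<in> Md"
 obtains M inc prj where "dsum M I A inc prj"
proof -
 let ?C = "fsum_carrier I A"
 let ?r = "\<lambda>g x. \<lambda>i\<in>I. act (A i) g (x i)"
 let ?M = "fmod I A ?C ?r"
 let ?inc = "\<lambda>i x. \<lambda>j\<in>I. if j = i then x else \<zero>\<^bsub>A j\<^esub>"
 have kA: "\<And>i. i \<in> I ==> kmod (A i)" using A Md_kmod by blast
 interpret D: lsum K ?M I A ?inc "\<lambda>i x. x i" by (rule lsum_fmod[OF K.is_cring]) (rule Md_mod[OF A])
 have Cc: "x i \<in>. (A i)" if "x \<in> ?C" "i \<in> I" for x i using that by (auto simp: fsum_carrier_def)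
 have act0: "act (A i) g \<zero>\<^bsub>A i\<^esub> = \<zero>\<^bsub>A i\<^esub>" if "i \<in> I" "g \<in>. G" for i g
  by (rule lin_zero[OF act_lin[OF kA[OF that(1)] that(2)] Md_mod[OF A[OF that(1)]] Md_mod[OF A[OF that(1)]]])
 have rC: "?r g x \<in> ?C" if g: "g \<in>. G" and x: "x \<in> ?C" for g x
 proof -
  have "{i \<in> I. ?r g x i \<noteq> \<zero>\<^bsub>A i\<^esub>} \<subseteq> {i \<in> I. x i \<noteq> \<zero>\<^bsub>A i\<^esub>}" using act0 g by auto
  moreover have "finite {i \<in> I. x i \<noteq> \<zero>\<^bsub>A i\<^esub>}" using x by (simp add: fsum_carrier_def)
  ultimately have "finite {i \<in> I. ?r g x i \<noteq> \<zero>\<^bsub>A i\<^esub>}" by (rule finite_subset)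
  thus ?thesis using act_in[OF kA g Cc[OF x]] by (auto simp: fsum_carrier_def)
 qed
 have kM: "kmod ?M"
 proof (rule kG_moduleI[OF D.M.modl])
  show "lin K ?M ?M (act ?M g)" if g: "g \<in>. G" for g using g rC[OF g] by (intro linI)
    (auto simp: lin_add[OF act_lin[OF kA]] lin_smult[OF act_lin[OF kA]] Cc intro!: restrict_ext)
  show "act ?M \<one>\<^sub>G x = x" if "x \<in>. ?M" for x
  proof (rule extensionalityI[of _ I])
   show "x \<in> extensional I" using that by (auto simp: fsum_carrier_def PiE_def)
   fix i assume i: "i \<in> I"
   have "x i \<in>. (A i)" using that i by (intro Cc) simp_all
   thus "act ?M \<one>\<^sub>G x i = x i" using act_one[OF kA[OF i]] i by simp
  qed simp
  show "act ?M (g \<otimes>\<^sub>G h) x = act ?M g (act ?M h x)" if "g \<in>. G" "h \<in>. G" "x \<in>. ?M" for g h x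
   using that by (auto simp: act_mult[OF kA] Cc intro!: restrict_ext)
 qed
 have "small TYPE('u) (carrier ?M)" unfolding fmod_simps fsum_carrier_def
  by (rule small_finsupp[OF univ I]) (rule Md_small[OF A])
 then obtain N :: "('g, 'k, 'u) gmod" and f f' where N: "N \<in> Md" "giso G K ?M N f f'"
  by (rule transport[OF kM]) (rule that)
 have f: "ghm ?M N f" "ghm N ?M f'" "\<And>x. x \<in>. ?M ==> f' (f x) = x"
  "\<And>y. y \<in>. N ==> f (f' y) = y" using N(2) unfolding giso_def by blast+
 have inc: "ghm (A i) ?M (?inc i)" if i: "i \<in> I" for i
  by (rule ghomI[OF D.lin_inc[OF i]]) (use act0 in \<open>auto intro!: restrict_ext\<close>)
 have prj: "ghm ?M (A i) (\<lambda>x. x i)" if i: "i \<in> I" for i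
  by (rule ghomI[OF D.lin_prj[OF i]]) (use i in simp)
 have "dsum N I A (\<lambda>i x. f (?inc i x)) (\<lambda>i y. f' y i)" unfolding dsum_def
 proof (intro conjI ballI)
  show "lsum K N I A (\<lambda>i x. f (?inc i x)) (\<lambda>i y. f' y i)"
   by (rule lsum_transport[OF D.lsum_axioms Md_mod[OF N(1)] ghom_lin[OF f(1)] ghom_lin[OF f(2)]])
    (use f(3,4) in auto)
 qed (use N(1) A ghom_comp[OF inc f(1)] ghom_comp[OF f(2) prj] in auto)
 thus thesis by (rule that)
qed

lemma cls_finsum:
 assumes M: "M \<in> Md" and N: "N \<in> Md" and f: "\<And>i. i \<in> F ==> ghm M N (f i)"
 shows "ghm M N (\<lambda>x. finsum N (\<lambda>i. f i x) F)"
  "finprod (hom_group St M N) (\<lambda>i. cls M N (f i)) F = cls M N (\<lambda>x. finsum N (\<lambda>i. f i x) F)"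
proof -
 interpret H: comm_group "hom_group St M N" by (rule S.comm_group_hom) (use M N in simp_all)
 interpret M: module K M by (rule Md_mod[OF M])
 interpret N: module K N by (rule Md_mod[OF N])
 have "ghm M N (\<lambda>x. finsum N (\<lambda>i. f i x) F) \<and>
  finprod (hom_group St M N) (\<lambda>i. cls M N (f i)) F = cls M N (\<lambda>x. finsum N (\<lambda>i. f i x) F)"
  using f
 proof (induction F rule: infinite_finite_induct)
  case (insert j F)
  note g = ghom_plus[OF Md_kmod[OF N] insert.prems[of j], of "\<lambda>x. finsum N (\<lambda>i. f i x) F"]
  have IH: "ghm M N (\<lambda>x. finsum N (\<lambda>i. f i x) F)"
   "finprod (hom_group St M N) (\<lambda>i. cls M N (f i)) F = cls M N (\<lambda>x. finsum N (\<lambda>i. f i x) F)"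
   using insert.IH insert.prems by auto
  have fj: "ghm M N (f j)" using insert.prems by simp
  note g = ghom_plus[OF Md_kmod[OF N] fj IH(1)]
  have e: "finsum N (\<lambda>i. f i x) (insert j F) = f j x \<oplus>\<^sub>N finsum N (\<lambda>i. f i x) F" if "x \<in>. M" for x
   using insert(1,2) ghom_in[OF insert.prems that] by (intro N.finsum_insert) auto
  have "ghm M N (\<lambda>x. finsum N (\<lambda>i. f i x) (insert j F))"
   using g unfolding ghom_def lin_def by (simp add: e act_in[OF Md_kmod[OF M]] Pi_def)
  moreover have "finprod (hom_group St M N) (\<lambda>i. cls M N (f i)) (insert j F) =
    addm St (cls M N (f j)) (cls M N (\<lambda>x. finsum N (\<lambda>i. f i x) F))"
   using insert(1,2) cls_mor[OF M N] insert.prems by (subst H.finprod_insert) (auto simp: hom_group_simps IH(2))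
  moreover have "... = cls M N (\<lambda>x. finsum N (\<lambda>i. f i x) (insert j F))"
   unfolding addm_cls[OF M N fj IH(1)] by (rule cls_cong[OF M N g, symmetric]) (simp add: e)
  ultimately show ?case by simp
 qed (simp_all add: ghom_zero[OF Md_kmod[OF N]] hom_group_simps zerom_cls)
 thus "ghm M N (\<lambda>x. finsum N (\<lambda>i. f i x) F)"
  "finprod (hom_group St M N) (\<lambda>i. cls M N (f i)) F = cls M N (\<lambda>x. finsum N (\<lambda>i. f i x) F)" by auto
qed

text \<open>An arbitrary coproduct is compared with the concrete direct sum. Of the two inverse
  identities only the one that returns to X is recorded.\<close>

lemma coproduct_comparison:
 assumes D: "dsum D I A inc prj" and X: "is_coproduct St I A X \<iota>"
 obtains \<theta> \<psi> where "\<theta> \<in> Mor St X D" "\<psi> \<in> Mor St D X" "\<And>i. i \<in> I ==> \<theta> \<bullet>\<^sub>St \<iota> i = cls (A i) D (inc i)"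
  "\<And>i. i \<in> I ==> \<psi> \<bullet>\<^sub>St cls (A i) D (inc i) = \<iota> i" "\<psi> \<bullet>\<^sub>St \<theta> = idm St X"
proof -
 note d = dsumD[OF D] and DC = dsum_coproduct[OF D]
 have XO: "X \<in> Ob St" and DO: "D \<in> Ob St" using X DC by (auto simp: is_coproduct_def)
 have \<iota>: "\<forall>i\<in>I. \<iota> i \<in> Mor St (A i) X" and AO: "\<And>i. i \<in> I ==> A i \<in> Ob St" using X by (auto simp: is_coproduct_def)
 have inc: "\<forall>i\<in>I. cls (A i) D (inc i) \<in> Mor St (A i) D" using DC by (auto simp: is_coproduct_def)
 have uX: "\<And>Y \<phi>. Y \<in> Ob St ==> \<forall>i\<in>I. \<phi> i \<in> Mor St (A i) Y ==>
   \<exists>!f. f \<in> Mor St X Y \<and> (\<forall>i\<in>I. f \<bullet>\<^sub>St \<iota> i = \<phi> i)" using X unfolding is_coproduct_def by blast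
 have uD: "\<And>Y \<phi>. Y \<in> Ob St ==> \<forall>i\<in>I. \<phi> i \<in> Mor St (A i) Y ==>
   \<exists>!f. f \<in> Mor St D Y \<and> (\<forall>i\<in>I. f \<bullet>\<^sub>St cls (A i) D (inc i) = \<phi> i)" using DC unfolding is_coproduct_def by blast
 obtain \<theta> where \<theta>: "\<theta> \<in> Mor St X D" "\<forall>i\<in>I. \<theta> \<bullet>\<^sub>St \<iota> i = cls (A i) D (inc i)" using uX[OF DO inc] by blast
 obtain \<psi> where \<psi>: "\<psi> \<in> Mor St D X" "\<forall>i\<in>I. \<psi> \<bullet>\<^sub>St cls (A i) D (inc i) = \<iota> i" using uD[OF XO \<iota>] by blast
 have "\<forall>i\<in>I. (\<psi> \<bullet>\<^sub>St \<theta>) \<bullet>\<^sub>St \<iota> i = \<iota> i"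
  using S.cmp_assoc[OF AO XO DO XO _ \<theta>(1) \<psi>(1)] \<iota> \<theta>(2) \<psi>(2) by metis
 moreover have "\<forall>i\<in>I. idm St X \<bullet>\<^sub>St \<iota> i = \<iota> i" using S.idm_left[OF AO XO] \<iota> by blast
 ultimately have "\<psi> \<bullet>\<^sub>St \<theta> = idm St X"
  using uX[OF XO \<iota>] S.cmp_closed[OF XO DO XO \<theta>(1) \<psi>(1)] S.idm_closed[OF XO] by blast
 thus thesis using that \<theta> \<psi> by blast
qed

text \<open>A homomorphism from a finitely generated module into a direct sum is a finite sum
  through the summands, since its values on the generators have finite support.\<close>

lemma compact_finite_dim:
 assumes c: "c \<in> Md" and Y: "finite Y" "Y \<subseteq> carrier c"
  and gen: "\<And>H. module.subsp K c H ==> Y \<subseteq> H ==> carrier c \<subseteq> H"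
 shows "compact_object TYPE('u) St c"
proof (rule S.compact_objectI)
 interpret c: module K c by (rule Md_mod[OF c])
 show "c \<in> Ob St" using c by simp
 fix I :: "'u set" and A X \<iota>
 assume I: "small TYPE('u) I" and X: "is_coproduct St I A X \<iota>"
 have XO: "X \<in> Ob St" and A: "\<And>i. i \<in> I ==> A i \<in> Md" and \<iota>: "\<And>i. i \<in> I ==> \<iota> i \<in> Mor St (A i) X"
  using X by (auto simp: is_coproduct_def)
 obtain D inc prj where D: "dsum D I A inc prj" by (rule ex_dsum[OF I, of A], erule A, erule that)
 note d = dsumD[OF D]
 interpret D: lsum K D I A inc prj by (rule d(1))
 have DO: "D \<in> Ob St" using d(2) by simp
 obtain \<theta> \<psi> where \<theta>: "\<theta> \<in> Mor St X D" "\<psi> \<in> Mor St D X" "\<And>i. i \<in> I ==> \<theta> \<bullet>\<^sub>St \<iota> i = cls (A i) D (inc i)"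
  "\<And>i. i \<in> I ==> \<psi> \<bullet>\<^sub>St cls (A i) D (inc i) = \<iota> i" "\<psi> \<bullet>\<^sub>St \<theta> = idm St X"
  by (rule coproduct_comparison[OF D X]) (rule that)
 have prj: "cls D (A j) (prj j) \<in> Mor St D (A j)" if "j \<in> I" for j by (rule cls_mor[OF d(2) A[OF that] d(5)[OF that]])
 show "\<exists>\<pi>. (\<forall>j\<in>I. \<pi> j \<in> Mor St X (A j) \<and> \<pi> j \<bullet>\<^sub>St \<iota> j = idm St (A j) \<and>
    (\<forall>i\<in>I. i \<noteq> j --> \<pi> j \<bullet>\<^sub>St \<iota> i = zerom St (A i) (A j)))"
 proof (rule exI[of _ "\<lambda>j. cls D (A j) (prj j) \<bullet>\<^sub>St \<theta>"], intro conjI ballI impI)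
  fix j assume j: "j \<in> I"
  have AO: "A j \<in> Ob St" using A[OF j] by simp
  show "cls D (A j) (prj j) \<bullet>\<^sub>St \<theta> \<in> Mor St X (A j)" by (rule S.cmp_closed[OF XO DO AO \<theta>(1) prj[OF j]])
  have e: "(cls D (A j) (prj j) \<bullet>\<^sub>St \<theta>) \<bullet>\<^sub>St \<iota> i = cls (A i) (A j) (\<lambda>x. prj j (inc i x))" if i: "i \<in> I" for i
  proof -
   have "(cls D (A j) (prj j) \<bullet>\<^sub>St \<theta>) \<bullet>\<^sub>St \<iota> i = cls D (A j) (prj j) \<bullet>\<^sub>St cls (A i) D (inc i)"
    using S.cmp_assoc[OF _ XO DO AO \<iota>[OF i] \<theta>(1) prj[OF j]] \<theta>(3)[OF i] A[OF i] by simp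
   thus ?thesis using cmp_cls[OF A[OF i] d(2) A[OF j] d(4)[OF i] d(5)[OF j]] by simp
  qed
  show "(cls D (A j) (prj j) \<bullet>\<^sub>St \<theta>) \<bullet>\<^sub>St \<iota> j = idm St (A j)"
   unfolding e[OF j] idm_cls[OF A[OF j]] by (rule cls_cong[OF A[OF j] A[OF j] ghom_id]) (simp add: D.prj_inc[OF j])
  fix i assume i: "i \<in> I" and ij: "i \<noteq> j"
  show "(cls D (A j) (prj j) \<bullet>\<^sub>St \<theta>) \<bullet>\<^sub>St \<iota> i = zerom St (A i) (A j)"
   unfolding e[OF i] zerom_cls
   by (rule cls_cong[OF A[OF i] A[OF j] ghom_zero[OF Md_kmod[OF A[OF j]]]]) (simp add: D.prj_inc_zero[OF i j ij])
 qed
 fix m assume m: "m \<in> Mor St c X"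
 have cO: "c \<in> Ob St" using c by simp
 obtain h where h: "ghm c D h" "\<theta> \<bullet>\<^sub>St m = cls c D h"
  by (rule morE[OF c d(2) S.cmp_closed[OF cO XO DO m \<theta>(1)]]) (rule that)
 define F where "F = (\<Union>y\<in>Y. D.supp (h y))"
 have F: "finite F" "F \<subseteq> I" using Y D.finite_supp ghom_in[OF h(1)] by (auto simp: F_def D.supp_def)
 let ?\<phi> = "\<lambda>i. cls c (A i) (\<lambda>x. prj i (h x))"
 have hp: "ghm c (A i) (\<lambda>x. prj i (h x))" if "i \<in> I" for i by (rule ghom_comp[OF h(1) d(5)[OF that]])
 have hip: "ghm c D (\<lambda>x. inc i (prj i (h x)))" if "i \<in> F" for i
  using that F(2) by (intro ghom_comp[OF hp d(4)]) auto
 have eqlin: "lin K c D (\<lambda>x. \<Oplus>\<^sub>D i\<in>F. inc i (prj i (h x)))"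
  by (rule lin_finsum_fun[OF ghom_lin[OF hip] c.modl D.M.modl])
 have "carrier c \<subseteq> {x \<in> carrier c. h x = (\<Oplus>\<^sub>D i\<in>F. inc i (prj i (h x)))}"
 proof (rule gen[OF c.subsp_equalizer[OF ghom_lin[OF h(1)] eqlin D.M.modl]], rule subsetI)
  fix y assume y: "y \<in> Y"
  have "h y = (\<Oplus>\<^sub>D i\<in>F. inc i (prj i (h y)))"
   using y Y(2) by (intro D.expand[OF ghom_in[OF h(1)] F]) (auto simp: F_def)
  thus "y \<in> {x \<in> carrier c. h x = (\<Oplus>\<^sub>D i\<in>F. inc i (prj i (h x)))}" using y Y(2) by auto
 qed
 hence eq: "h x = (\<Oplus>\<^sub>D i\<in>F. inc i (prj i (h x)))" if "x \<in>. c" for x using that by blast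
 have cO: "c \<in> Ob St" using c by simp
 interpret HX: comm_group "hom_group St c X" by (rule S.comm_group_hom[OF cO XO])
 have \<phi>m: "?\<phi> i \<in> Mor St c (A i)" if "i \<in> I" for i by (rule cls_mor[OF c A[OF that] hp[OF that]])
 have fs: "finprod (hom_group St c D) (\<lambda>i. cls c D (\<lambda>x. inc i (prj i (h x)))) F =
   cls c D (\<lambda>x. \<Oplus>\<^sub>D i\<in>F. inc i (prj i (h x)))" by (rule cls_finsum(2)[OF c d(2)]) (rule hip)
 have "m = \<psi> \<bullet>\<^sub>St cls c D h"
  using S.cmp_assoc[OF cO XO DO XO m \<theta>(1,2)] \<theta>(5) S.idm_left[OF cO XO m] h(2) by simp
 also have "cls c D h = finprod (hom_group St c D) (\<lambda>i. cls c D (\<lambda>x. inc i (prj i (h x)))) F"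
  unfolding fs by (rule cls_cong[OF c d(2) h(1), symmetric]) (rule eq)
 also have "\<psi> \<bullet>\<^sub>St ... = finprod (hom_group St c X) (\<lambda>i. \<psi> \<bullet>\<^sub>St cls c D (\<lambda>x. inc i (prj i (h x)))) F"
  using cls_mor[OF c d(2) hip] by (intro S.cmp_finprod[OF cO DO XO \<theta>(2)]) auto
 also have "... = finprod (hom_group St c X) (\<lambda>i. \<iota> i \<bullet>\<^sub>St ?\<phi> i) F"
 proof (rule HX.finprod_cong')
  fix i assume "i \<in> F"
  hence i: "i \<in> I" using F by blast
  have AO: "A i \<in> Ob St" using A[OF i] by simp
  have "\<psi> \<bullet>\<^sub>St cls c D (\<lambda>x. inc i (prj i (h x))) = \<psi> \<bullet>\<^sub>St cls (A i) D (inc i) \<bullet>\<^sub>St ?\<phi> i"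
   using cmp_cls[OF c A[OF i] d(2) hp[OF i] d(4)[OF i]] by simp
  also have "... = \<iota> i \<bullet>\<^sub>St ?\<phi> i"
   using S.cmp_assoc[OF cO AO DO XO \<phi>m[OF i] cls_mor[OF A[OF i] d(2) d(4)[OF i]] \<theta>(2)] \<theta>(4)[OF i] by simp
  finally show "\<psi> \<bullet>\<^sub>St cls c D (\<lambda>x. inc i (prj i (h x))) = \<iota> i \<bullet>\<^sub>St ?\<phi> i" .
 next
  show "(\<lambda>i. \<iota> i \<bullet>\<^sub>St ?\<phi> i) \<in> F \<rightarrow> carrier (hom_group St c X)"
   using F(2) A \<iota> \<phi>m by (auto simp: hom_group_simps intro!: S.cmp_closed[OF cO _ XO])
 qed simp
 finally show "\<exists>F \<phi>. finite F \<and> F \<subseteq> I \<and> (\<forall>i\<in>F. \<phi> i \<in> Mor St c (A i)) \<and>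
    m = finprod (hom_group St c X) (\<lambda>i. \<iota> i \<bullet>\<^sub>St \<phi> i) F"
  using F \<phi>m by (intro exI[of _ F] exI[of _ ?\<phi>]) auto
qed

end

section \<open>Cyclic decomposition for a nilpotent operator\<close>

lemma lin_funpow: "lin K M M t ==> lin K M M (t ^^ n)"
 by (induction n) (auto simp: lin_def Pi_def)

context module
begin

text \<open>The set \<open>B\<close> consists of generators of cyclic summands with bases \<open>b, t b, ..., t\<^bsup>len b - 1\<^esup> b\<close>;
 \<open>\<psi> b\<close> is the coordinate function of the last of these basis vectors.\<close>

definition cyclic_system where
 "cyclic_system t B len \<psi> \<longleftrightarrow> B \<subseteq> carrier M \<and>
   (\<forall>b\<in>B. 0 < len b \<and> (t ^^ len b) b = \<zero>\<^sub>M \<and> functional R M (\<psi> b) \<and>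
    (\<forall>b'\<in>B. \<forall>i. \<psi> b ((t ^^ i) b') = (if b' = b \<and> i = len b - 1 then \<one> else \<zero>))) \<and>
   (\<forall>H. subsp H \<and> (\<forall>x\<in>H. t x \<in> H) \<and> B \<subseteq> H --> carrier M \<subseteq> H)"

text \<open>The chains of full length n + 1 are split off. Their last vectors form V = t^n M, a
  linear section s of t^n picks their generators, and r becomes the projection onto the span of
  these chains. The complement H is stable under t and killed by t^n, so the induction hypothesis
  applies to it.\<close>

lemma cyclic_system_exists_aux:
 assumes F: "field R" and t: "lin R M M t" and nil: "\<And>x. x \<in>. M ==> (t ^^ Suc n) x = \<zero>\<^sub>M"
  and IH: "\<And>H. subsp H ==> (\<And>x. x \<in> H ==> t x \<in> H) ==> (\<And>x. x \<in> H ==> (t ^^ n) x = \<zero>\<^sub>M) ==>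
   \<exists>B len \<psi>. module.cyclic_system R (M\<lparr>carrier := H\<rparr>) t B len \<psi> \<and> (\<forall>b\<in>B. len b \<le> n)"
 shows "\<exists>B len \<psi>. cyclic_system t B len \<psi> \<and> (\<forall>b\<in>B. len b \<le> Suc n)"
proof -
 note tp = lin_funpow[OF t]
 note tpc = lin_in[OF tp]
 have tadd: "(t ^^ i) ((t ^^ j) x) = (t ^^ (i + j)) x" for i j x by (simp add: funpow_add)
 have tbig: "(t ^^ i) x = \<zero>\<^sub>M" if "x \<in>. M" "i > n" for x i
 proof -
  have "(t ^^ i) x = (t ^^ (i - Suc n)) ((t ^^ Suc n) x)" using that(2) unfolding tadd by simp
  thus ?thesis using nil[OF that(1)] lin_zero[OF tp module_axioms module_axioms] by simp
 qed
 define V where "V = (t ^^ n) ` carrier M"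
 have V: "subsp V" unfolding V_def by (rule subsp_range[OF tp module_axioms])
 have Vc: "\<And>v. v \<in> V ==> v \<in>. M" using sub_carrier[OF V] .
 define VM where "VM = M\<lparr>carrier := V\<rparr>"
 interpret V: module R VM unfolding VM_def by (rule sub_module[OF V])
 have VMs [simp]: "carrier VM = V" "\<And>x y. x \<oplus>\<^sub>VM y = x \<oplus>\<^sub>M y" "\<And>a x. a \<odot>\<^sub>VM x = a \<odot>\<^sub>M x" "\<zero>\<^sub>VM = \<zero>\<^sub>M"
  by (simp_all add: VM_def)
 have tV: "lin R M VM (t ^^ n)" unfolding VM_def by (rule lin_sub_cod[OF tp]) (simp add: V_def)
 have "(t ^^ n) ` carrier M = carrier VM" by (simp add: V_def)
 then obtain s where s: "lin R VM M s" "\<And>v. v \<in> V ==> (t ^^ n) (s v) = v"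
  using ex_section[OF F tV V.modl] VMs(1) by metis
 have sc: "\<And>v. v \<in> V ==> s v \<in>. M" using lin_in[OF s(1)] by simp
 have tV0: "(t ^^ i) v = \<zero>\<^sub>M" if "v \<in> V" "i > 0" for v i using that tbig by (auto simp: V_def tadd)
 \<comment> \<open>A projection e onto V that kills t^i s(V) for all i < n is built by correcting
   the exponents one at a time, downwards from n - 1; k counts the exponents already
   corrected.\<close>
 have "\<exists>e. lin R M M e \<and> (\<forall>x\<in>carrier M. e x \<in> V) \<and> (\<forall>v\<in>V. e v = v) \<and>
   (\<forall>v\<in>V. \<forall>i. n - k \<le> i \<and> i < n --> e ((t ^^ i) (s v)) = \<zero>\<^sub>M)" if "k \<le> n" for k
  using that
 proof (induction k)
  case 0
  obtain e where "lin R M M e" "\<And>x. x \<in>. M ==> e x \<in> V" "\<And>x. x \<in> V ==> e x = x"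
   by (rule ex_retraction[OF F V]) (rule that)
  thus ?case by auto
 next
  case (Suc k)
  then obtain e where e: "lin R M M e" "\<And>x. x \<in>. M ==> e x \<in> V" "\<And>v. v \<in> V ==> e v = v"
   "\<And>v i. v \<in> V ==> n - k \<le> i ==> i < n ==> e ((t ^^ i) (s v)) = \<zero>\<^sub>M" by auto
  define l where "l = n - Suc k"
  have l: "l < n" "n - k = Suc l" using Suc.prems by (auto simp: l_def)
  \<comment> \<open>The correction for the exponent l: on t^l s(v) it equals e, while on V and on
    t^i s(v) with i > l it vanishes, because t^(n-l) sends these vectors to zero.\<close>
  define u where "u x = e ((t ^^ l) (s (e ((t ^^ (n - l)) x))))" for x
  have eV: "lin R M VM e" unfolding VM_def by (rule lin_sub_cod[OF e(1,2)])
  have u: "lin R M M u" unfolding u_def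
   by (rule lin_comp[OF lin_comp[OF lin_comp[OF lin_comp[OF tp eV] s(1)] tp] e(1)])
  have u0: "u x = \<zero>\<^sub>M" if "x \<in>. M" "(t ^^ (n - l)) x = \<zero>\<^sub>M" for x
   using that lin_zero[OF e(1) module_axioms module_axioms] lin_zero[OF s(1) V.modl module_axioms]
    lin_zero[OF tp module_axioms module_axioms] by (simp add: u_def)
  have uV: "u x \<in> V" if "x \<in>. M" for x unfolding u_def using that e(2) tpc sc by simp
  let ?e = "\<lambda>x. e x \<ominus>\<^sub>M u x"
  show ?case
  proof (intro exI[of _ ?e] conjI ballI allI impI)
   show "lin R M M ?e" by (rule lin_diff[OF e(1) u module_axioms])
   show "?e x \<in> V" if "x \<in>. M" for x by (rule sub_minus[OF V e(2)[OF that] uV[OF that]])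
   show "?e v = v" if v: "v \<in> V" for v
    using u0[OF Vc[OF v] tV0[OF v]] l e(3)[OF v] Vc[OF v] by (simp add: M.minus_eq)
   fix v i assume v: "v \<in> V" and i: "n - Suc k \<le> i \<and> i < n"
   have c: "(t ^^ i) (s v) \<in>. M" using sc[OF v] tpc by simp
   show "?e ((t ^^ i) (s v)) = \<zero>\<^sub>M"
   proof (cases "i = l")
    case True
    have "(t ^^ (n - l)) ((t ^^ l) (s v)) = v" using l s(2)[OF v] by (simp add: tadd)
    hence "u ((t ^^ i) (s v)) = e ((t ^^ i) (s v))" using True e(3)[OF v] by (simp add: u_def)
    moreover have "e ((t ^^ i) (s v)) \<in>. M" using Vc[OF e(2)[OF c]] .
    ultimately show ?thesis by (simp add: M.minus_zero_iff)
   next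
    case False
    hence li: "l < i" using i l_def by auto
    hence "(t ^^ (n - l)) ((t ^^ i) (s v)) = \<zero>\<^sub>M" unfolding tadd using l(1) by (intro tbig[OF sc[OF v]]) simp
    hence "u ((t ^^ i) (s v)) = \<zero>\<^sub>M" by (rule u0[OF c])
    moreover have "e ((t ^^ i) (s v)) = \<zero>\<^sub>M" using e(4)[OF v, of i] li i l by simp
    ultimately show ?thesis by (simp add: M.minus_eq)
   qed
  qed
 qed
 from this[of n] obtain e where e: "lin R M M e" "\<And>x. x \<in>. M ==> e x \<in> V" "\<And>v. v \<in> V ==> e v = v"
   "\<And>v i. v \<in> V ==> i < n ==> e ((t ^^ i) (s v)) = \<zero>\<^sub>M" by auto
 have ec: "\<And>x. x \<in>. M ==> e x \<in>. M" using e(2) Vc by blast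
 have eV: "lin R M VM e" unfolding VM_def by (rule lin_sub_cod[OF e(1,2)])
 have e0: "e \<zero>\<^sub>M = \<zero>\<^sub>M" by (rule lin_zero[OF e(1) module_axioms module_axioms])
 have s0: "s \<zero>\<^sub>M = \<zero>\<^sub>M" using lin_zero[OF s(1) V.modl module_axioms] by simp
 have t0: "(t ^^ i) \<zero>\<^sub>M = \<zero>\<^sub>M" for i by (rule lin_zero[OF tp module_axioms module_axioms])
 have es: "e ((t ^^ i) (s v)) = (if i = n then v else \<zero>\<^sub>M)" if v: "v \<in> V" for v i
 proof (cases i n rule: linorder_cases)
  case less thus ?thesis using e(4)[OF v] by simp
 next
  case equal thus ?thesis using s(2)[OF v] e(3)[OF v] by simp
 next
  case greater thus ?thesis using tbig[OF sc[OF v]] e0 by simp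
 qed
 \<comment> \<open>The component of x at t^i s(V) is found by pushing x up by t^(n-i) and applying
   e, which reads only what sits at t^n.\<close>
 define r where "r x = (\<Oplus>\<^sub>M i\<in>{..n}. (t ^^ i) (s (e ((t ^^ (n - i)) x))))" for x
 have rl: "lin R M M (\<lambda>x. (t ^^ i) (s (e ((t ^^ (n - i)) x))))" for i
  by (rule lin_comp[OF lin_comp[OF lin_comp[OF tp eV] s(1)] tp])
 have r: "lin R M M r" unfolding r_def by (rule lin_finsum_fun[OF rl module_axioms module_axioms])
 have rc: "\<And>x. x \<in>. M ==> r x \<in>. M" using lin_in[OF r] .
 have rs: "r ((t ^^ j) (s v)) = (t ^^ j) (s v)" if v: "v \<in> V" for v j
 proof (cases "j \<le> n")
  case True
  have "r ((t ^^ j) (s v)) = (\<Oplus>\<^sub>M i\<in>{..n}. if j = i then (t ^^ i) (s v) else \<zero>\<^sub>M)"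
   unfolding r_def
  proof (rule M.finsum_cong')
   fix i assume "i \<in> {..n}"
   hence "n - i + j = n \<longleftrightarrow> j = i" by auto
   thus "(t ^^ i) (s (e ((t ^^ (n - i)) ((t ^^ j) (s v))))) = (if j = i then (t ^^ i) (s v) else \<zero>\<^sub>M)"
    using es[OF v, of "n - i + j"] s0 t0 by (simp add: tadd)
  qed (use sc[OF v] tpc in auto)
  also have "... = (t ^^ j) (s v)" using True sc[OF v] tpc by (subst M.add.finprod_singleton) auto
  finally show ?thesis .
 next
  case False
  hence "(t ^^ j) (s v) = \<zero>\<^sub>M" using tbig[OF sc[OF v]] by simp
  thus ?thesis using lin_zero[OF r module_axioms module_axioms] by simp
 qed
 \<comment> \<open>x and r x have the same image under every e t^j, so x - r x lies in the subspace
   H below.\<close>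
 have er: "e ((t ^^ j) (r x)) = e ((t ^^ j) x)" if x: "x \<in>. M" for x j
 proof -
  have vi: "e ((t ^^ (n - i)) x) \<in> V" for i using e(2) tpc x by simp
  have "e ((t ^^ j) (r x)) = (\<Oplus>\<^sub>M i\<in>{..n}. e ((t ^^ j) ((t ^^ i) (s (e ((t ^^ (n - i)) x))))))"
   unfolding r_def using lin_in[OF rl x]
   by (intro lin_finsum[OF lin_comp[OF tp e(1)] module_axioms module_axioms]) auto
  also have "... = (\<Oplus>\<^sub>M i\<in>{..n}. if j + i = n then e ((t ^^ (n - i)) x) else \<zero>\<^sub>M)"
   using Vc[OF vi] by (intro M.finsum_cong') (auto simp: tadd es[OF vi])
  also have "... = e ((t ^^ j) x)"
  proof (cases "j \<le> n")
   case True
   have "(\<Oplus>\<^sub>M i\<in>{..n}. if j + i = n then e ((t ^^ (n - i)) x) else \<zero>\<^sub>M) =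
    (\<Oplus>\<^sub>M i\<in>{..n}. if n - j = i then e ((t ^^ (n - i)) x) else \<zero>\<^sub>M)"
    using True Vc[OF vi] by (intro M.finsum_cong') auto
   also have "... = e ((t ^^ j) x)" using True Vc[OF vi] by (subst M.add.finprod_singleton) auto
   finally show ?thesis .
  next
   case False
   hence "(\<Oplus>\<^sub>M i\<in>{..n}. if j + i = n then e ((t ^^ (n - i)) x) else \<zero>\<^sub>M) = (\<Oplus>\<^sub>M i\<in>{..n}. \<zero>\<^sub>M)"
    by (intro M.finsum_cong') auto
   thus ?thesis using False tbig[OF x] e0 by simp
  qed
  finally show ?thesis .
 qed
 \<comment> \<open>The vectors with no component along the full chains. The condition on all i makes
   H stable under t; and t^n vanishes on H because t^n x lies in V, where e is the identity.\<close>
 define H where "H = {x \<in> carrier M. \<forall>i. e ((t ^^ i) x) = \<zero>\<^sub>M}"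
 have H: "subsp H"
 proof -
  have "H = (\<Inter>i. {x \<in> carrier M. e ((t ^^ i) x) = \<zero>\<^sub>M})" by (auto simp: H_def)
  moreover have "subsp {x \<in> carrier M. e ((t ^^ i) x) = \<zero>\<^sub>M}" for i
   by (rule subsp_kernel[OF lin_comp[OF tp e(1)] module_axioms])
  ultimately show ?thesis using subsp_Inter[of "range (\<lambda>i. {x \<in> carrier M. e ((t ^^ i) x) = \<zero>\<^sub>M})"] by auto
 qed
 have Hc: "\<And>x. x \<in> H ==> x \<in>. M" by (simp add: H_def)
 have Ht: "t x \<in> H" if "x \<in> H" for x
 proof -
  have "e ((t ^^ i) (t x)) = \<zero>\<^sub>M" for i
  proof -
   have "(t ^^ i) (t x) = (t ^^ Suc i) x" by (simp only: funpow_Suc_right comp_apply)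
   thus ?thesis using that by (simp only: H_def mem_Collect_eq)
  qed
  thus ?thesis using that lin_in[OF t] by (simp add: H_def)
 qed
 have Htp: "(t ^^ i) x \<in> H" if "x \<in> H" for x i using that by (induction i) (auto simp: Ht)
 have Hn: "(t ^^ n) x = \<zero>\<^sub>M" if "x \<in> H" for x
 proof -
  have "(t ^^ n) x \<in> V" using Hc[OF that] by (simp add: V_def)
  hence "(t ^^ n) x = e ((t ^^ n) x)" by (rule e(3)[symmetric])
  thus ?thesis using that by (simp add: H_def)
 qed
 have rH: "r x = \<zero>\<^sub>M" if "x \<in> H" for x
  unfolding r_def using that s0 t0 by (intro M.add.finprod_one_eqI) (simp add: H_def)
 have xrH: "x \<ominus>\<^sub>M r x \<in> H" if x: "x \<in>. M" for x using x rc[OF x] tpc ec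
  by (simp add: H_def lin_minus[OF tp module_axioms module_axioms] lin_minus[OF e(1) module_axioms module_axioms] er M.minus_zero_iff)
 define HM where "HM = M\<lparr>carrier := H\<rparr>"
 interpret H: module R HM unfolding HM_def by (rule sub_module[OF H])
 have HMs [simp]: "carrier HM = H" "\<And>x y. x \<oplus>\<^sub>HM y = x \<oplus>\<^sub>M y" "\<And>a x. a \<odot>\<^sub>HM x = a \<odot>\<^sub>M x" "\<zero>\<^sub>HM = \<zero>\<^sub>M"
  by (simp_all add: HM_def)
 obtain B' len' \<psi>' where sys: "H.cyclic_system t B' len' \<psi>'" and len': "\<And>b. b \<in> B' ==> len' b \<le> n"
  using IH[OF H Ht Hn] unfolding HM_def by blast
 have B': "B' \<subseteq> H" "\<And>b. b \<in> B' ==> 0 < len' b" "\<And>b. b \<in> B' ==> (t ^^ len' b) b = \<zero>\<^sub>M"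
  "\<And>b. b \<in> B' ==> functional R HM (\<psi>' b)"
  "\<And>b b' i. b \<in> B' ==> b' \<in> B' ==> \<psi>' b ((t ^^ i) b') = (if b' = b \<and> i = len' b - 1 then \<one> else \<zero>)"
  "\<And>L. H.subsp L ==> (\<And>x. x \<in> L ==> t x \<in> L) ==> B' \<subseteq> L ==> H \<subseteq> L"
  using sys by (auto simp: H.cyclic_system_def)
 obtain B0 \<chi> where B0: "B0 \<subseteq> carrier VM" "V.spn B0 = carrier VM" "\<And>b. b \<in> B0 ==> functional R VM (\<chi> b)"
  "\<And>b b'. b \<in> B0 ==> b' \<in> B0 ==> \<chi> b b' = (if b = b' then \<one> else \<zero>)"
  by (rule V.ex_basis[OF F]) (rule that)
 have B0V: "\<And>b. b \<in> B0 ==> b \<in> V" using B0(1) by auto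
 have ts: "(t ^^ n) (s b) = b" if "b \<in> B0" for b using s(2)[OF B0V[OF that]] .
 interpret F: field R by (rule F)
 have disj: "s b \<notin> B'" if b: "b \<in> B0" for b
 proof
  assume "s b \<in> B'"
  hence "s b \<in> H" using B'(1) by blast
  hence "b = \<zero>\<^sub>M" using Hn[of "s b"] ts[OF b] by simp
  hence "\<chi> b b = \<zero>" using lin_zero[OF B0(3)[OF b] V.modl module_Kmod[OF R.is_cring]] by simp
  thus False using B0(4)[OF b b] by simp
 qed
 define B where "B = s ` B0 \<union> B'"
 define len where "len b = (if b \<in> B' then len' b else Suc n)" for b
 \<comment> \<open>For an old generator the full chains are removed first. For a new one b = s b0
   the last coordinate is the b0-coordinate of e x, and b0 is recovered as t^n b.\<close>
 define \<psi> where "\<psi> b x = (if b \<in> B' then \<psi>' b (x \<ominus>\<^sub>M r x) else \<chi> ((t ^^ n) b) (e x))" for b x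
 have \<chi>0: "\<chi> b \<zero>\<^sub>M = \<zero>" if "b \<in> B0" for b
  using lin_zero[OF B0(3)[OF that] V.modl module_Kmod[OF R.is_cring]] by simp
 have \<psi>0: "\<psi>' b \<zero>\<^sub>M = \<zero>" if "b \<in> B'" for b
  using lin_zero[OF B'(4)[OF that] H.modl module_Kmod[OF R.is_cring]] by simp
 have "cyclic_system t B len \<psi>" unfolding cyclic_system_def
 proof (intro conjI ballI allI impI)
  show "B \<subseteq> carrier M" using B0V sc B'(1) Hc by (auto simp: B_def)
  fix b assume b: "b \<in> B"
  show "0 < len b" using B'(2) by (simp add: len_def)
  show "(t ^^ len b) b = \<zero>\<^sub>M"
   using b B'(3) nil[OF sc[OF B0V]] by (auto simp: B_def len_def simp del: funpow.simps)
  show "functional R M (\<psi> b)"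
  proof (cases "b \<in> B'")
   case True
   have "lin R M HM (\<lambda>x. x \<ominus>\<^sub>M r x)" unfolding HM_def
    by (rule lin_sub_cod[OF lin_diff[OF lin_id r module_axioms] xrH])
   from lin_comp[OF this B'(4)[OF True]] show ?thesis using True by (simp add: \<psi>_def[abs_def])
  next
   case False
   then obtain b0 where b0: "b0 \<in> B0" "b = s b0" using b by (auto simp: B_def)
   show ?thesis using lin_comp[OF eV B0(3)[OF b0(1)]] False b0 ts by (simp add: \<psi>_def[abs_def])
  qed
  fix b' i assume b': "b' \<in> B"
  show "\<psi> b ((t ^^ i) b') = (if b' = b \<and> i = len b - 1 then \<one> else \<zero>)"
  proof (cases "b \<in> B'")
   case True
   show ?thesis
   proof (cases "b' \<in> B'")
    case b'B: True
    hence "(t ^^ i) b' \<in> H" using B'(1) Htp by blast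
    hence "(t ^^ i) b' \<ominus>\<^sub>M r ((t ^^ i) b') = (t ^^ i) b'" using rH Hc by (simp add: M.minus_eq)
    thus ?thesis using True b'B B'(5)[OF True b'B] by (simp add: \<psi>_def len_def)
   next
    case False
    then obtain b0 where b0: "b0 \<in> B0" "b' = s b0" using b' by (auto simp: B_def)
    have "(t ^^ i) b' \<ominus>\<^sub>M r ((t ^^ i) b') = \<zero>\<^sub>M"
     using rs[OF B0V[OF b0(1)], of i] b0(2) tpc[OF sc[OF B0V[OF b0(1)]]] by (simp add: M.minus_zero_iff)
    thus ?thesis using True False \<psi>0 by (auto simp: \<psi>_def)
   qed
  next
   case False
   then obtain b0 where b0: "b0 \<in> B0" "b = s b0" using b by (auto simp: B_def)
   show ?thesis
   proof (cases "b' \<in> B'")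
    case b'B: True
    hence "e ((t ^^ i) b') = \<zero>\<^sub>M" using B'(1) by (auto simp: H_def)
    thus ?thesis using False b'B b0 ts \<chi>0 by (auto simp: \<psi>_def)
   next
    case b'B: False
    then obtain b1 where b1: "b1 \<in> B0" "b' = s b1" using b' by (auto simp: B_def)
    have "b' = b \<longleftrightarrow> b0 = b1" using b0 b1 ts by metis
    moreover have "e ((t ^^ i) b') = (if i = n then b1 else \<zero>\<^sub>M)" using es[OF B0V[OF b1(1)]] b1(2) by simp
    ultimately show ?thesis
     using False b0 ts[OF b0(1)] \<chi>0[OF b0(1)] B0(4)[OF b0(1) b1(1)] by (auto simp: \<psi>_def len_def)
   qed
  qed
 next
  fix L assume L: "subsp L \<and> (\<forall>x\<in>L. t x \<in> L) \<and> B \<subseteq> L"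
  hence Ls: "subsp L" and Lt: "\<And>x. x \<in> L ==> t x \<in> L" and LB: "\<And>b. b \<in> B0 ==> s b \<in> L" "B' \<subseteq> L"
   by (auto simp: B_def)
  have Ltp: "(t ^^ i) x \<in> L" if "x \<in> L" for x i using that by (induction i) (auto simp: Lt)
  have "V.spn B0 \<subseteq> {v \<in> carrier VM. s v \<in> L}"
   by (rule V.spn_minimal[OF V.subsp_vimage[OF s(1) module_axioms Ls]]) (use B0V LB in auto)
  hence sL: "s v \<in> L" if "v \<in> V" for v using that B0(2) by auto
  have rL: "r x \<in> L" if "x \<in>. M" for x
   unfolding r_def by (rule sub_finsum[OF Ls]) (use that e(2) tpc sL Ltp in auto)
  have "H.subsp (H \<inter> L)"
   using sub_zero[OF H] sub_zero[OF Ls] sub_add[OF H] sub_add[OF Ls] sub_smult[OF H] sub_smult[OF Ls]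
   by (intro H.subspI) auto
  hence "H \<subseteq> H \<inter> L" by (rule B'(6)) (use Ht Lt B'(1) LB in auto)
  hence HL: "H \<subseteq> L" by blast
  show "carrier M \<subseteq> L"
  proof
   fix x assume x: "x \<in>. M"
   have "(x \<ominus>\<^sub>M r x) \<oplus>\<^sub>M r x \<in> L" using sub_add[OF Ls] xrH[OF x] HL rL[OF x] by blast
   thus "x \<in> L" using M.minus_add_cancel[OF x rc[OF x]] by simp
  qed
 qed
 moreover have "\<forall>b\<in>B. len b \<le> Suc n" using len' by (auto simp: len_def le_SucI)
 ultimately show ?thesis by blast
qed

end

text \<open>The induction runs over the exponent of nilpotency and not over a dimension, so it
  reaches infinite-dimensional modules.\<close>

theorem cyclic_system_exists:
 assumes "field K" "module K M" "lin K M M t" "\<And>x. x \<in>. M ==> (t ^^ n) x = \<zero>\<^sub>M"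
 shows "\<exists>B len \<psi>. module.cyclic_system K M t B len \<psi> \<and> (\<forall>b\<in>B. len b \<le> n)"
 using assms(2-)
proof (induction n arbitrary: M)
 case 0
 interpret M: module K M by (rule 0(1))
 have "carrier M \<subseteq> H" if "M.subsp H" for H using 0(3) M.sub_zero[OF that] by auto
 thus ?case by (auto simp: M.cyclic_system_def intro!: exI[of _ "{}"])
next
 case (Suc n)
 interpret M: module K M by (rule Suc(2))
 show ?case
 proof (rule M.cyclic_system_exists_aux[OF assms(1) Suc.prems(2,3)])
  fix H assume H: "M.subsp H" "\<And>x. x \<in> H ==> t x \<in> H" "\<And>x. x \<in> H ==> (t ^^ n) x = \<zero>\<^sub>M"
  have "lin K (M\<lparr>carrier := H\<rparr>) (M\<lparr>carrier := H\<rparr>) t"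
   using H(1,2) M.sub_carrier[OF H(1)] lin_add[OF Suc.prems(2)] lin_smult[OF Suc.prems(2)] by (intro linI) auto
  thus "\<exists>B len \<psi>. module.cyclic_system K (M\<lparr>carrier := H\<rparr>) t B len \<psi> \<and> (\<forall>b\<in>B. len b \<le> n)"
   using H(3) by (intro Suc.IH[OF M.sub_module[OF H(1)]]) auto
 qed
qed

section \<open>Cyclic groups of prime order\<close>

context field
begin

text \<open>The image of n under the semiring map from the naturals to the field.\<close>

primrec kn :: "nat => 'a" where
 "kn 0 = \<zero>"
| "kn (Suc n) = kn n \<oplus> \<one>"

lemma kn_closed [simp]: "kn n \<in>. R"
 by (induction n) auto

lemma kn_add: "kn (m + n) = kn m \<oplus> kn n"
 by (induction m) (auto simp: a_ac)

lemma kn_mult: "kn (m * n) = kn m \<otimes> kn n"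
 by (induction m) (auto simp: kn_add l_distr a_ac)

lemma kn_eq_zero_iff: "kn n = \<zero> \<longleftrightarrow> ring_char R dvd n"
proof -
 have "kn n = \<one> [^]\<^bsub>add_monoid R\<^esub> n" by (induction n) auto
 moreover have "group (add_monoid R)" by (rule a_group)
 ultimately show ?thesis using group.pow_eq_id[of "add_monoid R" \<one> n] by (simp add: ring_char_def)
qed

lemma kn_sum: "finite A ==> kn (sum f A) = (\<Oplus>i\<in>A. kn (f i))"
 by (induction A rule: finite_induct) (auto simp: kn_add)

lemma kn_power: "kn (m ^ n) = kn m [^] n"
 by (induction n) (auto simp: kn_mult m_comm)

end

context module
begin

text \<open>The binomial theorem for the commuting operators t and 1, by Pascal's rule.\<close>

lemma lin_act_shift:
 assumes t: "lin R M M t" and x: "x \<in>. M" and F: "field R"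
 shows "((\<lambda>y. t y \<oplus>\<^sub>M y) ^^ n) x = (\<Oplus>\<^sub>M i\<in>{..n}. field.kn R (n choose i) \<odot>\<^sub>M (t ^^ i) x)"
proof -
 interpret F: field R by fact
 note tc = lin_in[OF lin_funpow[OF t] x]
 show ?thesis
 proof (induction n)
  case 0 thus ?case using x by simp
 next
  case (Suc n)
  let ?A = "\<lambda>n. \<Oplus>\<^sub>M i\<in>{..n}. F.kn (n choose i) \<odot>\<^sub>M (t ^^ i) x"
  have "?A (Suc n) = (\<Oplus>\<^sub>M i\<in>{..n}. F.kn (Suc n choose Suc i) \<odot>\<^sub>M (t ^^ Suc i) x) \<oplus>\<^sub>M x"
   using tc x by (subst M.finsum_Suc2) (auto simp del: funpow.simps)
  also have "(\<Oplus>\<^sub>M i\<in>{..n}. F.kn (Suc n choose Suc i) \<odot>\<^sub>M (t ^^ Suc i) x) =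
    (\<Oplus>\<^sub>M i\<in>{..n}. F.kn (n choose i) \<odot>\<^sub>M (t ^^ Suc i) x \<oplus>\<^sub>M F.kn (n choose Suc i) \<odot>\<^sub>M (t ^^ Suc i) x)"
   using tc by (intro M.finsum_cong') (auto simp: F.kn_add smult_l_distr simp del: funpow.simps)
  also have "... = (\<Oplus>\<^sub>M i\<in>{..n}. F.kn (n choose i) \<odot>\<^sub>M (t ^^ Suc i) x) \<oplus>\<^sub>M
    (\<Oplus>\<^sub>M i\<in>{..n}. F.kn (n choose Suc i) \<odot>\<^sub>M (t ^^ Suc i) x)"
   using tc by (intro M.finsum_addf) (auto simp del: funpow.simps)
  also have "(\<Oplus>\<^sub>M i\<in>{..n}. F.kn (n choose i) \<odot>\<^sub>M (t ^^ Suc i) x) = t (?A n)"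
  proof -
   have "t (?A n) = (\<Oplus>\<^sub>M i\<in>{..n}. t (F.kn (n choose i) \<odot>\<^sub>M (t ^^ i) x))"
    using tc by (intro lin_finsum[OF t module_axioms module_axioms]) auto
   also have "... = (\<Oplus>\<^sub>M i\<in>{..n}. F.kn (n choose i) \<odot>\<^sub>M (t ^^ Suc i) x)"
    using tc lin_in[OF t] by (intro M.finsum_cong') (auto simp: lin_smult[OF t])
   finally show ?thesis ..
  qed
  also have "(t (?A n) \<oplus>\<^sub>M (\<Oplus>\<^sub>M i\<in>{..n}. F.kn (n choose Suc i) \<odot>\<^sub>M (t ^^ Suc i) x)) \<oplus>\<^sub>M x = t (?A n) \<oplus>\<^sub>M ?A n"
  proof -
   have "(\<Oplus>\<^sub>M i\<in>{..n}. F.kn (n choose Suc i) \<odot>\<^sub>M (t ^^ Suc i) x) \<oplus>\<^sub>M x =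
     (\<Oplus>\<^sub>M i\<in>{..Suc n}. F.kn (n choose i) \<odot>\<^sub>M (t ^^ i) x)"
    using tc x by (subst M.finsum_Suc2) (auto simp del: funpow.simps)
   also have "... = F.kn (n choose Suc n) \<odot>\<^sub>M (t ^^ Suc n) x \<oplus>\<^sub>M ?A n"
    using tc by (subst M.finsum_Suc) (auto simp del: funpow.simps)
   also have "... = ?A n" using tc[of "Suc n"] tc by (simp add: binomial_eq_0 del: funpow.simps)
   finally have e: "(\<Oplus>\<^sub>M i\<in>{..n}. F.kn (n choose Suc i) \<odot>\<^sub>M (t ^^ Suc i) x) \<oplus>\<^sub>M x = ?A n" .
   have c: "?A n \<in>. M" "(\<Oplus>\<^sub>M i\<in>{..n}. F.kn (n choose Suc i) \<odot>\<^sub>M (t ^^ Suc i) x) \<in>. M"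
    using tc by (auto simp del: funpow.simps)
   show ?thesis using M.a_assoc[OF lin_in[OF t c(1)] c(2) x] e by simp
  qed
  finally show ?case using Suc by simp
 qed
qed

end

locale cyc = stab G K u\<^sub>0
 for G :: "('g, 'w) monoid_scheme" and K :: "('k, 'x) ring_scheme" and u\<^sub>0 :: 'u +
 fixes p :: nat and g\<^sub>0 :: 'g
 assumes prime: "prime p" and ord_G: "order G = p" and char_K: "ring_char K = p"
  and g0: "g\<^sub>0 \<in>. G" and gen: "carrier G = range (\<lambda>n::int. g\<^sub>0 [^]\<^sub>G n)"
begin

lemma p_pos: "p > 0" and p_gt_1: "p > 1"
 using prime prime_gt_0_nat prime_gt_1_nat by auto

lemma g0_pow_p: "g\<^sub>0 [^]\<^sub>G p = \<one>\<^sub>G"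
 using G.pow_order_eq_1[OF g0] ord_G by simp

lemma g0_pow_mod: "g\<^sub>0 [^]\<^sub>G (n mod p) = g\<^sub>0 [^]\<^sub>G n"
proof -
 have "g\<^sub>0 [^]\<^sub>G n = g\<^sub>0 [^]\<^sub>G (p * (n div p)) \<otimes>\<^sub>G g\<^sub>0 [^]\<^sub>G (n mod p)"
  using g0 by (simp add: G.nat_pow_mult)
 also have "g\<^sub>0 [^]\<^sub>G (p * (n div p)) = \<one>\<^sub>G"
  using g0 by (simp add: g0_pow_p flip: G.nat_pow_pow)
 finally show ?thesis using g0 by simp
qed

lemma carrier_pow: "carrier G = (\<lambda>i. g\<^sub>0 [^]\<^sub>G i) ` {..<p}"
proof (intro equalityI subsetI)
 fix g assume "g \<in>. G"
 then obtain n :: int where n: "g = g\<^sub>0 [^]\<^sub>G n" using gen by blast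
 have "g\<^sub>0 [^]\<^sub>G n = g\<^sub>0 [^]\<^sub>G nat (n mod int p)"
 proof -
  have "g\<^sub>0 [^]\<^sub>G n = g\<^sub>0 [^]\<^sub>G (int p * (n div int p)) \<otimes>\<^sub>G g\<^sub>0 [^]\<^sub>G (n mod int p)"
   using g0 by (simp flip: G.int_pow_mult)
  also have "g\<^sub>0 [^]\<^sub>G (int p * (n div int p)) = \<one>\<^sub>G"
   using g0 g0_pow_p G.int_pow_pow[OF g0, of "int p" "n div int p"] by (simp add: int_pow_int)
  also have "g\<^sub>0 [^]\<^sub>G (n mod int p) = g\<^sub>0 [^]\<^sub>G nat (n mod int p)"
   using p_pos by (simp flip: int_pow_int)
  finally show ?thesis using g0 by simp
 qed
 moreover have "nat (n mod int p) < p" using p_pos by (simp add: nat_less_iff)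
 ultimately show "g \<in> (\<lambda>i. g\<^sub>0 [^]\<^sub>G i) ` {..<p}" using n by blast
qed (use g0 in auto)

lemma inj_pow: "inj_on (\<lambda>i. g\<^sub>0 [^]\<^sub>G i) {..<p}"
proof (rule eq_card_imp_inj_on)
 have "card (carrier G) = p" using ord_G by (simp add: order_def)
 thus "card ((\<lambda>i. g\<^sub>0 [^]\<^sub>G i) ` {..<p}) = card {..<p}" using carrier_pow by simp
qed simp

lemma finsum_G:
 assumes "abelian_monoid N" "\<And>g. g \<in>. G ==> f g \<in>. N"
 shows "(\<Oplus>\<^sub>N g\<in>carrier G. f g) = (\<Oplus>\<^sub>N i\<in>{..<p}. f (g\<^sub>0 [^]\<^sub>G i))"
proof -
 interpret N: abelian_monoid N by fact
 show ?thesis by (subst carrier_pow, rule N.finsum_reindex[OF _ inj_pow]) (use assms(2) g0 in auto)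
qed

lemma kn_zero_iff: "K.kn n = \<zero>\<^sub>K \<longleftrightarrow> p dvd n"
 using K.kn_eq_zero_iff char_K by simp

text \<open>The operator g0 - 1, whose group ring element generates the augmentation ideal.\<close>

definition tt :: "('g, 'k, 'a) gmod => 'a => 'a" where
 "tt M x = act M g\<^sub>0 x \<ominus>\<^sub>M x"

lemma lin_tt: "kmod M ==> lin K M M (tt M)"
 unfolding tt_def by (rule lin_diff[OF act_lin lin_id kmod_mod]) (use g0 in auto)

lemma act_g0: "kmod M ==> x \<in>. M ==> act M g\<^sub>0 x = tt M x \<oplus>\<^sub>M x"
proof -
 assume M: "kmod M" and x: "x \<in>. M"
 interpret M: module K M using M by (rule kmod_mod)
 show ?thesis using M.minus_add_cancel[OF act_in[OF M g0 x] x] by (simp add: tt_def)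
qed

lemma act_pow: "kmod M ==> x \<in>. M ==> act M (g\<^sub>0 [^]\<^sub>G n) x = (act M g\<^sub>0 ^^ n) x"
proof (induction n arbitrary: x)
 case (Suc n)
 have "act M (g\<^sub>0 [^]\<^sub>G Suc n) x = act M (g\<^sub>0 [^]\<^sub>G n) (act M g\<^sub>0 x)"
  using Suc.prems g0 by (simp add: act_mult)
 thus ?case using Suc.IH[OF Suc.prems(1) act_in[OF Suc.prems(1) g0 Suc.prems(2)]]
  by (simp add: funpow_Suc_right del: funpow.simps)
qed (simp add: act_one)

text \<open>In (1 + t)^p all binomial coefficients strictly between the ends vanish in the field, so
  1 = g0^p = 1 + t^p.\<close>

lemma tt_nilpotent:
 assumes M: "kmod M" and x: "x \<in>. M" shows "(tt M ^^ p) x = \<zero>\<^sub>M"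
proof -
 interpret M: module K M using M by (rule kmod_mod)
 note tc = lin_in[OF lin_funpow[OF lin_tt[OF M]] x]
 have eq: "((\<lambda>y. tt M y \<oplus>\<^sub>M y) ^^ n) x = (act M g\<^sub>0 ^^ n) x" for n
 proof (induction n)
  case (Suc n)
  have "(act M g\<^sub>0 ^^ n) x \<in>. M" by (rule lin_in[OF lin_funpow[OF act_lin[OF M g0]] x])
  thus ?case using Suc act_g0[OF M] by simp
 qed simp
 let ?f = "\<lambda>i. K.kn (p choose i) \<odot>\<^sub>M (tt M ^^ i) x"
 have fc: "?f i \<in>. M" for i using tc by simp
 have "x = (act M g\<^sub>0 ^^ p) x" using act_pow[OF M x, of p] act_one[OF M x] by (simp add: g0_pow_p)
 also have "... = (\<Oplus>\<^sub>M i\<in>{..p}. ?f i)"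
  using M.lin_act_shift[OF lin_tt[OF M] x K.field_axioms, of p] eq[of p] by simp
 also have "... = (\<Oplus>\<^sub>M i\<in>{0, p}. ?f i)"
 proof (rule M.add.finprod_mono_neutral_cong_right)
  show "?f i = \<zero>\<^sub>M" if "i \<in> {..p} - {0, p}" for i
  proof -
   have "p dvd (p choose i)" using that prime by (intro dvd_choose_prime) auto
   hence "K.kn (p choose i) = \<zero>\<^sub>K" by (simp add: kn_zero_iff)
   thus ?thesis using tc by simp
  qed
 qed (use fc in auto)
 also have "... = x \<oplus>\<^sub>M (tt M ^^ p) x" using p_pos x tc[of p] by (subst M.finsum_insert) auto
 finally have "x \<oplus>\<^sub>M (tt M ^^ p) x = x" by (rule sym)
 hence "(x \<oplus>\<^sub>M (tt M ^^ p) x) \<ominus>\<^sub>M x = \<zero>\<^sub>M" using x by (simp add: M.minus_zero_iff)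
 thus ?thesis using M.add_minus_cancel_left[OF x tc[of p]] by simp
qed

lemma ghom_g0I:
 assumes M: "kmod M" and N: "kmod N" and f: "lin K M N f"
  and g: "\<And>x. x \<in>. M ==> f (act M g\<^sub>0 x) = act N g\<^sub>0 (f x)"
 shows "ghm M N f"
proof (rule ghomI[OF f])
 fix k x assume k: "k \<in>. G" and x: "x \<in>. M"
 obtain i where i: "k = g\<^sub>0 [^]\<^sub>G (i::nat)" using k unfolding carrier_pow by blast
 have "f ((act M g\<^sub>0 ^^ i) x) = (act N g\<^sub>0 ^^ i) (f x)"
 proof (induction i)
  case (Suc i)
  have "(act M g\<^sub>0 ^^ i) x \<in>. M" by (rule lin_in[OF lin_funpow[OF act_lin[OF M g0]] x])
  thus ?case using Suc g by simp
 qed simp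
 thus "f (act M k x) = act N k (f x)" using i act_pow[OF M x] act_pow[OF N lin_in[OF f x]] by simp
qed

end

section \<open>Blocks: the cyclic summands and their projectivity\<close>

context galg
begin

definition dual_basis :: "('g, 'k, 'a) gmod => nat => (nat => 'a) => (nat => 'a => 'k) => bool" where
 "dual_basis A d u v \<longleftrightarrow> (\<forall>l<d. u l \<in>. A \<and> functional K A (v l)) \<and>
   (\<forall>x\<in>carrier A. x = (\<Oplus>\<^sub>A l\<in>{..<d}. v l x \<odot>\<^sub>A u l)) \<and>
   (\<forall>l<d. \<forall>m<d. v l (u m) = (if l = m then \<one>\<^sub>K else \<zero>\<^sub>K))"

definition cyclic_gen :: "('g, 'k, 'a) gmod => 'a => bool" where
 "cyclic_gen A m \<longleftrightarrow> m \<in>. A \<and> (\<forall>H. module.subsp K A H \<and> (\<forall>g\<in>carrier G. \<forall>x\<in>H. act A g x \<in> H) \<and> m \<in> H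
   --> carrier A \<subseteq> H)"

text \<open>The sum of \<open>v l (u l)\<close> is the trace of the identity, i.e. the dimension
  seen in the field. The alternative separates blocks that vanish stably from those that can be
  recovered from a tensor product by division.\<close>

definition block :: "('g, 'k, 'a) gmod => bool" where
 "block A \<longleftrightarrow> (\<exists>d u v. dual_basis A d u v \<and>
   (rel_proj A \<or> (\<Oplus>\<^sub>K l\<in>{..<d}. v l (u l)) \<noteq> \<zero>\<^sub>K))"

end

context cyc
begin

context
 fixes M :: "('g, 'k, 'u) gmod" and B len \<psi>
 assumes M: "M \<in> Md" and sys: "module.cyclic_system K M (tt M) B len \<psi>" and len_le: "\<And>b. b \<in> B ==> len b \<le> p"
begin

interpretation M: module K M by (rule Md_mod[OF M])

private abbreviation t where "t \<equiv> tt M"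

private lemma sysD:
 shows BM: "\<And>b. b \<in> B ==> b \<in>. M" and len_pos: "\<And>b. b \<in> B ==> 0 < len b"
  and t_len: "\<And>b. b \<in> B ==> (t ^^ len b) b = \<zero>\<^sub>M" and \<psi>: "\<And>b. b \<in> B ==> functional K M (\<psi> b)"
  and \<psi>_val: "\<And>b b' i. b \<in> B ==> b' \<in> B ==> \<psi> b ((t ^^ i) b') = (if b' = b \<and> i = len b - 1 then \<one>\<^sub>K else \<zero>\<^sub>K)"
  and sys_gen: "\<And>H x. M.subsp H ==> (\<And>x. x \<in> H ==> t x \<in> H) ==> B \<subseteq> H ==> x \<in>. M ==> x \<in> H"
 using sys unfolding M.cyclic_system_def by blast+

private lemma lt: "lin K M M (t ^^ i)" by (rule lin_funpow[OF lin_tt[OF Md_kmod[OF M]]])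

text \<open>The vectors all of whose iterates lie in H form a t-stable subspace; this trades
  t-stability of H for a check on all iterates of the generators.\<close>

private lemma sys_gen_basis:
 assumes H: "M.subsp H" and B: "\<And>b i. b \<in> B ==> (t ^^ i) b \<in> H" and x: "x \<in>. M"
 shows "x \<in> H"
proof -
 let ?H = "{x \<in> carrier M. \<forall>i. (t ^^ i) x \<in> H}"
 have "M.subsp ?H"
 proof -
  have "?H = (\<Inter>i. {x \<in> carrier M. (t ^^ i) x \<in> H})" by auto
  moreover have "M.subsp {x \<in> carrier M. (t ^^ i) x \<in> H}" for i by (rule M.subsp_vimage[OF lt M.modl H])
  ultimately show ?thesis using M.subsp_Inter[of "range (\<lambda>i. {x \<in> carrier M. (t ^^ i) x \<in> H})"] by auto
 qed
 moreover have "t x \<in> ?H" if "x \<in> ?H" for x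
 proof -
  have "(t ^^ i) (t x) = (t ^^ Suc i) x" for i by (simp only: funpow_Suc_right comp_apply)
  moreover have "t x \<in>. M" using that lin_in[OF lt, of x 1] by simp
  moreover have "\<forall>i. (t ^^ i) x \<in> H" using that by blast
  ultimately show ?thesis by (simp del: funpow.simps)
 qed
 ultimately have "x \<in> ?H" by (rule sys_gen) (use B BM x in auto)
 thus "x \<in> H" using spec[of "\<lambda>i. (t ^^ i) x \<in> H" 0] by simp
qed

private lemma sys_ext:
 assumes "lin K M N f" "lin K M N g" "module K N" "\<And>b i. b \<in> B ==> f ((t ^^ i) b) = g ((t ^^ i) b)" "x \<in>. M"
 shows "f x = g x"
 using sys_gen_basis[OF M.subsp_equalizer[OF assms(1-3)] _ assms(5)] assms(4) lin_in[OF lt BM] by auto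

text \<open>The projection onto the chain of b. Pushing x up by t^(len b - 1 - i) moves the
  component at t^i b to the end of the chain, where \<open>\<psi> b\<close> reads it.\<close>

private definition \<pi> where
 "\<pi> b x = (\<Oplus>\<^sub>M i\<in>{..<len b}. \<psi> b ((t ^^ (len b - 1 - i)) x) \<odot>\<^sub>M (t ^^ i) b)"

private lemma lin_coef: "b \<in> B ==> functional K M (\<lambda>x. \<psi> b ((t ^^ i) x))"
 by (rule lin_comp[OF lt \<psi>])

private lemma lin_\<pi>: "b \<in> B ==> lin K M M (\<pi> b)" unfolding \<pi>_def
 by (intro lin_finsum_fun M.modl lin_functional_smult[OF lin_coef] lin_in[OF lt BM])

private lemma \<pi>_basis:
 assumes b: "b \<in> B" and b': "b' \<in> B" shows "\<pi> b ((t ^^ j) b') = (if b' = b then (t ^^ j) b else \<zero>\<^sub>M)"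
proof -
 have c: "(t ^^ i) b \<in>. M" for i by (rule lin_in[OF lt BM[OF b]])
 have val: "\<psi> b ((t ^^ (len b - 1 - i)) ((t ^^ j) b')) = (if b' = b \<and> j = i then \<one>\<^sub>K else \<zero>\<^sub>K)" if "i < len b" for i
 proof -
  have "len b - 1 - i + j = len b - 1 \<longleftrightarrow> j = i" using that by auto
  thus ?thesis using \<psi>_val[OF b b', of "len b - 1 - i + j"] by (simp add: funpow_add)
 qed
 have "\<pi> b ((t ^^ j) b') = (\<Oplus>\<^sub>M i\<in>{..<len b}. if j = i then (if b' = b then (t ^^ i) b else \<zero>\<^sub>M) else \<zero>\<^sub>M)"
  unfolding \<pi>_def
 proof (rule M.finsum_cong')
  fix i assume "i \<in> {..<len b}"
  hence i: "i < len b" by simp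
  show "\<psi> b ((t ^^ (len b - 1 - i)) ((t ^^ j) b')) \<odot>\<^sub>M (t ^^ i) b =
   (if j = i then (if b' = b then (t ^^ i) b else \<zero>\<^sub>M) else \<zero>\<^sub>M)"
   unfolding val[OF i] using c by simp
 qed (use c in auto)
 also have "... = (if b' = b then (t ^^ j) b else \<zero>\<^sub>M)"
 proof (cases "j < len b")
  case True thus ?thesis using c by (subst M.add.finprod_singleton) auto
 next
  case False
  have "(t ^^ j) b = (t ^^ (j - len b)) ((t ^^ len b) b)" using False by (simp flip: funpow_add comp_apply[of "t ^^ _" "t ^^ _"])
  hence "(t ^^ j) b = \<zero>\<^sub>M" using t_len[OF b] lin_zero[OF lt M.modl M.modl] by simp
  moreover have "(\<Oplus>\<^sub>M i\<in>{..<len b}. if j = i then (if b' = b then (t ^^ i) b else \<zero>\<^sub>M) else \<zero>\<^sub>M) = \<zero>\<^sub>M"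
   using False by (intro M.add.finprod_one_eqI) auto
  ultimately show ?thesis by simp
 qed
 finally show ?thesis .
qed

private lemma \<pi>_\<pi>:
 assumes b: "b \<in> B" and b': "b' \<in> B" and x: "x \<in>. M"
 shows "\<pi> b (\<pi> b' x) = (if b' = b then \<pi> b x else \<zero>\<^sub>M)"
proof (cases "b' = b")
 case True
 have "\<pi> b (\<pi> b x) = \<pi> b x"
  by (rule sys_ext[OF lin_comp[OF lin_\<pi>[OF b] lin_\<pi>[OF b]] lin_\<pi>[OF b] M.modl _ x])
   (use lin_zero[OF lin_\<pi>[OF b] M.modl M.modl] in \<open>simp add: \<pi>_basis b\<close>)
 thus ?thesis using True by simp
next
 case False
 have "\<pi> b (\<pi> b' x) = \<zero>\<^sub>M"
  by (rule sys_ext[OF lin_comp[OF lin_\<pi>[OF b'] lin_\<pi>[OF b]] lin_const0[OF M.modl] M.modl _ x])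
   (use lin_zero[OF lin_\<pi>[OF b] M.modl M.modl] False in \<open>simp add: \<pi>_basis b b'\<close>)
 thus ?thesis using False by simp
qed

private lemma ghom_\<pi>: assumes b: "b \<in> B" shows "ghm M M (\<pi> b)"
proof (rule ghom_g0I[OF Md_kmod[OF M] Md_kmod[OF M] lin_\<pi>[OF b]])
 fix x assume x: "x \<in>. M"
 have t1: "lin K M M t" using lt[of 1] by simp
 have "\<pi> b (t x) = t (\<pi> b x)"
 proof (rule sys_ext[OF lin_comp[OF t1 lin_\<pi>[OF b]] lin_comp[OF lin_\<pi>[OF b] t1] M.modl _ x])
  fix b' i assume b': "b' \<in> B"
  show "\<pi> b (t ((t ^^ i) b')) = t (\<pi> b ((t ^^ i) b'))"
   using \<pi>_basis[OF b b', of "Suc i"] \<pi>_basis[OF b b', of i] lin_zero[OF t1 M.modl M.modl] by simp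
 qed
 thus "\<pi> b (act M g\<^sub>0 x) = act M g\<^sub>0 (\<pi> b x)" using x lin_in[OF t1 x] lin_in[OF lin_\<pi>[OF b] x]
  by (simp add: act_g0[OF Md_kmod[OF M]] lin_add[OF lin_\<pi>[OF b]])
qed

text \<open>The image of the idempotent, described by its fixed vectors so that membership is an
  equation.\<close>

private definition Blk where "Blk b = M\<lparr>carrier := {x \<in> carrier M. \<pi> b x = x}\<rparr>"

private lemma Blk_simps [simp]:
 "carrier (Blk b) = {x \<in> carrier M. \<pi> b x = x}" "x \<oplus>\<^bsub>Blk b\<^esub> y = x \<oplus>\<^sub>M y" "\<zero>\<^bsub>Blk b\<^esub> = \<zero>\<^sub>M"
 "a \<odot>\<^bsub>Blk b\<^esub> x = a \<odot>\<^sub>M x" "act (Blk b) g x = act M g x" by (simp_all add: Blk_def)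

private lemma Blk_sub: "b \<in> B ==> M.subsp {x \<in> carrier M. \<pi> b x = x}"
 by (rule M.subsp_equalizer[OF lin_\<pi> lin_id M.modl])

private lemma Blk_Md: "b \<in> B ==> Blk b \<in> Md" unfolding Blk_def
 by (rule Md_sub[OF M Blk_sub]) (auto simp: ghom_act[OF ghom_\<pi>] act_in[OF Md_kmod[OF M]])

private lemma lin_into_Blk: "b \<in> B ==> lin K M (Blk b) (\<pi> b)"
 unfolding Blk_def by (rule lin_sub_cod[OF lin_\<pi>]) (auto simp: \<pi>_\<pi> lin_in[OF lin_\<pi>])

private lemma dsum_Blk: "dsum M B Blk (\<lambda>b x. x) \<pi>" unfolding dsum_def
proof (intro conjI ballI M)
 show "lsum K M B Blk (\<lambda>b x. x) \<pi>"
 proof (rule lsum.intro[OF M.modl lsum_axioms.intro])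
  show "module K (Blk b)" if "b \<in> B" for b by (rule Md_mod[OF Blk_Md[OF that]])
  show "lin K (Blk b) M (\<lambda>x. x)" if "b \<in> B" for b unfolding Blk_def by (rule lin_sub_dom[OF lin_id]) auto
  show "lin K M (Blk b) (\<pi> b)" if "b \<in> B" for b by (rule lin_into_Blk[OF that])
  show "\<pi> b x = x" if "x \<in>. (Blk b)" for b x using that by simp
  show "\<pi> b' x = \<zero>\<^bsub>Blk b'\<^esub>" if "b \<in> B" "b' \<in> B" "b \<noteq> b'" "x \<in>. (Blk b)" for b b' x
  proof -
   have x: "x \<in>. M" "\<pi> b x = x" using that(4) by auto
   have "\<pi> b' (\<pi> b x) = \<zero>\<^sub>M" using \<pi>_\<pi>[OF that(2,1) x(1)] that(3) by simp
   thus ?thesis using x(2) by simp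
  qed
  fix H y assume H: "M.subsp H" and inc: "\<And>b x. b \<in> B ==> x \<in>. (Blk b) ==> x \<in> H" and y: "y \<in>. M"
  show "y \<in> H"
  proof (rule sys_gen_basis[OF H _ y])
   fix b i assume b: "b \<in> B"
   show "(t ^^ i) b \<in> H" by (rule inc[OF b]) (simp add: \<pi>_basis b lin_in[OF lt BM])
  qed
 qed
 fix b assume b: "b \<in> B"
 show "Blk b \<in> Md" by (rule Blk_Md[OF b])
 show "ghm (Blk b) M (\<lambda>x. x)" by (rule ghomI[OF linI]) auto
 show "ghm M (Blk b) (\<pi> b)" by (rule ghomI[OF lin_into_Blk[OF b]]) (simp add: ghom_act[OF ghom_\<pi>[OF b]])
qed

private lemma finsum_Blk:
 assumes b: "b \<in> B" and f: "\<And>i. i \<in> A ==> f i \<in>. (Blk b)"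
 shows "finsum (Blk b) f A = finsum M f A"
proof -
 have "lin K (Blk b) M (\<lambda>x. x)" unfolding Blk_def by (rule lin_sub_dom[OF lin_id]) auto
 from lin_finsum[OF this Md_mod[OF Blk_Md[OF b]] M.modl, of f A] f show ?thesis by auto
qed

private lemma b_Blk: "b \<in> B ==> (t ^^ i) b \<in>. (Blk b)" by (simp add: \<pi>_basis lin_in[OF lt BM])

private lemma Blk_dual_basis:
 assumes b: "b \<in> B"
 shows "dual_basis (Blk b) (len b) (\<lambda>i. (t ^^ i) b) (\<lambda>i x. \<psi> b ((t ^^ (len b - 1 - i)) x))"
 unfolding dual_basis_def
proof (intro conjI allI impI ballI)
 interpret A: module K "Blk b" by (rule Md_mod[OF Blk_Md[OF b]])
 fix i assume "i < len b"
 show "(t ^^ i) b \<in>. (Blk b)" by (rule b_Blk[OF b])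
 show "functional K (Blk b) (\<lambda>x. \<psi> b ((t ^^ (len b - 1 - i)) x))"
  unfolding Blk_def by (rule lin_sub_dom[OF lin_coef[OF b]]) auto
next
 interpret A: module K "Blk b" by (rule Md_mod[OF Blk_Md[OF b]])
 fix x assume x: "x \<in>. (Blk b)"
 have xM: "x \<in>. M" using x by simp
 have "(\<Oplus>\<^bsub>Blk b\<^esub>i\<in>{..<len b}. \<psi> b ((t ^^ (len b - 1 - i)) x) \<odot>\<^bsub>Blk b\<^esub> (t ^^ i) b) = \<pi> b x"
  unfolding \<pi>_def using lin_in[OF lin_coef[OF b] xM] b_Blk[OF b] A.smult_closed by (subst finsum_Blk[OF b]) auto
 thus "x = (\<Oplus>\<^bsub>Blk b\<^esub>i\<in>{..<len b}. \<psi> b ((t ^^ (len b - 1 - i)) x) \<odot>\<^bsub>Blk b\<^esub> (t ^^ i) b)" using x by simp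
next
 fix i m assume im: "i < len b" "m < len b"
 have "(t ^^ (len b - 1 - i)) ((t ^^ m) b) = (t ^^ (len b - 1 - i + m)) b" by (simp add: funpow_add)
 thus "\<psi> b ((t ^^ (len b - 1 - i)) ((t ^^ m) b)) = (if i = m then \<one>\<^sub>K else \<zero>\<^sub>K)"
  using im \<psi>_val[OF b b] by auto
qed

private lemma Blk_trace:
 assumes b: "b \<in> B"
 shows "(\<Oplus>\<^sub>K i\<in>{..<len b}. \<psi> b ((t ^^ (len b - 1 - i)) ((t ^^ i) b))) = K.kn (len b)"
proof -
 have "(\<Oplus>\<^sub>K i\<in>{..<len b}. \<psi> b ((t ^^ (len b - 1 - i)) ((t ^^ i) b))) = (\<Oplus>\<^sub>K i\<in>{..<len b}. K.kn 1)"
 proof (rule K.finsum_cong')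
  fix i assume "i \<in> {..<len b}"
  hence "len b - 1 - i + i = len b - 1" by auto
  hence "(t ^^ (len b - 1 - i)) ((t ^^ i) b) = (t ^^ (len b - 1)) b" by (metis comp_apply funpow_add)
  thus "\<psi> b ((t ^^ (len b - 1 - i)) ((t ^^ i) b)) = K.kn 1" using \<psi>_val[OF b b, of "len b - 1"] by simp
 qed auto
 also have "... = K.kn (\<Sum>i\<in>{..<len b}. 1)" by (rule K.kn_sum[symmetric]) simp
 finally show ?thesis by simp
qed

private lemma Blk_gen:
 assumes b: "b \<in> B" shows "cyclic_gen (Blk b) b" unfolding cyclic_gen_def
proof (intro conjI allI impI)
 interpret A: module K "Blk b" by (rule Md_mod[OF Blk_Md[OF b]])
 show "b \<in>. (Blk b)" using b_Blk[OF b, of 0] by simp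
 fix H assume H: "A.subsp H \<and> (\<forall>g\<in>carrier G. \<forall>x\<in>H. act (Blk b) g x \<in> H) \<and> b \<in> H"
 hence Hs: "A.subsp H" by simp
 have tH: "t x \<in> H" if x: "x \<in> H" for x
 proof -
  have xA: "x \<in>. (Blk b)" by (rule A.sub_carrier[OF Hs x])
  have "act M g\<^sub>0 x \<in> H" using H g0 x by auto
  moreover have "(\<ominus>\<^sub>K \<one>\<^sub>K) \<odot>\<^bsub>Blk b\<^esub> x \<in> H" using A.sub_smult[OF Hs _ x] by simp
  ultimately have "act M g\<^sub>0 x \<oplus>\<^bsub>Blk b\<^esub> (\<ominus>\<^sub>K \<one>\<^sub>K) \<odot>\<^bsub>Blk b\<^esub> x \<in> H" by (rule A.sub_add[OF Hs])
  thus ?thesis using xA by (simp add: tt_def a_minus_def M.neg_smult)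
 qed
 have tpH: "(t ^^ i) b \<in> H" for i using H by (induction i) (auto simp: tH)
 show "carrier (Blk b) \<subseteq> H"
 proof
  fix x assume x: "x \<in>. (Blk b)"
  have "(\<Oplus>\<^bsub>Blk b\<^esub>i\<in>{..<len b}. \<psi> b ((t ^^ (len b - 1 - i)) x) \<odot>\<^bsub>Blk b\<^esub> (t ^^ i) b) \<in> H"
   using x lin_in[OF lin_coef[OF b]] tpH A.sub_smult[OF Hs] by (intro A.sub_finsum[OF Hs]) auto
  thus "x \<in> H" using Blk_dual_basis[OF b] x by (simp add: dual_basis_def)
 qed
qed

text \<open>A block of full length p is free on b. The trace of the rank one map \<open>?h\<close>
  is equivariant and fixes the generator b, so it is the identity.\<close>

private lemma Blk_rel_proj:
 assumes b: "b \<in> B" and len: "len b = p" shows "rel_proj (Blk b)"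
proof -
 let ?A = "Blk b"
 interpret A: module K ?A by (rule Md_mod[OF Blk_Md[OF b]])
 note kA = Md_kmod[OF Blk_Md[OF b]] and kM = Md_kmod[OF M]
 have \<psi>A: "functional K ?A (\<psi> b)" unfolding Blk_def by (rule lin_sub_dom[OF \<psi>[OF b]]) auto
 have bA: "b \<in>. ?A" using b_Blk[OF b, of 0] by simp
 have ig: "invG g\<^sub>0 \<in>. G" using g0 by simp
 \<comment> \<open>The coordinate of (1 + t)^m t^i b at t^(p-1) b; under the bound on m + i only the
   top term t^(m+i) can reach it.\<close>
 have val: "\<psi> b ((act M g\<^sub>0 ^^ m) ((t ^^ i) b)) = (if m + i = p - 1 then \<one>\<^sub>K else \<zero>\<^sub>K)" if "m + i \<le> p - 1" for m i
  using that
 proof (induction m arbitrary: i)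
  case 0 thus ?case using \<psi>_val[OF b b, of i] len by simp
 next
  case (Suc m)
  have c: "(t ^^ j) b \<in>. M" for j by (rule lin_in[OF lt BM[OF b]])
  note la = lin_funpow[OF act_lin[OF kM g0], of m]
  have "(act M g\<^sub>0 ^^ Suc m) ((t ^^ i) b) = (act M g\<^sub>0 ^^ m) ((t ^^ Suc i) b \<oplus>\<^sub>M (t ^^ i) b)"
   using act_g0[OF kM c[of i]] by (simp add: funpow_Suc_right del: funpow.simps) (simp add: funpow_swap1)
  also have "... = (act M g\<^sub>0 ^^ m) ((t ^^ Suc i) b) \<oplus>\<^sub>M (act M g\<^sub>0 ^^ m) ((t ^^ i) b)"
   by (rule lin_add[OF la c c])
  finally have e: "(act M g\<^sub>0 ^^ Suc m) ((t ^^ i) b) =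
   (act M g\<^sub>0 ^^ m) ((t ^^ Suc i) b) \<oplus>\<^sub>M (act M g\<^sub>0 ^^ m) ((t ^^ i) b)" .
  have "\<psi> b ((act M g\<^sub>0 ^^ Suc m) ((t ^^ i) b)) =
    \<psi> b ((act M g\<^sub>0 ^^ m) ((t ^^ Suc i) b)) \<oplus>\<^sub>K \<psi> b ((act M g\<^sub>0 ^^ m) ((t ^^ i) b))"
   unfolding e using lin_add[OF \<psi>[OF b] lin_in[OF la c] lin_in[OF la c]] by (simp only: Kmod_simps)
  thus ?case using Suc.IH[of "Suc i"] Suc.IH[of i] Suc.prems by auto
 qed
 \<comment> \<open>For m < p the functional \<open>\<psi> b\<close> is nonzero on g0^m b only if m =
   p - 1, and g0^(p-1) = g0^-1. So in the trace only g = g0 contributes, with g0 (g0^-1 b) =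
   b.\<close>
 let ?h = "\<lambda>x. \<psi> b x \<odot>\<^bsub>?A\<^esub> act ?A (invG g\<^sub>0) b"
 have igb: "act ?A (invG g\<^sub>0) b \<in>. ?A" by (rule act_in[OF kA ig bA])
 have h: "lin K ?A ?A ?h" by (rule lin_functional_smult[OF \<psi>A igb A.modl])
 have hb: "?h (act ?A (invG g) b) = (if g\<^sub>0 = g then act ?A (invG g\<^sub>0) b else \<zero>\<^bsub>?A\<^esub>)" if g: "g \<in>. G" for g
 proof -
  obtain m where m: "invG g = g\<^sub>0 [^]\<^sub>G m" "m < p" using G.inv_closed[OF g] unfolding carrier_pow by auto
  have "g\<^sub>0 [^]\<^sub>G (p - 1) \<otimes>\<^sub>G g\<^sub>0 = g\<^sub>0 [^]\<^sub>G Suc (p - 1)" by simp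
  also have "... = \<one>\<^sub>G" using g0_pow_p p_pos by (simp del: G.nat_pow_Suc)
  finally have inv: "invG g\<^sub>0 = g\<^sub>0 [^]\<^sub>G (p - 1)" using g0 by (intro G.inv_equality) auto
  have "g\<^sub>0 = g \<longleftrightarrow> invG g = invG g\<^sub>0" using g g0 G.inv_inv by metis
  also have "... \<longleftrightarrow> m = p - 1" using m inv inj_onD[OF inj_pow, of m "p - 1"] p_pos by auto
  finally have e: "g\<^sub>0 = g \<longleftrightarrow> m = p - 1" .
  have "act ?A (invG g) b = (act M g\<^sub>0 ^^ m) b" using m(1) act_pow[OF kM BM[OF b]] by simp
  hence val': "\<psi> b (act ?A (invG g) b) = (if g\<^sub>0 = g then \<one>\<^sub>K else \<zero>\<^sub>K)" using val[of m 0] m(2) e by simp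
  show ?thesis
  proof (cases "g\<^sub>0 = g")
   case True
   show ?thesis unfolding val' if_P[OF True] by (rule A.smult_one[OF igb])
  next
   case False
   show ?thesis unfolding val' if_not_P[OF False] by (rule A.smult_l_null[OF igb])
  qed
 qed
 have "Tr ?A ?A ?h b = (\<Oplus>\<^bsub>?A\<^esub>g\<in>carrier G. if g\<^sub>0 = g then b else \<zero>\<^bsub>?A\<^esub>)" unfolding Tr_def
 proof (rule A.finsum_cong')
  fix g assume g: "g \<in>. G"
  have "act ?A g\<^sub>0 (act ?A (invG g\<^sub>0) b) = b" using act_mult[OF kA g0 ig bA] act_one[OF kA bA] g0 by simp
  moreover have "act ?A g \<zero>\<^bsub>?A\<^esub> = \<zero>\<^bsub>?A\<^esub>" by (rule lin_zero[OF act_lin[OF kA g] A.modl A.modl])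
  ultimately show "act ?A g (?h (act ?A (invG g) b)) = (if g\<^sub>0 = g then b else \<zero>\<^bsub>?A\<^esub>)"
   unfolding hb[OF g] by (cases "g\<^sub>0 = g") (simp_all only: if_True if_False simp_thms)
 qed (use bA A.zero_closed in auto)
 also have "... = b" using g0 bA by (subst A.add.finprod_singleton[OF g0 fin]) auto
 finally have Tb: "Tr ?A ?A ?h b = b" .
 let ?H = "{x \<in> carrier ?A. Tr ?A ?A ?h x = x}"
 note gT = ghom_Tr[OF kA kA h]
 have "A.subsp ?H" by (rule A.subsp_equalizer[OF ghom_lin[OF gT] lin_id A.modl])
 moreover have "\<forall>g\<in>carrier G. \<forall>x\<in>?H. act ?A g x \<in> ?H"
  using act_in[OF kA] ghom_act[OF gT] by (auto simp del: Blk_simps)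
 moreover have "b \<in> ?H" using bA Tb by blast
 ultimately have "carrier ?A \<subseteq> ?H" using Blk_gen[OF b] unfolding cyclic_gen_def by blast
 thus ?thesis unfolding rel_proj_def using h by blast
qed

lemma block_decomposition_aux:
 "\<exists>(I :: 'u set) A inc prj. small TYPE('u) I \<and> dsum M I A inc prj \<and> (\<forall>i\<in>I. block (A i))"
proof (intro exI conjI ballI)
 show "small TYPE('u) B" using BM by (intro small_subset[OF Md_small[OF M]]) auto
 show "dsum M B Blk (\<lambda>b x. x) \<pi>" by (rule dsum_Blk)
 fix b assume b: "b \<in> B"
 \<comment> \<open>Length p gives a projective block, and a positive length below p is nonzero in
   characteristic p.\<close>
 have "rel_proj (Blk b) \<or> K.kn (len b) \<noteq> \<zero>\<^sub>K"
 proof (cases "len b = p")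
  case True thus ?thesis using Blk_rel_proj[OF b] by simp
 next
  case False
  hence "len b < p" using len_le[OF b] by simp
  thus ?thesis using len_pos[OF b] by (auto simp: kn_zero_iff dest: dvd_imp_le)
 qed
 hence "rel_proj (Blk b) \<or> (\<Oplus>\<^sub>K i\<in>{..<len b}. \<psi> b ((t ^^ (len b - 1 - i)) ((t ^^ i) b))) \<noteq> \<zero>\<^sub>K"
  unfolding Blk_trace[OF b] .
 with Blk_dual_basis[OF b] show "block (Blk b)" unfolding block_def by (intro exI conjI)
qed

end

theorem block_decomposition:
 assumes M: "M \<in> Md"
 obtains I :: "'u set" and A inc prj where "small TYPE('u) I" "dsum M I A inc prj" "\<And>i. i \<in> I ==> block (A i)"
proof -
 obtain B len \<psi> where "module.cyclic_system K M (tt M) B len \<psi>" "\<And>b. b \<in> B ==> len b \<le> p"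
  using cyclic_system_exists[OF K.field_axioms Md_mod[OF M] lin_tt[OF Md_kmod[OF M]] tt_nilpotent[OF Md_kmod[OF M]]]
  by blast
 from block_decomposition_aux[OF M this] that show thesis by blast
qed

end

section \<open>Finite generation, quotients and factorizations\<close>

context galg
begin

definition fin_gen :: "('g, 'k, 'a) gmod => bool" where
 "fin_gen A \<longleftrightarrow> (\<exists>Y. finite Y \<and> Y \<subseteq> carrier A \<and> (\<forall>H. module.subsp K A H \<and> Y \<subseteq> H --> carrier A \<subseteq> H))"

lemma fin_gen_image:
 assumes A: "module K A" and B: "module K B" and f: "lin K A B f" "f ` carrier A = carrier B" and fg: "fin_gen A"
 shows "fin_gen B"
proof -
 interpret A: module K A by fact
 interpret B: module K B by fact
 obtain Y where Y: "finite Y" "Y \<subseteq> carrier A" "\<And>H. A.subsp H ==> Y \<subseteq> H ==> carrier A \<subseteq> H"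
  using fg by (auto simp: fin_gen_def)
 have "carrier B \<subseteq> H" if H: "B.subsp H" "f ` Y \<subseteq> H" for H
 proof -
  have "carrier A \<subseteq> {x \<in> carrier A. f x \<in> H}"
   by (rule Y(3)[OF A.subsp_vimage[OF f(1) B H(1)]]) (use Y(2) H(2) in auto)
  hence "f ` carrier A \<subseteq> H" by blast
  thus ?thesis using f(2) by simp
 qed
 thus ?thesis unfolding fin_gen_def using Y lin_in[OF f(1)] by (intro exI[of _ "f ` Y"]) auto
qed

text \<open>For finite G the coinduced module is, as a vector space, a finite direct sum of copies
  of A.\<close>

lemma fin_gen_funG:
 assumes A: "kmod A" and fg: "fin_gen A" shows "fin_gen (funG A)"
proof -
 interpret A: module K A using A by (rule kmod_mod)
 interpret F: module K "funG A" using kmod_funG[OF A] by (rule kmod_mod)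
 let ?inc = "\<lambda>i x. \<lambda>j\<in>carrier G. if j = i then x else \<zero>\<^sub>A"
 have C: "fsum_carrier (carrier G) (\<lambda>_. A) = (\<Pi>\<^sub>E g\<in>carrier G. carrier A)" using fin by (auto simp: fsum_carrier_def)
 have "lsum K (funG A) (carrier G) (\<lambda>_. A) ?inc (\<lambda>i x. x i)"
  using lsum_fmod[OF K.is_cring A.modl, where I = "carrier G"] unfolding funG_def C by blast
 then interpret L: lsum K "funG A" "carrier G" "\<lambda>_. A" ?inc "\<lambda>i x. x i" .
 obtain Y where Y: "finite Y" "Y \<subseteq> carrier A" "\<And>H. A.subsp H ==> Y \<subseteq> H ==> carrier A \<subseteq> H"
  using fg by (auto simp: fin_gen_def)
 let ?Y = "(\<lambda>(g, y). ?inc g y) ` (carrier G \<times> Y)"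
 have "carrier (funG A) \<subseteq> H" if H: "F.subsp H" "?Y \<subseteq> H" for H
 proof
  fix x assume x: "x \<in>. (funG A)"
  show "x \<in> H"
  proof (rule L.generated[OF H(1) _ x])
   fix g a assume g: "g \<in>. G" and a: "a \<in>. A"
   have "carrier A \<subseteq> {x \<in> carrier A. ?inc g x \<in> H}"
    by (rule Y(3)[OF A.subsp_vimage[OF L.lin_inc[OF g] F.modl H(1)]]) (use Y(2) H(2) g in auto)
   thus "?inc g a \<in> H" using a by auto
  qed
 qed
 moreover have "?Y \<subseteq> carrier (funG A)" using Y(2) lin_in[OF L.lin_inc] by auto
 ultimately show ?thesis unfolding fin_gen_def using Y(1) fin by (intro exI[of _ ?Y]) auto
qed

text \<open>A linear retraction exhibits the subspace as a linear image of A.\<close>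

lemma fin_gen_sub:
 assumes A: "kmod A" and H: "module.subsp K A H" and fg: "fin_gen A" shows "fin_gen (A\<lparr>carrier := H\<rparr>)"
proof -
 interpret A: module K A using A by (rule kmod_mod)
 obtain r where r: "lin K A A r" "\<And>x. x \<in>. A ==> r x \<in> H" "\<And>x. x \<in> H ==> r x = x"
  by (rule A.ex_retraction[OF K.field_axioms H]) (rule that)
 have "r ` carrier A = H"
 proof (intro equalityI subsetI)
  fix x assume "x \<in> H" thus "x \<in> r ` carrier A" using r(3) A.sub_carrier[OF H] by (intro image_eqI[of _ _ x]) auto
 qed (use r(2) in auto)
 thus ?thesis using fin_gen_image[OF A.modl A.sub_module[OF H] lin_sub_cod[OF r(1,2)] _ fg] by simp
qed

lemma dual_basis_fin_gen:
 assumes A: "kmod A" and d: "dual_basis A d u v" shows "fin_gen A"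
proof -
 interpret A: module K A using A by (rule kmod_mod)
 have "x \<in> H" if H: "A.subsp H" "u ` {..<d} \<subseteq> H" and x: "x \<in>. A" for H x
 proof -
  have "(\<Oplus>\<^sub>A l\<in>{..<d}. v l x \<odot>\<^sub>A u l) \<in> H"
  proof (rule A.sub_finsum[OF H(1)], rule Pi_I)
   fix l assume l: "l \<in> {..<d}"
   hence "functional K A (v l)" using d by (simp add: dual_basis_def)
   hence "v l x \<in>. K" using lin_in[OF _ x] by fastforce
   thus "v l x \<odot>\<^sub>A u l \<in> H" using A.sub_smult[OF H(1)] H(2) l by blast
  qed
  moreover have "x = (\<Oplus>\<^sub>A l\<in>{..<d}. v l x \<odot>\<^sub>A u l)" using d x unfolding dual_basis_def by blast
  ultimately show ?thesis by simp
 qed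
 thus ?thesis unfolding fin_gen_def using d by (intro exI[of _ "u ` {..<d}"]) (auto simp: dual_basis_def)
qed

end

context stab
begin

lemma compact_fin_gen:
 assumes "c \<in> Md" "fin_gen c" shows "compact_object TYPE('u) St c"
proof -
 obtain Y where Y: "finite Y" "Y \<subseteq> carrier c" "\<forall>H. module.subsp K c H \<and> Y \<subseteq> H --> carrier c \<subseteq> H"
  using assms(2) by (auto simp: fin_gen_def)
 show ?thesis by (rule compact_finite_dim[OF assms(1) Y(1,2)]) (use Y(3) in blast)
qed

text \<open>The trace witness of P, placed between the two maps, is a witness for the
  composite.\<close>

lemma steq_zero_factor:
 assumes M: "M \<in> Md" and N: "N \<in> Md" and P: "kmod P" "rel_proj P"
  and a: "ghm M P a" and b: "ghm P N b"
 shows "steq M N (\<lambda>x. b (a x)) (\<lambda>x. \<zero>\<^sub>N)"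
proof -
 interpret N: module K N by (rule Md_mod[OF N])
 obtain e where e: "lin K P P e" "\<And>x. x \<in>. P ==> Tr P P e x = x" using P(2) by (auto simp: rel_proj_def)
 have l: "lin K P N (\<lambda>x. b (e x))" by (rule lin_comp[OF e(1) ghom_lin[OF b]])
 have "b (a x) = \<zero>\<^sub>N \<oplus>\<^sub>N Tr M N (\<lambda>x. b (e (a x))) x" if x: "x \<in>. M" for x
 proof -
  have "Tr M N (\<lambda>x. b (e (a x))) x = Tr P N (\<lambda>x. b (e x)) (a x)"
   by (rule Tr_right[OF P(1) Md_kmod[OF N] Md_kmod[OF M] l a x, symmetric])
  also have "... = b (Tr P P e (a x))" by (rule Tr_left[OF P(1) P(1) Md_kmod[OF N] e(1) b ghom_in[OF a x], symmetric])
  finally show ?thesis using e(2)[OF ghom_in[OF a x]] ghom_in[OF b ghom_in[OF a x]] by simp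
 qed
 thus ?thesis using lin_comp[OF ghom_lin[OF a] l] by (auto simp: steq_def)
qed

text \<open>The quotient is modelled on a linear complement of H, with the action followed by the
  projection q; thus it stays inside the carrier of M and is small.\<close>

lemma ex_quotient:
 assumes M: "M \<in> Md" and H: "module.subsp K M H" and act: "\<And>g x. g \<in>. G ==> x \<in> H ==> act M g x \<in> H"
 obtains C q where "C \<in> Md" "ghm M C q" "q ` carrier M = carrier C"
  "\<And>x. x \<in>. M ==> q x = \<zero>\<^sub>C \<longleftrightarrow> x \<in> H"
proof -
 interpret M: module K M by (rule Md_mod[OF M])
 note kM = Md_kmod[OF M]
 obtain r where r: "lin K M M r" "\<And>x. x \<in>. M ==> r x \<in> H" "\<And>x. x \<in> H ==> r x = x"
  by (rule M.ex_retraction[OF K.field_axioms H]) (rule that)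
 define q where "q x = x \<ominus>\<^sub>M r x" for x
 have q: "lin K M M q" unfolding q_def by (rule lin_diff[OF lin_id r(1) M.modl])
 note qc = lin_in[OF q] and rc = lin_in[OF r(1)]
 have qH: "q x = \<zero>\<^sub>M \<longleftrightarrow> x \<in> H" if x: "x \<in>. M" for x
 proof
  assume "q x = \<zero>\<^sub>M" hence "x = r x" using x rc by (simp add: q_def M.minus_zero_iff)
  thus "x \<in> H" using r(2)[OF x] by simp
 next
  assume "x \<in> H" thus "q x = \<zero>\<^sub>M" using r(3) x by (simp add: q_def M.minus_zero_iff)
 qed
 let ?L = "{x \<in> carrier M. r x = \<zero>\<^sub>M}"
 have L: "M.subsp ?L" by (rule M.subsp_kernel[OF r(1) M.modl])
 have qL: "q x \<in> ?L" if x: "x \<in>. M" for x using qc[OF x] rc[OF x] r(2)[OF x] r(3)[of "r x"] x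
  by (simp add: q_def lin_minus[OF r(1) M.modl M.modl] M.minus_zero_iff)
 have qid: "q x = x" if "x \<in> ?L" for x using that by (simp add: q_def M.minus_eq)
 have qact: "q (act M g (q x)) = q (act M g x)" if g: "g \<in>. G" and x: "x \<in>. M" for g x
 proof -
  note ac = act_in[OF kM g]
  have "q (act M g (q x)) = q (act M g x) \<ominus>\<^sub>M q (act M g (r x))"
   using ac x rc by (simp add: q_def[of x] lin_minus[OF act_lin[OF kM g] M.modl M.modl]
     lin_minus[OF q M.modl M.modl])
  moreover have "q (act M g (r x)) = \<zero>\<^sub>M" using qH[OF ac[OF rc[OF x]]] act[OF g r(2)[OF x]] by simp
  ultimately show ?thesis using qc[OF ac[OF x]] by (simp add: M.minus_eq)
 qed
 define C where "C = M\<lparr>carrier := ?L, act := (\<lambda>g x. q (act M g x))\<rparr>"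
 have Cs: "carrier C = ?L" "\<zero>\<^sub>C = \<zero>\<^sub>M" "\<And>x y. x \<oplus>\<^sub>C y = x \<oplus>\<^sub>M y" "\<And>a x. a \<odot>\<^sub>C x = a \<odot>\<^sub>M x"
  "\<And>g x. act C g x = q (act M g x)" by (simp_all add: C_def)
 have mC: "module K C"
  using M.sub_module[OF L] by (simp add: C_def module_def abelian_group_def abelian_group_axioms_def abelian_monoid_def module_axioms_def)
 have "kmod C"
 proof (rule kG_moduleI[OF mC])
  show "lin K C C (act C g)" if g: "g \<in>. G" for g
   using qL act_in[OF kM g] lin_add[OF act_lin[OF kM g]] lin_smult[OF act_lin[OF kM g]] lin_add[OF q] lin_smult[OF q]
   by (intro linI) (auto simp: Cs)
  show "act C \<one>\<^sub>G x = x" if "x \<in>. C" for x using that qid act_one[OF kM] by (auto simp: Cs)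
  show "act C (g \<otimes>\<^sub>G h) x = act C g (act C h x)" if "g \<in>. G" "h \<in>. G" "x \<in>. C" for g h x
   using that qact act_mult[OF kM] act_in[OF kM] by (auto simp: Cs)
 qed
 hence CM: "C \<in> Md" using small_subset[OF Md_small[OF M], of "carrier C"] by (auto simp: kG_mods_def Cs)
 have gq: "ghm M C q"
 proof (rule ghomI[OF linI])
  show "q x \<in>. C" if "x \<in>. M" for x using qL[OF that] by (simp add: Cs)
  show "q (act M g x) = act C g (q x)" if "g \<in>. G" "x \<in>. M" for g x using qact[OF that] by (simp add: Cs)
 qed (simp_all add: Cs lin_add[OF q] lin_smult[OF q])
 moreover have "q ` carrier M = carrier C"
 proof (intro equalityI subsetI)
  fix x assume "x \<in>. C"
  hence "x \<in> ?L" by (simp add: Cs)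
  thus "x \<in> q ` carrier M" using qid by (intro image_eqI[of _ _ x]) auto
 qed (use ghom_in[OF gq] in auto)
 ultimately show thesis using CM qH by (intro that[of C q]) (auto simp: Cs)
qed

text \<open>Compose f with any linear section of q; the kernel condition makes the result
  independent of the section and hence equivariant.\<close>

lemma ghom_factor:
 assumes M: "kmod M" and N: "kmod N" and L: "kmod L" and q: "ghm M N q" "q ` carrier M = carrier N"
  and f: "ghm M L f" and ker: "\<And>x. x \<in>. M ==> q x = \<zero>\<^sub>N ==> f x = \<zero>\<^sub>L"
 obtains h where "ghm N L h" "\<And>x. x \<in>. M ==> h (q x) = f x"
proof -
 interpret M: module K M using M by (rule kmod_mod)
 interpret N: module K N using N by (rule kmod_mod)
 interpret L: module K L using L by (rule kmod_mod)
 obtain s where s: "lin K N M s" "\<And>y. y \<in>. N ==> q (s y) = y"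
  by (rule M.ex_section[OF K.field_axioms ghom_lin[OF q(1)] N.modl q(2)]) (rule that)
 note fl = ghom_lin[OF f] and ql = ghom_lin[OF q(1)]
 have h: "f (s (q x)) = f x" if x: "x \<in>. M" for x
 proof -
  have c: "s (q x) \<in>. M" using lin_in[OF s(1) lin_in[OF ql x]] .
  have "q (s (q x) \<ominus>\<^sub>M x) = \<zero>\<^sub>N"
   using c x s(2) lin_in[OF ql x] by (simp add: lin_minus[OF ql M.modl N.modl] N.minus_zero_iff)
  hence "f (s (q x) \<ominus>\<^sub>M x) = \<zero>\<^sub>L" using c x by (intro ker) auto
  thus ?thesis using c x lin_in[OF fl] by (simp add: lin_minus[OF fl M.modl L.modl] L.minus_zero_iff)
 qed
 have "ghm N L (\<lambda>y. f (s y))"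
 proof (rule ghomI[OF lin_comp[OF s(1) fl]])
  fix g y assume g: "g \<in>. G" and y: "y \<in>. N"
  have c: "s y \<in>. M" by (rule lin_in[OF s(1) y])
  have "f (s (act N g y)) = f (s (q (act M g (s y))))" using ghom_act[OF q(1) g c] s(2)[OF y] by simp
  also have "... = act L g (f (s y))" using h[OF act_in[OF M g c]] ghom_act[OF f g c] by simp
  finally show "f (s (act N g y)) = act L g (f (s y))" .
 qed
 thus thesis using h by (rule that)
qed

text \<open>The linear witnesses of the summands glue, also for an infinite index set.\<close>

lemma rel_proj_dsum:
 assumes D: "dsum M I A inc prj" and A: "\<And>i. i \<in> I ==> rel_proj (A i)" shows "rel_proj M"
proof -
 interpret lsum K M I A inc prj by (rule dsumD(1)[OF D])
 note d = dsumD[OF D]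
 note kM = Md_kmod[OF d(2)]
 have "\<forall>i\<in>I. \<exists>e. lin K (A i) (A i) e \<and> (\<forall>x\<in>carrier (A i). Tr (A i) (A i) e x = x)"
  using A by (simp add: rel_proj_def)
 from bchoice[OF this] obtain e where e: "\<And>i. i \<in> I ==> lin K (A i) (A i) (e i)"
  "\<And>i x. i \<in> I ==> x \<in>. (A i) ==> Tr (A i) (A i) (e i) x = x" by blast
 let ?h = "\<lambda>i x. inc i (e i x)"
 have h: "lin K (A i) M (?h i)" if "i \<in> I" for i by (rule lin_comp[OF e(1)[OF that] lin_inc[OF that]])
 have E: "lin K M M (gather M ?h)" by (rule lin_gather[OF M.modl]) (rule h)
 have Ei: "gather M ?h (inc i x) = ?h i x" if "i \<in> I" "x \<in>. (A i)" for i x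
  by (rule gather_inc[OF M.modl _ that]) (rule h)
 have "Tr M M (gather M ?h) x = x" if x: "x \<in>. M" for x
 proof (rule lin_ext[OF lin_Tr[OF kM kM E] lin_id M.modl _ x])
  fix i x assume i: "i \<in> I" and x: "x \<in>. (A i)"
  note kA = Md_kmod[OF d(3)[OF i]]
  have "Tr M M (gather M ?h) (inc i x) = Tr (A i) M (\<lambda>x. gather M ?h (inc i x)) x"
   by (rule Tr_right[OF kM kM kA E d(4)[OF i] x])
  also have "... = Tr (A i) M (?h i) x" by (rule Tr_cong[OF kA kM h[OF i] _ x]) (simp add: Ei[OF i])
  also have "... = inc i x" using Tr_left[OF kA kA kM e(1)[OF i] d(4)[OF i] x] e(2)[OF i x] by simp
  finally show "Tr M M (gather M ?h) (inc i x) = inc i x" .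
 qed
 thus ?thesis using E by (auto simp: rel_proj_def)
qed

end

context cyc
begin

section \<open>Objects are coproducts of compact objects\<close>

lemma block_fin_gen: "kmod A ==> block A ==> fin_gen A"
 unfolding block_def using dual_basis_fin_gen by blast

theorem coproduct_of_compacts:
 assumes M: "M \<in> Md"
 shows "\<exists>(I :: 'u set) c \<iota>. small TYPE('u) I \<and> (\<forall>i\<in>I. compact_object TYPE('u) St (c i)) \<and> is_coproduct St I c M \<iota>"
proof -
 obtain I :: "'u set" and A inc prj where I: "small TYPE('u) I" and D: "dsum M I A inc prj" and A: "\<And>i. i \<in> I ==> block (A i)"
  by (rule block_decomposition[OF M]) (rule that)
 have "compact_object TYPE('u) St (A i)" if "i \<in> I" for i
  using compact_fin_gen[OF dsumD(3)[OF D that] block_fin_gen[OF Md_kmod[OF dsumD(3)[OF D that]] A[OF that]]] .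
 thus ?thesis using I dsum_coproduct[OF D] by blast
qed

section \<open>Pure-injectivity\<close>

text \<open>Adding an embedding of Y into a projective P replaces f by an injective f' into W = Z
  \<oplus> P without changing it stably. The cokernel C is a sum of finite-dimensional blocks. For
  each block the obstruction to lifting it to W is a map from its syzygy to Y; the syzygy is
  compact, so purity kills the obstruction.\<close>

theorem pure_injective_all:
 assumes Y: "Y \<in> Md" shows "pure_injective TYPE('u) St Y" unfolding pure_injective_def
proof (intro conjI ballI allI impI)
 show "Y \<in> Ob St" using Y by simp
 fix Z f assume "Z \<in> Ob St" and pm: "pure_mono TYPE('u) St Y Z f"
 hence Z: "Z \<in> Md" by simp
 interpret Y: module K Y by (rule Md_mod[OF Y])
 interpret Z: module K Z by (rule Md_mod[OF Z])
 note kY = Md_kmod[OF Y] and kZ = Md_kmod[OF Z]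
 have fm: "f \<in> Mor St Y Z" using pm by (simp add: pure_mono_def)
 obtain f0 where f0: "ghm Y Z f0" "f = cls Y Z f0" by (rule morE[OF Y Z fm]) (rule that)
 obtain P i where P: "P \<in> Md" "rel_proj P" and i: "ghm Y P i" "inj_on i (carrier Y)"
  by (rule ex_embedding[OF Y]) (rule that)
 let ?S = "\<lambda>b::bool. if b then Z else P"
 have "small TYPE('u) (UNIV :: bool set)" by (rule small_finite[OF infinite_univ]) simp
 then obtain W inc prj where W: "dsum W (UNIV :: bool set) ?S inc prj"
  by (rule ex_dsum[where A = ?S]) (use Z P in \<open>auto intro: that\<close>)
 note w = dsumD[OF W]
 interpret W: lsum K W "UNIV :: bool set" ?S inc prj by (rule w(1))
 note kW = Md_kmod[OF w(2)]
 have i1: "ghm Z W (inc True)" and i2: "ghm P W (inc False)"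
  and p1: "ghm W Z (prj True)" and p2: "ghm W P (prj False)"
  using w(4)[of True] w(4)[of False] w(5)[of True] w(5)[of False] by simp_all
 define f' where "f' y = inc True (f0 y) \<oplus>\<^sub>W inc False (i y)" for y
 have f': "ghm Y W f'" unfolding f'_def by (rule ghom_plus[OF kW ghom_comp[OF f0(1) i1] ghom_comp[OF i(1) i2]])
 have pf: "prj True (f' y) = f0 y" "prj False (f' y) = i y" if y: "y \<in>. Y" for y
 proof -
  interpret P: module K P by (rule Md_mod[OF P(1)])
  note c = ghom_in[OF f0(1) y] ghom_in[OF i(1) y]
  note c' = ghom_in[OF i1 c(1)] ghom_in[OF i2 c(2)]
  show "prj True (f' y) = f0 y"
   using c W.prj_inc[of True] W.prj_inc_zero[of False True] by (simp add: f'_def lin_add[OF ghom_lin[OF p1] c'])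
  show "prj False (f' y) = i y"
   using c W.prj_inc[of False] W.prj_inc_zero[of True False] by (simp add: f'_def lin_add[OF ghom_lin[OF p2] c'])
 qed
 have inj: "inj_on f' (carrier Y)" using i(2) pf(2) by (metis (no_types, lifting) inj_on_def)
 obtain l where l: "lin K W Y l" "\<And>y. y \<in>. Y ==> l (f' y) = y"
  by (rule W.M.ex_left_inverse[OF K.field_axioms ghom_lin[OF f'] Y.modl inj]) (rule that)
 let ?H = "f' ` carrier Y"
 have H: "W.M.subsp ?H" by (rule W.M.subsp_range[OF ghom_lin[OF f'] Y.modl])
 have Hact: "act W g x \<in> ?H" if "g \<in>. G" "x \<in> ?H" for g x
  using that ghom_act[OF f'] act_in[OF kY] by (metis (no_types, lifting) imageE imageI)
 obtain C q where C: "C \<in> Md" and q: "ghm W C q" "q ` carrier W = carrier C"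
  and ker: "\<And>x. x \<in>. W ==> q x = \<zero>\<^sub>C \<longleftrightarrow> x \<in> ?H"
  by (rule ex_quotient[OF w(2) H Hact]) (assumption | rule that)+
 note kC = Md_kmod[OF C]
 interpret C: module K C by (rule Md_mod[OF C])
 \<comment> \<open>l is only linear, but on maps into W that die in C it inverts the injective
   homomorphism f', so the result is equivariant.\<close>
 have lift_l: "ghm N Y (\<lambda>x. l (s x))" "\<And>x. x \<in>. N ==> f' (l (s x)) = s x"
  if s: "ghm N W s" and z: "\<And>x. x \<in>. N ==> q (s x) = \<zero>\<^sub>C" and kN: "kmod N" for N :: "('g, 'k, 'u) gmod" and s
 proof -
  have ex: "\<exists>y\<in>carrier Y. s x = f' y" if "x \<in>. N" for x
   using ker[OF ghom_in[OF s that]] z[OF that] by auto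
  show e: "f' (l (s x)) = s x" if "x \<in>. N" for x using ex[OF that] l(2) by auto
  show "ghm N Y (\<lambda>x. l (s x))"
  proof (rule ghomI[OF lin_comp[OF ghom_lin[OF s] l(1)]])
   fix g x assume g: "g \<in>. G" and x: "x \<in>. N"
   obtain y where y: "y \<in>. Y" "s x = f' y" using ex[OF x] by blast
   show "l (s (act N g x)) = act Y g (l (s x))"
    using ghom_act[OF s g x] ghom_act[OF f' g y(1)] y(2) l(2)[OF y(1)] l(2)[OF act_in[OF kY g y(1)]] by simp
  qed
 qed
 obtain I :: "'u set" and A incC prjC where D: "dsum C I A incC prjC" and A: "\<And>i. i \<in> I ==> block (A i)"
  by (rule block_decomposition[OF C]) (rule that)
 note d = dsumD[OF D]
 interpret D: lsum K C I A incC prjC by (rule d(1))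
 have "\<exists>s. ghm (A j) W s \<and> (\<forall>x\<in>carrier (A j). q (s x) = incC j x)" if j: "j \<in> I" for j
 proof -
  note Aj = d(3)[OF j]
  note kA = Md_kmod[OF Aj]
  interpret A: module K "A j" by (rule Md_mod[OF Aj])
  obtain R c e where R: "R \<in> Md" "rel_proj R" and c: "ghm R (A j) c" "c ` carrier R = carrier (A j)"
   and e: "lin K (funG (A j)) R e" "e ` carrier (funG (A j)) = carrier R" by (rule ex_cover[OF Aj]) (rule that)
  note kR = Md_kmod[OF R(1)]
  interpret R: module K R by (rule Md_mod[OF R(1)])
  \<comment> \<open>The cover R of the block is finite dimensional, so its kernel N, the syzygy, is
    compact.\<close>
  have fgR: "fin_gen R"
   by (rule fin_gen_image[OF kmod_mod[OF kmod_funG[OF kA]] R.modl e fin_gen_funG[OF kA block_fin_gen[OF kA A[OF j]]]])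
  obtain s where s: "ghm R W s" "\<And>x. x \<in>. R ==> q (s x) = incC j (c x)"
   by (rule rel_proj_lift[OF kR R(2) kW kC q ghom_comp[OF c(1) d(4)[OF j]]]) (rule that)
  let ?K = "{x \<in> carrier R. c x = \<zero>\<^bsub>A j\<^esub>}"
  have Ks: "R.subsp ?K" by (rule R.subsp_kernel[OF ghom_lin[OF c(1)] A.modl])
  define N where "N = R\<lparr>carrier := ?K\<rparr>"
  have Ns: "carrier N = ?K" "\<And>x y. x \<oplus>\<^sub>N y = x \<oplus>\<^sub>R y" "\<And>a x. a \<odot>\<^sub>N x = a \<odot>\<^sub>R x" "\<And>g x. act N g x = act R g x"
   by (simp_all add: N_def)
  have N: "N \<in> Md" unfolding N_def by (rule Md_sub[OF R(1) Ks])
    (simp add: ghom_act[OF c(1)] act_in[OF kR] lin_zero[OF act_lin[OF kA] A.modl A.modl])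
  note kN = Md_kmod[OF N]
  have jN: "ghm N R (\<lambda>x. x)" by (rule ghomI[OF linI]) (simp_all add: Ns)
  have cN: "compact_object TYPE('u) St N"
   unfolding N_def by (rule compact_fin_gen[OF N[unfolded N_def] fin_gen_sub[OF kR Ks fgR]])
  have sN: "ghm N W s" using ghom_comp[OF jN s(1)] .
  have z: "q (s x) = \<zero>\<^sub>C" if "x \<in>. N" for x
   using s(2)[of x] that lin_zero[OF d(4)[OF j, THEN ghom_lin] A.modl C.modl] by (simp add: Ns)
  have kk: "ghm N Y (\<lambda>x. l (s x))" by (rule lift_l(1)[OF sN _ kN]) (rule z)
  have kk2: "f' (l (s x)) = s x" if "x \<in>. N" for x by (rule lift_l(2)[OF sN _ kN that]) (rule z)
  \<comment> \<open>The composite of f with the obstruction map is the restriction to N of a map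
    defined on the projective R, hence stably zero; purity then applies.\<close>
  have "steq N Z (\<lambda>x. prj True (s x)) (\<lambda>x. \<zero>\<^sub>Z)"
   by (rule steq_zero_factor[OF N Z kR R(2) jN ghom_comp[OF s(1) p1]])
  moreover have e0: "prj True (s x) = f0 (l (s x))" if "x \<in>. N" for x
   using pf(1)[OF ghom_in[OF kk that]] kk2[OF that] by simp
  ultimately have "steq N Z (\<lambda>x. f0 (l (s x))) (\<lambda>x. \<zero>\<^sub>Z)" by (simp add: steq_def)
  hence "cls N Z (\<lambda>x. f0 (l (s x))) = cls N Z (\<lambda>x. \<zero>\<^sub>Z)"
   using cls_eq_iff[OF N Z ghom_comp[OF kk f0(1)] ghom_zero[OF kZ]] by simp
  moreover have "cls N Z (\<lambda>x. f0 \<zero>\<^sub>Y) = cls N Z (\<lambda>x. \<zero>\<^sub>Z)"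
   using lin_zero[OF ghom_lin[OF f0(1)] Y.modl Z.modl] by simp
  ultimately have "f \<bullet>\<^sub>St cls N Y (\<lambda>x. l (s x)) = f \<bullet>\<^sub>St cls N Y (\<lambda>x. \<zero>\<^sub>Y)"
   unfolding f0(2) cmp_cls[OF N Y Z kk f0(1)] cmp_cls[OF N Y Z ghom_zero[OF kY] f0(1)] by simp
  moreover have "inj_on (\<lambda>g. f \<bullet>\<^sub>St g) (Mor St N Y)" using pm cN by (simp add: pure_mono_def)
  ultimately have "cls N Y (\<lambda>x. l (s x)) = cls N Y (\<lambda>x. \<zero>\<^sub>Y)"
   using cls_mor[OF N Y kk] cls_mor[OF N Y ghom_zero[OF kY]] by (simp add: inj_on_eq_iff)
  then obtain h where h: "lin K N Y h" "\<And>x. x \<in>. N ==> l (s x) = Tr N Y h x"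
   using cls_eq_iff[OF N Y kk ghom_zero[OF kY]] lin_in[OF lin_Tr[OF kN kY]] by (auto simp: steq_def)
  \<comment> \<open>A linear retraction of R onto N extends the witness h, so the trace b extends
    the obstruction map from N to R.\<close>
  obtain r where r: "lin K R R r" "\<And>x. x \<in>. R ==> r x \<in> ?K" "\<And>x. x \<in> ?K ==> r x = x"
   by (rule R.ex_retraction[OF K.field_axioms Ks]) (rule that)
  have rN: "lin K R N r" unfolding N_def by (rule lin_sub_cod[OF r(1,2)])
  have hr: "lin K R Y (\<lambda>x. h (r x))" by (rule lin_comp[OF rN h(1)])
  define b where "b = Tr R Y (\<lambda>x. h (r x))"
  have b: "ghm R Y b" unfolding b_def by (rule ghom_Tr[OF kR kY hr])
  have bN: "b x = l (s x)" if x: "x \<in>. N" for x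
  proof -
   have "b x = Tr N Y (\<lambda>x. h (r x)) x" unfolding b_def by (rule Tr_right[OF kR kY kN hr jN x])
   also have "... = Tr N Y h x" by (rule Tr_cong[OF kN kY h(1) _ x]) (simp add: r(3) Ns)
   finally show ?thesis using h(2)[OF x] by simp
  qed
  \<comment> \<open>The lift is corrected by f' b: it still covers the inclusion of the block and
    now vanishes on N, so it descends to the block.\<close>
  define s' where "s' x = s x \<ominus>\<^sub>W f' (b x)" for x
  have s': "ghm R W s'" unfolding s'_def by (rule ghom_diff[OF kW s(1) ghom_comp[OF b f']])
  have "s' x = \<zero>\<^sub>W" if "x \<in>. R" "c x = \<zero>\<^bsub>A j\<^esub>" for x
  proof -
   have x: "x \<in>. N" using that by (simp add: Ns)
   show ?thesis using bN[OF x] kk2[OF x] ghom_in[OF s(1) that(1)] by (simp add: s'_def W.M.minus_zero_iff)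
  qed
  then obtain s'' where s'': "ghm (A j) W s''" "\<And>x. x \<in>. R ==> s'' (c x) = s' x"
   by (rule ghom_factor[OF kR kA kW c s']) (assumption | rule that)+
  have qf: "q (f' y) = \<zero>\<^sub>C" if "y \<in>. Y" for y using ker[OF ghom_in[OF f' that]] that by blast
  have "q (s'' a) = incC j a" if a: "a \<in>. (A j)" for a
  proof -
   obtain x where x: "x \<in>. R" "a = c x" using a c(2) by blast
   have "q (s' x) = incC j (c x)"
    using qf[OF ghom_in[OF b x(1)]] s(2)[OF x(1)] ghom_in[OF s(1) x(1)] ghom_in[OF f' ghom_in[OF b x(1)]]
     ghom_in[OF d(4)[OF j] a] x(2) by (simp add: s'_def lin_minus[OF ghom_lin[OF q(1)] W.M.modl C.modl] C.minus_eq)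
   thus ?thesis using s''(2)[OF x(1)] x(2) by simp
  qed
  thus ?thesis using s''(1) by blast
 qed
 hence "\<forall>j\<in>I. \<exists>s. ghm (A j) W s \<and> (\<forall>x\<in>carrier (A j). q (s x) = incC j x)" by blast
 from bchoice[OF this] obtain s where s: "\<And>j. j \<in> I ==> ghm (A j) W (s j)"
  "\<And>j x. j \<in> I ==> x \<in>. (A j) ==> q (s j x) = incC j x" by blast
 define S where "S = D.gather W s"
 have S: "ghm C W S" unfolding S_def by (rule dsum_gather[OF D kW]) (rule s(1))
 have qS: "q (S x) = x" if x: "x \<in>. C" for x
 proof (rule D.lin_ext[OF lin_comp[OF ghom_lin[OF S] ghom_lin[OF q(1)]] lin_id C.modl _ x])
  fix j x assume j: "j \<in> I" and x: "x \<in>. (A j)"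
  have "S (incC j x) = s j x" unfolding S_def by (rule D.gather_inc[OF W.M.modl _ j x]) (rule ghom_lin[OF s(1)])
  thus "q (S (incC j x)) = incC j x" using s(2)[OF j x] by simp
 qed
 \<comment> \<open>The projection of W onto the image of Y along the section S.\<close>
 define t where "t w = w \<ominus>\<^sub>W S (q w)" for w
 have t: "ghm W W t" unfolding t_def by (rule ghom_diff[OF kW ghom_id ghom_comp[OF q(1) S]])
 have qt: "q (t w) = \<zero>\<^sub>C" if w: "w \<in>. W" for w using w qS ghom_in[OF q(1) w] ghom_in[OF S]
  by (simp add: t_def lin_minus[OF ghom_lin[OF q(1)] W.M.modl C.modl] C.minus_zero_iff)
 have lt: "ghm W Y (\<lambda>x. l (t x))" by (rule lift_l(1)[OF t _ kW]) (rule qt)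
 have rf: "l (t (f' y)) = y" if y: "y \<in>. Y" for y
 proof -
  have "q (f' y) = \<zero>\<^sub>C" using ker[OF ghom_in[OF f' y]] y by blast
  hence "t (f' y) = f' y"
   using ghom_in[OF f' y] lin_zero[OF ghom_lin[OF S] C.modl W.M.modl] by (simp add: t_def W.M.minus_eq)
  thus ?thesis using l(2)[OF y] by simp
 qed
 \<comment> \<open>The retraction of f' is the sum of its parts on Z and on P. The part through P is
   stably zero, which leaves a retraction of f.\<close>
 let ?r = "\<lambda>z. l (t (inc True z))"
 have r: "ghm Z Y ?r" by (rule ghom_comp[OF i1 lt])
 have z: "steq Y Y (\<lambda>y. l (t (inc False (i y)))) (\<lambda>x. \<zero>\<^sub>Y)"
  by (rule steq_zero_factor[OF Y Y Md_kmod[OF P(1)] P(2) i(1) ghom_comp[OF i2 lt]])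
 have gz: "ghm Y Y (\<lambda>y. l (t (inc False (i y))))" by (rule ghom_comp[OF i(1) ghom_comp[OF i2 lt]])
 have rf0: "ghm Y Y (\<lambda>y. ?r (f0 y))" by (rule ghom_comp[OF f0(1) r])
 have sum: "?r (f0 y) \<oplus>\<^sub>Y l (t (inc False (i y))) = y" if y: "y \<in>. Y" for y
  using rf[OF y] ghom_in[OF i1 ghom_in[OF f0(1) y]] ghom_in[OF i2 ghom_in[OF i(1) y]]
  by (simp add: f'_def lin_add[OF ghom_lin[OF lt]])
 have "idm St Y = cls Y Y (\<lambda>y. ?r (f0 y) \<oplus>\<^sub>Y l (t (inc False (i y))))"
  unfolding idm_cls[OF Y] by (rule cls_cong[OF Y Y ghom_plus[OF kY rf0 gz]]) (rule sum)
 also have "... = cls Y Y (\<lambda>y. ?r (f0 y) \<oplus>\<^sub>Y \<zero>\<^sub>Y)"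
  using cls_eq_iff[OF Y Y ghom_plus[OF kY rf0 gz] ghom_plus[OF kY rf0 ghom_zero[OF kY]]]
   steq_plus[OF Y Y rf0 ghom_zero[OF kY] steq_refl[OF Y Y rf0] z] by simp
 also have "... = cls Y Y (\<lambda>y. ?r (f0 y))" by (rule cls_cong[OF Y Y rf0]) (simp add: ghom_in[OF rf0])
 also have "... = cls Z Y ?r \<bullet>\<^sub>St f" unfolding f0(2) cmp_cls[OF Y Z Y f0(1) r] ..
 finally show "\<exists>r\<in>Mor St Z Y. r \<bullet>\<^sub>St f = idm St Y" using cls_mor[OF Z Y r] by auto
qed

end

section \<open>Endofiniteness\<close>

text \<open>A strictly monotone bounded function on the lattice of submodules gives a composition series.\<close>

lemma hom_finite_lengthI:
 fixes \<mu> :: "'m set => nat"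
 assumes bot: "end_submodule C c X {zerom C c X}" and top: "end_submodule C c X (Mor C c X)"
  and mono: "\<And>H L. end_submodule C c X H ==> end_submodule C c X L ==> H \<subset> L ==> \<mu> H < \<mu> L"
 shows "hom_finite_length C c X"
proof -
 let ?E = "end_submodule C c X" and ?T = "Mor C c X"
 have leT: "H \<subseteq> ?T" if "?E H" for H
 proof -
  have "H \<subseteq> carrier (hom_group C c X)" using that by (intro subgroup.subset) (simp add: end_submodule_def)
  thus ?thesis by (simp add: hom_group_def)
 qed
 have "\<exists>n S. S 0 = H \<and> S n = ?T \<and> (\<forall>i\<le>n::nat. ?E (S i)) \<and>
   (\<forall>i<n. S i \<subset> S (Suc i) \<and> (\<forall>L. ?E L \<and> S i \<subseteq> L \<and> L \<subseteq> S (Suc i) --> L = S i \<or> L = S (Suc i)))"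
  if "?E H" for H using that
 proof (induction "\<mu> ?T - \<mu> H" arbitrary: H rule: less_induct)
  case less
  show ?case
  proof (cases "H = ?T")
   case True
   thus ?thesis using top by (intro exI[of _ 0] exI[of _ "\<lambda>_. H"]) auto
  next
   case False
   \<comment> \<open>Among the submodules strictly above H one with least measure is taken, so
     nothing lies strictly between.\<close>
   hence "?E ?T \<and> H \<subset> ?T" using leT[OF less.prems] top by blast
   then obtain L where L: "?E L" "H \<subset> L" and min: "\<And>L'. ?E L' ==> H \<subset> L' ==> \<mu> L \<le> \<mu> L'"
    using ex_has_least_nat[of "\<lambda>L. ?E L \<and> H \<subset> L" ?T \<mu>] by (elim impE exE conjE) auto
   have "\<mu> H < \<mu> L" by (rule mono[OF less.prems L])
   moreover have "\<mu> L \<le> \<mu> ?T"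
   proof (cases "L = ?T")
    case False
    hence "L \<subset> ?T" using leT[OF L(1)] by blast
    thus ?thesis using mono[OF L(1) top] by simp
   qed simp
   ultimately have "\<mu> ?T - \<mu> L < \<mu> ?T - \<mu> H" by simp
   from less.hyps[OF this L(1)] obtain n S where S: "S 0 = L" "S n = ?T" "\<forall>i\<le>n::nat. ?E (S i)"
    "\<forall>i<n. S i \<subset> S (Suc i) \<and> (\<forall>L. ?E L \<and> S i \<subseteq> L \<and> L \<subseteq> S (Suc i) --> L = S i \<or> L = S (Suc i))"
    by (elim exE conjE)
   have between: "L' = H \<or> L' = L" if "?E L'" "H \<subseteq> L'" "L' \<subseteq> L" for L'
   proof (rule ccontr)
    assume n: "\<not> ?thesis"
    hence "\<mu> L' < \<mu> L" using mono[OF that(1) L(1)] that(3) by blast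
    moreover have "\<mu> L \<le> \<mu> L'" using min[OF that(1)] n that(2) by blast
    ultimately show False by simp
   qed
   let ?S = "case_nat H S"
   show ?thesis
   proof (intro exI[of _ "Suc n"] exI[of _ ?S] conjI allI impI)
    fix i assume "i \<le> Suc n" thus "?E (?S i)" using S(3) less.prems by (cases i) auto
   next
    fix i assume "i < Suc n" thus "?S i \<subset> ?S (Suc i)" using S(1,4) L(2) by (cases i) auto
   next
    fix i L' assume "i < Suc n" "?E L' \<and> ?S i \<subseteq> L' \<and> L' \<subseteq> ?S (Suc i)"
    thus "L' = ?S i \<or> L' = ?S (Suc i)" using S(1,4) between by (cases i) auto
   qed (use S in auto)
  qed
 qed
 from this[OF bot] show ?thesis unfolding hom_finite_length_def by blast
qed

context stab
begin

lemma ghom_scale: "kmod M ==> a \<in>. K ==> ghm M M (\<lambda>x. a \<odot>\<^sub>M x)"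
 by (rule ghomI[OF lin_scale[OF lin_id _ kmod_mod]]) (auto simp: lin_smult[OF act_lin])

text \<open>The submodules are measured by the positions of leading coordinates, as for echelon forms.\<close>

lemma hom_finite_length_coordinates:
 fixes n :: nat
 assumes c: "c \<in> Md" and M: "M \<in> Md"
  and closed: "\<And>h j. ghm c M h ==> j < n ==> \<chi> j h \<in>. K"
  and lin: "\<And>h h' a j. ghm c M h ==> ghm c M h' ==> a \<in>. K ==> j < n ==>
   \<chi> j (\<lambda>x. h x \<oplus>\<^sub>M a \<odot>\<^sub>M h' x) = \<chi> j h \<oplus>\<^sub>K a \<otimes>\<^sub>K \<chi> j h'"
  and sep: "\<And>h. ghm c M h ==> (\<And>j. j < n ==> \<chi> j h = \<zero>\<^sub>K) ==> cls c M h = zerom St c M"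
 shows "hom_finite_length St c M"
proof -
 interpret S: preadditive_category St by (rule preadditive_Stab)
 interpret M: module K M by (rule Md_mod[OF M])
 note kM = Md_kmod[OF M]
 interpret H: comm_group "hom_group St c M" by (rule S.comm_group_hom) (use c M in simp_all)
 have endD: "zerom St c M \<in> H" "\<And>x y. x \<in> H ==> y \<in> H ==> addm St x y \<in> H" "H \<subseteq> Mor St c M"
  "\<And>h f. h \<in> H ==> f \<in> Mor St M M ==> f \<bullet>\<^sub>St h \<in> H" if "end_submodule St c M H" for H
  using that subgroup.one_closed[of H "hom_group St c M"] subgroup.m_closed[of H "hom_group St c M"]
   subgroup.subset[of H "hom_group St c M"] unfolding end_submodule_def hom_group_simps by auto
 have comb: "ghm c M (\<lambda>x. h x \<oplus>\<^sub>M a \<odot>\<^sub>M h' x)"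
  "end_submodule St c M H ==> cls c M h \<in> H ==> cls c M h' \<in> H ==> cls c M (\<lambda>x. h x \<oplus>\<^sub>M a \<odot>\<^sub>M h' x) \<in> H"
  if h: "ghm c M h" "ghm c M h'" and a: "a \<in>. K" for H h h' a
 proof -
  note s = ghom_scale[OF kM a] and sh = ghom_comp[OF h(2) ghom_scale[OF kM a]]
  show "ghm c M (\<lambda>x. h x \<oplus>\<^sub>M a \<odot>\<^sub>M h' x)" by (rule ghom_plus[OF kM h(1) sh])
  assume H: "end_submodule St c M H" and m: "cls c M h \<in> H" "cls c M h' \<in> H"
  show "cls c M (\<lambda>x. h x \<oplus>\<^sub>M a \<odot>\<^sub>M h' x) \<in> H"
   using endD(2)[OF H m(1) endD(4)[OF H m(2) cls_mor[OF M M s]]]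
   unfolding cmp_cls[OF c M M h(2) s] addm_cls[OF c M h(1) sh] .
 qed
 \<comment> \<open>Leading positions of representatives of elements of H. The coordinates are
   functions of homomorphisms and not of stable classes, so a position counts as soon as one
   representative realizes it.\<close>
 define piv where "piv H = {s. s < n \<and> (\<exists>h. ghm c M h \<and> cls c M h \<in> H \<and> \<chi> s h \<noteq> \<zero>\<^sub>K \<and> (\<forall>j<s. \<chi> j h = \<zero>\<^sub>K))}" for H
 show ?thesis
 proof (rule hom_finite_lengthI)
  have "f \<bullet>\<^sub>St zerom St c M = zerom St c M" if "f \<in> Mor St M M" for f
   using S.cmp_zero_right[of c M M f] that c M by simp
  thus "end_submodule St c M {zerom St c M}" using H.triv_subgroup by (simp add: end_submodule_def hom_group_simps)
  have "f \<bullet>\<^sub>St h \<in> Mor St c M" if "f \<in> Mor St M M" "h \<in> Mor St c M" for f h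
   using S.cmp_closed[of c M M h f] that c M by simp
  thus "end_submodule St c M (Mor St c M)" using H.subgroup_self by (simp add: end_submodule_def hom_group_simps)
  fix H L assume H: "end_submodule St c M H" and L: "end_submodule St c M L" and HL: "H \<subset> L"
  have "piv H \<noteq> piv L"
  proof
   assume eq: "piv H = piv L"
   \<comment> \<open>Gaussian elimination: with equal pivots, each step subtracts a multiple of an
     element of H and clears one more coordinate; k bounds the number that may remain nonzero. When
     none remains the class is zero by \<open>sep\<close>.\<close>
   have "cls c M h \<in> H" if "k \<le> n" "ghm c M h" "cls c M h \<in> L" "\<And>j. j < n - k ==> \<chi> j h = \<zero>\<^sub>K" for k h
    using that
   proof (induction k arbitrary: h)
    case 0
    thus ?case using sep[of h] endD(1)[OF H] by simp
   next
    case (Suc k)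
    define s where "s = n - Suc k"
    have s: "s < n" "n - k = Suc s" using Suc.prems(1) by (auto simp: s_def)
    show ?case
    proof (cases "\<chi> s h = \<zero>\<^sub>K")
     case True
     thus ?thesis using Suc s by (auto simp: less_Suc_eq s_def)
    next
     case False
     hence "s \<in> piv H" using Suc.prems s unfolding eq by (auto simp: piv_def s_def)
     then obtain z where z: "ghm c M z" "cls c M z \<in> H" "\<chi> s z \<noteq> \<zero>\<^sub>K" "\<And>j. j < s ==> \<chi> j z = \<zero>\<^sub>K"
      by (auto simp: piv_def)
     note zs = closed[OF z(1) s(1)] and hs = closed[OF Suc.prems(2) s(1)]
     have i: "inv\<^bsub>K\<^esub> (\<chi> s z) \<in>. K" "inv\<^bsub>K\<^esub> (\<chi> s z) \<otimes>\<^sub>K \<chi> s z = \<one>\<^sub>K" using zs z(3) K.field_Units by auto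
     define a where "a = \<chi> s h \<otimes>\<^sub>K inv\<^bsub>K\<^esub> (\<chi> s z)"
     have a: "a \<in>. K" "\<ominus>\<^sub>K a \<in>. K" "a \<otimes>\<^sub>K \<chi> s z = \<chi> s h" using zs hs i by (simp_all add: a_def K.m_assoc)
     let ?w = "\<lambda>x. h x \<oplus>\<^sub>M (\<ominus>\<^sub>K a) \<odot>\<^sub>M z x"
     note w = comb[OF Suc.prems(2) z(1) a(2)]
     have "cls c M ?w \<in> H"
     proof (rule Suc.IH[OF _ w(1) w(2)[OF L Suc.prems(3)]])
      show "cls c M z \<in> L" using z(2) HL by blast
      show "\<chi> j ?w = \<zero>\<^sub>K" if "j < n - k" for j
       using that s lin[OF Suc.prems(2) z(1) a(2), of j] a z(4) Suc.prems(4) zs hs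
       by (auto simp: less_Suc_eq s_def[symmetric] K.l_minus K.r_neg)
     qed (use Suc.prems in simp)
     hence "cls c M (\<lambda>x. ?w x \<oplus>\<^sub>M a \<odot>\<^sub>M z x) \<in> H" by (rule comb(2)[OF w(1) z(1) a(1) H _ z(2)])
     moreover have "cls c M (\<lambda>x. ?w x \<oplus>\<^sub>M a \<odot>\<^sub>M z x) = cls c M h"
      using ghom_in[OF Suc.prems(2)] ghom_in[OF z(1)] a
      by (intro cls_cong[OF c M Suc.prems(2)]) (simp add: M.a_assoc M.l_neg flip: M.smult_l_distr add: K.l_neg)
     ultimately show ?thesis by simp
    qed
   qed
   from this[of n] have sub: "cls c M h \<in> H" if "ghm c M h" "cls c M h \<in> L" for h using that by simp
   have "L \<subseteq> H"
   proof
    fix m assume m: "m \<in> L"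
    hence "m \<in> Mor St c M" using endD(3)[OF L] by blast
    then obtain h where "ghm c M h" "m = cls c M h" by (rule morE[OF c M]) (rule that)
    thus "m \<in> H" using sub m by simp
   qed
   thus False using HL by blast
  qed
  moreover have "piv H \<subseteq> piv L" using HL by (auto simp: piv_def)
  moreover have "finite (piv L)" by (simp add: piv_def)
  ultimately show "card (piv H) < card (piv L)" by (intro psubset_card_mono) auto
 qed
qed

end

context cyc
begin

text \<open>An indecomposable object is isomorphic to a block, since the other summand is zero.\<close>

lemma indecomposable_retract_block:
 assumes M: "indecomposable St M"
 obtains A i q where "A \<in> Md" "block A" "ghm A M i" "ghm M A q" "cls M M (\<lambda>x. i (q x)) = idm St M"
proof -
 have MM: "M \<in> Md" and nz: "\<not> rel_proj M"
  and ind: "\<And>A B i j p q. is_biproduct St A B M i j p q ==> zero_object St A \<or> zero_object St B"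
 proof -
  show MM: "M \<in> Md" using M by (simp add: indecomposable_def)
  show "\<not> rel_proj M" using M zero_object_iff[OF MM] by (simp add: indecomposable_def)
  show "zero_object St A \<or> zero_object St B" if "is_biproduct St A B M i j p q" for A B i j p q
   using M that unfolding indecomposable_def by blast
 qed
 interpret M: module K M by (rule Md_mod[OF MM])
 note kM = Md_kmod[OF MM]
 obtain I :: "'u set" and A inc prj where D: "dsum M I A inc prj" and A: "\<And>i. i \<in> I ==> block (A i)"
  by (rule block_decomposition[OF MM]) (rule that)
 note d = dsumD[OF D]
 interpret D: lsum K M I A inc prj by (rule d(1))
 obtain k where k: "k \<in> I" "\<not> rel_proj (A k)" using rel_proj_dsum[OF D] nz by blast
 note Ak = d(3)[OF k(1)] and i = d(4)[OF k(1)] and q = d(5)[OF k(1)]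
 note kA = Md_kmod[OF Ak]
 interpret A: module K "A k" by (rule Md_mod[OF Ak])
 \<comment> \<open>The complement of the block \<open>A k\<close>, as the kernel of its
   projection.\<close>
 define B where "B = M\<lparr>carrier := {x \<in> carrier M. prj k x = \<zero>\<^bsub>A k\<^esub>}\<rparr>"
 have Bs: "carrier B = {x \<in> carrier M. prj k x = \<zero>\<^bsub>A k\<^esub>}" "\<zero>\<^sub>B = \<zero>\<^sub>M" "\<And>x y. x \<oplus>\<^sub>B y = x \<oplus>\<^sub>M y"
  "\<And>a x. a \<odot>\<^sub>B x = a \<odot>\<^sub>M x" "\<And>g x. act B g x = act M g x" by (simp_all add: B_def)
 have B: "B \<in> Md" unfolding B_def by (rule Md_sub[OF MM M.subsp_kernel[OF ghom_lin[OF q] A.modl]])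
   (simp add: ghom_act[OF q] act_in[OF kM] lin_zero[OF act_lin[OF kA] A.modl A.modl])
 note kB = Md_kmod[OF B]
 have j: "ghm B M (\<lambda>x. x)" by (rule ghomI[OF linI]) (simp_all add: Bs)
 let ?t = "\<lambda>x. x \<ominus>\<^sub>M inc k (prj k x)"
 have tM: "ghm M M ?t" by (rule ghom_diff[OF kM ghom_id ghom_comp[OF q i]])
 have "?t x \<in>. B" if x: "x \<in>. M" for x using x ghom_in[OF q x] ghom_in[OF i] D.prj_inc[OF k(1)]
  by (simp add: Bs lin_minus[OF ghom_lin[OF q] M.modl A.modl] A.minus_zero_iff)
 hence t: "ghm M B ?t" using tM by (auto simp: ghom_def lin_def Bs)
 have "is_biproduct St (A k) B M (cls (A k) M (inc k)) (cls B M (\<lambda>x. x)) (cls M (A k) (prj k)) (cls M B ?t)"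
  unfolding is_biproduct_def
 proof (intro conjI)
  show "A k \<in> Ob St" "B \<in> Ob St" "M \<in> Ob St" using Ak B MM by simp_all
  show "cls (A k) M (inc k) \<in> Mor St (A k) M" by (rule cls_mor[OF Ak MM i])
  show "cls B M (\<lambda>x. x) \<in> Mor St B M" by (rule cls_mor[OF B MM j])
  show "cls M (A k) (prj k) \<in> Mor St M (A k)" by (rule cls_mor[OF MM Ak q])
  show "cls M B ?t \<in> Mor St M B" by (rule cls_mor[OF MM B t])
  show "cls M (A k) (prj k) \<bullet>\<^sub>St cls (A k) M (inc k) = idm St (A k)"
   unfolding cmp_cls[OF Ak MM Ak i q] idm_cls[OF Ak]
   by (rule cls_cong[OF Ak Ak ghom_id]) (simp add: D.prj_inc[OF k(1)])
  show "cls M B ?t \<bullet>\<^sub>St cls B M (\<lambda>x. x) = idm St B"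
   unfolding cmp_cls[OF B MM B j t] idm_cls[OF B] by (rule cls_cong[OF B B ghom_id])
    (simp add: Bs lin_zero[OF ghom_lin[OF i] A.modl M.modl] M.minus_eq)
  show "cls M B ?t \<bullet>\<^sub>St cls (A k) M (inc k) = zerom St (A k) B"
   unfolding cmp_cls[OF Ak MM B i t] zerom_cls by (rule cls_cong[OF Ak B ghom_zero[OF kB]], rule sym)
    (simp add: Bs D.prj_inc[OF k(1)] ghom_in[OF i] M.minus_zero_iff)
  show "cls M (A k) (prj k) \<bullet>\<^sub>St cls B M (\<lambda>x. x) = zerom St B (A k)"
   unfolding cmp_cls[OF B MM Ak j q] zerom_cls by (rule cls_cong[OF B Ak ghom_zero[OF kA]]) (simp add: Bs)
  show "addm St (cls (A k) M (inc k) \<bullet>\<^sub>St cls M (A k) (prj k)) (cls B M (\<lambda>x. x) \<bullet>\<^sub>St cls M B ?t) = idm St M"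
   unfolding cmp_cls[OF MM Ak MM q i] cmp_cls[OF MM B MM t j] addm_cls[OF MM MM ghom_comp[OF q i] tM] idm_cls[OF MM]
  proof (rule cls_cong[OF MM MM ghom_id])
   fix x assume x: "x \<in>. M"
   note c = ghom_in[OF i ghom_in[OF q x]]
   show "x = inc k (prj k x) \<oplus>\<^sub>M ?t x" using M.minus_add_cancel[OF x c] c x by (simp add: M.a_comm)
  qed
 qed
 \<comment> \<open>The block is not zero, so indecomposability makes the complement zero. It is then
   relatively projective, and the idempotent of the block is stably the identity.\<close>
 hence "zero_object St B" using ind zero_object_iff[OF Ak] k(2) by blast
 hence rB: "rel_proj B" using zero_object_iff[OF B] by simp
 have "steq M M ?t (\<lambda>x. \<zero>\<^sub>M)" by (rule steq_zero_factor[OF MM MM kB rB t j])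
 hence "steq M M (\<lambda>x. inc k (prj k x) \<oplus>\<^sub>M ?t x) (\<lambda>x. inc k (prj k x) \<oplus>\<^sub>M \<zero>\<^sub>M)"
  using steq_plus[OF MM MM ghom_comp[OF q i] ghom_zero[OF kM] steq_refl[OF MM MM ghom_comp[OF q i]]] by blast
 hence "cls M M (\<lambda>x. inc k (prj k x) \<oplus>\<^sub>M ?t x) = cls M M (\<lambda>x. inc k (prj k x) \<oplus>\<^sub>M \<zero>\<^sub>M)"
  using cls_eq_iff[OF MM MM ghom_plus[OF kM ghom_comp[OF q i] tM] ghom_plus[OF kM ghom_comp[OF q i] ghom_zero[OF kM]]]
  by blast
 also have "... = cls M M (\<lambda>x. inc k (prj k x))"
  by (rule cls_cong[OF MM MM ghom_comp[OF q i]]) (simp add: ghom_in[OF ghom_comp[OF q i]])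
 finally have "cls M M (\<lambda>x. inc k (prj k x)) = cls M M (\<lambda>x. inc k (prj k x) \<oplus>\<^sub>M ?t x)" ..
 also have "... = idm St M" unfolding idm_cls[OF MM]
 proof (rule cls_cong[OF MM MM ghom_id])
  fix x assume x: "x \<in>. M"
  note c = ghom_in[OF i ghom_in[OF q x]]
  show "x = inc k (prj k x) \<oplus>\<^sub>M ?t x" using M.minus_add_cancel[OF x c] c x by (simp add: M.a_comm)
 qed
 finally show thesis by (rule that[OF Ak A[OF k(1)] i q])
qed

text \<open>M is stably a retract of a finite-dimensional block A, and the identity of a compact c
  factors through finitely many blocks of c. So a stable map h from c to M is determined by finitely
  many field elements, the coordinates of q h on the bases of these blocks.\<close>

theorem indecomposable_endofinite:
 assumes M: "indecomposable St M" shows "endofinite TYPE('u) St M" unfolding endofinite_def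
proof (intro conjI allI impI)
 interpret S: preadditive_category St by (rule preadditive_Stab)
 show MO: "M \<in> Ob St" using M by (simp add: indecomposable_def)
 hence MM: "M \<in> Md" by simp
 interpret M: module K M by (rule Md_mod[OF MM])
 obtain A i q where A: "A \<in> Md" "block A" and i: "ghm A M i" and q: "ghm M A q"
  and id: "cls M M (\<lambda>x. i (q x)) = idm St M" by (rule indecomposable_retract_block[OF M]) (rule that)
 obtain d u v where db: "dual_basis A d u v" using A(2) by (auto simp: block_def)
 fix c assume cc: "compact_object TYPE('u) St c"
 hence cO: "c \<in> Ob St" by (simp add: compact_object_def)
 hence c: "c \<in> Md" by simp
 interpret c: module K c by (rule Md_mod[OF c])
 obtain I :: "'u set" and B inc prj where I: "small TYPE('u) I" and D: "dsum c I B inc prj" and B: "\<And>i. i \<in> I ==> block (B i)"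
  by (rule block_decomposition[OF c]) (rule that)
 note dd = dsumD[OF D]
 interpret H: comm_group "hom_group St c c" by (rule S.comm_group_hom[OF cO cO])
 let ?s = "\<lambda>\<phi>. {i\<in>I. \<phi> i \<noteq> zerom St c (B i)}"
 \<comment> \<open>Compactness applied to the decomposition of c itself: the identity is a finite
   sum through the blocks.\<close>
 have "idm St c \<in> (\<lambda>\<phi>. finprod (hom_group St c c) (\<lambda>i. cls (B i) c (inc i) \<bullet>\<^sub>St \<phi> i) (?s \<phi>)) `
   {\<phi> \<in> (\<Pi>\<^sub>E i\<in>I. Mor St c (B i)). finite (?s \<phi>)}"
  using cc I dsum_coproduct[OF D] S.idm_closed[OF cO] unfolding compact_object_def bij_betw_def by blast
 then obtain \<phi> where \<phi>: "\<phi> \<in> (\<Pi>\<^sub>E i\<in>I. Mor St c (B i))" "finite (?s \<phi>)"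
  "idm St c = finprod (hom_group St c c) (\<lambda>i. cls (B i) c (inc i) \<bullet>\<^sub>St \<phi> i) (?s \<phi>)" by blast
 define F where "F = ?s \<phi>"
 have F: "finite F" "\<And>i. i \<in> F ==> i \<in> I" using \<phi>(2) by (auto simp: F_def)
 have "\<forall>i\<in>F. \<exists>f. ghm c (B i) f \<and> \<phi> i = cls c (B i) f"
 proof
  fix i assume "i \<in> F"
  hence i: "i \<in> I" by (rule F(2))
  have "\<phi> i \<in> Mor St c (B i)" using \<phi>(1) i by blast
  thus "\<exists>f. ghm c (B i) f \<and> \<phi> i = cls c (B i) f" by (rule morE[OF c dd(3)[OF i]]) blast
 qed
 from bchoice[OF this] obtain f where f: "\<And>i. i \<in> F ==> ghm c (B i) (f i)" "\<And>i. i \<in> F ==> \<phi> i = cls c (B i) (f i)"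
  by blast
 have fi: "ghm c c (\<lambda>x. inc i (f i x))" if "i \<in> F" for i by (rule ghom_comp[OF f(1)[OF that] dd(4)[OF F(2)[OF that]]])
 let ?J = "\<lambda>x. \<Oplus>\<^sub>c i\<in>F. inc i (f i x)"
 have J: "ghm c c ?J" by (rule cls_finsum(1)[OF c c]) (rule fi)
 have "idm St c = finprod (hom_group St c c) (\<lambda>i. cls c c (\<lambda>x. inc i (f i x))) F"
  unfolding \<phi>(3) F_def[symmetric]
 proof (rule H.finprod_cong')
  fix i assume i: "i \<in> F"
  show "cls (B i) c (inc i) \<bullet>\<^sub>St \<phi> i = cls c c (\<lambda>x. inc i (f i x))"
   unfolding f(2)[OF i] by (rule cmp_cls[OF c dd(3)[OF F(2)[OF i]] c f(1)[OF i] dd(4)[OF F(2)[OF i]]])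
 qed (use cls_mor[OF c c fi] in \<open>auto simp: hom_group_simps\<close>)
 also have "... = cls c c ?J" by (rule cls_finsum(2)[OF c c]) (rule fi)
 finally have idJ: "idm St c = cls c c ?J" .
 have "\<forall>i\<in>F. \<exists>d u v. dual_basis (B i) d u v" using B F(2) unfolding block_def by blast
 then obtain e b w where dbB: "\<And>i. i \<in> F ==> dual_basis (B i) (e i) (b i) (w i)" by metis
 \<comment> \<open>Triples of a block of c, a basis vector of that block and a coordinate of
   A.\<close>
 define E where "E = (SIGMA k:F. {..<e k} \<times> {..<d})"
 have "finite E" unfolding E_def using F by blast
 then obtain en where en: "bij_betw en {..<card E} E" using ex_bij_betw_nat_finite[of E] by (auto simp: atLeast0LessThan)
 define \<chi> where "\<chi> j h = (case en j of (k, m, l) => v l (q (h (inc k (b k m)))))" for j and h :: "'u => 'u"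
 have v: "functional K A (v l)" and u: "u l \<in>. A" if "l < d" for l using db that by (simp_all add: dual_basis_def)
 have bB: "b k m \<in>. (B k)" and w: "functional K (B k) (w k m)" if "k \<in> F" "m < e k" for k m
  using dbB[OF that(1)] that(2) by (simp_all add: dual_basis_def)
 have bc: "inc k (b k m) \<in>. c" if "k \<in> F" "m < e k" for k m
  by (rule ghom_in[OF dd(4)[OF F(2)[OF that(1)]] bB[OF that]])
 have en_in: "\<exists>k m l. en j = (k, m, l) \<and> k \<in> F \<and> m < e k \<and> l < d" if "j < card E" for j
 proof -
  have "en j \<in> E" using bij_betwE[OF en] that by simp
  thus ?thesis by (cases "en j") (simp add: E_def)
 qed
 have vq: "functional K M (\<lambda>x. v l (q x))" if "l < d" for l by (rule lin_comp[OF ghom_lin[OF q] v[OF that]])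
 show "hom_finite_length St c M"
 proof (rule hom_finite_length_coordinates[OF c MM, of "card E" \<chi>])
  fix h j assume h: "ghm c M h" and j: "j < card E"
  obtain k m l where j': "en j = (k, m, l)" "k \<in> F" "m < e k" "l < d" using en_in[OF j] by blast
  note hc = ghom_in[OF h bc[OF j'(2,3)]]
  show "\<chi> j h \<in>. K" using lin_in[OF vq[OF j'(4)] hc] j'(1) by (simp add: \<chi>_def)
  fix h' a assume h': "ghm c M h'" and a: "a \<in>. K"
  note hc' = ghom_in[OF h' bc[OF j'(2,3)]]
  show "\<chi> j (\<lambda>x. h x \<oplus>\<^sub>M a \<odot>\<^sub>M h' x) = \<chi> j h \<oplus>\<^sub>K a \<otimes>\<^sub>K \<chi> j h'"
   using lin_add[OF vq[OF j'(4)] hc M.smult_closed[OF a hc']] lin_smult[OF vq[OF j'(4)] a hc'] j'(1) by (simp add: \<chi>_def)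
 next
  fix h assume h: "ghm c M h" and z: "\<And>j. j < card E ==> \<chi> j h = \<zero>\<^sub>K"
  interpret A: module K A by (rule Md_mod[OF A(1)])
  have qb: "q (h (inc k (b k m))) = \<zero>\<^sub>A" if km: "k \<in> F" "m < e k" for k m
  proof -
   have zl: "v l (q (h (inc k (b k m)))) = \<zero>\<^sub>K" if "l < d" for l
   proof -
    have "(k, m, l) \<in> E" using km that by (simp add: E_def)
    then obtain j where "j < card E" "en j = (k, m, l)" using en unfolding bij_betw_def by (metis imageE lessThan_iff)
    thus ?thesis using z[of j] by (simp add: \<chi>_def)
   qed
   have "q (h (inc k (b k m))) = (\<Oplus>\<^sub>A l\<in>{..<d}. v l (q (h (inc k (b k m)))) \<odot>\<^sub>A u l)"
    using db ghom_in[OF q ghom_in[OF h bc[OF km]]] unfolding dual_basis_def by blast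
   also have "... = \<zero>\<^sub>A" using zl u by (intro A.add.finprod_one_eqI) simp
   finally show ?thesis .
  qed
  have qh: "q (h (inc k y)) = \<zero>\<^sub>A" if k: "k \<in> F" and y: "y \<in>. (B k)" for k y
  proof -
   interpret Bk: module K "B k" by (rule Md_mod[OF dd(3)[OF F(2)[OF k]]])
   have l: "lin K (B k) A (\<lambda>y. q (h (inc k y)))"
    by (rule ghom_lin[OF ghom_comp[OF ghom_comp[OF dd(4)[OF F(2)[OF k]] h] q]])
   note Q = Bk.subsp_kernel[OF l A.modl]
   have "(\<Oplus>\<^bsub>B k\<^esub>m\<in>{..<e k}. w k m y \<odot>\<^bsub>B k\<^esub> b k m) \<in> {y \<in> carrier (B k). q (h (inc k y)) = \<zero>\<^sub>A}"
    by (rule Bk.sub_finsum[OF Q], rule Pi_I, rule Bk.sub_smult[OF Q]) (use lin_in[OF w[OF k] y] bB[OF k] qb[OF k] in auto)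
   moreover have "y = (\<Oplus>\<^bsub>B k\<^esub>m\<in>{..<e k}. w k m y \<odot>\<^bsub>B k\<^esub> b k m)" using dbB[OF k] y unfolding dual_basis_def by blast
   ultimately show ?thesis by simp
  qed
  note hm = cls_mor[OF c MM h] and l = ghom_comp[OF ghom_comp[OF h q] i]
  \<comment> \<open>Stably h equals i q h \<open>?J\<close>, and the vanishing coordinates kill q h
    on every block that occurs in \<open>?J\<close>.\<close>
  have "cls c M h = idm St M \<bullet>\<^sub>St cls c M h \<bullet>\<^sub>St idm St c"
   using S.idm_left[OF cO MO hm] S.idm_right[OF cO MO hm] by simp
  also have "... = cls c M (\<lambda>x. i (q (h (?J x))))"
   unfolding id[symmetric] idJ cmp_cls[OF c c MM J h] cmp_cls[OF c MM MM ghom_comp[OF J h] ghom_comp[OF q i]] ..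
  also have "... = cls c M (\<lambda>x. \<zero>\<^sub>M)"
  proof (rule cls_cong[OF c MM ghom_zero[OF Md_kmod[OF MM]]])
   fix x assume x: "x \<in>. c"
   have "i (q (h (?J x))) = (\<Oplus>\<^sub>M k\<in>F. i (q (h (inc k (f k x)))))"
    using ghom_in[OF fi x] by (intro lin_finsum[OF ghom_lin[OF l] c.modl M.modl]) auto
   also have "... = \<zero>\<^sub>M" using qh ghom_in[OF f(1) x] lin_zero[OF ghom_lin[OF i] A.modl M.modl]
    by (intro M.add.finprod_one_eqI) simp
   finally show "\<zero>\<^sub>M = i (q (h (?J x)))" by simp
  qed
  finally show "cls c M h = zerom St c M" by (simp add: zerom_cls)
 qed
qed

end

section \<open>Tensor products\<close>

lemma (in abelian_monoid) finsum_swap: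
 assumes "finite A" "finite B" "\<And>a b. a \<in> A ==> b \<in> B ==> f a b \<in>. G"
 shows "(\<Oplus>a\<in>A. \<Oplus>b\<in>B. f a b) = (\<Oplus>b\<in>B. \<Oplus>a\<in>A. f a b)" using assms(1,3)
proof (induction A rule: finite_induct)
 case empty thus ?case by simp
next
 case (insert x A)
 have "(\<Oplus>a\<in>insert x A. \<Oplus>b\<in>B. f a b) = (\<Oplus>b\<in>B. f x b) \<oplus> (\<Oplus>b\<in>B. \<Oplus>a\<in>A. f a b)"
  using insert assms(2) by (subst finsum_insert) (auto intro!: finsum_closed)
 also have "... = (\<Oplus>b\<in>B. f x b \<oplus> (\<Oplus>a\<in>A. f a b))"
  using insert by (intro finsum_addf[symmetric]) (auto intro!: finsum_closed)
 also have "... = (\<Oplus>b\<in>B. \<Oplus>a\<in>insert x A. f a b)"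
  using insert by (intro finsum_cong') (auto intro!: finsum_closed)
 finally show ?case .
qed

text \<open>Bilinearity without extensionality, in the same relation to \<open>bilinear_map\<close>
  as \<open>lin\<close> to \<open>lin_maps\<close>.\<close>

definition bil ::
 "('k, 'x) ring_scheme => ('k, 'a, 'y) module_scheme => ('k, 'b, 'z) module_scheme =>
  ('k, 'c, 'v) module_scheme => ('a => 'b => 'c) => bool" where
 "bil K M N V \<beta> \<longleftrightarrow> (\<forall>x\<in>carrier M. lin K N V (\<beta> x)) \<and> (\<forall>y\<in>carrier N. lin K M V (\<lambda>x. \<beta> x y))"

lemma bilD: "bil K M N V \<beta> ==> x \<in>. M ==> lin K N V (\<beta> x)"
 "bil K M N V \<beta> ==> y \<in>. N ==> lin K M V (\<lambda>x. \<beta> x y)" by (auto simp: bil_def)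

lemma bil_closed: "bil K M N V \<beta> ==> x \<in>. M ==> y \<in>. N ==> \<beta> x y \<in>. V"
 using bilD(1) lin_in by metis

lemma bil_comp:
 assumes "bil K M N V \<beta>" "lin K M' M f" "lin K N' N g" "lin K V V' h"
 shows "bil K M' N' V' (\<lambda>x y. h (\<beta> (f x) (g y)))" unfolding bil_def
proof (intro conjI ballI)
 fix x assume "x \<in>. M'"
 thus "lin K N' V' (\<lambda>y. h (\<beta> (f x) (g y)))"
  by (intro lin_comp[OF lin_comp[OF assms(3) bilD(1)[OF assms(1)]] assms(4)] lin_in[OF assms(2)])
next
 fix y assume "y \<in>. N'"
 thus "lin K M' V' (\<lambda>x. h (\<beta> (f x) (g y)))"
  by (intro lin_comp[OF lin_comp[OF assms(2) bilD(2)[OF assms(1)]] assms(4)] lin_in[OF assms(3)])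
qed

lemma bil_functional:
 assumes "functional K M f" "lin K N V g" "module K V" shows "bil K M N V (\<lambda>x y. f x \<odot>\<^sub>V g y)"
 unfolding bil_def
proof (intro conjI ballI)
 fix x assume "x \<in>. M"
 hence "f x \<in>. K" using lin_in[OF assms(1)] by simp
 thus "lin K N V (\<lambda>y. f x \<odot>\<^sub>V g y)" by (rule lin_scale[OF assms(2) _ assms(3)])
next
 fix y assume "y \<in>. N"
 thus "lin K M V (\<lambda>x. f x \<odot>\<^sub>V g y)" by (intro lin_functional_smult assms lin_in[OF assms(2)])
qed

lemma lin_maps_restrict:
 assumes "module K M" shows "restrict f (carrier M) \<in> lin_maps K M N \<longleftrightarrow> lin K M N f"
proof -
 interpret M: module K M by fact
 show ?thesis by (auto simp: lin_maps_def lin_def)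
qed

lemma lin_maps_lin: "f \<in> lin_maps K M N ==> lin K M N f"
 by (auto simp: lin_maps_def lin_def)

lemma bilinear_map_iff:
 assumes "module K M" "module K N" shows "bilinear_map K M N V \<beta> \<longleftrightarrow> bil K M N V \<beta>"
 by (simp add: bilinear_map_def bil_def lin_maps_restrict assms)

text \<open>The universal property in \<open>is_tensor_product\<close> is stated for plain
  \<open>module\<close> records; truncation makes it usable for targets with further fields, such as
  an action.\<close>

lemma lin_truncate: "lin K M (module.truncate V) f \<longleftrightarrow> lin K M V f"
 by (simp add: lin_def module.truncate_def)

lemma module_truncate: "module K V ==> module K (module.truncate V)"
proof -
 assume "module K V"
 then interpret V: module K V .
 have s: "carrier (module.truncate V) = carrier V" "\<zero>\<^bsub>module.truncate V\<^esub> = \<zero>\<^sub>V"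
  "\<And>x y. x \<oplus>\<^bsub>module.truncate V\<^esub> y = x \<oplus>\<^sub>V y" "\<And>a x. a \<odot>\<^bsub>module.truncate V\<^esub> x = a \<odot>\<^sub>V x"
  by (simp_all add: module.truncate_def)
 show ?thesis
 proof (rule moduleI[OF V.R.is_cring])
  show "abelian_group (module.truncate V)"
  proof (rule abelian_groupI)
   fix x assume "x \<in>. (module.truncate V)"
   thus "\<exists>y\<in>carrier (module.truncate V). y \<oplus>\<^bsub>module.truncate V\<^esub> x = \<zero>\<^bsub>module.truncate V\<^esub>"
    by (intro bexI[of _ "\<ominus>\<^sub>V x"]) (auto simp: s V.l_neg)
  qed (auto simp: s V.M.a_ac)
 qed (auto simp: s V.smult_l_distr V.smult_r_distr V.smult_assoc1)
qed

context module
begin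

lemma lsum_basis:
 assumes B: "B \<subseteq> carrier M" "spn B = carrier M" and \<chi>: "\<And>b. b \<in> B ==> functional R M (\<chi> b)"
  "\<And>b b'. b \<in> B ==> b' \<in> B ==> \<chi> b b' = (if b = b' then \<one> else \<zero>)"
 shows "lsum R M B (\<lambda>_. Kv R) (\<lambda>b a. a \<odot>\<^sub>M b) \<chi>"
proof (rule lsum.intro[OF module_axioms lsum_axioms.intro])
 show "module R (Kv R)" by (rule module_Kmod[OF R.is_cring])
 show "lin R (Kv R) M (\<lambda>a. a \<odot>\<^sub>M b)" if "b \<in> B" for b
  using that B(1) by (intro lin_smult_vec module_axioms) auto
 show "functional R M (\<chi> b)" if "b \<in> B" for b by (rule \<chi>(1)[OF that])
 show "\<chi> b (a \<odot>\<^sub>M b) = a" if "b \<in> B" "a \<in>. Kv R" for a b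
  using that B(1) by (subst lin_smult[OF \<chi>(1)]) (auto simp: \<chi>(2))
 show "\<chi> b' (a \<odot>\<^sub>M b) = \<zero>\<^bsub>Kv R\<^esub>"
  if "b \<in> B" "b' \<in> B" "b \<noteq> b'" "a \<in>. Kv R" for a b b'
  using that B(1) by (subst lin_smult[OF \<chi>(1)]) (auto simp: \<chi>(2))
 fix H y assume H: "subsp H" and inc: "\<And>b a. b \<in> B ==> a \<in>. Kv R ==> a \<odot>\<^sub>M b \<in> H"
  and y: "y \<in>. M"
 have "B \<subseteq> H"
 proof
  fix b assume b: "b \<in> B"
  have "\<one> \<odot>\<^sub>M b \<in> H" by (rule inc[OF b]) simp
  thus "b \<in> H" using b B(1) by auto
 qed
 thus "y \<in> H" using spn_minimal[OF H] B(2) y by blast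
qed

end

context stab
begin

text \<open>In terms of a basis B of M, the tensor product consists of the functions of finite
  support from B to N, and \<open>\<tau> x y\<close> has at b the value (b-coordinate of x) times
  y.\<close>

lemma ex_tensor_product:
 assumes M: "M \<in> Md" and N: "N \<in> Md"
 shows "\<exists>T \<tau>. is_tensor_product G K M N T \<tau>"
proof -
 interpret M: module K M by (rule Md_mod[OF M])
 interpret N: module K N by (rule Md_mod[OF N])
 note kM = Md_kmod[OF M] and kN = Md_kmod[OF N]
 obtain B \<chi> where B: "B \<subseteq> carrier M" "M.spn B = carrier M" and \<chi>: "\<And>b. b \<in> B ==> functional K M (\<chi> b)"
  "\<And>b b'. b \<in> B ==> b' \<in> B ==> \<chi> b b' = (if b = b' then \<one>\<^sub>K else \<zero>\<^sub>K)"
  by (rule M.ex_basis[OF K.field_axioms]) (rule that)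
 have L: "lsum K M B (\<lambda>_. Kv K) (\<lambda>b a. a \<odot>\<^sub>M b) \<chi>"
  by (rule M.lsum_basis[OF B]) (rule \<chi>, assumption+)+
 interpret L: lsum K M B "\<lambda>_. Kv K" "\<lambda>b a. a \<odot>\<^sub>M b" \<chi> by (rule L)
 let ?C = "fsum_carrier B (\<lambda>_. N)"
 \<comment> \<open>The action is a parameter, since it is constructed afterwards from the universal
   property, which involves the module structure alone.\<close>
 define T :: "('g => ('u => 'u) => 'u => 'u) => ('g, 'k, 'u => 'u) gmod" where "T r = fmod B (\<lambda>_. N) ?C r" for r
 let ?inc = "\<lambda>b x. \<lambda>j\<in>B. if j = b then x else \<zero>\<^sub>N"
 have T: "lsum K (T r) B (\<lambda>_. N) ?inc (\<lambda>b x. x b)" for r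
  unfolding T_def by (rule lsum_fmod[OF K.is_cring N.modl])
 define \<tau> where "\<tau> x y = (\<lambda>b\<in>B. \<chi> b x \<odot>\<^sub>N y)" for x y
 have \<chi>c: "\<chi> b x \<in>. K" if "b \<in> B" "x \<in>. M" for b x using lin_in[OF \<chi>(1)[OF that(1)] that(2)] by simp
 have \<tau>C: "\<tau> x y \<in> ?C" if x: "x \<in>. M" and y: "y \<in>. N" for x y
 proof -
  have "{b \<in> B. \<tau> x y b \<noteq> \<zero>\<^sub>N} \<subseteq> L.supp x" using y by (auto simp: \<tau>_def L.supp_def)
  hence "finite {b \<in> B. \<tau> x y b \<noteq> \<zero>\<^sub>N}" using L.finite_supp[OF x] by (rule finite_subset)
  thus ?thesis using \<chi>c x y by (auto simp: fsum_carrier_def \<tau>_def)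
 qed
 have \<tau>bil: "bil K M N (T r) \<tau>" for r unfolding bil_def T_def using \<tau>C \<chi>c
  by (auto intro!: linI restrict_ext simp: \<tau>_def N.smult_r_distr N.smult_l_distr K.m_comm lin_add[OF \<chi>(1)] lin_smult[OF \<chi>(1)]
    simp flip: N.smult_assoc1)
 have \<tau>b: "\<tau> b y = ?inc b y" if "b \<in> B" "y \<in>. N" for b y
  using that by (auto simp: \<tau>_def \<chi>(2) intro!: restrict_ext)
 have ext: "f z = g z" if V: "module K V" and fg: "lin K (T r) V f" "lin K (T r) V g"
  "\<And>x y. x \<in>. M ==> y \<in>. N ==> f (\<tau> x y) = g (\<tau> x y)" and z: "z \<in> ?C"
  for V :: "('k, 'v, 'z) module_scheme" and r f g z
 proof -
  interpret T: lsum K "T r" B "\<lambda>_. N" ?inc "\<lambda>b x. x b" by (rule T)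
  show ?thesis
  proof (rule T.lin_ext[OF fg(1,2) V])
   fix b y assume "b \<in> B" "y \<in>. N"
   thus "f (?inc b y) = g (?inc b y)" using fg(3)[of b y] B(1) \<tau>b by auto
  qed (use z in \<open>simp add: T_def\<close>)
 qed
 have univT: "\<exists>h. lin K (T r) V h \<and> (\<forall>x\<in>carrier M. \<forall>y\<in>carrier N. h (\<tau> x y) = \<beta> x y)"
  if V: "module K V" and \<beta>: "bil K M N V \<beta>" for V :: "('k, 'v, 'z) module_scheme" and r \<beta>
 proof -
  interpret T: lsum K "T r" B "\<lambda>_. N" ?inc "\<lambda>b x. x b" by (rule T)
  have l: "lin K N V (\<beta> b)" if "b \<in> B" for b using bilD(1)[OF \<beta>] B(1) that by auto
  have g: "lin K (T r) V (T.gather V \<beta>)" by (rule T.lin_gather[OF V]) (rule l)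
  have gi: "T.gather V \<beta> (\<tau> b y) = \<beta> b y" if "b \<in> B" "y \<in>. N" for b y
   unfolding \<tau>b[OF that] by (rule T.gather_inc[OF V _ that]) (rule l)
  have "T.gather V \<beta> (\<tau> x y) = \<beta> x y" if x: "x \<in>. M" and y: "y \<in>. N" for x y
   by (rule M.lin_eq_on_spn[OF lin_comp[OF bilD(2)[OF \<tau>bil y] g] bilD(2)[OF \<beta> y] V B(1)])
    (use gi y x B(2) in auto)
  thus ?thesis using g by blast
 qed
 \<comment> \<open>The diagonal action of g, induced by the bilinear map that sends x and y to
   \<tau> (g x) (g y); the action stored in \<open>T undefined\<close> is a placeholder.\<close>
 have "\<exists>A. lin K (T undefined) (T undefined) A \<and> (\<forall>x\<in>carrier M. \<forall>y\<in>carrier N. A (\<tau> x y) = \<tau> (act M g x) (act N g y))"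
  if g: "g \<in>. G" for g
  by (rule univT[OF lsum.axioms(1)[OF T] bil_comp[OF \<tau>bil act_lin[OF kM g] act_lin[OF kN g] lin_id]])
 hence "\<forall>g\<in>carrier G. \<exists>A. lin K (T undefined) (T undefined) A \<and> (\<forall>x\<in>carrier M. \<forall>y\<in>carrier N. A (\<tau> x y) = \<tau> (act M g x) (act N g y))"
  by blast
 from bchoice[OF this] obtain r where r0: "\<And>g. g \<in>. G ==> lin K (T undefined) (T undefined) (r g)"
  "\<And>g x y. g \<in>. G ==> x \<in>. M ==> y \<in>. N ==> r g (\<tau> x y) = \<tau> (act M g x) (act N g y)" by blast
 have r: "lin K (T r) (T r) (r g)" if "g \<in>. G" for g using r0(1)[OF that] by (simp add: lin_def T_def)
 have Tc: "carrier (T r) = ?C" "act (T r) = r" by (simp_all add: T_def)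
 have mT: "module K (T r)" by (rule lsum.axioms(1)[OF T])
 interpret T: module K "T r" by (rule mT)
 have kT: "kmod (T r)"
 proof (rule kG_moduleI[OF mT])
  show "lin K (T r) (T r) (act (T r) g)" if "g \<in>. G" for g unfolding Tc by (rule r[OF that])
  show "act (T r) \<one>\<^sub>G z = z" if "z \<in>. (T r)" for z
   unfolding Tc by (rule ext[OF mT r lin_id]) (use that in \<open>auto simp: r0(2) act_one[OF kM] act_one[OF kN] Tc\<close>)
  show "act (T r) (g \<otimes>\<^sub>G h) z = act (T r) g (act (T r) h z)"
   if g: "g \<in>. G" "h \<in>. G" and z: "z \<in>. (T r)" for g h z unfolding Tc
   by (rule ext[OF mT r[OF G.m_closed[OF g]] lin_comp[OF r[OF g(2)] r[OF g(1)]]])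
    (use g z in \<open>auto simp: r0(2) act_mult[OF kM] act_mult[OF kN] act_in[OF kM] act_in[OF kN] Tc\<close>)
 qed
 have "small TYPE('u) (carrier (T r))" unfolding Tc fsum_carrier_def by (rule small_finsupp[OF univ])
   (use small_subset[OF Md_small[OF M] B(1)] Md_small[OF N] in auto)
 then obtain T' :: "('g, 'k, 'u) gmod" and f f' where T': "T' \<in> Md" "giso G K (T r) T' f f'"
  by (rule transport[OF kT]) (rule that)
 have f: "ghm (T r) T' f" "ghm T' (T r) f'" "\<And>x. x \<in>. (T r) ==> f' (f x) = x"
  "\<And>y. y \<in>. T' ==> f (f' y) = y" using T'(2) unfolding giso_def by blast+
 let ?\<tau> = "\<lambda>x y. f (\<tau> x y)"
 have \<tau>T: "\<tau> x y \<in>. (T r)" if "x \<in>. M" "y \<in>. N" for x y using \<tau>C[OF that] by (simp add: Tc)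
 have "is_tensor_product G K M N T' ?\<tau>" unfolding is_tensor_product_def bilinear_map_iff[OF M.modl N.modl]
 proof (intro conjI ballI allI impI T'(1))
  show "bil K M N T' ?\<tau>" by (rule bil_comp[OF \<tau>bil lin_id lin_id ghom_lin[OF f(1)]])
  show "act T' g (?\<tau> x y) = ?\<tau> (act M g x) (act N g y)" if "g \<in>. G" "x \<in>. M" "y \<in>. N" for g x y
   using ghom_act[OF f(1) that(1) \<tau>T[OF that(2,3)]] r0(2)[OF that] by (simp add: Tc)
  fix V :: "('k, 'u) module" and \<beta> assume "module K V \<and> bil K M N V \<beta>"
  hence V: "module K V" and \<beta>: "bil K M N V \<beta>" by auto
  obtain h where h: "lin K (T r) V h" "\<And>x y. x \<in>. M ==> y \<in>. N ==> h (\<tau> x y) = \<beta> x y"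
   using univT[OF V \<beta>] by blast
  let ?h = "restrict (\<lambda>z. h (f' z)) (carrier T')"
  have hl: "lin K T' V (\<lambda>z. h (f' z))" by (rule lin_comp[OF ghom_lin[OF f(2)] h(1)])
  show "\<exists>!h. h \<in> lin_maps K T' V \<and> (\<forall>x\<in>carrier M. \<forall>y\<in>carrier N. h (f (\<tau> x y)) = \<beta> x y)"
  proof (rule ex1I[of _ ?h], intro conjI ballI)
   show "?h \<in> lin_maps K T' V" using hl lin_maps_restrict[OF Md_mod[OF T'(1)]] by blast
   show "?h (f (\<tau> x y)) = \<beta> x y" if "x \<in>. M" "y \<in>. N" for x y
    using \<tau>T[OF that] f(3) h(2)[OF that] ghom_in[OF f(1)] by simp
  next
   fix k assume k: "k \<in> lin_maps K T' V \<and> (\<forall>x\<in>carrier M. \<forall>y\<in>carrier N. k (f (\<tau> x y)) = \<beta> x y)"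
   hence kl: "lin K T' V k" and ke: "k \<in> extensional (carrier T')" using lin_maps_lin by (auto simp: lin_maps_def PiE_def)
   show "k = ?h"
   proof (rule extensionalityI[OF ke])
    fix z assume z: "z \<in>. T'"
    have "k (f (f' z)) = h (f' z)"
     by (rule ext[OF V lin_comp[OF ghom_lin[OF f(1)] kl] h(1)]) (use k h(2) ghom_in[OF f(2) z] in \<open>auto simp: Tc\<close>)
    thus "k z = ?h z" using z f(4) by simp
   qed simp
  qed
 qed
 thus ?thesis by blast
qed

abbreviation tm where "tm M N \<equiv> tensor_mod G K M N"
abbreviation pt where "pt M N \<equiv> pure_tensor G K M N"

context
 fixes M N :: "('g, 'k, 'u) gmod"
 assumes M: "M \<in> Md" and N: "N \<in> Md"
begin

private lemma is_tensor: "is_tensor_product G K M N (tm M N) (pt M N)"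
proof -
 have "case tensor_pair G K M N of (T, \<tau>) => is_tensor_product G K M N T \<tau>"
  unfolding tensor_pair_def by (rule someI_ex) (use ex_tensor_product[OF M N] in auto)
 thus ?thesis by (simp add: tensor_mod_def pure_tensor_def case_prod_beta)
qed

lemma tm_Md: "tm M N \<in> Md"
 using is_tensor by (simp add: is_tensor_product_def)

lemma pt_bil: "bil K M N (tm M N) (pt M N)"
 using is_tensor by (simp add: is_tensor_product_def bilinear_map_iff Md_mod M N)

lemma pt_in: "x \<in>. M ==> y \<in>. N ==> pt M N x y \<in>. (tm M N)"
 by (rule bil_closed[OF pt_bil])

lemma pt_act: "g \<in>. G ==> x \<in>. M ==> y \<in>. N ==>
  act (tm M N) g (pt M N x y) = pt M N (act M g x) (act N g y)" using is_tensor by (simp add: is_tensor_product_def)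

context
 fixes V :: "('k, 'u, 'v) module_scheme"
 assumes V: "module K V"
begin

private lemma univ1:
 assumes "bil K M N V \<beta>"
 shows "\<exists>!h. h \<in> lin_maps K (tm M N) (module.truncate V) \<and> (\<forall>x\<in>carrier M. \<forall>y\<in>carrier N. h (pt M N x y) = \<beta> x y)"
proof -
 have "bilinear_map K M N (module.truncate V) \<beta>"
  using assms unfolding bilinear_map_iff[OF Md_mod[OF M] Md_mod[OF N]] bil_def lin_truncate .
 thus ?thesis using is_tensor module_truncate[OF V] unfolding is_tensor_product_def by blast
qed

lemma tensor_univ:
 assumes "bil K M N V \<beta>"
 obtains h where "lin K (tm M N) V h" "\<And>x y. x \<in>. M ==> y \<in>. N ==> h (pt M N x y) = \<beta> x y"
proof -
 obtain h where h: "h \<in> lin_maps K (tm M N) (module.truncate V)"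
  "\<And>x y. x \<in>. M ==> y \<in>. N ==> h (pt M N x y) = \<beta> x y"
  using ex1_implies_ex[OF univ1[OF assms]] by blast
 show thesis by (rule that[OF _ h(2)]) (use lin_maps_lin[OF h(1)] in \<open>simp_all add: lin_truncate\<close>)
qed

text \<open>Both restrictions are the unique map induced by the same bilinear map.\<close>

lemma tensor_ext:
 assumes f: "lin K (tm M N) V f" and g: "lin K (tm M N) V g"
  and eq: "\<And>x y. x \<in>. M ==> y \<in>. N ==> f (pt M N x y) = g (pt M N x y)"
  and z: "z \<in>. (tm M N)"
 shows "f z = g z"
proof -
 let ?r = "\<lambda>f. restrict f (carrier (tm M N))"
 have "bil K M N V (\<lambda>x y. f (pt M N x y))" by (rule bil_comp[OF pt_bil lin_id lin_id f])
 from univ1[OF this] have "?r f = ?r g"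
 proof (rule ex1E)
  fix h assume u: "\<forall>h'. h' \<in> lin_maps K (tm M N) (module.truncate V) \<and>
   (\<forall>x\<in>carrier M. \<forall>y\<in>carrier N. h' (pt M N x y) = f (pt M N x y)) --> h' = h"
  have "?r f \<in> lin_maps K (tm M N) (module.truncate V)" "?r g \<in> lin_maps K (tm M N) (module.truncate V)"
   using f g by (simp_all add: lin_maps_restrict[OF Md_mod[OF tm_Md]] lin_truncate)
  hence "?r f = h" "?r g = h" using u pt_in eq by auto
  thus ?thesis by simp
 qed
 from fun_cong[OF this, of z] show ?thesis using z by simp
qed

end

end

lemma tensor_lin:
 assumes M: "M \<in> Md" "M' \<in> Md" and N: "N \<in> Md" "N' \<in> Md" and f: "lin K M M' f" and g: "lin K N N' g"
 obtains h where "lin K (tm M N) (tm M' N') h"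
  "\<And>x y. x \<in>. M ==> y \<in>. N ==> h (pt M N x y) = pt M' N' (f x) (g y)"
 by (rule tensor_univ[OF M(1) N(1) Md_mod[OF tm_Md[OF M(2) N(2)]] bil_comp[OF pt_bil[OF M(2) N(2)] f g lin_id]])
  (rule that)

text \<open>Unlike \<open>tensor_map\<close>, defined for maps that are merely linear, as required
  for the witnesses of traces.\<close>

definition tmap where
 "tmap M M' N N' f g = (SOME h. lin K (tm M N) (tm M' N') h \<and>
  (\<forall>x\<in>carrier M. \<forall>y\<in>carrier N. h (pt M N x y) = pt M' N' (f x) (g y)))"

context
 fixes M M' N N' :: "('g, 'k, 'u) gmod"
 assumes M: "M \<in> Md" "M' \<in> Md" and N: "N \<in> Md" "N' \<in> Md"
begin

lemma
 assumes f: "lin K M M' f" and g: "lin K N N' g"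
 shows lin_tmap: "lin K (tm M N) (tm M' N') (tmap M M' N N' f g)"
  and tmap_pt: "x \<in>. M ==> y \<in>. N ==> tmap M M' N N' f g (pt M N x y) = pt M' N' (f x) (g y)"
proof -
 have "\<exists>h. lin K (tm M N) (tm M' N') h \<and> (\<forall>x\<in>carrier M. \<forall>y\<in>carrier N. h (pt M N x y) = pt M' N' (f x) (g y))"
  by (rule tensor_lin[OF M N f g]) blast
 from someI_ex[OF this] show "lin K (tm M N) (tm M' N') (tmap M M' N N' f g)"
  "x \<in>. M ==> y \<in>. N ==> tmap M M' N N' f g (pt M N x y) = pt M' N' (f x) (g y)" unfolding tmap_def by blast+
qed

lemma ghom_tmap:
 assumes f: "ghom G K M M' f" and g: "ghom G K N N' g"
 shows "ghom G K (tm M N) (tm M' N') (tmap M M' N N' f g)"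
proof (rule ghomI)
 note fl = ghom_lin[OF f] and gl = ghom_lin[OF g]
 show l: "lin K (tm M N) (tm M' N') (tmap M M' N N' f g)" by (rule lin_tmap[OF fl gl])
 note T = tm_Md[OF M(1) N(1)] and T' = tm_Md[OF M(2) N(2)]
 fix k z assume k: "k \<in>. G" and z: "z \<in>. (tm M N)"
 show "tmap M M' N N' f g (act (tm M N) k z) = act (tm M' N') k (tmap M M' N N' f g z)"
 proof (rule tensor_ext[OF M(1) N(1) Md_mod[OF T'] lin_comp[OF act_lin[OF Md_kmod[OF T] k] l] lin_comp[OF l act_lin[OF Md_kmod[OF T'] k]] _ z])
  fix x y assume x: "x \<in>. M" and y: "y \<in>. N"
  show "tmap M M' N N' f g (act (tm M N) k (pt M N x y)) = act (tm M' N') k (tmap M M' N N' f g (pt M N x y))"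
   using k x y act_in[OF Md_kmod[OF M(1)] k x] act_in[OF Md_kmod[OF N(1)] k y] ghom_in[OF f x] ghom_in[OF g y]
   by (simp add: pt_act M N tmap_pt[OF fl gl] ghom_act[OF f] ghom_act[OF g])
 qed
qed

text \<open>The projection formula Tr(h \<otimes> g) = Tr(h) \<otimes> g for equivariant g:
  conjugation by a group element leaves g alone.\<close>

lemma Tr_tmap_left:
 assumes h: "lin K M M' h" and g: "ghom G K N N' g" and x: "x \<in>. M" and y: "y \<in>. N"
 shows "Tr (tm M N) (tm M' N') (tmap M M' N N' h g) (pt M N x y) = pt M' N' (Tr M M' h x) (g y)"
proof -
 note gl = ghom_lin[OF g]
 note T = tm_Md[OF M(1) N(1)] and T' = tm_Md[OF M(2) N(2)]
 interpret M': module K M' by (rule Md_mod[OF M(2)])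
 interpret T': module K "tm M' N'" by (rule Md_mod[OF T'])
 note tc = lin_in[OF lin_Tr_term[OF Md_kmod[OF M(1)] Md_kmod[OF M(2)] h] x]
 have "Tr (tm M N) (tm M' N') (tmap M M' N N' h g) (pt M N x y) =
   (\<Oplus>\<^bsub>tm M' N'\<^esub>k\<in>carrier G. pt M' N' (act M' k (h (act M (inv\<^bsub>G\<^esub> k) x))) (g y))" unfolding Tr_def
 proof (rule T'.finsum_cong')
  fix k assume k: "k \<in>. G"
  hence ik: "inv\<^bsub>G\<^esub> k \<in>. G" by simp
  note cx = act_in[OF Md_kmod[OF M(1)] ik x] and cy = act_in[OF Md_kmod[OF N(1)] ik y]
  have "act N' k (g (act N (inv\<^bsub>G\<^esub> k) y)) = g y"
   using ghom_act[OF g k cy] act_mult[OF Md_kmod[OF N(1)] k ik y] act_one[OF Md_kmod[OF N(1)] y] k by simp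
  thus "act (tm M' N') k (tmap M M' N N' h g (act (tm M N) (inv\<^bsub>G\<^esub> k) (pt M N x y))) =
    pt M' N' (act M' k (h (act M (inv\<^bsub>G\<^esub> k) x))) (g y)"
   using pt_act[OF M(1) N(1) ik x y] tmap_pt[OF h gl cx cy]
    pt_act[OF M(2) N(2) k lin_in[OF h cx] ghom_in[OF g cy]] by simp
 qed (use pt_in[OF M(2) N(2) tc ghom_in[OF g y]] in auto)
 also have "... = pt M' N' (Tr M M' h x) (g y)" unfolding Tr_def
  using tc by (intro lin_finsum[OF bilD(2)[OF pt_bil[OF M(2) N(2)] ghom_in[OF g y]] M'.module_axioms T'.module_axioms, symmetric]) auto
 finally show ?thesis .
qed

lemma Tr_tmap_right:
 assumes f: "ghom G K M M' f" and h: "lin K N N' h" and x: "x \<in>. M" and y: "y \<in>. N"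
 shows "Tr (tm M N) (tm M' N') (tmap M M' N N' f h) (pt M N x y) = pt M' N' (f x) (Tr N N' h y)"
proof -
 note fl = ghom_lin[OF f]
 note T = tm_Md[OF M(1) N(1)] and T' = tm_Md[OF M(2) N(2)]
 interpret N': module K N' by (rule Md_mod[OF N(2)])
 interpret T': module K "tm M' N'" by (rule Md_mod[OF T'])
 note tc = lin_in[OF lin_Tr_term[OF Md_kmod[OF N(1)] Md_kmod[OF N(2)] h] y]
 have "Tr (tm M N) (tm M' N') (tmap M M' N N' f h) (pt M N x y) =
   (\<Oplus>\<^bsub>tm M' N'\<^esub>k\<in>carrier G. pt M' N' (f x) (act N' k (h (act N (inv\<^bsub>G\<^esub> k) y))))" unfolding Tr_def
 proof (rule T'.finsum_cong')
  fix k assume k: "k \<in>. G"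
  hence ik: "inv\<^bsub>G\<^esub> k \<in>. G" by simp
  note cx = act_in[OF Md_kmod[OF M(1)] ik x] and cy = act_in[OF Md_kmod[OF N(1)] ik y]
  have "act M' k (f (act M (inv\<^bsub>G\<^esub> k) x)) = f x"
   using ghom_act[OF f k cx] act_mult[OF Md_kmod[OF M(1)] k ik x] act_one[OF Md_kmod[OF M(1)] x] k by simp
  thus "act (tm M' N') k (tmap M M' N N' f h (act (tm M N) (inv\<^bsub>G\<^esub> k) (pt M N x y))) =
    pt M' N' (f x) (act N' k (h (act N (inv\<^bsub>G\<^esub> k) y)))"
   using pt_act[OF M(1) N(1) ik x y] tmap_pt[OF fl h cx cy]
    pt_act[OF M(2) N(2) k ghom_in[OF f cx] lin_in[OF h cy]] by simp
 qed (use pt_in[OF M(2) N(2) ghom_in[OF f x] tc] in auto)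
 also have "... = pt M' N' (f x) (Tr N N' h y)" unfolding Tr_def
  using tc by (intro lin_finsum[OF bilD(1)[OF pt_bil[OF M(2) N(2)] ghom_in[OF f x]] N'.module_axioms T'.module_axioms, symmetric]) auto
 finally show ?thesis .
qed

lemma tensor_map_ghom:
 assumes f: "f \<in> kG_hom G K M M'" and g: "g \<in> kG_hom G K N N'"
 shows "ghom G K (tm M N) (tm M' N') (tensor_map G K M M' N N' f g)"
  "tensor_map G K M M' N N' f g \<in> extensional (carrier (tm M N))"
  "x \<in>. M ==> y \<in>. N ==> tensor_map G K M M' N N' f g (pt M N x y) = pt M' N' (f x) (g y)"
proof -
 have fg: "ghom G K M M' f" "ghom G K N N' g" using f g by (simp_all add: kG_hom_iff)
 note T = tm_Md[OF M(1) N(1)] and T' = tm_Md[OF M(2) N(2)]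
 let ?P = "\<lambda>h. h \<in> kG_hom G K (tm M N) (tm M' N') \<and>
  (\<forall>x\<in>carrier M. \<forall>y\<in>carrier N. h (pt M N x y) = pt M' N' (f x) (g y))"
 let ?h = "restrict (tmap M M' N N' f g) (carrier (tm M N))"
 have "?P (tensor_map G K M M' N N' f g)" unfolding tensor_map_def
 proof (rule theI[of ?P ?h])
  show h: "?P ?h"
   using ghom_restrict[OF Md_kmod[OF T] ghom_tmap[OF fg]] pt_in[OF M(1) N(1)] tmap_pt[OF ghom_lin[OF fg(1)] ghom_lin[OF fg(2)]]
   by simp
  fix k assume k: "?P k"
  hence kk: "ghom G K (tm M N) (tm M' N') k" "k \<in> extensional (carrier (tm M N))" by (simp_all add: kG_hom_iff)
  have hg: "ghom G K (tm M N) (tm M' N') ?h" using h by (simp only: kG_hom_iff)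
  show "k = ?h"
  proof (rule extensionalityI[OF kk(2)])
   fix z assume z: "z \<in>. (tm M N)"
   have "k (pt M N x y) = ?h (pt M N x y)" if "x \<in>. M" "y \<in>. N" for x y
    by (rule trans[OF conjunct2[OF k, rule_format, OF that] conjunct2[OF h, rule_format, OF that, symmetric]])
   thus "k z = ?h z" by (rule tensor_ext[OF M(1) N(1) Md_mod[OF T'] ghom_lin[OF kk(1)] ghom_lin[OF hg] _ z])
  qed simp
 qed
 thus "ghom G K (tm M N) (tm M' N') (tensor_map G K M M' N N' f g)"
  "tensor_map G K M M' N N' f g \<in> extensional (carrier (tm M N))"
  "x \<in>. M ==> y \<in>. N ==> tensor_map G K M M' N N' f g (pt M N x y) = pt M' N' (f x) (g y)"
  by (simp_all add: kG_hom_iff)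
qed

end

text \<open>f \<otimes> g - f' \<otimes> g' = Tr(a) \<otimes> g + f' \<otimes> Tr(b), and both terms
  are traces by the projection formulas.\<close>

lemma steq_tensor:
 assumes M: "M \<in> Md" "M' \<in> Md" and N: "N \<in> Md" "N' \<in> Md"
  and f: "ghom G K M M' f" "ghom G K M M' f'" "steq M M' f f'" and g: "ghom G K N N' g" "ghom G K N N' g'" "steq N N' g g'"
  and h: "ghom G K (tm M N) (tm M' N') h" "\<And>x y. x \<in>. M ==> y \<in>. N ==> h (pt M N x y) = pt M' N' (f x) (g y)"
  and h': "ghom G K (tm M N) (tm M' N') h'" "\<And>x y. x \<in>. M ==> y \<in>. N ==> h' (pt M N x y) = pt M' N' (f' x) (g' y)"
 shows "steq (tm M N) (tm M' N') h h'"
proof -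
 note T = tm_Md[OF M(1) N(1)] and T' = tm_Md[OF M(2) N(2)]
 note kT = Md_kmod[OF T] and kT' = Md_kmod[OF T']
 interpret T': module K "tm M' N'" by (rule Md_mod[OF T'])
 interpret M': module K M' by (rule Md_mod[OF M(2)])
 interpret N': module K N' by (rule Md_mod[OF N(2)])
 obtain a where a: "lin K M M' a" "\<And>x. x \<in>. M ==> f x = f' x \<oplus>\<^sub>M' Tr M M' a x" using f(3) by (auto simp: steq_def)
 obtain b where b: "lin K N N' b" "\<And>x. x \<in>. N ==> g x = g' x \<oplus>\<^sub>N' Tr N N' b x" using g(3) by (auto simp: steq_def)
 let ?a = "tmap M M' N N' a g" and ?b = "tmap M M' N N' f' b"
 have la: "lin K (tm M N) (tm M' N') ?a" by (rule lin_tmap[OF M N a(1) ghom_lin[OF g(1)]])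
 have lb: "lin K (tm M N) (tm M' N') ?b" by (rule lin_tmap[OF M N ghom_lin[OF f(2)] b(1)])
 note lab = lin_plus[OF lb la T'.module_axioms]
 have "h z = h' z \<oplus>\<^bsub>tm M' N'\<^esub> Tr (tm M N) (tm M' N') (\<lambda>z. ?b z \<oplus>\<^bsub>tm M' N'\<^esub> ?a z) z" if z: "z \<in>. (tm M N)" for z
 proof (rule tensor_ext[OF M(1) N(1) T'.module_axioms ghom_lin[OF h(1)]
    lin_plus[OF ghom_lin[OF h'(1)] lin_Tr[OF kT kT' lab] T'.module_axioms] _ z])
  fix x y assume x: "x \<in>. M" and y: "y \<in>. N"
  note p = pt_in[OF M(1) N(1) x y]
  note c = ghom_in[OF f(2) x] ghom_in[OF g(2) y] lin_in[OF lin_Tr[OF Md_kmod[OF M(1)] Md_kmod[OF M(2)] a(1)] x]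
   lin_in[OF lin_Tr[OF Md_kmod[OF N(1)] Md_kmod[OF N(2)] b(1)] y] ghom_in[OF g(1) y]
  note pc = pt_in[OF M(2) N(2)]
  have "h (pt M N x y) = pt M' N' (f' x) (g y) \<oplus>\<^bsub>tm M' N'\<^esub> pt M' N' (Tr M M' a x) (g y)"
   using h(2)[OF x y] a(2)[OF x] lin_add[OF bilD(2)[OF pt_bil[OF M(2) N(2)] c(5)] c(1) c(3)] by simp
  also have "pt M' N' (f' x) (g y) = pt M' N' (f' x) (g' y) \<oplus>\<^bsub>tm M' N'\<^esub> pt M' N' (f' x) (Tr N N' b y)"
   using b(2)[OF y] lin_add[OF bilD(1)[OF pt_bil[OF M(2) N(2)] c(1)] c(2) c(4)] by simp
  finally show "h (pt M N x y) = h' (pt M N x y) \<oplus>\<^bsub>tm M' N'\<^esub> Tr (tm M N) (tm M' N') (\<lambda>z. ?b z \<oplus>\<^bsub>tm M' N'\<^esub> ?a z) (pt M N x y)"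
   using h'(2)[OF x y] c pc
   by (simp add: Tr_plus[OF kT kT' lb la p] Tr_tmap_left[OF M N a(1) g(1) x y] Tr_tmap_right[OF M N f(2) b(1) x y] T'.a_assoc)
 qed
 thus ?thesis using lab by (auto simp: steq_def)
qed

text \<open>The representative h may be any homomorphism with the right values on pure tensors, for
  instance \<open>tmap\<close>.\<close>

lemma tmo_cls:
 assumes M: "M \<in> Md" "M' \<in> Md" and N: "N \<in> Md" "N' \<in> Md" and f: "ghom G K M M' f" and g: "ghom G K N N' g"
  and h: "ghom G K (tm M N) (tm M' N') h" "\<And>x y. x \<in>. M ==> y \<in>. N ==> h (pt M N x y) = pt M' N' (f x) (g y)"
 shows "cls M M' f \<boxdot>\<^sub>St cls N N' g = cls (tm M N) (tm M' N') h"
proof -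
 let ?C = "\<lambda>M N f. {k \<in> kG_hom G K M N. steq M N k f}"
 note T = tm_Md[OF M(1) N(1)] and T' = tm_Md[OF M(2) N(2)]
 have "stab_class G K (tm M N) (tm M' N') (tensor_map G K M M' N N' a b) = ?C (tm M N) (tm M' N') h"
  if "a \<in> ?C M M' f" "b \<in> ?C N N' g" for a b
 proof -
  have ab: "a \<in> kG_hom G K M M'" "b \<in> kG_hom G K N N'" "ghom G K M M' a" "ghom G K N N' b" "steq M M' a f" "steq N N' b g"
   using that by (auto simp: kG_hom_iff)
  note tg = tensor_map_ghom[OF M N ab(1,2)]
  have "steq (tm M N) (tm M' N') (tensor_map G K M M' N N' a b) h"
   by (rule steq_tensor[OF M N ab(3) f ab(5) ab(4) g ab(6) tg(1) _ h(1)]) (use tg(3) h(2) in auto)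
  hence "cls (tm M N) (tm M' N') (tensor_map G K M M' N N' a b) = cls (tm M N) (tm M' N') h"
   using cls_eq_iff[OF T T' tg(1) h(1)] by simp
  moreover have "restrict (tensor_map G K M M' N N' a b) (carrier (tm M N)) = tensor_map G K M M' N N' a b"
   using tg(2) by (rule extensional_restrict)
  ultimately show ?thesis using stab_class_eq[OF T T' tg(1)] by (simp add: cls_eq[OF T T' tg(1)] cls_eq[OF T T' h(1)])
 qed
 moreover have "restrict f (carrier M) \<in> ?C M M' f" "restrict g (carrier N) \<in> ?C N N' g"
  using restrict_mem[OF M f f steq_refl[OF M f]] restrict_mem[OF N g g steq_refl[OF N g]] .
 ultimately have "(\<Union>a\<in>?C M M' f. \<Union>b\<in>?C N N' g. stab_class G K (tm M N) (tm M' N') (tensor_map G K M M' N N' a b)) =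
   ?C (tm M N) (tm M' N') h" by blast
 thus ?thesis by (simp add: Stab_def cls_eq[OF M f] cls_eq[OF N g] cls_eq[OF T T' h(1)])
qed

lemma tob_St [simp]: "tob St M N = tm M N"
 by (simp add: Stab_def)

lemma unt_St [simp]: "unt St = unit_mod G K"
 by (simp add: Stab_def)

section \<open>Duals and faithfulness of tensoring\<close>

text \<open>Contraction of the first tensor factor: \<xi> \<otimes> id, followed by the
  identification of K \<otimes> N with N.\<close>

definition con where
 "con X N \<xi> = (SOME h. lin K (tm X N) N h \<and> (\<forall>x\<in>carrier X. \<forall>y\<in>carrier N. h (pt X N x y) = \<xi> x \<odot>\<^sub>N y))"

lemma
 assumes X: "X \<in> Md" and N: "N \<in> Md" and \<xi>: "functional K X \<xi>"
 shows lin_con: "lin K (tm X N) N (con X N \<xi>)"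
  and con_pt: "x \<in>. X ==> y \<in>. N ==> con X N \<xi> (pt X N x y) = \<xi> x \<odot>\<^sub>N y"
proof -
 have "\<exists>h. lin K (tm X N) N h \<and> (\<forall>x\<in>carrier X. \<forall>y\<in>carrier N. h (pt X N x y) = \<xi> x \<odot>\<^sub>N y)"
  by (rule tensor_univ[OF X N Md_mod[OF N] bil_functional[OF \<xi> lin_id Md_mod[OF N]]]) blast
 from someI_ex[OF this] show "lin K (tm X N) N (con X N \<xi>)"
  "x \<in>. X ==> y \<in>. N ==> con X N \<xi> (pt X N x y) = \<xi> x \<odot>\<^sub>N y" unfolding con_def by blast+
qed

text \<open>A functional that is not invariant gives a contraction that is not equivariant; g is
  moved to the functional instead.\<close>

lemma con_act:
 assumes X: "X \<in> Md" and N: "N \<in> Md" and \<xi>: "functional K X \<xi>" and g: "g \<in>. G" and z: "z \<in>. (tm X N)"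
 shows "con X N \<xi> (act (tm X N) g z) = act N g (con X N (\<lambda>x. \<xi> (act X g x)) z)"
proof -
 note T = tm_Md[OF X N]
 have \<xi>g: "functional K X (\<lambda>x. \<xi> (act X g x))" by (rule lin_comp[OF act_lin[OF Md_kmod[OF X] g] \<xi>])
 show ?thesis
 proof (rule tensor_ext[OF X N Md_mod[OF N] lin_comp[OF act_lin[OF Md_kmod[OF T] g] lin_con[OF X N \<xi>]]
    lin_comp[OF lin_con[OF X N \<xi>g] act_lin[OF Md_kmod[OF N] g]] _ z])
  fix x y assume x: "x \<in>. X" and y: "y \<in>. N"
  have "\<xi> (act X g x) \<in>. K" using lin_in[OF \<xi>g x] by simp
  thus "con X N \<xi> (act (tm X N) g (pt X N x y)) = act N g (con X N (\<lambda>x. \<xi> (act X g x)) (pt X N x y))"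
   using x y g by (simp add: pt_act X N con_pt[OF X N \<xi>] con_pt[OF X N \<xi>g] act_in[OF Md_kmod[OF X]]
     act_in[OF Md_kmod[OF N]] lin_smult[OF act_lin[OF Md_kmod[OF N]]])
 qed
qed

lemma con_cong:
 assumes X: "X \<in> Md" and N: "N \<in> Md" and f: "functional K X \<xi>" and eq: "\<And>x. x \<in>. X ==> \<zeta> x = \<xi> x"
  and z: "z \<in>. (tm X N)"
 shows "con X N \<zeta> z = con X N \<xi> z"
proof -
 have f': "functional K X \<zeta>" by (rule lin_cong[OF f _ Md_mod[OF X]]) (rule eq[symmetric])
 show ?thesis by (rule tensor_ext[OF X N Md_mod[OF N] lin_con[OF X N f'] lin_con[OF X N f] _ z])
   (simp add: con_pt[OF X N f] con_pt[OF X N f'] eq)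
qed

lemma con_add_scale:
 assumes X: "X \<in> Md" and N: "N \<in> Md" and f: "functional K X \<xi>" "functional K X \<zeta>" and a: "a \<in>. K"
  and z: "z \<in>. (tm X N)"
 shows "con X N (\<lambda>x. \<xi> x \<oplus>\<^sub>K a \<otimes>\<^sub>K \<zeta> x) z = con X N \<xi> z \<oplus>\<^sub>N a \<odot>\<^sub>N con X N \<zeta> z"
proof -
 interpret N: module K N by (rule Md_mod[OF N])
 have f': "functional K X (\<lambda>x. \<xi> x \<oplus>\<^sub>K a \<otimes>\<^sub>K \<zeta> x)"
  using lin_plus[OF f(1) lin_scale[OF f(2) a mKmod] mKmod] by simp
 have c: "\<xi> x \<in>. K" "\<zeta> x \<in>. K" if "x \<in>. X" for x using lin_in[OF f(1) that] lin_in[OF f(2) that] by simp_all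
 show ?thesis by (rule tensor_ext[OF X N N.modl lin_con[OF X N f']
     lin_plus[OF lin_con[OF X N f(1)] lin_scale[OF lin_con[OF X N f(2)] a N.modl] N.modl] _ z])
   (simp add: con_pt[OF X N f'] con_pt[OF X N f(1)] con_pt[OF X N f(2)] N.smult_l_distr N.smult_assoc1 a c)
qed

end

context cyc
begin

text \<open>The dual \<open>D\<close> of \<open>A\<close> is \<open>A\<close> itself as a vector space: \<open>b\<close> is the bilinear form for which the dual
 basis is orthonormal, and \<open>G\<close> acts on \<open>D\<close> by inverse transposes. The element \<open>z = \<Sum>\<^sub>l u\<^sub>l \<otimes> u\<^sub>l\<close> of \<open>D \<otimes> A\<close>
 corresponds to the identity of \<open>A\<close>, hence is invariant.\<close>

lemma ex_dual_invariant:
 assumes A: "A \<in> Md" and db: "dual_basis A d u v"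
 obtains D b z where "D \<in> Md" "carrier D = carrier A" "\<And>x. x \<in>. A ==> functional K D (b x)"
  "\<And>y. y \<in>. A ==> functional K A (\<lambda>x. b x y)"
  "\<And>x l. x \<in>. A ==> l < d ==> b x (u l) = v l x"
  "\<And>g x y. g \<in>. G ==> x \<in>. A ==> y \<in>. A ==> b x (act D g y) = b (act A (invG g) x) y"
  "\<And>y. y \<in>. A ==> y = (\<Oplus>\<^sub>D l\<in>{..<d}. b (u l) y \<odot>\<^sub>D u l)"
  "z \<in>. (tm D A)" "\<And>g. g \<in>. G ==> act (tm D A) g z = z"
  "\<And>N f. N \<in> Md ==> lin K A N f ==> tmap D D A N (\<lambda>x. x) f z = (\<Oplus>\<^bsub>tm D N\<^esub>l\<in>{..<d}. pt D N (u l) (f (u l)))"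
proof -
 interpret A: module K A by (rule Md_mod[OF A])
 note kA = Md_kmod[OF A]
 have u: "u l \<in>. A" and v: "functional K A (v l)" and vu: "m < d ==> v l (u m) = (if l = m then \<one>\<^sub>K else \<zero>\<^sub>K)"
  if "l < d" for l m using db that by (simp_all add: dual_basis_def)
 have ex: "x = (\<Oplus>\<^sub>A l\<in>{..<d}. v l x \<odot>\<^sub>A u l)" if "x \<in>. A" for x using db that unfolding dual_basis_def by blast
 have vc: "v l x \<in>. K" if "l < d" "x \<in>. A" for l x using lin_in[OF v[OF that(1)] that(2)] by simp
 \<comment> \<open>The form that makes the basis u orthonormal. It identifies A with its dual, but
   in general it is not invariant, which is why the dual gets its own action r.\<close>
 define b where "b x y = (\<Oplus>\<^sub>K l\<in>{..<d}. v l x \<otimes>\<^sub>K v l y)" for x y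
 have b: "functional K A (b x)" if x: "x \<in>. A" for x
 proof -
  have "functional K A (\<lambda>y. \<Oplus>\<^bsub>Kv K\<^esub>l\<in>{..<d}. v l x \<odot>\<^bsub>Kv K\<^esub> v l y)"
   by (rule lin_finsum_fun[OF lin_scale[OF v vc[OF _ x] mKmod] A.modl mKmod]) auto
  thus ?thesis by (simp add: b_def [abs_def] A.finsum_Kmod)
 qed
 have sym: "b x y = b y x" if "x \<in>. A" "y \<in>. A" for x y
  unfolding b_def using vc that by (intro K.finsum_cong') (auto simp: K.m_comm)
 have bu: "b x (u m) = v m x" if m: "m < d" and x: "x \<in>. A" for m x
 proof -
  have "b x (u m) = (\<Oplus>\<^sub>K l\<in>{..<d}. if m = l then v l x else \<zero>\<^sub>K)"
   unfolding b_def using vc[OF _ x] vu m by (intro K.finsum_cong') auto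
  also have "... = v m x" using vc[OF _ x] m by (intro K.finsum_singleton) auto
  finally show ?thesis .
 qed
 have bc: "b x y \<in>. K" if "x \<in>. A" "y \<in>. A" for x y using lin_in[OF b[OF that(1)] that(2)] by simp
 have b': "functional K A (\<lambda>x. b x y)" if y: "y \<in>. A" for y
  by (rule lin_cong[OF b[OF y] _ A.modl]) (rule sym[OF y])
 have bsum: "b x (\<Oplus>\<^sub>A l\<in>{..<d}. c l \<odot>\<^sub>A u l) = (\<Oplus>\<^sub>K l\<in>{..<d}. c l \<otimes>\<^sub>K v l x)"
  if c: "\<And>l. l < d ==> c l \<in>. K" and x: "x \<in>. A" for c x
 proof -
  have "b x (\<Oplus>\<^sub>A l\<in>{..<d}. c l \<odot>\<^sub>A u l) = (\<Oplus>\<^sub>K l\<in>{..<d}. b x (c l \<odot>\<^sub>A u l))"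
   using c u by (intro A.functional_finsum[OF b[OF x]]) auto
  also have "... = (\<Oplus>\<^sub>K l\<in>{..<d}. c l \<otimes>\<^sub>K v l x)"
   using c vc[OF _ x] lin_smult[OF b[OF x] c u] bu[OF _ x] by (intro K.finsum_cong') auto
  finally show ?thesis .
 qed
 have nd: "y = y'" if y: "y \<in>. A" "y' \<in>. A" and e: "\<And>x. x \<in>. A ==> b x y = b x y'" for y y'
 proof -
  have "v l y = v l y'" if "l < d" for l using e[OF u[OF that]] sym[OF u[OF that]] bu[OF that] y by simp
  hence "(\<Oplus>\<^sub>A l\<in>{..<d}. v l y \<odot>\<^sub>A u l) = (\<Oplus>\<^sub>A l\<in>{..<d}. v l y' \<odot>\<^sub>A u l)"
   using vc[OF _ y(2)] u by (intro A.finsum_cong') auto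
  thus ?thesis using ex[OF y(1)] ex[OF y(2)] by simp
 qed
 \<comment> \<open>The inverse transpose of g with respect to b: the coordinate of
   \<open>r g y\<close> at u_l has to be b (g^-1 u_l) y.\<close>
 define r where "r g y = (\<Oplus>\<^sub>A l\<in>{..<d}. b (act A (invG g) (u l)) y \<odot>\<^sub>A u l)" for g y
 have iu: "act A (invG g) x \<in>. A" if "g \<in>. G" "x \<in>. A" for g x
  using act_in[OF kA _ that(2)] that(1) by simp
 have lr: "lin K A A (r g)" if g: "g \<in>. G" for g unfolding r_def
  by (rule lin_finsum_fun[OF lin_functional_smult[OF b[OF iu[OF g u]] u A.modl] A.modl A.modl]) auto
 have br: "b x (r g y) = b (act A (invG g) x) y" if g: "g \<in>. G" and x: "x \<in>. A" and y: "y \<in>. A" for g x y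
 proof -
  have ig: "invG g \<in>. G" using g by simp
  note l = lin_comp[OF act_lin[OF kA ig] b'[OF y]]
  have c: "b (act A (invG g) (u l)) y \<in>. K" if "l < d" for l by (rule bc[OF iu[OF g u[OF that]] y])
  have "b (act A (invG g) x) y = b (act A (invG g) (\<Oplus>\<^sub>A l\<in>{..<d}. v l x \<odot>\<^sub>A u l)) y" using ex[OF x] by simp
  also have "... = (\<Oplus>\<^sub>K l\<in>{..<d}. b (act A (invG g) (v l x \<odot>\<^sub>A u l)) y)"
   using vc[OF _ x] u by (intro A.functional_finsum[OF l]) auto
  also have "... = (\<Oplus>\<^sub>K l\<in>{..<d}. b (act A (invG g) (u l)) y \<otimes>\<^sub>K v l x)"
   using c vc[OF _ x] lin_smult[OF l vc[OF _ x] u] by (intro K.finsum_cong') (auto simp: K.m_comm)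
  finally show ?thesis unfolding r_def using bsum[OF c x] by simp
 qed
 have D: "A\<lparr>act := r\<rparr> \<in> Md"
 proof -
  have mD: "module K (A\<lparr>act := r\<rparr>)"
   using Md_mod[OF A] by (simp add: module_def module_axioms_def abelian_group_def abelian_monoid_def abelian_group_axioms_def)
  have "kmod (A\<lparr>act := r\<rparr>)"
  proof (rule kG_moduleI[OF mD])
   show "lin K (A\<lparr>act := r\<rparr>) (A\<lparr>act := r\<rparr>) (act (A\<lparr>act := r\<rparr>) g)" if "g \<in>. G" for g
    using lr[OF that] by (simp add: lin_def)
   show "act (A\<lparr>act := r\<rparr>) \<one>\<^sub>G x = x" if "x \<in>. (A\<lparr>act := r\<rparr>)" for x
    using that nd[OF lin_in[OF lr[OF G.one_closed]]] br[OF G.one_closed] act_one[OF kA] by simp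
   fix g h x assume g: "g \<in>. G" "h \<in>. G" and "x \<in>. (A\<lparr>act := r\<rparr>)"
   hence x: "x \<in>. A" by simp
   have "r (g \<otimes>\<^sub>G h) x = r g (r h x)"
   proof (rule nd)
    fix y assume y: "y \<in>. A"
    show "b y (r (g \<otimes>\<^sub>G h) x) = b y (r g (r h x))"
     using br[OF G.m_closed[OF g] y x] br[OF g(1) y lin_in[OF lr[OF g(2)] x]] br[OF g(2) iu[OF g(1) y] x]
      act_mult[OF kA G.inv_closed[OF g(2)] G.inv_closed[OF g(1)] y] g by (simp add: G.inv_mult_group)
   qed (use lin_in[OF lr] g x in auto)
   thus "act (A\<lparr>act := r\<rparr>) (g \<otimes>\<^sub>G h) x = act (A\<lparr>act := r\<rparr>) g (act (A\<lparr>act := r\<rparr>) h x)" by simp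
  qed
  thus ?thesis using Md_small[OF A] by (simp add: kG_mods_def)
 qed
 have uA: "u l \<in>. A" if "l < d" for l by (rule u[OF that])
 define D where "D = A\<lparr>act := r\<rparr>"
 have D': "D \<in> Md" and s: "carrier D = carrier A" "act D = r" "\<And>a x. a \<odot>\<^sub>D x = a \<odot>\<^sub>A x"
  using D by (simp_all add: D_def)
 interpret D: module K D by (rule Md_mod[OF D'])
 have bD: "functional K D (b x)" if "x \<in>. A" for x using b[OF that] by (simp add: lin_def D_def)
 have bul: "b (u l) y = v l y" if "l < d" "y \<in>. A" for l y using sym[OF u[OF that(1)] that(2)] bu[OF that] by simp
 have exD: "y = (\<Oplus>\<^sub>D l\<in>{..<d}. b (u l) y \<odot>\<^sub>D u l)" if y: "y \<in>. A" for y
 proof -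
  have "lin K A D (\<lambda>x. x)" by (simp add: lin_def D_def)
  from lin_finsum[OF this A.modl D.modl, of "\<lambda>l. v l y \<odot>\<^sub>A u l" "{..<d}"]
  have "y = (\<Oplus>\<^sub>D l\<in>{..<d}. v l y \<odot>\<^sub>D u l)" using ex[OF y] vc[OF _ y] u by (simp add: Pi_def s(3))
  also have "... = (\<Oplus>\<^sub>D l\<in>{..<d}. b (u l) y \<odot>\<^sub>D u l)" using bul[OF _ y] vc[OF _ y] u by (intro D.finsum_cong') (auto simp: s)
  finally show ?thesis .
 qed
 interpret TA: module K "tm D A" by (rule Md_mod[OF tm_Md[OF D' A]])
 note kT = Md_kmod[OF tm_Md[OF D' A]]
 define z where "z = (\<Oplus>\<^bsub>tm D A\<^esub>l\<in>{..<d}. pt D A (u l) (u l))"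
 have puu: "pt D A (u l) a \<in>. (tm D A)" if "l < d" "a \<in>. A" for l a using pt_in[OF D' A] u[OF that(1)] that(2) s by simp
 have z: "z \<in>. (tm D A)" unfolding z_def using puu u by (intro TA.finsum_closed) auto
 \<comment> \<open>A tensor is determined by its contractions with the functionals
   \<open>b (u l)\<close>, so invariance of z can be tested on contractions.\<close>
 have expand: "w = (\<Oplus>\<^bsub>tm D A\<^esub>l\<in>{..<d}. pt D A (u l) (con D A (b (u l)) w))" if w: "w \<in>. (tm D A)" for w
 proof -
  note pb = pt_bil[OF D' A]
  have l: "lin K (tm D A) (tm D A) (\<lambda>w. \<Oplus>\<^bsub>tm D A\<^esub>l\<in>{..<d}. pt D A (u l) (con D A (b (u l)) w))"
   by (rule lin_finsum_fun[OF lin_comp[OF lin_con[OF D' A bD[OF u]] bilD(1)[OF pb]] TA.modl TA.modl])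
    (use u s in auto)
  show ?thesis
  proof (rule tensor_ext[OF D' A TA.modl lin_id l _ w])
   fix x y assume x: "x \<in>. D" and y: "y \<in>. A"
   have xA: "x \<in>. A" using x s by simp
   have c: "b (u l) x \<in>. K" if "l < d" for l by (rule bc[OF u[OF that] xA])
   have "pt D A x y = pt D A (\<Oplus>\<^sub>D l\<in>{..<d}. b (u l) x \<odot>\<^sub>D u l) y" using exD[OF xA] by simp
   also have "... = (\<Oplus>\<^bsub>tm D A\<^esub>l\<in>{..<d}. pt D A (b (u l) x \<odot>\<^sub>D u l) y)"
    using c u by (intro lin_finsum[OF bilD(2)[OF pb y] D.modl TA.modl]) (auto simp: s)
   also have "... = (\<Oplus>\<^bsub>tm D A\<^esub>l\<in>{..<d}. pt D A (u l) (con D A (b (u l)) (pt D A x y)))"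
   proof (rule TA.finsum_cong')
    fix l assume "l \<in> {..<d}"
    hence l: "l < d" by simp
    have ul: "u l \<in>. D" using u[OF l] s by simp
    show "pt D A (b (u l) x \<odot>\<^sub>D u l) y = pt D A (u l) (con D A (b (u l)) (pt D A x y))"
     using con_pt[OF D' A bD[OF u[OF l]] x y] lin_smult[OF bilD(2)[OF pb y] c[OF l] ul]
      lin_smult[OF bilD(1)[OF pb ul] c[OF l] y] by simp
   qed (use puu lin_in[OF lin_con[OF D' A bD[OF u]] pt_in[OF D' A x y]] in auto)
   finally show "pt D A x y = (\<Oplus>\<^bsub>tm D A\<^esub>l\<in>{..<d}. pt D A (u l) (con D A (b (u l)) (pt D A x y)))" .
  qed
 qed
 \<comment> \<open>z represents the identity of A: contracting it with \<open>b x\<close> returns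
   x.\<close>
 have conz: "con D A (b x) z = x" if x: "x \<in>. A" for x
 proof -
  have "con D A (b x) z = (\<Oplus>\<^sub>A l\<in>{..<d}. con D A (b x) (pt D A (u l) (u l)))"
   unfolding z_def using puu u by (intro lin_finsum[OF lin_con[OF D' A bD[OF x]] TA.modl A.modl]) auto
  also have "... = (\<Oplus>\<^sub>A l\<in>{..<d}. v l x \<odot>\<^sub>A u l)"
   using vc[OF _ x] u s by (intro A.finsum_cong') (auto simp: con_pt[OF D' A bD[OF x]] bu[OF _ x])
  finally show ?thesis using ex[OF x] by simp
 qed
 have zfix: "act (tm D A) g z = z" if g: "g \<in>. G" for g
 proof -
  have c: "con D A (b (u l)) (act (tm D A) g z) = u l" if l: "l < d" for l
  proof -
   note i = iu[OF g u[OF l]]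
   have "con D A (\<lambda>y. b (u l) (act D g y)) z = con D A (b (act A (invG g) (u l))) z"
    by (rule con_cong[OF D' A bD[OF i] _ z]) (use br[OF g u[OF l]] s in auto)
   thus ?thesis
    using con_act[OF D' A bD[OF u[OF l]] g z] conz[OF i] act_mult[OF kA g G.inv_closed[OF g] u[OF l]] act_one[OF kA u[OF l]] g by simp
  qed
  have "act (tm D A) g z = (\<Oplus>\<^bsub>tm D A\<^esub>l\<in>{..<d}. pt D A (u l) (con D A (b (u l)) (act (tm D A) g z)))"
   by (rule expand[OF act_in[OF kT g z]])
  also have "... = (\<Oplus>\<^bsub>tm D A\<^esub>l\<in>{..<d}. pt D A (u l) (u l))" using c puu u by (intro TA.finsum_cong') auto
  also have "... = z" by (simp only: z_def)
  finally show ?thesis .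
 qed
 have zf: "tmap D D A N (\<lambda>x. x) f z = (\<Oplus>\<^bsub>tm D N\<^esub>l\<in>{..<d}. pt D N (u l) (f (u l)))" if N: "N \<in> Md" and f: "lin K A N f" for N f
 proof -
  interpret TN: module K "tm D N" by (rule Md_mod[OF tm_Md[OF D' N]])
  have "tmap D D A N (\<lambda>x. x) f z = (\<Oplus>\<^bsub>tm D N\<^esub>l\<in>{..<d}. tmap D D A N (\<lambda>x. x) f (pt D A (u l) (u l)))"
   unfolding z_def using puu u by (intro lin_finsum[OF lin_tmap[OF D' D' A N lin_id f] TA.modl TN.modl]) auto
  also have "... = (\<Oplus>\<^bsub>tm D N\<^esub>l\<in>{..<d}. pt D N (u l) (f (u l)))"
   using tmap_pt[OF D' D' A N lin_id f] pt_in[OF D' N] lin_in[OF f] u s by (intro TN.finsum_cong') auto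
  finally show ?thesis .
 qed
 show thesis by (rule that[of D b z, OF D' s(1) bD b' bu _ exD z zfix zf]) (use br s in auto)
qed

lemma lin_con_param:
 assumes X: "X \<in> Md" and Y: "Y \<in> Md" and "module K A" and \<beta>: "\<And>x. x \<in>. A ==> functional K X (\<beta> x)"
  and \<beta>': "\<And>y. y \<in>. X ==> functional K A (\<lambda>x. \<beta> x y)" and n: "n \<in>. (tm X Y)"
 shows "lin K A Y (\<lambda>x. con X Y (\<beta> x) n)" (is "lin K A Y ?h")
proof (rule linI)
 interpret A: module K A by fact
 interpret Y: module K Y by (rule Md_mod[OF Y])
 show hc: "?h x \<in>. Y" if "x \<in>. A" for x by (rule lin_in[OF lin_con[OF X Y \<beta>[OF that]] n])
 \<comment> \<open>Both laws at once: a = 1 gives additivity, and x = 0 gives compatibility with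
   scalars.\<close>
 have c: "?h (x \<oplus>\<^sub>A a \<odot>\<^sub>A y) = ?h x \<oplus>\<^sub>Y a \<odot>\<^sub>Y ?h y" if x: "x \<in>. A" and y: "y \<in>. A" and a: "a \<in>. K" for x y a
 proof -
  have "con X Y (\<lambda>w. \<beta> x w \<oplus>\<^sub>K a \<otimes>\<^sub>K \<beta> y w) n = ?h (x \<oplus>\<^sub>A a \<odot>\<^sub>A y)"
   using lin_add[OF \<beta>' x A.smult_closed[OF a y]] lin_smult[OF \<beta>' a y] x y a
   by (intro con_cong[OF X Y \<beta> _ n]) auto
  thus ?thesis using con_add_scale[OF X Y \<beta>[OF x] \<beta>[OF y] a n] by simp
 qed
 show add: "?h (x \<oplus>\<^sub>A y) = ?h x \<oplus>\<^sub>Y ?h y" if "x \<in>. A" "y \<in>. A" for x y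
  using c[OF that K.one_closed] that hc by simp
 have "?h \<zero>\<^sub>A = \<zero>\<^sub>Y" using add[OF A.zero_closed A.zero_closed] hc by simp
 thus "?h (a \<odot>\<^sub>A y) = a \<odot>\<^sub>Y ?h y" if "a \<in>. K" "y \<in>. A" for a y
  using c[OF A.zero_closed that(2,1)] that hc by simp
qed

text \<open>If \<open>A\<close> is a summand of \<open>X\<close>, then \<open>f\<close>, multiplied with the trace of the identity of \<open>A\<close>, is the composite of
 \<open>id\<^bsub>D\<^esub> \<otimes> id\<^bsub>X\<^esub> \<otimes> f\<close> with a coevaluation and an evaluation.\<close>

lemma ltensor_faithful_aux:
 assumes X: "X \<in> Md" and A: "A \<in> Md" "dual_basis A d u v" and tr: "(\<Oplus>\<^sub>K l\<in>{..<d}. v l (u l)) \<noteq> \<zero>\<^sub>K"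
  and i: "ghm A X i" and q: "ghm X A q" "\<And>a. a \<in>. A ==> q (i a) = a"
 shows "faithful_functor St (ltensor St X)" unfolding faithful_functor_def
proof (intro ballI inj_onI)
 fix Y Z m m' assume "Y \<in> Ob St" "Z \<in> Ob St" and m: "m \<in> Mor St Y Z" "m' \<in> Mor St Y Z"
  and eq: "fmo (ltensor St X) m = fmo (ltensor St X) m'"
 hence Y: "Y \<in> Md" and Z: "Z \<in> Md" by simp_all
 obtain D b z where D: "D \<in> Md" "carrier D = carrier A" and b: "\<And>x. x \<in>. A ==> functional K D (b x)"
  and b': "\<And>y. y \<in>. A ==> functional K A (\<lambda>x. b x y)"
  and bu: "\<And>x l. x \<in>. A ==> l < d ==> b x (u l) = v l x"
  and br: "\<And>g x y. g \<in>. G ==> x \<in>. A ==> y \<in>. A ==> b x (act D g y) = b (act A (invG g) x) y"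
  and z: "z \<in>. (tm D A)" "\<And>g. g \<in>. G ==> act (tm D A) g z = z"
  and zf: "\<And>N f. N \<in> Md ==> lin K A N f ==> tmap D D A N (\<lambda>x. x) f z = (\<Oplus>\<^bsub>tm D N\<^esub>l\<in>{..<d}. pt D N (u l) (f (u l)))"
  by (rule ex_dual_invariant[OF A]) (rule that)
 interpret Z: module K Z by (rule Md_mod[OF Z])
 note kA = Md_kmod[OF A(1)] and kX = Md_kmod[OF X] and kY = Md_kmod[OF Y] and kZ = Md_kmod[OF Z]
 let ?XY = "tm X Y" and ?XZ = "tm X Z" and ?DY = "tm D (tm X Y)" and ?DZ = "tm D (tm X Z)"
 note XY = tm_Md[OF X Y] and XZ = tm_Md[OF X Z]
 note DY = tm_Md[OF D(1) XY] and DZ = tm_Md[OF D(1) XZ]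
 interpret DY: module K ?DY by (rule Md_mod[OF DY])
 interpret DZ: module K ?DZ by (rule Md_mod[OF DZ])
 have u: "u l \<in>. A" and v: "functional K A (v l)" if "l < d" for l using A(2) that by (simp_all add: dual_basis_def)
 have uD: "u l \<in>. D" and iu: "i (u l) \<in>. X" if "l < d" for l using u[OF that] D(2) ghom_in[OF i] by simp_all
 have vu: "v l (u l) \<in>. K" if "l < d" for l using lin_in[OF v[OF that] u[OF that]] by simp
 \<comment> \<open>The coevaluation of A tensored with Y, followed by the inclusion i of A into X in
   the second factor.\<close>
 let ?eta = "\<lambda>y. \<Oplus>\<^bsub>?DY\<^esub>l\<in>{..<d}. pt D ?XY (u l) (pt X Y (i (u l)) y)"
 let ?phi = "\<lambda>y a. pt X Y (i a) y"
 have phi: "lin K A ?XY (?phi y)" if "y \<in>. Y" for y by (rule lin_comp[OF ghom_lin[OF i] bilD(2)[OF pt_bil[OF X Y] that]])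
 have leta: "lin K Y ?DY ?eta"
  by (rule lin_finsum_fun[OF lin_comp[OF bilD(1)[OF pt_bil[OF X Y] iu] bilD(1)[OF pt_bil[OF D(1) XY] uD]] Md_mod[OF Y] DY.modl]) auto
 have geta: "ghm Y ?DY ?eta"
 proof (rule ghomI[OF leta])
  fix g y assume g: "g \<in>. G" and y: "y \<in>. Y"
  note gy = act_in[OF kY g y]
  \<comment> \<open>\<open>?eta y\<close> is the image of the invariant element z under id \<otimes>
    \<open>?phi y\<close>, so its equivariance in y follows from the invariance of z.\<close>
  let ?t = "\<lambda>y. tmap D D A ?XY (\<lambda>x. x) (?phi y)"
  note lt = lin_tmap[OF D(1) D(1) A(1) XY lin_id phi]
  note kDA = Md_kmod[OF tm_Md[OF D(1) A(1)]]
  have "act ?DY g (?t y z) = ?t (act Y g y) (act (tm D A) g z)"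
  proof (rule tensor_ext[OF D(1) A(1) DY.modl lin_comp[OF lt[OF y] act_lin[OF Md_kmod[OF DY] g]]
     lin_comp[OF act_lin[OF kDA g] lt[OF gy]] _ z(1)])
   fix x a assume x: "x \<in>. D" and a: "a \<in>. A"
   note ia = ghom_in[OF i a]
   show "act ?DY g (?t y (pt D A x a)) = ?t (act Y g y) (act (tm D A) g (pt D A x a))"
    using tmap_pt[OF D(1) D(1) A(1) XY lin_id phi[OF y] x a] pt_act[OF D(1) XY g x pt_in[OF X Y ia y]] pt_act[OF X Y g ia y]
     pt_act[OF D(1) A(1) g x a] ghom_act[OF i g a]
     tmap_pt[OF D(1) D(1) A(1) XY lin_id phi[OF gy] act_in[OF Md_kmod[OF D(1)] g x] act_in[OF kA g a]] by simp
  qed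
  thus "?eta (act Y g y) = act ?DY g (?eta y)" using zf[OF XY phi[OF y]] zf[OF XY phi[OF gy]] z(2)[OF g] by simp
 qed
 \<comment> \<open>The evaluation of D against X through the projection q, tensored with Z.\<close>
 let ?C = "\<lambda>y. con X Z (\<lambda>x. b (q x) y)"
 have bq: "functional K X (\<lambda>x. b (q x) y)" if "y \<in>. D" for y
  using lin_comp[OF ghom_lin[OF q(1)] b'] that D(2) by simp
 have Cc: "?C y t \<in>. Z" if "y \<in>. D" "t \<in>. ?XZ" for y t by (rule lin_in[OF lin_con[OF X Z bq[OF that(1)]] that(2)])
 have bilC: "bil K D ?XZ Z ?C" unfolding bil_def
 proof (intro conjI ballI)
  show "lin K ?XZ Z (?C y)" if "y \<in>. D" for y by (rule lin_con[OF X Z bq[OF that]])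
  fix t assume t: "t \<in>. ?XZ"
  show "lin K D Z (\<lambda>y. ?C y t)" using lin_comp[OF ghom_lin[OF q(1)] b'] b ghom_in[OF q(1)] D(2)
   by (intro lin_con_param[OF X Z Md_mod[OF D(1)] _ _ t]) auto
 qed
 obtain ep where ep: "lin K ?DZ Z ep" "\<And>y t. y \<in>. D ==> t \<in>. ?XZ ==> ep (pt D ?XZ y t) = ?C y t"
  by (rule tensor_univ[OF D(1) XZ Z.modl bilC]) (rule that)
 have gep: "ghm ?DZ Z ep"
 proof (rule ghomI[OF ep(1)])
  fix g w assume g: "g \<in>. G" and w: "w \<in>. ?DZ"
  show "ep (act ?DZ g w) = act Z g (ep w)"
  proof (rule tensor_ext[OF D(1) XZ Z.modl lin_comp[OF act_lin[OF Md_kmod[OF DZ] g] ep(1)] lin_comp[OF ep(1) act_lin[OF kZ g]] _ w])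
   fix y t assume y: "y \<in>. D" and t: "t \<in>. ?XZ"
   note gy = act_in[OF Md_kmod[OF D(1)] g y]
   have "b (q (act X g x)) (act D g y) = b (q x) y" if x: "x \<in>. X" for x
   proof -
    note qx = ghom_in[OF q(1) x]
    have "act A (invG g) (act A g (q x)) = q x" using act_mult[OF kA G.inv_closed[OF g] g qx] act_one[OF kA qx] g by simp
    thus ?thesis using br[OF g act_in[OF kA g qx], of y] y D(2) ghom_act[OF q(1) g x] by simp
   qed
   hence "con X Z (\<lambda>x. b (q (act X g x)) (act D g y)) t = ?C y t" by (intro con_cong[OF X Z bq[OF y] _ t])
   thus "ep (act ?DZ g (pt D ?XZ y t)) = act Z g (ep (pt D ?XZ y t))"
    using pt_act[OF D(1) XZ g y t] ep(2)[OF gy act_in[OF Md_kmod[OF XZ] g t]] ep(2)[OF y t] con_act[OF X Z bq[OF gy] g t] by simp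
  qed
 qed
 define c where "c = (\<Oplus>\<^sub>K l\<in>{..<d}. v l (u l))"
 have c: "c \<in>. K" unfolding c_def using vu by (intro K.finsum_closed) auto
 have c0: "c \<noteq> \<zero>\<^sub>K" using tr by (simp add: c_def)
 hence ic: "inv\<^bsub>K\<^esub> c \<in>. K" "inv\<^bsub>K\<^esub> c \<otimes>\<^sub>K c = \<one>\<^sub>K" using c K.field_Units by auto
 note gs = ghom_scale[OF kZ ic(1)]
 \<comment> \<open>A formula for m in terms of X \<otimes> m: the composite multiplies a
   representative f of m by c, the trace of the identity of A, which is invertible.\<close>
 have key: "m = cls Z Z (\<lambda>z. inv\<^bsub>K\<^esub> c \<odot>\<^sub>Z z) \<bullet>\<^sub>St cls ?DZ Z ep \<bullet>\<^sub>St (idm St D \<boxdot>\<^sub>St (idm St X \<boxdot>\<^sub>St m)) \<bullet>\<^sub>St cls Y ?DY ?eta"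
  if m: "m \<in> Mor St Y Z" for m
 proof -
  obtain f where f: "ghm Y Z f" "m = cls Y Z f" by (rule morE[OF Y Z m]) (rule that)
  let ?s = "tmap X X Y Z (\<lambda>x. x) f"
  let ?t = "tmap D D ?XY ?XZ (\<lambda>x. x) ?s"
  note gsf = ghom_tmap[OF X X Y Z ghom_id f(1)]
  note gt = ghom_tmap[OF D(1) D(1) XY XZ ghom_id gsf]
  have 1: "idm St X \<boxdot>\<^sub>St m = cls ?XY ?XZ ?s" unfolding idm_cls[OF X] f(2)
   by (rule tmo_cls[OF X X Y Z ghom_id f(1) gsf]) (rule tmap_pt[OF X X Y Z lin_id ghom_lin[OF f(1)]])
  have 2: "idm St D \<boxdot>\<^sub>St cls ?XY ?XZ ?s = cls ?DY ?DZ ?t" unfolding idm_cls[OF D(1)]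
   by (rule tmo_cls[OF D(1) D(1) XY XZ ghom_id gsf gt]) (rule tmap_pt[OF D(1) D(1) XY XZ lin_id ghom_lin[OF gsf]])
  have "ep (?t (?eta y)) = c \<odot>\<^sub>Z f y" if y: "y \<in>. Y" for y
  proof -
   note fy = ghom_in[OF f(1) y]
   note p1 = pt_in[OF X Y iu y] and p2 = pt_in[OF X Z iu fy]
   have "ep (?t (?eta y)) = (\<Oplus>\<^sub>Z l\<in>{..<d}. ep (?t (pt D ?XY (u l) (pt X Y (i (u l)) y))))"
    using pt_in[OF D(1) XY uD p1] by (intro lin_finsum[OF lin_comp[OF ghom_lin[OF gt] ep(1)] DY.modl Z.modl]) auto
   also have "... = (\<Oplus>\<^sub>Z l\<in>{..<d}. v l (u l) \<odot>\<^sub>Z f y)"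
   proof (rule Z.finsum_cong')
    fix l assume "l \<in> {..<d}"
    hence l: "l < d" by simp
    show "ep (?t (pt D ?XY (u l) (pt X Y (i (u l)) y))) = v l (u l) \<odot>\<^sub>Z f y"
     using tmap_pt[OF D(1) D(1) XY XZ lin_id ghom_lin[OF gsf] uD[OF l] p1[OF l]] tmap_pt[OF X X Y Z lin_id ghom_lin[OF f(1)] iu[OF l] y]
      ep(2)[OF uD[OF l] p2[OF l]] con_pt[OF X Z bq[OF uD[OF l]] iu[OF l] fy] q(2)[OF u[OF l]] bu[OF u[OF l] l] by simp
   qed (use vu fy in auto)
   also have "... = c \<odot>\<^sub>Z f y" unfolding c_def using vu by (intro Z.finsum_smult_vec[OF fy]) auto
   finally show ?thesis .
  qed
  hence "f y = inv\<^bsub>K\<^esub> c \<odot>\<^sub>Z ep (?t (?eta y))" if "y \<in>. Y" for y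
   using that c ic ghom_in[OF f(1) that] by (simp flip: Z.smult_assoc1)
  hence "cls Y Z (\<lambda>y. inv\<^bsub>K\<^esub> c \<odot>\<^sub>Z ep (?t (?eta y))) = cls Y Z f" by (intro cls_cong[OF Y Z f(1)])
  moreover have "idm St D \<boxdot>\<^sub>St (idm St X \<boxdot>\<^sub>St m) = cls ?DY ?DZ ?t" using 1 2 by simp
  ultimately show ?thesis by (simp only: f(2) cmp_cls[OF Y DY DZ geta gt] cmp_cls[OF Y DZ Z ghom_comp[OF geta gt] gep]
    cmp_cls[OF Y Z Z ghom_comp[OF ghom_comp[OF geta gt] gep] gs])
 qed
 from key[OF m(1)] key[OF m(2)] show "m = m'" using eq by (simp add: ltensor_def)
qed

text \<open>A nonzero object has a block that is not projective, and for such a block the trace of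
  the identity is nonzero.\<close>

theorem ltensor_faithful:
 assumes X: "X \<in> Md" and nz: "\<not> zero_object St X" shows "faithful_functor St (ltensor St X)"
proof -
 obtain I :: "'u set" and A inc prj where D: "dsum X I A inc prj" and A: "\<And>i. i \<in> I ==> block (A i)"
  by (rule block_decomposition[OF X]) (rule that)
 note d = dsumD[OF D]
 obtain k where k: "k \<in> I" "\<not> rel_proj (A k)" using rel_proj_dsum[OF D] nz zero_object_iff[OF X] by blast
 obtain n u v where "dual_basis (A k) n u v" "(\<Oplus>\<^sub>K l\<in>{..<n}. v l (u l)) \<noteq> \<zero>\<^sub>K"
  using A[OF k(1)] k(2) unfolding block_def by blast
 from ltensor_faithful_aux[OF X d(3)[OF k(1)] this d(4)[OF k(1)] d(5)[OF k(1)]] show ?thesis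
  using lsum.prj_inc[OF d(1) k(1)] by blast
qed

end

section \<open>Split epimorphisms under tensor triangulated functors\<close>

lemma additive_functorD:
 assumes "additive_functor C D F"
 shows "X \<in> Ob C ==> fob F X \<in> Ob D"
  "X \<in> Ob C ==> fmo F (idm C X) = idm D (fob F X)"
  "X \<in> Ob C ==> Y \<in> Ob C ==> f \<in> Mor C X Y ==> fmo F f \<in> Mor D (fob F X) (fob F Y)"
  "X \<in> Ob C ==> Y \<in> Ob C ==> Z \<in> Ob C ==> f \<in> Mor C X Y ==> g \<in> Mor C Y Z ==>
   fmo F (g \<bullet>\<^sub>C f) = fmo F g \<bullet>\<^sub>D fmo F f"
  "X \<in> Ob C ==> Y \<in> Ob C ==> f \<in> Mor C X Y ==> g \<in> Mor C X Y ==>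
   fmo F (addm C f g) = addm D (fmo F f) (fmo F g)" using assms unfolding additive_functor_def by blast+

lemma additive_functor_zero:
 assumes F: "additive_functor C D F" and C: "preadditive_category C" and D: "preadditive_category D"
  and X: "X \<in> Ob C" "Y \<in> Ob C"
 shows "fmo F (zerom C X Y) = zerom D (fob F X) (fob F Y)"
proof -
 note d = additive_functorD[OF F] and z = preadditive_category.zerom_closed[OF C X]
 show ?thesis by (rule preadditive_category.addm_cancel_zero[OF D d(1)[OF X(1)] d(1)[OF X(2)] d(3)[OF X z]])
   (simp add: d(5)[OF X z z, symmetric] preadditive_category.addm_zero[OF C X])
qed

definition split_epi :: "('o, 'm, 'x) cat_scheme => 'o => 'o => 'm => bool" where
 "split_epi C X Y f \<longleftrightarrow> f \<in> Mor C X Y \<and> (\<exists>s\<in>Mor C Y X. f \<bullet>\<^sub>C s = idm C Y)"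

lemma iso_split_epi: "iso_mor C X Y f ==> split_epi C X Y f"
 by (auto simp: iso_mor_def inverse_mors_def split_epi_def)

context preadditive_category
begin

lemma split_epi_comp:
 assumes ob: "X \<in> Ob C" "Y \<in> Ob C" "Z \<in> Ob C" and f: "split_epi C X Y f" and g: "split_epi C Y Z g"
 shows "split_epi C X Z (g \<bullet> f)"
proof -
 obtain s where s: "s \<in> Mor C Y X" "f \<bullet> s = idm C Y" and fm: "f \<in> Mor C X Y" using f by (auto simp: split_epi_def)
 obtain t where t: "t \<in> Mor C Z Y" "g \<bullet> t = idm C Z" and gm: "g \<in> Mor C Y Z" using g by (auto simp: split_epi_def)
 note st = cmp_closed[OF ob(3,2,1) t(1) s(1)]
 have "(g \<bullet> f) \<bullet> (s \<bullet> t) = g \<bullet> ((f \<bullet> s) \<bullet> t)"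
  using cmp_assoc[OF ob(3,1,2,3) st fm gm] cmp_assoc[OF ob(3,2,1,2) t(1) s(1) fm] by simp
 also have "... = idm C Z" using s t idm_left[OF ob(3,2) t(1)] by simp
 finally show ?thesis using st cmp_closed[OF ob fm gm] by (auto simp: split_epi_def)
qed

lemma split_epi_cancel_iso:
 assumes ob: "W \<in> Ob C" "X \<in> Ob C" "Y \<in> Ob C" and f: "f \<in> Mor C X Y" and i: "iso_mor C W X i"
  and s: "split_epi C W Y (f \<bullet> i)"
 shows "split_epi C X Y f"
proof -
 obtain t where t: "t \<in> Mor C Y W" "(f \<bullet> i) \<bullet> t = idm C Y" using s by (auto simp: split_epi_def)
 have im: "i \<in> Mor C W X" using i by (auto simp: iso_mor_def inverse_mors_def)
 show ?thesis unfolding split_epi_def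
  using cmp_assoc[OF ob(3,1,2,3) t(1) im f] cmp_closed[OF ob(3,1,2) t(1) im] t(2) f by auto
qed

lemma split_epi_zero:
 assumes ob: "X \<in> Ob C" "Y \<in> Ob C" and s: "split_epi C X Y (zerom C X Y)"
 shows "idm C Y = zerom C Y Y"
proof -
 obtain t where "t \<in> Mor C Y X" "zerom C X Y \<bullet> t = idm C Y" using s by (auto simp: split_epi_def)
 thus ?thesis using cmp_zero_left[OF ob(2,1,2)] by simp
qed

lemma zero_objectI:
 assumes X: "X \<in> Ob C" and z: "idm C X = zerom C X X" shows "zero_object C X" unfolding zero_object_def
proof (intro conjI ballI X)
 fix Y assume Y: "Y \<in> Ob C"
 have "f = zerom C X Y" if "f \<in> Mor C X Y" for f
  using idm_right[OF X Y that] cmp_zero_right[OF X X Y that] z by simp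
 thus "\<exists>!f. f \<in> Mor C X Y" using zerom_closed[OF X Y] by blast
 have "f = zerom C Y X" if "f \<in> Mor C Y X" for f
  using idm_left[OF Y X that] cmp_zero_left[OF Y X X that] z by simp
 thus "\<exists>!f. f \<in> Mor C Y X" using zerom_closed[OF Y X] by blast
qed

lemma cmp_inv_left:
 assumes ob: "X \<in> Ob C" "Y \<in> Ob C" "Z \<in> Ob C" and f: "f \<in> Mor C X Y" and g: "g \<in> Mor C Y Z"
 shows "inv\<^bsub>hom_group C Y Z\<^esub> g \<bullet> f = inv\<^bsub>hom_group C X Z\<^esub> (g \<bullet> f)"
proof -
 interpret Y: comm_group "hom_group C Y Z" by (rule comm_group_hom[OF ob(2,3)])
 interpret X: comm_group "hom_group C X Z" by (rule comm_group_hom[OF ob(1,3)])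
 have s: "carrier (hom_group C Y Z) = Mor C Y Z" "carrier (hom_group C X Z) = Mor C X Z" by (simp_all add: hom_group_def)
 have ig: "inv\<^bsub>hom_group C Y Z\<^esub> g \<in> Mor C Y Z" using Y.inv_closed[of g] g by (simp add: s)
 have "addm C (inv\<^bsub>hom_group C Y Z\<^esub> g) g = zerom C Y Z" using Y.l_inv[of g] g by (simp add: hom_group_def)
 hence "addm C (inv\<^bsub>hom_group C Y Z\<^esub> g \<bullet> f) (g \<bullet> f) = zerom C X Z"
  using cmp_add_left[OF ob f ig g] cmp_zero_left[OF ob f] by simp
 thus ?thesis using X.inv_equality[of "inv\<^bsub>hom_group C Y Z\<^esub> g \<bullet> f" "g \<bullet> f"] cmp_closed[OF ob f ig] cmp_closed[OF ob f g]
  by (simp add: hom_group_def)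
qed

end

text \<open>The identity of Z has to be lifted along g. The axiom \<open>tri_mor\<close> only fills
  in a third map, so the triangle and the trivial triangle of Z are rotated until the lift is the
  third map; it then lives between shifts and is brought back by the fullness of the shift.\<close>

lemma (in triangulated_category) triangle_split_epi:
 assumes T: "(X, Y, Z, f, g, zerom C Z (sho C X)) \<in> tri C" shows "split_epi C Y Z g"
proof -
 note sh = shift_equivalence[unfolded equivalence_functor_def shift_functor_def, simplified]
 note shD = additive_functorD[OF conjunct1[OF sh], simplified]
 have t: "X \<in> Ob C" "Y \<in> Ob C" "Z \<in> Ob C" "f \<in> Mor C X Y" "g \<in> Mor C Y Z"
  using tri_triangle[OF T] by (simp_all add: Defs.triangle_def)
 obtain N where N: "zero_object C N" using ex_zero by blast
 have No: "N \<in> Ob C" using N by (simp add: zero_object_def)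
 note s = shD(1)[OF t(1)] shD(1)[OF t(2)] shD(1)[OF t(3)]
 have inv: "inv\<^bsub>hom_group C A B\<^esub> h \<in> Mor C A B" if "A \<in> Ob C" "B \<in> Ob C" "h \<in> Mor C A B" for A B h
  using group.inv_closed[of "hom_group C A B" h] comm_group_hom[OF that(1,2)] that(3)
  by (simp add: hom_group_def comm_group_def)
 have T1: "(Y, Z, sho C X, g, zerom C Z (sho C X), inv\<^bsub>hom_group C (sho C X) (sho C Y)\<^esub> (shm C f)) \<in> tri C"
  using T tri_rotate tri_triangle by blast
 hence T2: "(Z, sho C X, sho C Y, zerom C Z (sho C X), inv\<^bsub>hom_group C (sho C X) (sho C Y)\<^esub> (shm C f),
   inv\<^bsub>hom_group C (sho C Y) (sho C Z)\<^esub> (shm C g)) \<in> tri C" using tri_rotate tri_triangle by blast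
 have I: "(Z, Z, N, idm C Z, zerom C Z N, zerom C N (sho C Z)) \<in> tri C" by (rule tri_id[OF t(3) N])
 hence I2: "(Z, N, sho C Z, zerom C Z N, zerom C N (sho C Z), inv\<^bsub>hom_group C (sho C Z) (sho C Z)\<^esub> (shm C (idm C Z))) \<in> tri C"
  using tri_rotate tri_triangle by blast
 have "zerom C N (sho C X) \<bullet> zerom C Z N = zerom C Z (sho C X) \<bullet> idm C Z"
  using cmp_zero_right[OF t(3) No s(1) zerom_closed[OF No s(1)]] idm_right[OF t(3) s(1) zerom_closed[OF t(3) s(1)]] by simp
 from tri_mor[OF I2 T2 idm_closed[OF t(3)] zerom_closed[OF No s(1)] this]
 obtain c where c: "c \<in> Mor C (sho C Z) (sho C Y)"
  "shm C (idm C Z) \<bullet> inv\<^bsub>hom_group C (sho C Z) (sho C Z)\<^esub> (shm C (idm C Z)) = inv\<^bsub>hom_group C (sho C Y) (sho C Z)\<^esub> (shm C g) \<bullet> c"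
  by blast
 note sg = shD(3)[OF t(2,3,5)]
 interpret H: comm_group "hom_group C (sho C Z) (sho C Z)" by (rule comm_group_hom[OF s(3,3)])
 have Hc: "carrier (hom_group C (sho C Z) (sho C Z)) = Mor C (sho C Z) (sho C Z)" by (simp add: hom_group_def)
 note idZ = idm_closed[OF s(3)]
 have "inv\<^bsub>hom_group C (sho C Z) (sho C Z)\<^esub> (idm C (sho C Z)) = inv\<^bsub>hom_group C (sho C Z) (sho C Z)\<^esub> (shm C g \<bullet> c)"
  using c(2) idm_left[OF s(3,3) inv[OF s(3,3) idZ]] cmp_inv_left[OF s(3,2,3) c(1) sg] by (simp add: shD(2)[OF t(3)])
 \<comment> \<open>Rotation put a minus sign on both the shifted identity and the shifted g; the
   signs cancel.\<close>
 hence gc: "shm C g \<bullet> c = idm C (sho C Z)"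
  using H.inv_inj cmp_closed[OF s(3,2,3) c(1) sg] idZ by (auto simp: Hc inj_on_def)
 have bij: "bij_betw (shm C) (Mor C A B) (Mor C (sho C A) (sho C B))" if "A \<in> Ob C" "B \<in> Ob C" for A B
  using sh that by blast
 have "c \<in> shm C ` Mor C Z Y" using bij[OF t(3,2)] c(1) by (simp add: bij_betw_def)
 then obtain r where r: "r \<in> Mor C Z Y" "shm C r = c" by blast
 have "shm C (g \<bullet> r) = shm C (idm C Z)" using shD(4)[OF t(3,2,3) r(1) t(5)] r(2) gc shD(2)[OF t(3)] by simp
 hence "g \<bullet> r = idm C Z"
  using bij[OF t(3,3)] cmp_closed[OF t(3,2,3) r(1) t(5)] idm_closed[OF t(3)] by (auto simp: bij_betw_def inj_on_def)
 thus ?thesis using r(1) t(5) by (auto simp: split_epi_def)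
qed

lemma (in symmetric_monoidal) split_epi_tensor:
 assumes C: "preadditive_category C" and ob: "X \<in> Ob C" "Y \<in> Ob C" "Z \<in> Ob C" and f: "split_epi C X Y f"
 shows "split_epi C (X \<boxtimes> Z) (Y \<boxtimes> Z) (f \<boxdot> idm C Z)"
proof -
 interpret preadditive_category C by (rule C)
 obtain s where s: "s \<in> Mor C Y X" "f \<bullet> s = idm C Y" and fm: "f \<in> Mor C X Y" using f by (auto simp: split_epi_def)
 note i = idm_closed[OF ob(3)]
 have "(f \<boxdot> idm C Z) \<bullet> (s \<boxdot> idm C Z) = idm C (Y \<boxtimes> Z)"
  using tmo_cmp[OF ob(2,1,2) ob(3,3,3) s(1) fm i i] s(2) idm_left[OF ob(3,3) i] tmo_id[OF ob(2,3)] by simp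
 thus ?thesis unfolding split_epi_def using tmo_closed[OF ob(2,1,3,3) s(1) i] tmo_closed[OF ob(1,2,3,3) fm i] by blast
qed

text \<open>X is isomorphic to the unit tensored with X, whose identity is the tensor product of the
  two identities and vanishes with that of the unit.\<close>

lemma (in big_tt_category) zero_of_unit_zero:
 assumes z: "idm C (unt C) = zerom C (unt C) (unt C)" and X: "X \<in> Ob C" shows "zero_object C X"
proof (rule zero_objectI[OF X])
 note u = unt_closed
 note uX = tob_closed[OF u X]
 have add: "additive_functor C C (rtensor C X)" using rtensor_exact[OF X] by (simp add: exact_functor_def)
 have "idm C (unt C \<boxtimes> X) = zerom C (unt C \<boxtimes> X) (unt C \<boxtimes> X)"
  using additive_functor_zero[OF add preadditive_category_axioms preadditive_category_axioms u u] tmo_id[OF u X] z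
  by (simp add: rtensor_def)
 moreover obtain l where l: "inverse_mors C (unt C \<boxtimes> X) X (luni C X) l" using luni_iso[OF X] by (auto simp: iso_mor_def)
 hence lm: "luni C X \<in> Mor C (unt C \<boxtimes> X) X" "l \<in> Mor C X (unt C \<boxtimes> X)" "luni C X \<bullet> l = idm C X"
  by (auto simp: inverse_mors_def)
 ultimately show "idm C X = zerom C X X"
  using idm_left[OF X uX lm(2)] cmp_zero_left[OF X uX uX lm(2)] cmp_zero_right[OF X uX X lm(1)] by simp
qed

text \<open>The source enters through its preadditive structure and the closure of its tensor
  product, which is what has been established for \<open>Stab\<close>.\<close>

context
 fixes C :: "('o, 'm, 'x) ttcat_scheme" and D :: "('p, 'n, 'y) ttcat_scheme" and F
 assumes C: "preadditive_category C" and D: "preadditive_category D" "symmetric_monoidal D"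
  and F: "additive_functor C D F" "strong_symmetric_monoidal_functor C D F"
  and tob: "\<And>X Y. X \<in> Ob C ==> Y \<in> Ob C ==> X \<boxtimes>\<^sub>C Y \<in> Ob C"
  and tmo: "\<And>X X' Y f. X \<in> Ob C ==> X' \<in> Ob C ==> Y \<in> Ob C ==> f \<in> Mor C X X' ==>
   f \<boxdot>\<^sub>C idm C Y \<in> Mor C (X \<boxtimes>\<^sub>C Y) (X' \<boxtimes>\<^sub>C Y)"
   "\<And>X Y Y' f. X \<in> Ob C ==> Y \<in> Ob C ==> Y' \<in> Ob C ==> f \<in> Mor C Y Y' ==>
   idm C X \<boxdot>\<^sub>C f \<in> Mor C (X \<boxtimes>\<^sub>C Y) (X \<boxtimes>\<^sub>C Y')"
begin

private lemma mu:
 "\<exists>\<mu>. (\<forall>X\<in>Ob C. \<forall>Y\<in>Ob C. iso_mor D (fob F X \<boxtimes>\<^sub>D fob F Y) (fob F (X \<boxtimes>\<^sub>C Y)) (\<mu> X Y)) \<and>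
  (\<forall>X\<in>Ob C. \<forall>X'\<in>Ob C. \<forall>Y\<in>Ob C. \<forall>Y'\<in>Ob C. \<forall>f\<in>Mor C X X'. \<forall>g\<in>Mor C Y Y'.
   fmo F (f \<boxdot>\<^sub>C g) \<bullet>\<^sub>D \<mu> X Y = \<mu> X' Y' \<bullet>\<^sub>D (fmo F f \<boxdot>\<^sub>D fmo F g))"
 using F(2) unfolding strong_symmetric_monoidal_functor_def by (elim exE conjE) (rule exI, rule conjI, assumption+)

text \<open>By naturality of the comparison isomorphism, F(f \<otimes> id) is F f \<otimes> id up to
  isomorphisms on both sides.\<close>

lemma functor_split_epi_tensor:
 assumes ob: "X \<in> Ob C" "X' \<in> Ob C" "Y \<in> Ob C" and f: "f \<in> Mor C X X'" and s: "split_epi D (fob F X) (fob F X') (fmo F f)"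
 shows "split_epi D (fob F (X \<boxtimes>\<^sub>C Y)) (fob F (X' \<boxtimes>\<^sub>C Y)) (fmo F (f \<boxdot>\<^sub>C idm C Y))"
proof -
 interpret C: preadditive_category C by (rule C)
 interpret D: preadditive_category D by (rule D)
 interpret DM: symmetric_monoidal D by (rule D)
 note d = additive_functorD[OF F(1)]
 obtain \<mu> where \<mu>: "\<And>X Y. X \<in> Ob C ==> Y \<in> Ob C ==> iso_mor D (fob F X \<boxtimes>\<^sub>D fob F Y) (fob F (X \<boxtimes>\<^sub>C Y)) (\<mu> X Y)"
  "fmo F (f \<boxdot>\<^sub>C idm C Y) \<bullet>\<^sub>D \<mu> X Y = \<mu> X' Y \<bullet>\<^sub>D (fmo F f \<boxdot>\<^sub>D fmo F (idm C Y))"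
  using mu ob f C.idm_closed by metis
 have t: "split_epi D (fob F X \<boxtimes>\<^sub>D fob F Y) (fob F X' \<boxtimes>\<^sub>D fob F Y) (fmo F f \<boxdot>\<^sub>D fmo F (idm C Y))"
  unfolding d(2)[OF ob(3)] by (rule DM.split_epi_tensor[OF D(1) d(1)[OF ob(1)] d(1)[OF ob(2)] d(1)[OF ob(3)] s])
 note o = DM.tob_closed[OF d(1)[OF ob(1)] d(1)[OF ob(3)]] DM.tob_closed[OF d(1)[OF ob(2)] d(1)[OF ob(3)]]
  d(1)[OF tob[OF ob(1,3)]] d(1)[OF tob[OF ob(2,3)]]
 show ?thesis
  by (rule D.split_epi_cancel_iso[OF o(1,3,4) d(3)[OF tob[OF ob(1,3)] tob[OF ob(2,3)] tmo(1)[OF ob f]] \<mu>(1)[OF ob(1,3)]])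
   (use D.split_epi_comp[OF o(1,2,4) t iso_split_epi[OF \<mu>(1)[OF ob(2,3)]]] \<mu>(2) in simp)
qed

lemma functor_zero_tensor:
 assumes S: "additive_functor D D (ltensor D (fob F X))"
  and ob: "X \<in> Ob C" "Y \<in> Ob C" "Y' \<in> Ob C" and f: "f \<in> Mor C Y Y'" and z: "fmo F f = zerom D (fob F Y) (fob F Y')"
 shows "fmo F (idm C X \<boxdot>\<^sub>C f) = zerom D (fob F (X \<boxtimes>\<^sub>C Y)) (fob F (X \<boxtimes>\<^sub>C Y'))"
proof -
 interpret C: preadditive_category C by (rule C)
 interpret D: preadditive_category D by (rule D)
 interpret DM: symmetric_monoidal D by (rule D)
 note d = additive_functorD[OF F(1)]
 obtain \<mu> where \<mu>: "\<And>X Y. X \<in> Ob C ==> Y \<in> Ob C ==> iso_mor D (fob F X \<boxtimes>\<^sub>D fob F Y) (fob F (X \<boxtimes>\<^sub>C Y)) (\<mu> X Y)"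
  "fmo F (idm C X \<boxdot>\<^sub>C f) \<bullet>\<^sub>D \<mu> X Y = \<mu> X Y' \<bullet>\<^sub>D (fmo F (idm C X) \<boxdot>\<^sub>D fmo F f)"
  using mu ob f C.idm_closed by metis
 note o = DM.tob_closed[OF d(1)[OF ob(1)] d(1)[OF ob(2)]] DM.tob_closed[OF d(1)[OF ob(1)] d(1)[OF ob(3)]]
  d(1)[OF tob[OF ob(1,2)]] d(1)[OF tob[OF ob(1,3)]]
 obtain i where "inverse_mors D (fob F X \<boxtimes>\<^sub>D fob F Y) (fob F (X \<boxtimes>\<^sub>C Y)) (\<mu> X Y) i"
  using \<mu>(1)[OF ob(1,2)] by (auto simp: iso_mor_def)
 hence i: "\<mu> X Y \<in> Mor D (fob F X \<boxtimes>\<^sub>D fob F Y) (fob F (X \<boxtimes>\<^sub>C Y))"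
  "i \<in> Mor D (fob F (X \<boxtimes>\<^sub>C Y)) (fob F X \<boxtimes>\<^sub>D fob F Y)" "\<mu> X Y \<bullet>\<^sub>D i = idm D (fob F (X \<boxtimes>\<^sub>C Y))"
  by (auto simp: inverse_mors_def)
 have m: "\<mu> X Y' \<in> Mor D (fob F X \<boxtimes>\<^sub>D fob F Y') (fob F (X \<boxtimes>\<^sub>C Y'))"
  using \<mu>(1)[OF ob(1,3)] by (auto simp: iso_mor_def inverse_mors_def)
 have "fmo F (idm C X) \<boxdot>\<^sub>D fmo F f = zerom D (fob F X \<boxtimes>\<^sub>D fob F Y) (fob F X \<boxtimes>\<^sub>D fob F Y')"
  using additive_functor_zero[OF S D(1) D(1) d(1)[OF ob(2)] d(1)[OF ob(3)]] z by (simp add: ltensor_def d(2)[OF ob(1)])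
 hence z: "fmo F (idm C X \<boxdot>\<^sub>C f) \<bullet>\<^sub>D \<mu> X Y = zerom D (fob F X \<boxtimes>\<^sub>D fob F Y) (fob F (X \<boxtimes>\<^sub>C Y'))"
  using \<mu>(2) D.cmp_zero_right[OF o(1,2,4) m] by simp
 note Ff = d(3)[OF tob[OF ob(1,2)] tob[OF ob(1,3)] tmo(2)[OF ob f]]
 have "fmo F (idm C X \<boxdot>\<^sub>C f) = fmo F (idm C X \<boxdot>\<^sub>C f) \<bullet>\<^sub>D (\<mu> X Y \<bullet>\<^sub>D i)"
  using D.idm_right[OF o(3,4) Ff] i(3) by simp
 also have "... = zerom D (fob F (X \<boxtimes>\<^sub>C Y)) (fob F (X \<boxtimes>\<^sub>C Y'))"
  using D.cmp_assoc[OF o(3,1,3,4) i(2,1) Ff] z D.cmp_zero_left[OF o(3,1,4) i(2)] by simp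
 finally show ?thesis .
qed

end

section \<open>The unit and the extensions of a module by it\<close>

context stab
begin

abbreviation U where "U \<equiv> unit_mod G K :: ('g, 'k, 'u) gmod"

definition e\<^sub>0 :: 'u where "e\<^sub>0 = snd (unit_pair G K :: ('g, 'k, 'u) gmod \<times> 'u)"

text \<open>The coordinate with respect to the basis vector of the unit.\<close>

definition eps :: "'u => 'k" where "eps = the_inv_into (carrier K) (\<lambda>a. a \<odot>\<^sub>U e\<^sub>0)"

text \<open>The choice in \<open>unit_pair\<close> succeeds because the field with trivial action is
  small and can be transported.\<close>

lemma unit_props: "U \<in> Md \<and> e\<^sub>0 \<in>. U \<and> bij_betw (\<lambda>a. a \<odot>\<^sub>U e\<^sub>0) (carrier K) (carrier U) \<and>
  (\<forall>g\<in>carrier G. \<forall>x\<in>carrier U. act U g x = x)"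
proof -
 let ?K = "Kmod K :: ('g, 'k, 'k) gmod"
 let ?P = "\<lambda>(E :: ('g, 'k, 'u) gmod, e). E \<in> Md \<and> e \<in>. E \<and> bij_betw (\<lambda>a. a \<odot>\<^sub>E e) (carrier K) (carrier E) \<and>
   (\<forall>g\<in>carrier G. \<forall>x\<in>carrier E. act E g x = x)"
 have mK: "module K ?K" by (rule mKmod)
 have kK: "kmod ?K" by (rule kG_moduleI[OF mK]) (auto intro!: linI)
 have "small TYPE('u) (carrier ?K)" using small_field by simp
 then obtain E :: "('g, 'k, 'u) gmod" and f f' where E: "E \<in> Md" "giso G K ?K E f f'"
  by (rule transport[OF kK]) (rule that)
 have f: "ghm ?K E f" "ghm E ?K f'" "\<And>x. x \<in>. K ==> f' (f x) = x" "\<And>y. y \<in>. E ==> f (f' y) = y"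
  using E(2) unfolding giso_def by auto
 have fa: "a \<odot>\<^sub>E f \<one>\<^sub>K = f a" if "a \<in>. K" for a
  using lin_smult[OF ghom_lin[OF f(1)] that, of "\<one>\<^sub>K"] that by simp
 have fc: "f a \<in>. E" if "a \<in>. K" for a using ghom_in[OF f(1)] that by simp
 have fc': "f' y \<in>. K" if "y \<in>. E" for y using ghom_in[OF f(2) that] by simp
 have "bij_betw (\<lambda>a. a \<odot>\<^sub>E f \<one>\<^sub>K) (carrier K) (carrier E)"
  by (rule bij_betw_byWitness[where f' = f']) (use f(3,4) fa fc fc' in auto)
 moreover have "act E g x = x" if "g \<in>. G" "x \<in>. E" for g x
  using ghom_act[OF f(1) that(1), of "f' x"] fc'[OF that(2)] f(4)[OF that(2)] by simp
 ultimately have "?P (E, f \<one>\<^sub>K)" using E(1) fc by simp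
 hence "?P (unit_pair G K)" unfolding unit_pair_def by (rule someI[of ?P])
 thus ?thesis by (simp add: unit_mod_def e\<^sub>0_def case_prod_beta)
qed

lemma U_Md: "U \<in> Md" and e0_in: "e\<^sub>0 \<in>. U"
 and U_act: "g \<in>. G ==> x \<in>. U ==> act U g x = x" using unit_props by blast+

lemma eps_smult: "a \<in>. K ==> eps (a \<odot>\<^sub>U e\<^sub>0) = a"
 unfolding eps_def using unit_props by (intro the_inv_into_f_f) (auto simp: bij_betw_def)

lemma eps_expand: "x \<in>. U ==> eps x \<odot>\<^sub>U e\<^sub>0 = x"
 unfolding eps_def using unit_props by (intro f_the_inv_into_f) (auto simp: bij_betw_def)

lemma eps_e0 [simp]: "eps e\<^sub>0 = \<one>\<^sub>K"
proof -
 interpret U: module K U by (rule Md_mod[OF U_Md])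
 show ?thesis using eps_smult[OF K.one_closed] e0_in by simp
qed

lemma functional_eps: "functional K U eps"
proof (rule linI)
 interpret U: module K U by (rule Md_mod[OF U_Md])
 have ex: "\<exists>a\<in>carrier K. x = a \<odot>\<^sub>U e\<^sub>0" if "x \<in>. U" for x
  using unit_props that unfolding bij_betw_def by blast
 show "eps x \<in>. Kv K" if "x \<in>. U" for x using ex[OF that] eps_smult by auto
 show "eps (x \<oplus>\<^sub>U y) = eps x \<oplus>\<^bsub>(Kv K)\<^esub> eps y" if xy: "x \<in>. U" "y \<in>. U" for x y
 proof -
  obtain a b where "a \<in>. K" "x = a \<odot>\<^sub>U e\<^sub>0" "b \<in>. K" "y = b \<odot>\<^sub>U e\<^sub>0" using ex xy by blast
  thus ?thesis using eps_smult e0_in by (simp flip: U.smult_l_distr)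
 qed
 show "eps (c \<odot>\<^sub>U x) = c \<odot>\<^bsub>(Kv K)\<^esub> eps x" if c: "c \<in>. K" and x: "x \<in>. U" for c x
 proof -
  obtain a where "a \<in>. K" "x = a \<odot>\<^sub>U e\<^sub>0" using ex x by blast
  thus ?thesis using eps_smult e0_in c by (simp flip: U.smult_assoc1)
 qed
qed

lemma eps_closed: "x \<in>. U ==> eps x \<in>. K"
 using lin_in[OF functional_eps] by simp

text \<open>The homomorphism from the unit that represents an invariant vector.\<close>

lemma ghom_unit:
 assumes N: "N \<in> Md" and v: "v \<in>. N" and fixed: "\<And>g. g \<in>. G ==> act N g v = v"
 shows "ghm U N (\<lambda>x. eps x \<odot>\<^sub>N v)"
 by (rule ghomI[OF lin_functional_smult[OF functional_eps v Md_mod[OF N]]])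
  (simp add: U_act lin_smult[OF act_lin[OF Md_kmod[OF N]]] eps_closed v fixed)

end

context cyc
begin

text \<open>An action of the cyclic group amounts to an operator whose p-th power is the identity:
  each group element acts by the power given by its exponent below p.\<close>

lemma cyclic_action:
 assumes M: "M \<in> Md" and A: "lin K M M A" and Ap: "\<And>x. x \<in>. M ==> (A ^^ p) x = x"
 obtains r where "M\<lparr>act := r\<rparr> \<in> Md" "\<And>x. x \<in>. M ==> r g\<^sub>0 x = A x"
proof -
 define idx where "idx = the_inv_into {..<p} (\<lambda>i. g\<^sub>0 [^]\<^sub>G i)"
 define r where "r g = A ^^ idx g" for g
 have An: "(A ^^ n) x \<in>. M" if "x \<in>. M" for n x by (rule lin_in[OF lin_funpow[OF A] that])
 have r: "r (g\<^sub>0 [^]\<^sub>G n) x = (A ^^ n) x" if x: "x \<in>. M" for n x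
 proof -
  have "idx (g\<^sub>0 [^]\<^sub>G (n mod p)) = n mod p" unfolding idx_def
   by (rule the_inv_into_f_f[OF inj_pow]) (use p_pos in simp)
  hence "r (g\<^sub>0 [^]\<^sub>G n) x = (A ^^ (n mod p)) x" unfolding r_def g0_pow_mod by simp
  also have "... = (A ^^ n) x" by (rule funpow_mod_eq[OF Ap[OF x]])
  finally show ?thesis .
 qed
 have mM: "module K (M\<lparr>act := r\<rparr>)"
  using Md_mod[OF M] by (simp add: module_def module_axioms_def abelian_group_def abelian_monoid_def abelian_group_axioms_def)
 have pow: "\<exists>n::nat. g = g\<^sub>0 [^]\<^sub>G n" if "g \<in>. G" for g using that unfolding carrier_pow by blast
 have "kmod (M\<lparr>act := r\<rparr>)"
 proof (rule kG_moduleI[OF mM])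
  show "lin K (M\<lparr>act := r\<rparr>) (M\<lparr>act := r\<rparr>) (act (M\<lparr>act := r\<rparr>) g)" for g
   using lin_funpow[OF A, of "idx g"] by (simp add: lin_def r_def)
  show "act (M\<lparr>act := r\<rparr>) \<one>\<^sub>G x = x" if "x \<in>. (M\<lparr>act := r\<rparr>)" for x using r[of x 0] that by simp
  fix g h x assume "g \<in>. G" "h \<in>. G" and x: "x \<in>. (M\<lparr>act := r\<rparr>)"
  then obtain m n :: nat where "g = g\<^sub>0 [^]\<^sub>G m" "h = g\<^sub>0 [^]\<^sub>G n" using pow by blast
  thus "act (M\<lparr>act := r\<rparr>) (g \<otimes>\<^sub>G h) x = act (M\<lparr>act := r\<rparr>) g (act (M\<lparr>act := r\<rparr>) h x)"
   using r[of x] r[OF An, of x] x g0 by (simp add: G.nat_pow_mult funpow_add)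
 qed
 hence "M\<lparr>act := r\<rparr> \<in> Md" using Md_small[OF M] by (simp add: kG_mods_def)
 thus thesis using r[of _ 1] g0 by (intro that[of r]) auto
qed

text \<open>The extension E of N by the unit whose cocycle is \<open>lam\<close> on the generator.
  The p-th power of the twisted operator differs from the identity by the sums of \<open>lam\<close>
  over orbits, so the norm condition is exactly what makes it an action.\<close>

lemma unit_extension:
 assumes N: "N \<in> Md" and lam: "functional K N lam"
  and norm: "\<And>n. n \<in>. N ==> (\<Oplus>\<^sub>K i\<in>{..<p}. lam (act N (g\<^sub>0 [^]\<^sub>G i) n)) = \<zero>\<^sub>K"
 obtains E i j s q where "E \<in> Md" "ghm U E i" "lin K N E j" "functional K E s" "ghm E N q"
  "\<And>x. x \<in>. E ==> x = i (s x \<odot>\<^sub>U e\<^sub>0) \<oplus>\<^sub>E j (q x)"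
  "\<And>a. a \<in>. U ==> s (i a) = eps a" "\<And>a. a \<in>. U ==> q (i a) = \<zero>\<^sub>N"
  "\<And>n. n \<in>. N ==> s (j n) = \<zero>\<^sub>K" "\<And>n. n \<in>. N ==> q (j n) = n"
  "\<And>n. n \<in>. N ==> act E g\<^sub>0 (j n) = i (lam n \<odot>\<^sub>U e\<^sub>0) \<oplus>\<^sub>E j (act N g\<^sub>0 n)"
proof -
 let ?A = "\<lambda>b. if b then U else N"
 have "small TYPE('u) (UNIV :: bool set)" by (rule small_finite[OF infinite_univ]) simp
 then obtain W inc prj where D: "dsum W UNIV ?A inc prj"
  by (rule ex_dsum[of UNIV ?A]) (use U_Md N in \<open>auto intro: that\<close>)
 note d = dsumD[OF D]
 interpret W: module K W by (rule Md_mod[OF d(2)])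
 interpret D: lsum K W UNIV ?A inc prj by (rule d(1))
 interpret N: module K N by (rule Md_mod[OF N])
 interpret U: module K U by (rule Md_mod[OF U_Md])
 note kW = Md_kmod[OF d(2)] and kN = Md_kmod[OF N]
 let ?i = "inc True" and ?j = "inc False" and ?s = "prj True" and ?q = "prj False"
 have ij: "ghm U W ?i" "ghm N W ?j" "ghm W U ?s" "ghm W N ?q"
  using d(4)[of True] d(4)[of False] d(5)[of True] d(5)[of False] by simp_all
 note l = ij[THEN ghom_lin]
 have prj: "?s (?i a) = a" "?q (?i a) = \<zero>\<^sub>N" if "a \<in>. U" for a
  using D.prj_inc[of True a] D.prj_inc_zero[of True False a] that by simp_all
 have prj': "?s (?j n) = \<zero>\<^sub>U" "?q (?j n) = n" if "n \<in>. N" for n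
  using D.prj_inc[of False n] D.prj_inc_zero[of False True n] that by simp_all
 have ex: "x = ?i (?s x) \<oplus>\<^sub>W ?j (?q x)" if x: "x \<in>. W" for x
 proof -
  have "x = (\<Oplus>\<^sub>W b\<in>{True, False}. inc b (prj b x))" by (rule D.expand[OF x]) auto
  thus ?thesis using lin_in[OF l(1) lin_in[OF l(3) x]] lin_in[OF l(2) lin_in[OF l(4) x]] by simp
 qed
 define A where "A x = act W g\<^sub>0 x \<oplus>\<^sub>W ?i (lam (?q x) \<odot>\<^sub>U e\<^sub>0)" for x
 have lamc: "lam n \<in>. K" if "n \<in>. N" for n using lin_in[OF lam that] by simp
 have A: "lin K W W A" unfolding A_def
  by (rule lin_plus[OF act_lin[OF kW g0] lin_comp[OF lin_comp[OF l(4) lin_functional_smult[OF lam e0_in U.modl]] l(1)] W.modl])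
 \<comment> \<open>Each application of A adds the value of \<open>lam\<close> at the current
   translate, and the unit part is fixed by the group, so the contributions accumulate as partial
   orbit sums.\<close>
 have pow: "(A ^^ n) x = act W (g\<^sub>0 [^]\<^sub>G n) x \<oplus>\<^sub>W ?i ((\<Oplus>\<^sub>K k\<in>{..<n}. lam (act N (g\<^sub>0 [^]\<^sub>G k) (?q x))) \<odot>\<^sub>U e\<^sub>0)"
  if x: "x \<in>. W" for n x
 proof (induction n)
  case 0
  show ?case using x e0_in lin_zero[OF l(1) U.modl W.modl] by (simp add: act_one[OF kW])
 next
  case (Suc n)
  let ?c = "\<lambda>n :: nat. \<Oplus>\<^sub>K k\<in>{..<n}. lam (act N (g\<^sub>0 [^]\<^sub>G k) (?q x))" and ?x = "act W (g\<^sub>0 [^]\<^sub>G n) x"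
  let ?b = "lam (act N (g\<^sub>0 [^]\<^sub>G n) (?q x))"
  have gn: "g\<^sub>0 [^]\<^sub>G n \<in>. G" using g0 by simp
  have qx: "?q x \<in>. N" by (rule lin_in[OF l(4) x])
  have t: "lam (act N (g\<^sub>0 [^]\<^sub>G k) (?q x)) \<in>. K" for k :: nat using lamc act_in[OF kN _ qx] g0 by simp
  have c: "?c n \<in>. K" for n using t by (intro K.finsum_closed) auto
  note xc = act_in[OF kW gn x]
  have i: "?i (a \<odot>\<^sub>U e\<^sub>0) \<in>. W" "?q (?i (a \<odot>\<^sub>U e\<^sub>0)) = \<zero>\<^sub>N" "act W g\<^sub>0 (?i (a \<odot>\<^sub>U e\<^sub>0)) = ?i (a \<odot>\<^sub>U e\<^sub>0)"
   if "a \<in>. K" for a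
   using that e0_in lin_in[OF l(1)] prj(2) ghom_act[OF ij(1) g0, of "a \<odot>\<^sub>U e\<^sub>0"] U_act[OF g0] by simp_all
  have q: "?q (?x \<oplus>\<^sub>W ?i (?c n \<odot>\<^sub>U e\<^sub>0)) = act N (g\<^sub>0 [^]\<^sub>G n) (?q x)"
   using lin_add[OF l(4) xc i(1)[OF c]] i(2)[OF c] ghom_act[OF ij(4) gn x] act_in[OF kN gn qx] by simp
  have "(A ^^ Suc n) x = A (?x \<oplus>\<^sub>W ?i (?c n \<odot>\<^sub>U e\<^sub>0))" using Suc by simp
  also have "... = (act W g\<^sub>0 ?x \<oplus>\<^sub>W ?i (?c n \<odot>\<^sub>U e\<^sub>0)) \<oplus>\<^sub>W ?i (?b \<odot>\<^sub>U e\<^sub>0)"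
   unfolding A_def q using lin_add[OF act_lin[OF kW g0] xc i(1)[OF c]] i(3)[OF c] by simp
  also have "... = act W g\<^sub>0 ?x \<oplus>\<^sub>W ?i (?c n \<odot>\<^sub>U e\<^sub>0 \<oplus>\<^sub>U ?b \<odot>\<^sub>U e\<^sub>0)"
   using act_in[OF kW g0 xc] i(1) c t e0_in by (simp add: W.a_assoc lin_add[OF l(1)])
  also have "act W g\<^sub>0 ?x = act W (g\<^sub>0 [^]\<^sub>G Suc n) x"
   using g0 by (subst G.nat_pow_Suc2) (simp_all add: act_mult[OF kW g0 gn x])
  also have "?c n \<odot>\<^sub>U e\<^sub>0 \<oplus>\<^sub>U ?b \<odot>\<^sub>U e\<^sub>0 = ?c (Suc n) \<odot>\<^sub>U e\<^sub>0"
  proof -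
   have "?c (Suc n) = ?c n \<oplus>\<^sub>K ?b"
    by (subst lessThan_Suc, subst K.finsum_insert) (use t K.a_comm[OF t[of n] c[of n]] in auto)
   thus ?thesis by (simp only: U.smult_l_distr[OF c t e0_in])
  qed
  finally show ?case .
 qed
 have Ap: "(A ^^ p) x = x" if x: "x \<in>. W" for x
  using pow[OF x, of p] norm[OF lin_in[OF l(4) x]] x e0_in lin_zero[OF l(1) U.modl W.modl]
  by (simp add: g0_pow_p act_one[OF kW])
 obtain r where r: "W\<lparr>act := r\<rparr> \<in> Md" "\<And>x. x \<in>. W ==> r g\<^sub>0 x = A x"
  by (rule cyclic_action[OF d(2) A]) (erule Ap, rule that, assumption+)
 let ?E = "W\<lparr>act := r\<rparr>"
 have lE: "lin K U ?E ?i" "lin K N ?E ?j" "lin K ?E U ?s" "lin K ?E N ?q" using l by (simp_all add: lin_def)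
 show thesis
 proof (rule that[of ?E ?i ?j "\<lambda>x. eps (?s x)" ?q])
  show "?E \<in> Md" by (rule r(1))
  show "lin K N ?E ?j" by (rule lE(2))
  show "functional K ?E (\<lambda>x. eps (?s x))" by (rule lin_comp[OF lE(3) functional_eps])
  show "ghm U ?E ?i"
  proof (rule ghom_g0I[OF Md_kmod[OF U_Md] Md_kmod[OF r(1)] lE(1)])
   fix x assume x: "x \<in>. U"
   have "lam \<zero>\<^sub>N = \<zero>\<^sub>K" using lin_zero[OF lam N.modl mKmod] by simp
   hence "A (?i x) = ?i x" using x prj(2)[OF x] e0_in lin_in[OF l(1) x] lin_zero[OF l(1) U.modl W.modl]
     ghom_act[OF ij(1) g0 x] U_act[OF g0 x] by (simp add: A_def)
   thus "?i (act U g\<^sub>0 x) = act ?E g\<^sub>0 (?i x)" using r(2)[OF lin_in[OF l(1) x]] U_act[OF g0 x] by simp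
  qed
  show "ghm ?E N ?q"
  proof (rule ghom_g0I[OF Md_kmod[OF r(1)] kN lE(4)])
   fix x assume "x \<in>. ?E"
   hence x: "x \<in>. W" by simp
   have "lam (?q x) \<odot>\<^sub>U e\<^sub>0 \<in>. U" using lamc lin_in[OF l(4) x] e0_in by simp
   thus "?q (act ?E g\<^sub>0 x) = act N g\<^sub>0 (?q x)"
    using lin_add[OF l(4) act_in[OF kW g0 x] lin_in[OF l(1)]] prj(2) ghom_act[OF ij(4) g0 x] r(2)[OF x]
     act_in[OF kN g0 lin_in[OF l(4) x]] by (simp add: A_def)
  qed
  show "x = ?i (eps (?s x) \<odot>\<^sub>U e\<^sub>0) \<oplus>\<^bsub>?E\<^esub> ?j (?q x)" if "x \<in>. ?E" for x
   using ex[of x] that lin_in[OF l(3)] by (simp add: eps_expand)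
  show "eps (?s (?i a)) = eps a" "?q (?i a) = \<zero>\<^sub>N" if "a \<in>. U" for a using prj that by simp_all
  show "eps (?s (?j n)) = \<zero>\<^sub>K" "?q (?j n) = n" if "n \<in>. N" for n
   using prj' that lin_zero[OF functional_eps U.modl mKmod] by simp_all
  fix n assume n: "n \<in>. N"
  have "lam n \<odot>\<^sub>U e\<^sub>0 \<in>. U" using lamc[OF n] e0_in by simp
  thus "act ?E g\<^sub>0 (?j n) = ?i (lam n \<odot>\<^sub>U e\<^sub>0) \<oplus>\<^bsub>?E\<^esub> ?j (act N g\<^sub>0 n)"
   using r(2)[OF lin_in[OF l(2) n]] prj'(2)[OF n] ghom_act[OF ij(2) g0 n]
    lin_in[OF l(2) act_in[OF kN g0 n]] lin_in[OF l(1)] by (simp add: A_def W.a_comm)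
 qed
qed

end

section \<open>Maps from the unit and triangles\<close>

context stab
begin

text \<open>The choice in \<open>inj_seq\<close> succeeds: embed M into a relatively projective
  module, which is injective, and take the quotient.\<close>

lemma inj_seqE:
 assumes M: "M \<in> Md"
 obtains J i S q where "inj_seq G K M = (J, i, S, q)" "injective_mod G K J" "short_exact G K M J S i q"
proof -
 obtain P i where P: "P \<in> Md" "rel_proj P" and i: "ghm M P i" "inj_on i (carrier M)"
  by (rule ex_embedding[OF M]) (rule that)
 interpret P: module K P by (rule Md_mod[OF P(1)])
 note kM = Md_kmod[OF M] and kP = Md_kmod[OF P(1)]
 have H: "P.subsp (i ` carrier M)" by (rule P.subsp_range[OF ghom_lin[OF i(1)] Md_mod[OF M]])
 have Ha: "act P g x \<in> i ` carrier M" if g: "g \<in>. G" and x: "x \<in> i ` carrier M" for g x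
 proof -
  obtain y where y: "y \<in>. M" "x = i y" using x by blast
  show ?thesis using ghom_act[OF i(1) g y(1)] act_in[OF kM g y(1)] y(2) by force
 qed
 obtain C q where C: "C \<in> Md" "ghm P C q" "q ` carrier P = carrier C"
  "\<And>x. x \<in>. P ==> q x = \<zero>\<^sub>C \<longleftrightarrow> x \<in> i ` carrier M"
  by (rule ex_quotient[OF P(1) H Ha]) (assumption+, rule that)
 have "short_exact G K M P C (restrict i (carrier M)) (restrict q (carrier P))" unfolding short_exact_def
  using M P(1) C(1,3,4) ghom_restrict[OF kM i(1)] ghom_restrict[OF kP C(2)] i(2) ghom_in[OF i(1)]
  by (auto simp: inj_on_def)
 hence "\<exists>x. (\<lambda>(J, i, S, q). injective_mod G K J \<and> short_exact G K M J S i q) x"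
  using rel_proj_imp_injective[OF P] by auto
 from someI_ex[OF this] have "case inj_seq G K M of (J, i, S, q) => injective_mod G K J \<and> short_exact G K M J S i q"
  unfolding inj_seq_def .
 thus thesis by (cases "inj_seq G K M") (auto intro: that)
qed

lemma short_exactD:
 assumes "short_exact G K A B C f g"
 shows "A \<in> Md" "B \<in> Md" "C \<in> Md" "ghm A B f" "ghm B C g" "inj_on f (carrier A)"
  "g ` carrier B = carrier C" "f ` carrier A = {y \<in> carrier B. g y = \<zero>\<^sub>C}"
  "f \<in> extensional (carrier A)" "g \<in> extensional (carrier B)"
 using assms by (simp_all add: short_exact_def kG_hom_iff)

text \<open>Needed to see that a standard triangle belongs to \<open>tri\<close> by way of identity
  isomorphisms. The maps collected in \<open>susp_mor\<close> for the identity come from any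
  extension t to J of any representative f of the identity of M. Correcting t - id by a trace makes
  it vanish on M, so the induced map minus the identity factors through J, which is relatively
  projective.\<close>

lemma susp_idm_cmp:
 assumes M: "M \<in> Md" and J: "inj_seq G K M = (J, i, S, q)" "injective_mod G K J" "short_exact G K M J S i q"
  and X: "X \<in> Md" and w: "ghm X S w"
 shows "susp_mor G K (idm St M) \<bullet>\<^sub>St cls X S w = cls X S w"
proof -
 note d = short_exactD[OF J(3)]
 note kM = Md_kmod[OF M] and kJ = Md_kmod[OF d(2)] and kS = Md_kmod[OF d(3)]
 interpret M: module K M by (rule Md_mod[OF M])
 interpret J: module K J by (rule Md_mod[OF d(2)])
 interpret S: module K S by (rule Md_mod[OF d(3)])
 let ?C = "\<lambda>M N f. {k \<in> kG_hom G K M N. steq M N k f}"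
 let ?D = "{s \<in> kG_hom G K S S. \<exists>f\<in>?C M M (\<lambda>x. x). \<exists>t\<in>kG_hom G K J J.
       compose (carrier M) t i = compose (carrier M) i f \<and> compose (carrier J) s q = compose (carrier J) q t}"
 have D: "ghm S S s \<and> steq S S s (\<lambda>x. x)" if "s \<in> ?D" for s
 proof -
  obtain f t where s: "ghm S S s" and f: "ghm M M f" "steq M M f (\<lambda>x. x)" and t: "ghm J J t"
   and ti: "compose (carrier M) t i = compose (carrier M) i f" and sq: "compose (carrier J) s q = compose (carrier J) q t"
   using \<open>s \<in> ?D\<close> by (auto simp: kG_hom_iff)
  have ti: "t (i x) = i (f x)" if "x \<in>. M" for x using fun_cong[OF ti, of x] that by (simp add: compose_def)
  have sq: "s (q x) = q (t x)" if "x \<in>. J" for x using fun_cong[OF sq, of x] that by (simp add: compose_def)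
  obtain h where h: "lin K M M h" "\<And>x. x \<in>. M ==> f x = x \<oplus>\<^sub>M Tr M M h x" using f(2) by (auto simp: steq_def)
  obtain r where r: "lin K J M r" "\<And>x. x \<in>. M ==> r (i x) = x"
   by (rule J.ex_left_inverse[OF K.field_axioms ghom_lin[OF d(4)] M.modl d(6)]) (rule that)
  \<comment> \<open>The witness h of f on M, carried to J by the linear left inverse r of i.\<close>
  let ?h = "\<lambda>y. i (h (r y))"
  have lh: "lin K J J ?h" by (rule lin_comp[OF lin_comp[OF r(1) h(1)] ghom_lin[OF d(4)]])
  have Tri: "Tr J J ?h (i x) = i (Tr M M h x)" if x: "x \<in>. M" for x
  proof -
   have "Tr J J ?h (i x) = Tr M J (\<lambda>x. ?h (i x)) x" by (rule Tr_right[OF kJ kJ kM lh d(4) x])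
   also have "... = Tr M J (\<lambda>x. i (h x)) x" by (rule Tr_cong[OF kM kJ lin_comp[OF h(1) ghom_lin[OF d(4)]] _ x]) (simp add: r(2))
   also have "... = i (Tr M M h x)" by (rule Tr_left[OF kM kM kJ h(1) d(4) x, symmetric])
   finally show ?thesis .
  qed
  have qTr: "q (Tr J J ?h y) = \<zero>\<^sub>S" if y: "y \<in>. J" for y
  proof -
   have qi: "q (i z) = \<zero>\<^sub>S" if "z \<in>. M" for z using d(8) that by blast
   have "q (Tr J J ?h y) = Tr J S (\<lambda>y. q (?h y)) y" by (rule Tr_left[OF kJ kJ kS lh d(5) y])
   also have "... = Tr J S (\<lambda>y. \<zero>\<^sub>S) y"
    by (rule Tr_cong[OF kJ kS lin_const0[OF S.modl] _ y]) (rule qi[OF lin_in[OF lin_comp[OF r(1) h(1)]]])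
   finally show ?thesis using Tr_zero[OF kJ kS y] by simp
  qed
  note gT = ghom_Tr[OF kJ kJ lh]
  \<comment> \<open>t - id and the trace of \<open>?h\<close> agree on the image of M, so their
    difference factors through q; the trace itself is invisible after q.\<close>
  let ?d = "\<lambda>y. (t y \<ominus>\<^sub>J y) \<ominus>\<^sub>J Tr J J ?h y"
  note dg = ghom_diff[OF kJ ghom_diff[OF kJ t ghom_id] gT]
  have ker: "?d y = \<zero>\<^sub>J" if y: "y \<in>. J" "q y = \<zero>\<^sub>S" for y
  proof -
   obtain x where x: "x \<in>. M" "y = i x" using d(8) y by blast
   note c = lin_in[OF lin_Tr[OF kM kM h(1)] x(1)]
   have "t y = i x \<oplus>\<^sub>J i (Tr M M h x)" using ti[OF x(1)] h(2)[OF x(1)] lin_add[OF ghom_lin[OF d(4)] x(1) c] x(2) by simp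
   thus ?thesis using Tri[OF x(1)] ghom_in[OF d(4) x(1)] ghom_in[OF d(4) c] x(2)
    by (simp add: J.minus_eq J.a_ac J.r_neg J.r_neg1)
  qed
  obtain \<delta> where \<delta>: "ghm S J \<delta>" "\<And>y. y \<in>. J ==> \<delta> (q y) = ?d y"
   by (rule ghom_factor[OF kJ kS kJ d(5) d(7) dg ker]) (assumption+, rule that)
  obtain k where k: "lin K S S k" "\<And>z. z \<in>. S ==> q (\<delta> z) = \<zero>\<^sub>S \<oplus>\<^sub>S Tr S S k z"
   using steq_zero_factor[OF d(3,3) kJ injective_imp_rel_proj[OF J(2)] \<delta>(1) d(5)] by (auto simp: steq_def)
  have "s z = z \<oplus>\<^sub>S Tr S S k z" if z: "z \<in>. S" for z
  proof -
   obtain y where y: "y \<in>. J" "z = q y" using d(7) z by blast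
   note ty = ghom_in[OF t y(1)] and Ty = ghom_in[OF gT y(1)]
   have "q (?d y) = (q (t y) \<ominus>\<^sub>S q y) \<ominus>\<^sub>S q (Tr J J ?h y)"
    using lin_minus[OF ghom_lin[OF d(5)] J.modl S.modl] ty Ty y(1) by simp
   also have "... = s z \<ominus>\<^sub>S z"
    using qTr[OF y(1)] sq[OF y(1)] ghom_in[OF d(5) y(1)] ghom_in[OF d(5) ty] y(2) by (simp add: S.minus_eq)
   finally have "s z \<ominus>\<^sub>S z = Tr S S k z"
    using k(2)[OF z] \<delta>(2)[OF y(1)] y(2) lin_in[OF lin_Tr[OF kS kS k(1)] z] by simp
   moreover have "s z = z \<oplus>\<^sub>S (s z \<ominus>\<^sub>S z)"
    using S.minus_add_cancel[OF ghom_in[OF s z] z] S.a_comm[OF z S.minus_closed[OF ghom_in[OF s z] z]] by simp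
   ultimately show ?thesis by simp
  qed
  thus ?thesis using s k(1) by (auto simp: steq_def)
 qed
 have idD: "restrict (\<lambda>x. x) (carrier S) \<in> ?D"
 proof -
  have "restrict (\<lambda>x. x) (carrier M) \<in> ?C M M (\<lambda>x. x)" by (rule restrict_mem[OF M M ghom_id ghom_id steq_refl[OF M M ghom_id]])
  moreover have "compose (carrier M) (restrict (\<lambda>x. x) (carrier J)) i = compose (carrier M) i (restrict (\<lambda>x. x) (carrier M))"
   "compose (carrier J) (restrict (\<lambda>x. x) (carrier S)) q = compose (carrier J) q (restrict (\<lambda>x. x) (carrier J))"
   using ghom_in[OF d(4)] ghom_in[OF d(5)] by (auto simp: compose_def intro!: restrict_ext)
  ultimately show ?thesis using ghom_restrict[OF kS ghom_id] ghom_restrict[OF kJ ghom_id] by blast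
 qed
 have "stab_class G K X S (compose (carrier X) b a) = ?C X S w" if "a \<in> ?C X S w" "b \<in> ?D" for a b
 proof -
  have a: "ghm X S a" "steq X S a w" using that by (auto simp: kG_hom_iff)
  note b = conjunct1[OF D[OF that(2)]] conjunct2[OF D[OF that(2)]]
  note h = ghom_comp[OF a(1) b(1)]
  have "cls X S (\<lambda>x. b (a x)) = cls X S w"
   using steq_comp[OF X d(3,3) a(1) w a(2) b(1) ghom_id b(2)] cls_eq_iff[OF X d(3) h w] by simp
  thus ?thesis using stab_class_eq[OF X d(3) h] by (simp add: cls_eq[OF X d(3) h] cls_eq[OF X d(3) w] compose_def)
 qed
 moreover have "restrict w (carrier X) \<in> ?C X S w" by (rule restrict_mem[OF X d(3) w w steq_refl[OF X d(3) w]])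
 ultimately have "(\<Union>b\<in>?D. \<Union>a\<in>?C X S w. stab_class G K X S (compose (carrier X) b a)) = ?C X S w"
  using idD by blast
 moreover have "susp_mor G K (idm St M) = (S, ?D, S)"
  unfolding idm_cls[OF M] cls_eq[OF M M ghom_id] by (simp add: susp_mor_def J(1))
 ultimately show ?thesis by (simp add: Stab_def stab_cat_def cls_eq[OF X d(3) w])
qed

text \<open>Restricting the maps makes the triangle literally standard; identities then exhibit it
  as isomorphic to itself.\<close>

lemma standard_triangle_tri:
 assumes A: "inj_seq G K A = (J, iJ, S, qJ)" "injective_mod G K J" "short_exact G K A J S iJ qJ"
  and B: "B \<in> Md" and C: "C \<in> Md" and f: "ghm A B f" "inj_on f (carrier A)"
  and g: "ghm B C g" "g ` carrier B = carrier C" "f ` carrier A = {y \<in> carrier B. g y = \<zero>\<^sub>C}"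
  and t: "ghm B J t" "\<And>x. x \<in>. A ==> t (f x) = iJ x"
  and w: "ghm C S w" "\<And>x. x \<in>. B ==> w (g x) = qJ (t x)"
 shows "(A, B, C, cls A B f, cls B C g, cls C S w) \<in> tri St"
proof -
 note d = short_exactD[OF A(3)]
 note A' = d(1) and kA = Md_kmod[OF d(1)] and kB = Md_kmod[OF B] and kC = Md_kmod[OF C]
 interpret P: preadditive_category St by (rule preadditive_Stab)
 let ?f = "restrict f (carrier A)" and ?g = "restrict g (carrier B)"
 let ?t = "restrict t (carrier B)" and ?w = "restrict w (carrier C)"
 have se: "short_exact G K A B C ?f ?g" unfolding short_exact_def
  using A' B C ghom_restrict[OF kA f(1)] ghom_restrict[OF kB g(1)] f(2) g(2,3) ghom_in[OF f(1)]
  by (auto simp: inj_on_def)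
 have "compose (carrier A) ?t ?f = iJ"
  by (rule extensionalityI[OF _ d(9)]) (auto simp: compose_def t(2) ghom_in[OF f(1)])
 moreover have "compose (carrier B) ?w ?g = compose (carrier B) qJ ?t"
  using w(2) ghom_in[OF g(1)] by (auto simp: compose_def intro!: restrict_ext)
 ultimately have "(A, B, C, stab_of G K A B ?f, stab_of G K B C ?g, stab_of G K C S ?w) \<in> standard_triangles G K"
  unfolding standard_triangles_def using se A(1) ghom_restrict[OF kB t(1)] ghom_restrict[OF kC w(1)] by blast
 hence std: "(A, B, C, cls A B f, cls B C g, cls C S w) \<in> standard_triangles G K" by (simp add: cls_def)
 have sS: "susp G K A = S" by (simp add: susp_def A(1))
 have eqs: "Ob (stab_cat G K) = Ob St" "Mor (stab_cat G K) = Mor St" "cmp (stab_cat G K) = cmp St" "idm (stab_cat G K) = idm St"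
  by (simp_all add: Stab_def)
 note m = cls_mor[OF A' B f(1)] cls_mor[OF B C g(1)] cls_mor[OF C d(3) w(1)]
 have tr: "Defs.triangle (stab_cat G K) (susp G K) (A, B, C, cls A B f, cls B C g, cls C S w)"
  using A' B C m by (simp add: Defs.triangle_def eqs sS)
 have iso: "iso_mor (stab_cat G K) M M (idm St M)" if "M \<in> Md" for M unfolding iso_mor_def inverse_mors_def eqs
  using P.idm_closed[of M] P.idm_left[of M M] that by (intro exI[of _ "idm St M"]) simp
 have "triangle_iso (stab_cat G K) (susp_mor G K) (A, B, C, cls A B f, cls B C g, cls C S w)
  (A, B, C, cls A B f, cls B C g, cls C S w)" unfolding triangle_iso_def prod.case eqs
  using iso[OF A'] iso[OF B] iso[OF C] P.idm_left P.idm_right m A' B C d(3)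
  by (intro exI[of _ "idm St A"] exI[of _ "idm St B"] exI[of _ "idm St C"]) (simp add: susp_idm_cmp[OF A' A C w(1)])
 thus ?thesis using std tr by (auto simp: Stab_def)
qed

end

context cyc
begin

text \<open>A \<open>G\<close>-fixed element \<open>v\<close> that is not a norm is detected by a functional \<open>\<lambda>\<close> killing all norms.
 Such a functional is a cocycle on the generator of \<open>G\<close>, and so defines a map to \<open>\<Sigma> U\<close>, whose
 composition with \<open>v\<close> is the class of the non-split self-extension \<open>V\<close> of the unit.\<close>

lemma unit_triangle:
 assumes N: "N \<in> Md" and v: "v \<in>. N" "\<And>g. g \<in>. G ==> act N g v = v"
  and nn: "\<And>n. n \<in>. N ==> (\<Oplus>\<^sub>N i\<in>{..<p}. act N (g\<^sub>0 [^]\<^sub>G i) n) \<noteq> v"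
 obtains V i q s g where "V \<in> Md" "ghm V U q" "functional K V s"
  "\<And>x. x \<in>. V ==> s (act V g\<^sub>0 x) = s x \<oplus>\<^sub>K eps (q x)"
  "susp G K U \<in> Md" "ghm U V i" "ghm N (susp G K U) g"
  "(U, V, U, cls U V i, cls V U q, cls U (susp G K U) (\<lambda>x. g (eps x \<odot>\<^sub>N v))) \<in> tri St"
proof -
 interpret N: module K N by (rule Md_mod[OF N])
 interpret U: module K U by (rule Md_mod[OF U_Md])
 note kN = Md_kmod[OF N] and kU = Md_kmod[OF U_Md]
 let ?n = "\<lambda>n. \<Oplus>\<^sub>N i\<in>{..<p}. act N (g\<^sub>0 [^]\<^sub>G i) n"
 have ln: "lin K N N ?n" by (rule lin_finsum_fun[OF act_lin[OF kN] N.modl N.modl]) (use g0 in auto)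
 \<comment> \<open>The norms form a subspace that misses v, so some functional vanishes on them and
   is 1 at v.\<close>
 obtain lam where lam: "functional K N lam" "\<And>x. x \<in> ?n ` carrier N ==> lam x = \<zero>\<^sub>K" "lam v = \<one>\<^sub>K"
  by (rule N.ex_functional[OF K.field_axioms N.subsp_range[OF ln N.modl] v(1)])
   (use nn in blast, rule that)
 have norm: "(\<Oplus>\<^sub>K i\<in>{..<p}. lam (act N (g\<^sub>0 [^]\<^sub>G i) n)) = \<zero>\<^sub>K" if n: "n \<in>. N" for n
 proof -
  have "lam (?n n) = (\<Oplus>\<^sub>K i\<in>{..<p}. lam (act N (g\<^sub>0 [^]\<^sub>G i) n))"
   using act_in[OF kN _ n] g0 by (intro N.functional_finsum[OF lam(1)]) auto
  thus ?thesis using lam(2) n by simp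
 qed
 obtain E iE jE sE qE where E: "E \<in> Md" "ghm U E iE" "lin K N E jE" "functional K E sE" "ghm E N qE"
  "\<And>x. x \<in>. E ==> x = iE (sE x \<odot>\<^sub>U e\<^sub>0) \<oplus>\<^sub>E jE (qE x)"
  "\<And>a. a \<in>. U ==> sE (iE a) = eps a" "\<And>a. a \<in>. U ==> qE (iE a) = \<zero>\<^sub>N"
  "\<And>n. n \<in>. N ==> sE (jE n) = \<zero>\<^sub>K" "\<And>n. n \<in>. N ==> qE (jE n) = n"
  "\<And>n. n \<in>. N ==> act E g\<^sub>0 (jE n) = iE (lam n \<odot>\<^sub>U e\<^sub>0) \<oplus>\<^sub>E jE (act N g\<^sub>0 n)"
  by (rule unit_extension[OF N lam(1) norm]) (assumption, rule that, assumption+)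
 interpret E: module K E by (rule Md_mod[OF E(1)])
 note kE = Md_kmod[OF E(1)]
 have lamc: "lam n \<in>. K" if "n \<in>. N" for n using lin_in[OF lam(1) that] by simp
 have lamv: "lam (a \<odot>\<^sub>N v) = a" if "a \<in>. K" for a using lin_smult[OF lam(1) that v(1)] lam(3) that by simp
 have e0c: "a \<odot>\<^sub>U e\<^sub>0 \<in>. U" if "a \<in>. K" for a using that e0_in by simp
 have inj: "inj_on iE (carrier U)" by (rule inj_onI) (metis E(7) eps_expand)
 have surj: "qE ` carrier E = carrier N" using ghom_in[OF E(5)] lin_in[OF E(3)] E(10) by (auto simp: image_iff) metis
 have sEc: "sE x \<in>. K" if "x \<in>. E" for x using lin_in[OF E(4) that] by simp
 have imE: "x \<in> iE ` carrier U" if x: "x \<in>. E" "qE x = \<zero>\<^sub>N" for x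
  using E(6)[OF x(1)] x(2) e0c[OF sEc[OF x(1)]] lin_zero[OF E(3) N.modl E.modl] ghom_in[OF E(2)]
  by (intro image_eqI[of _ _ "sE x \<odot>\<^sub>U e\<^sub>0"]) auto
 have sE: "sE (act E g\<^sub>0 x) = sE x \<oplus>\<^sub>K lam (qE x)" if x: "x \<in>. E" for x
 proof -
  note a = sEc[OF x] and n = ghom_in[OF E(5) x]
  note b = lamc[OF n]
  have c: "iE (sE x \<odot>\<^sub>U e\<^sub>0) \<in>. E" "iE (lam (qE x) \<odot>\<^sub>U e\<^sub>0) \<in>. E" "jE (act N g\<^sub>0 (qE x)) \<in>. E"
   using ghom_in[OF E(2) e0c] a b lin_in[OF E(3) act_in[OF kN g0 n]] by auto
  have "act E g\<^sub>0 x = act E g\<^sub>0 (iE (sE x \<odot>\<^sub>U e\<^sub>0)) \<oplus>\<^sub>E act E g\<^sub>0 (jE (qE x))"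
   using lin_add[OF act_lin[OF kE g0] c(1) lin_in[OF E(3) n]] E(6)[OF x] by simp
  also have "... = iE (sE x \<odot>\<^sub>U e\<^sub>0) \<oplus>\<^sub>E (iE (lam (qE x) \<odot>\<^sub>U e\<^sub>0) \<oplus>\<^sub>E jE (act N g\<^sub>0 (qE x)))"
   using ghom_act[OF E(2) g0 e0c[OF a]] E(11)[OF n] by (simp add: U_act g0 e0c[OF a])
  finally show ?thesis
   using lin_add[OF E(4) c(1) E.a_closed[OF c(2,3)]] lin_add[OF E(4) c(2,3)] E(7)[OF e0c[OF a]] E(7)[OF e0c[OF b]]
    E(9)[OF act_in[OF kN g0 n]] eps_smult a b by simp
 qed
 \<comment> \<open>The pullback of E along the map from the unit to N given by v: the vectors whose
   image in N is a multiple of v.\<close>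
 define P where "P = {x \<in> carrier E. qE x = lam (qE x) \<odot>\<^sub>N v}"
 have lq: "functional K E (\<lambda>x. lam (qE x))" by (rule lin_comp[OF ghom_lin[OF E(5)] lam(1)])
 have P: "E.subsp P" unfolding P_def
  by (rule E.subsp_equalizer[OF ghom_lin[OF E(5)] lin_functional_smult[OF lq v(1) N.modl] N.modl])
 have lamg: "lam (qE (act E g x)) = lam (qE x)" "act E g x \<in> P" if g: "g \<in>. G" and "x \<in> P" for g x
 proof -
  have x: "x \<in>. E" "qE x = lam (qE x) \<odot>\<^sub>N v" using \<open>x \<in> P\<close> by (simp_all add: P_def)
  note b = lamc[OF ghom_in[OF E(5) x(1)]]
  have q: "qE (act E g x) = lam (qE x) \<odot>\<^sub>N v"
   using ghom_act[OF E(5) g x(1)] x(2) lin_smult[OF act_lin[OF kN g] b v(1)] v(2)[OF g] by simp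
  show "lam (qE (act E g x)) = lam (qE x)" unfolding q by (rule lamv[OF b])
  thus "act E g x \<in> P" using q act_in[OF kE g x(1)] by (simp add: P_def)
 qed
 define V where "V = E\<lparr>carrier := P\<rparr>"
 have Vs: "carrier V = P" "act V = act E" by (simp_all add: V_def)
 have V: "V \<in> Md" unfolding V_def by (rule Md_sub[OF E(1) P lamg(2)])
 have PE: "x \<in>. E" "lam (qE x) \<odot>\<^sub>N v = qE x" if "x \<in> P" for x using that by (simp_all add: P_def)
 \<comment> \<open>That multiple, as an element of the unit.\<close>
 let ?q = "\<lambda>x. lam (qE x) \<odot>\<^sub>U e\<^sub>0"
 have epsq: "eps (?q x) = lam (qE x)" if "x \<in> P" for x by (rule eps_smult[OF lamc[OF ghom_in[OF E(5) PE(1)[OF that]]]])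
 have lam0: "lam \<zero>\<^sub>N = \<zero>\<^sub>K" using lin_zero[OF lam(1) N.modl mKmod] by simp
 have iV: "ghm U V iE"
 proof (rule ghomI)
  show "lin K U V iE" unfolding V_def
   by (rule lin_sub_cod[OF ghom_lin[OF E(2)]]) (use E(8) ghom_in[OF E(2)] lam0 v(1) in \<open>simp add: P_def\<close>)
 qed (simp add: Vs ghom_act[OF E(2)])
 have qV: "ghm V U ?q"
 proof (rule ghomI)
  show "lin K V U ?q" unfolding V_def
   by (rule lin_sub_dom[OF lin_functional_smult[OF lq e0_in U.modl]]) (use PE(1) in blast)
 qed (use lamg(1) PE e0c lamc ghom_in[OF E(5)] in \<open>simp add: Vs U_act\<close>)
 have sV: "functional K V sE" unfolding V_def by (rule lin_sub_dom[OF E(4)]) (use PE(1) in blast)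
 have surjV: "?q ` carrier V = carrier U"
 proof
  show "?q ` carrier V \<subseteq> carrier U" using ghom_in[OF qV] by blast
  show "carrier U \<subseteq> ?q ` carrier V"
  proof
   fix y assume y: "y \<in>. U"
   note a = eps_closed[OF y]
   have av: "eps y \<odot>\<^sub>N v \<in>. N" using a v(1) by simp
   have "jE (eps y \<odot>\<^sub>N v) \<in>. V"
    using lin_in[OF E(3) av] E(10)[OF av] lamv[OF a] by (simp add: Vs P_def)
   moreover have "y = ?q (jE (eps y \<odot>\<^sub>N v))" using E(10)[OF av] lamv[OF a] eps_expand[OF y] by simp
   ultimately show "y \<in> ?q ` carrier V" by (rule rev_image_eqI)
  qed
 qed
 have kerV: "iE ` carrier U = {y \<in> carrier V. ?q y = \<zero>\<^sub>U}"
 proof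
  show "iE ` carrier U \<subseteq> {y \<in> carrier V. ?q y = \<zero>\<^sub>U}" using ghom_in[OF iV] E(8) lam0 e0_in by auto
  show "{y \<in> carrier V. ?q y = \<zero>\<^sub>U} \<subseteq> iE ` carrier U"
  proof
   fix y assume y: "y \<in> {y \<in> carrier V. ?q y = \<zero>\<^sub>U}"
   hence yP: "y \<in> P" by (simp add: Vs)
   have "lam (qE y) = eps \<zero>\<^sub>U" using epsq[OF yP] y by simp
   also have "... = \<zero>\<^sub>K" using lin_zero[OF functional_eps U.modl mKmod] by simp
   finally have "qE y = \<zero>\<^sub>N" using PE(2)[OF yP] v(1) by simp
   thus "y \<in> iE ` carrier U" by (rule imE[OF PE(1)[OF yP]])
  qed
 qed
 obtain J iJ S qJ where J: "inj_seq G K U = (J, iJ, S, qJ)" "injective_mod G K J" "short_exact G K U J S iJ qJ"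
  by (rule inj_seqE[OF U_Md]) (rule that)
 note d = short_exactD[OF J(3)]
 note kJ = Md_kmod[OF d(2)] and kS = Md_kmod[OF d(3)]
 have sS: "susp G K U = S" by (simp add: susp_def J(1))
 \<comment> \<open>One extension t of the embedding of U serves E and, by restriction, V. It induces
   g on N, so the connecting map of V is g composed with v.\<close>
 obtain t where t: "ghm E J t" "\<And>x. x \<in>. U ==> t (iE x) = iJ x"
  by (rule rel_proj_extend[OF kJ injective_imp_rel_proj[OF J(2)] kU kE E(2) inj d(4)]) (rule that)
 have ker: "qJ (t x) = \<zero>\<^sub>S" if x: "x \<in>. E" "qE x = \<zero>\<^sub>N" for x
 proof -
  obtain a where "a \<in>. U" "x = iE a" using imE[OF x] by blast
  thus ?thesis using t(2) d(8) by auto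
 qed
 obtain g where g: "ghm N S g" "\<And>x. x \<in>. E ==> g (qE x) = qJ (t x)"
  by (rule ghom_factor[OF kE kN kS E(5) surj ghom_comp[OF t(1) d(5)] ker]) (assumption+, rule that, assumption+)
 have tV: "ghm V J t"
 proof (rule ghomI)
  show "lin K V J t" unfolding V_def by (rule lin_sub_dom[OF ghom_lin[OF t(1)]]) (use PE(1) in blast)
 qed (simp add: Vs ghom_act[OF t(1)] PE)
 have w: "ghm U S (\<lambda>x. g (eps x \<odot>\<^sub>N v))" by (rule ghom_comp[OF ghom_unit[OF N v] g(1)])
 have wq: "g (eps (?q x) \<odot>\<^sub>N v) = qJ (t x)" if "x \<in>. V" for x
  using that epsq[of x] PE[of x] g(2)[of x] by (simp add: Vs)
 have "(U, V, U, cls U V iE, cls V U ?q, cls U S (\<lambda>x. g (eps x \<odot>\<^sub>N v))) \<in> tri St"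
  by (rule standard_triangle_tri[OF J V U_Md iV inj qV surjV kerV tV t(2) w wq])
 moreover have "sE (act V g\<^sub>0 x) = sE x \<oplus>\<^sub>K eps (?q x)" if "x \<in>. V" for x
  using that sE[OF PE(1)] epsq by (simp add: Vs)
 ultimately show thesis using V qV sV d(3) iV g(1) unfolding sS[symmetric] by (rule_tac that[of V ?q sE iE g])
qed

end

section \<open>Tensor powers of the self-extension of the unit\<close>

text \<open>Telescoping the differences (j+1)^(i+1) - j^(i+1) expresses i + 1 times the i-th power
  sum through p^(i+1) and the power sums of lower exponent, and i + 1 < p is prime to p.\<close>

lemma prime_dvd_power_sum:
 fixes p :: nat assumes p: "prime p" shows "i < p - 1 ==> p dvd (\<Sum>j<p. j ^ i)"
proof (induction i rule: less_induct)
 case (less i)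
 let ?S = "\<lambda>r. \<Sum>j<p. j ^ r"
 have b: "Suc j ^ Suc i = (\<Sum>r<i. (Suc i choose r) * j ^ r) + Suc i * j ^ i + j ^ Suc i" for j :: nat
 proof -
  have "Suc j ^ Suc i = (\<Sum>r\<le>Suc i. (Suc i choose r) * j ^ r)" using binomial_ring[of j 1 "Suc i"] by simp
  also have "... = (\<Sum>r\<le>i. (Suc i choose r) * j ^ r) + j ^ Suc i" by simp
  also have "{..i} = insert i {..<i}" by auto
  finally show ?thesis by (simp add: binomial_Suc_n)
 qed
 have "p ^ Suc i + ?S (Suc i) = (\<Sum>j<p. Suc j ^ Suc i)"
  using sum.lessThan_Suc_shift[of "\<lambda>j. j ^ Suc i" p] by simp
 also have "... = (\<Sum>j<p. \<Sum>r<i. (Suc i choose r) * j ^ r) + Suc i * ?S i + ?S (Suc i)"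
  unfolding b by (simp only: sum.distrib sum_distrib_left)
 also have "(\<Sum>j<p. \<Sum>r<i. (Suc i choose r) * j ^ r) = (\<Sum>r<i. (Suc i choose r) * ?S r)"
  by (subst sum.swap) (simp only: sum_distrib_left)
 finally have e: "p ^ Suc i = (\<Sum>r<i. (Suc i choose r) * ?S r) + Suc i * ?S i" by simp
 have "p dvd (\<Sum>r<i. (Suc i choose r) * ?S r)" by (rule dvd_sum, rule dvd_mult) (use less in auto)
 moreover have "p dvd p ^ Suc i" by simp
 ultimately have "p dvd Suc i * ?S i" unfolding e by (simp add: dvd_add_right_iff)
 moreover have "\<not> p dvd Suc i" using less.prems by (auto dest: dvd_imp_le)
 ultimately show ?case using prime_dvd_multD[OF p, of "Suc i" "?S i"] by blast
qed

text \<open>By Fermat every nonzero residue contributes 1, so the sum is p - 1 modulo p.\<close>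

lemma prime_not_dvd_power_sum:
 fixes p :: nat assumes p: "prime p" shows "\<not> p dvd (\<Sum>j<p. j ^ (p - 1))"
proof -
 have p1: "p > 1" using p prime_gt_1_nat by blast
 have "[(\<Sum>j<p. j ^ (p - 1)) = (\<Sum>j<p. if j = 0 then 0 else 1)] (mod p)"
 proof (rule cong_sum)
  fix j assume "j \<in> {..<p}"
  thus "[j ^ (p - 1) = (if j = 0 then 0 else 1)] (mod p)"
   using fermat_theorem[OF p, of j] nat_dvd_not_less[of j p] p1 by (cases "j = 0") (auto simp: power_0_left)
 qed
 also have "(\<Sum>j<p. if j = 0 then 0 else 1) = p - 1"
 proof -
  have "(\<Sum>j<m. if j = 0 then 0 else 1) = m - 1" for m :: nat by (induction m) auto
  thus ?thesis .
 qed
 finally show ?thesis using p1 by (auto simp: cong_dvd_iff dest: dvd_imp_le)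
qed

context stab
begin

text \<open>Nested to the right and ending in the unit, so that the contraction below peels off the
  first factor and ends in U.\<close>

primrec tpow :: "('g, 'k, 'u) gmod => nat => ('g, 'k, 'u) gmod" where
 "tpow V 0 = U"
| "tpow V (Suc n) = tm V (tpow V n)"

text \<open>All factors are contracted with the same functional. For the composite of
  \<open>eps\<close> and q this is the n-fold tensor power of q, up to the identification of the
  tensor power of U with U.\<close>

primrec conpow :: "('g, 'k, 'u) gmod => ('u => 'k) => nat => 'u => 'u" where
 "conpow V \<xi> 0 z = z"
| "conpow V \<xi> (Suc n) z = conpow V \<xi> n (con V (tpow V n) \<xi> z)"

context
 fixes V :: "('g, 'k, 'u) gmod"
 assumes V: "V \<in> Md"
begin

lemma tpow_Md: "tpow V n \<in> Md"
 by (induction n) (simp_all add: U_Md tm_Md V)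

lemma lin_conpow:
 assumes f: "functional K V \<xi>" shows "lin K (tpow V n) U (conpow V \<xi> n)"
proof (induction n)
 case (Suc n)
 show ?case using lin_comp[OF lin_con[OF V tpow_Md f] Suc] by simp
qed (simp add: lin_id)

lemma conpow_cong:
 assumes f: "functional K V \<xi>" and eq: "\<And>x. x \<in>. V ==> \<zeta> x = \<xi> x"
 shows "z \<in>. (tpow V n) ==> conpow V \<zeta> n z = conpow V \<xi> n z"
proof (induction n arbitrary: z)
 case (Suc n)
 have z: "z \<in>. (tm V (tpow V n))" using Suc.prems by simp
 have "con V (tpow V n) \<zeta> z = con V (tpow V n) \<xi> z" by (rule con_cong[OF V tpow_Md f eq z])
 thus ?case using Suc.IH[OF lin_in[OF lin_con[OF V tpow_Md f] z]] by simp
qed simp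

text \<open>The unit carries the trivial action, so g survives only inside the functionals.\<close>

lemma conpow_act:
 assumes f: "functional K V \<xi>" and g: "g \<in>. G"
 shows "z \<in>. (tpow V n) ==> conpow V \<xi> n (act (tpow V n) g z) = conpow V (\<lambda>x. \<xi> (act V g x)) n z"
proof (induction n arbitrary: z)
 case (Suc n)
 have z: "z \<in>. (tm V (tpow V n))" using Suc.prems by simp
 have fg: "functional K V (\<lambda>x. \<xi> (act V g x))" by (rule lin_comp[OF act_lin[OF Md_kmod[OF V] g] f])
 show ?case using Suc.IH[OF lin_in[OF lin_con[OF V tpow_Md fg] z]] con_act[OF V tpow_Md f g z] by simp
qed (simp add: U_act g)

text \<open>The n-fold product of \<xi> + a \<zeta>, expanded in powers of a; of the coefficients
  only the leading one is identified.\<close>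

lemma conpow_poly:
 assumes f: "functional K V \<xi>" "functional K V \<zeta>"
 shows "\<exists>A. \<forall>z\<in>carrier (tpow V n). (\<forall>i\<le>n. A i z \<in>. U) \<and> A n z = conpow V \<zeta> n z \<and>
  (\<forall>a\<in>carrier K. conpow V (\<lambda>x. \<xi> x \<oplus>\<^sub>K a \<otimes>\<^sub>K \<zeta> x) n z = (\<Oplus>\<^sub>U i\<in>{..n}. (a [^]\<^sub>K i) \<odot>\<^sub>U A i z))"
proof (induction n)
 case 0
 interpret U: module K U by (rule Md_mod[OF U_Md])
 show ?case by (intro exI[of _ "\<lambda>i z. z"]) (simp add: U.M.r_zero)
next
 case (Suc n)
 interpret U: module K U by (rule Md_mod[OF U_Md])
 obtain A where A: "\<And>z i. z \<in>. (tpow V n) ==> i \<le> n ==> A i z \<in>. U"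
  "\<And>z. z \<in>. (tpow V n) ==> A n z = conpow V \<zeta> n z"
  "\<And>z a. z \<in>. (tpow V n) ==> a \<in>. K ==>
   conpow V (\<lambda>x. \<xi> x \<oplus>\<^sub>K a \<otimes>\<^sub>K \<zeta> x) n z = (\<Oplus>\<^sub>U i\<in>{..n}. (a [^]\<^sub>K i) \<odot>\<^sub>U A i z)" using Suc by blast
 let ?x = "con V (tpow V n) \<xi>" and ?y = "con V (tpow V n) \<zeta>"
 \<comment> \<open>The first factor contributes either \<xi>, keeping the degree, or a \<zeta>,
   raising it by one. The guard is there because the induction hypothesis says nothing about
   \<open>A i\<close> for i > n.\<close>
 let ?A = "\<lambda>i z. (if i \<le> n then A i (?x z) else \<zero>\<^sub>U) \<oplus>\<^sub>U (case i of 0 => \<zero>\<^sub>U | Suc j => A j (?y z))"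
 show ?case
 proof (intro exI[of _ ?A] ballI conjI allI impI)
  fix z assume "z \<in>. (tpow V (Suc n))"
  hence z: "z \<in>. (tm V (tpow V n))" by simp
  have xy: "?x z \<in>. (tpow V n)" "?y z \<in>. (tpow V n)"
   using lin_in[OF lin_con[OF V tpow_Md f(1)] z] lin_in[OF lin_con[OF V tpow_Md f(2)] z] .
  show "?A i z \<in>. U" if "i \<le> Suc n" for i using that A(1)[OF xy(1)] A(1)[OF xy(2)] by (auto split: nat.split)
  show "?A (Suc n) z = conpow V \<zeta> (Suc n) z" using A(1)[OF xy(2), of n] A(2)[OF xy(2)] by simp
  fix a assume a: "a \<in>. K"
  let ?\<chi> = "\<lambda>x. \<xi> x \<oplus>\<^sub>K a \<otimes>\<^sub>K \<zeta> x"
  let ?B = "\<lambda>i. (a [^]\<^sub>K i) \<odot>\<^sub>U (if i \<le> n then A i (?x z) else \<zero>\<^sub>U)"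
  let ?C = "\<lambda>i. (a [^]\<^sub>K i) \<odot>\<^sub>U (case i of 0 => \<zero>\<^sub>U | Suc j => A j (?y z))"
  have B: "?B \<in> {..Suc n} \<rightarrow> carrier U" and C: "?C \<in> {..Suc n} \<rightarrow> carrier U"
   using a A(1)[OF xy(1)] A(1)[OF xy(2)] by (auto split: nat.split)
  have \<chi>: "functional K V ?\<chi>" using lin_plus[OF f(1) lin_scale[OF f(2) a mKmod] mKmod] by simp
  have ay: "a \<odot>\<^bsub>tpow V n\<^esub> ?y z \<in>. (tpow V n)" using module.smult_closed[OF Md_mod[OF tpow_Md] a xy(2)] .
  have "conpow V ?\<chi> (Suc n) z = conpow V ?\<chi> n (?x z) \<oplus>\<^sub>U a \<odot>\<^sub>U conpow V ?\<chi> n (?y z)"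
   using con_add_scale[OF V tpow_Md f a z] lin_add[OF lin_conpow[OF \<chi>] xy(1) ay] lin_smult[OF lin_conpow[OF \<chi>] a xy(2)] by simp
  also have "conpow V ?\<chi> n (?x z) = (\<Oplus>\<^sub>U i\<in>{..Suc n}. ?B i)"
  proof -
   have "(\<Oplus>\<^sub>U i\<in>{..Suc n}. ?B i) = ?B (Suc n) \<oplus>\<^sub>U (\<Oplus>\<^sub>U i\<in>{..n}. ?B i)" by (rule U.finsum_Suc[OF B])
   also have "(\<Oplus>\<^sub>U i\<in>{..n}. ?B i) = (\<Oplus>\<^sub>U i\<in>{..n}. (a [^]\<^sub>K i) \<odot>\<^sub>U A i (?x z))"
    using a A(1)[OF xy(1)] by (intro U.finsum_cong') auto
   finally show ?thesis using a A(3)[OF xy(1) a] A(1)[OF xy(1)] by (auto simp: Pi_def)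
  qed
  also have "a \<odot>\<^sub>U conpow V ?\<chi> n (?y z) = (\<Oplus>\<^sub>U i\<in>{..Suc n}. ?C i)"
  proof -
   have "a \<odot>\<^sub>U conpow V ?\<chi> n (?y z) = (\<Oplus>\<^sub>U i\<in>{..n}. a \<odot>\<^sub>U ((a [^]\<^sub>K i) \<odot>\<^sub>U A i (?y z)))"
    unfolding A(3)[OF xy(2) a] using a A(1)[OF xy(2)] by (intro U.finsum_smult_ldistr) auto
   also have "... = (\<Oplus>\<^sub>U i\<in>{..n}. ?C (Suc i))"
    using a A(1)[OF xy(2)] by (intro U.finsum_cong') (auto simp: U.smult_assoc1 K.m_comm simp flip: U.smult_assoc1)
   also have "... = (\<Oplus>\<^sub>U i\<in>{..Suc n}. ?C i)"
    using C U.finsum_Suc2[OF C] A(1)[OF xy(2)] a by (auto simp: Pi_def)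
   finally show ?thesis .
  qed
  also have "(\<Oplus>\<^sub>U i\<in>{..Suc n}. ?B i) \<oplus>\<^sub>U (\<Oplus>\<^sub>U i\<in>{..Suc n}. ?C i) = (\<Oplus>\<^sub>U i\<in>{..Suc n}. ?B i \<oplus>\<^sub>U ?C i)"
   by (rule U.finsum_addf[OF B C, symmetric])
  also have "... = (\<Oplus>\<^sub>U i\<in>{..Suc n}. (a [^]\<^sub>K i) \<odot>\<^sub>U ?A i z)"
   using a A(1)[OF xy(1)] A(1)[OF xy(2)] by (intro U.finsum_cong') (auto simp: U.smult_r_distr split: nat.split)
  finally show "conpow V ?\<chi> (Suc n) z = (\<Oplus>\<^sub>U i\<in>{..Suc n}. (a [^]\<^sub>K i) \<odot>\<^sub>U ?A i z)" .
 qed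
qed

end

end

context cyc
begin

text \<open>The function \<open>conpow V (s + a q)\<close> is a polynomial in \<open>a\<close> of degree \<open>p - 1\<close> with leading coefficient
 \<open>conpow V q\<close>, and the generator of \<open>G\<close> translates \<open>a\<close> by \<open>1\<close>. Since \<open>\<Sum>j\<^sup>i = 0\<close> in characteristic \<open>p\<close>
 for \<open>i < p - 1\<close>, the trace extracts the leading coefficient.\<close>

lemma conpow_stably_zero:
 assumes V: "V \<in> Md" and q: "ghm V U q" and s: "functional K V s"
  and sg: "\<And>x. x \<in>. V ==> s (act V g\<^sub>0 x) = s x \<oplus>\<^sub>K eps (q x)"
 shows "ghm (tpow V n) U (conpow V (\<lambda>x. eps (q x)) n)"
  "steq (tpow V (p - 1)) U (conpow V (\<lambda>x. eps (q x)) (p - 1)) (\<lambda>x. \<zero>\<^sub>U)"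
proof -
 interpret U: module K U by (rule Md_mod[OF U_Md])
 let ?e = "\<lambda>x. eps (q x)"
 note kV = Md_kmod[OF V] and kU = Md_kmod[OF U_Md]
 have e: "functional K V ?e" by (rule lin_comp[OF ghom_lin[OF q] functional_eps])
 have eg: "?e (act V g x) = ?e x" if "g \<in>. G" "x \<in>. V" for g x
  using ghom_act[OF q that] U_act[OF that(1) ghom_in[OF q that(2)]] by simp
 show gh: "ghm (tpow V n) U (conpow V ?e n)" for n
 proof (rule ghomI[OF lin_conpow[OF V e]])
  fix g z assume g: "g \<in>. G" and z: "z \<in>. (tpow V n)"
  show "conpow V ?e n (act (tpow V n) g z) = act U g (conpow V ?e n z)"
   using conpow_act[OF V e g z] conpow_cong[OF V e eg[OF g] z] U_act[OF g lin_in[OF lin_conpow[OF V e] z]] by simp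
 qed
 let ?n = "p - 1" and ?L = "conpow V s (p - 1)"
 let ?T = "tpow V ?n"
 note T = tpow_Md[OF V, of ?n] and lL = lin_conpow[OF V s, of ?n]
 have c: "s x \<in>. K" "?e x \<in>. K" if "x \<in>. V" for x using lin_in[OF s that] lin_in[OF e that] by simp_all
 \<comment> \<open>The generator translates s by the coordinate of q, which the group fixes; so its
   j-th power adds j times that coordinate.\<close>
 have sj: "s (act V (g\<^sub>0 [^]\<^sub>G j) x) = s x \<oplus>\<^sub>K K.kn j \<otimes>\<^sub>K ?e x" if x: "x \<in>. V" for j :: nat and x
 proof (induction j)
  case 0
  have "K.kn 0 = \<zero>\<^sub>K" using kn_zero_iff[of 0] by simp
  thus ?case using x c by (simp add: act_one[OF kV])
 next
  case (Suc j)
  have gj: "g\<^sub>0 [^]\<^sub>G j \<in>. G" using g0 by simp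
  have k1: "K.kn 1 = \<one>\<^sub>K" by (simp add: K.kn_def)
  have "s (act V (g\<^sub>0 [^]\<^sub>G Suc j) x) = s (act V g\<^sub>0 (act V (g\<^sub>0 [^]\<^sub>G j) x))"
   using g0 by (subst G.nat_pow_Suc2) (simp_all add: act_mult[OF kV g0 gj x])
  also have "... = (s x \<oplus>\<^sub>K K.kn j \<otimes>\<^sub>K ?e x) \<oplus>\<^sub>K ?e x"
   using sg[OF act_in[OF kV gj x]] Suc eg[OF gj x] by simp
  also have "... = s x \<oplus>\<^sub>K (K.kn j \<oplus>\<^sub>K K.kn 1) \<otimes>\<^sub>K ?e x"
   using c[OF x] k1 by (simp add: K.l_distr K.a_assoc)
  finally show ?case using K.kn_add[of j 1] by simp
 qed
 obtain A where A: "\<And>z i. z \<in>. ?T ==> i \<le> ?n ==> A i z \<in>. U"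
  "\<And>z. z \<in>. ?T ==> A ?n z = conpow V ?e ?n z"
  "\<And>z a. z \<in>. ?T ==> a \<in>. K ==>
   conpow V (\<lambda>x. s x \<oplus>\<^sub>K a \<otimes>\<^sub>K ?e x) ?n z = (\<Oplus>\<^sub>U i\<in>{..?n}. (a [^]\<^sub>K i) \<odot>\<^sub>U A i z)"
  using conpow_poly[OF V s e, of ?n] by blast
 \<comment> \<open>The factor that the trace puts in front of the leading coefficient; it is nonzero
   in the field by Fermat.\<close>
 define c0 where "c0 = K.kn (\<Sum>j<p. j ^ ?n)"
 have Tr: "Tr ?T U ?L z = c0 \<odot>\<^sub>U conpow V ?e ?n z" if z: "z \<in>. ?T" for z
 proof -
  have Lg: "conpow V (\<lambda>x. s (act V g x)) ?n z \<in>. U" if g: "g \<in>. G" for g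
   by (rule lin_in[OF lin_conpow[OF V lin_comp[OF act_lin[OF kV g] s]] z])
  have "Tr ?T U ?L z = (\<Oplus>\<^sub>U g\<in>carrier G. conpow V (\<lambda>x. s (act V (invG g) x)) ?n z)" unfolding Tr_def
   using conpow_act[OF V s _ z] Lg by (intro U.finsum_cong') (auto simp: U_act)
  \<comment> \<open>The trace involves inverses; reindexing by inversion turns the sum into one over
    the powers of the generator.\<close>
  also have "... = (\<Oplus>\<^sub>U g\<in>(\<lambda>g. invG g) ` carrier G. conpow V (\<lambda>x. s (act V g x)) ?n z)"
   by (rule U.finsum_reindex[symmetric]) (use Lg in \<open>auto intro!: inj_onI dest: G.inv_inj[THEN inj_onD]\<close>)
  also have "(\<lambda>g. invG g) ` carrier G = carrier G" by (auto simp: image_iff) (metis G.inv_closed G.inv_inv)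
  also have "(\<Oplus>\<^sub>U g\<in>carrier G. conpow V (\<lambda>x. s (act V g x)) ?n z) =
    (\<Oplus>\<^sub>U j\<in>{..<p}. conpow V (\<lambda>x. s (act V (g\<^sub>0 [^]\<^sub>G j) x)) ?n z)"
   by (rule finsum_G[OF U.abelian_monoid_axioms Lg])
  also have "... = (\<Oplus>\<^sub>U j\<in>{..<p}. \<Oplus>\<^sub>U i\<in>{..?n}. K.kn (j ^ i) \<odot>\<^sub>U A i z)"
  proof (rule U.finsum_cong')
   fix j assume "j \<in> {..<p}"
   have "functional K V (\<lambda>x. s x \<oplus>\<^sub>K K.kn j \<otimes>\<^sub>K ?e x)"
    using lin_plus[OF s lin_scale[OF e K.kn_closed mKmod] mKmod] by simp
   thus "conpow V (\<lambda>x. s (act V (g\<^sub>0 [^]\<^sub>G j) x)) ?n z = (\<Oplus>\<^sub>U i\<in>{..?n}. K.kn (j ^ i) \<odot>\<^sub>U A i z)"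
    using conpow_cong[OF V _ sj z] A(3)[OF z K.kn_closed] by (simp add: K.kn_power)
  qed (use A(1)[OF z] in \<open>auto intro!: U.finsum_closed\<close>)
  also have "... = (\<Oplus>\<^sub>U i\<in>{..?n}. \<Oplus>\<^sub>U j\<in>{..<p}. K.kn (j ^ i) \<odot>\<^sub>U A i z)"
   using A(1)[OF z] by (intro U.finsum_swap) auto
  also have "... = (\<Oplus>\<^sub>U i\<in>{..?n}. if ?n = i then c0 \<odot>\<^sub>U A i z else \<zero>\<^sub>U)"
  proof (rule U.finsum_cong')
   fix i assume "i \<in> {..?n}"
   hence i: "i \<le> ?n" by simp
   have "(\<Oplus>\<^sub>U j\<in>{..<p}. K.kn (j ^ i) \<odot>\<^sub>U A i z) = (\<Oplus>\<^sub>K j\<in>{..<p}. K.kn (j ^ i)) \<odot>\<^sub>U A i z"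
    by (intro U.finsum_smult_vec[OF A(1)[OF z i]]) auto
   hence "(\<Oplus>\<^sub>U j\<in>{..<p}. K.kn (j ^ i) \<odot>\<^sub>U A i z) = K.kn (\<Sum>j<p. j ^ i) \<odot>\<^sub>U A i z" by (simp add: K.kn_sum)
   moreover have "K.kn (\<Sum>j<p. j ^ i) = \<zero>\<^sub>K" if "i \<noteq> ?n"
    using prime_dvd_power_sum[OF prime, of i] i that by (simp add: kn_zero_iff)
   ultimately show "(\<Oplus>\<^sub>U j\<in>{..<p}. K.kn (j ^ i) \<odot>\<^sub>U A i z) = (if ?n = i then c0 \<odot>\<^sub>U A i z else \<zero>\<^sub>U)"
    using A(1)[OF z i] by (auto simp: c0_def)
  qed (use A(1)[OF z] in \<open>auto simp: c0_def\<close>)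
  also have "... = c0 \<odot>\<^sub>U A ?n z"
   by (rule U.finsum_singleton) (use A(1)[OF z] in \<open>auto simp: c0_def\<close>)
  finally show ?thesis using A(2)[OF z] by simp
 qed
 have c0: "c0 \<in>. K" "c0 \<noteq> \<zero>\<^sub>K"
  using prime_not_dvd_power_sum[OF prime] by (simp_all add: c0_def kn_zero_iff)
 hence ic: "inv\<^bsub>K\<^esub> c0 \<in>. K" "inv\<^bsub>K\<^esub> c0 \<otimes>\<^sub>K c0 = \<one>\<^sub>K" using K.field_Units by auto
 note gs = ghom_scale[OF kU ic(1)]
 have "conpow V ?e ?n z = \<zero>\<^sub>U \<oplus>\<^sub>U Tr ?T U (\<lambda>z. inv\<^bsub>K\<^esub> c0 \<odot>\<^sub>U ?L z) z" if z: "z \<in>. ?T" for z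
 proof -
  have w: "conpow V ?e ?n z \<in>. U" by (rule lin_in[OF lin_conpow[OF V e] z])
  have "Tr ?T U (\<lambda>z. inv\<^bsub>K\<^esub> c0 \<odot>\<^sub>U ?L z) z = inv\<^bsub>K\<^esub> c0 \<odot>\<^sub>U (c0 \<odot>\<^sub>U conpow V ?e ?n z)"
   using Tr_left[OF Md_kmod[OF T] kU kU lL gs z] Tr[OF z] by simp
  thus ?thesis using w ic c0(1) by (simp flip: U.smult_assoc1)
 qed
 thus "steq ?T U (conpow V ?e ?n) (\<lambda>x. \<zero>\<^sub>U)"
  using lin_comp[OF lL ghom_lin[OF gs]] by (auto simp: steq_def)
qed

end

section \<open>Faithfulness of tensor triangulated functors\<close>

context cyc
begin

text \<open>D \<otimes> Y is the space of linear maps from A to Y, by contraction. The invariant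
  that belongs to f is the image of z, and the norm of n is the trace of the linear map that belongs
  to n, so a norm would make f stably zero.\<close>

lemma invariant_not_norm:
 assumes A: "A \<in> Md" and db: "dual_basis A d u v" and Y: "Y \<in> Md" and f: "ghm A Y f"
  and nz: "\<not> steq A Y f (\<lambda>x. \<zero>\<^sub>Y)"
 obtains D z where "D \<in> Md" "z \<in>. (tm D A)" "\<And>g. g \<in>. G ==> act (tm D A) g z = z"
  "\<And>n. n \<in>. (tm D Y) ==>
   (\<Oplus>\<^bsub>tm D Y\<^esub>i\<in>{..<p}. act (tm D Y) (g\<^sub>0 [^]\<^sub>G i) n) \<noteq> tmap D D A Y (\<lambda>x. x) f z"
proof -
 obtain D b z where D: "D \<in> Md" "carrier D = carrier A" and b: "\<And>x. x \<in>. A ==> functional K D (b x)"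
  and b': "\<And>y. y \<in>. A ==> functional K A (\<lambda>x. b x y)"
  and bu: "\<And>x l. x \<in>. A ==> l < d ==> b x (u l) = v l x"
  and br: "\<And>g x y. g \<in>. G ==> x \<in>. A ==> y \<in>. A ==> b x (act D g y) = b (act A (invG g) x) y"
  and ex: "\<And>y. y \<in>. A ==> y = (\<Oplus>\<^sub>D l\<in>{..<d}. b (u l) y \<odot>\<^sub>D u l)"
  and z: "z \<in>. (tm D A)" "\<And>g. g \<in>. G ==> act (tm D A) g z = z"
  and zf: "\<And>N f. N \<in> Md ==> lin K A N f ==> tmap D D A N (\<lambda>x. x) f z = (\<Oplus>\<^bsub>tm D N\<^esub>l\<in>{..<d}. pt D N (u l) (f (u l)))"
  by (rule ex_dual_invariant[OF A db]) (rule that)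
 interpret A: module K A by (rule Md_mod[OF A])
 interpret Y: module K Y by (rule Md_mod[OF Y])
 interpret TY: module K "tm D Y" by (rule Md_mod[OF tm_Md[OF D(1) Y]])
 note kA = Md_kmod[OF A] and kY = Md_kmod[OF Y] and kT = Md_kmod[OF tm_Md[OF D(1) Y]]
 have u: "u l \<in>. A" and v: "functional K A (v l)" if "l < d" for l using db that by (simp_all add: dual_basis_def)
 have vc: "v l x \<in>. K" if "l < d" "x \<in>. A" for l x using lin_in[OF v[OF that(1)] that(2)] by simp
 let ?F = "tmap D D A Y (\<lambda>x. x) f"
 have sum: "con D Y (b x) (\<Oplus>\<^bsub>tm D Y\<^esub>l\<in>{..<d}. pt D Y (u l) (w l)) = (\<Oplus>\<^sub>Y l\<in>{..<d}. v l x \<odot>\<^sub>Y w l)"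
  if x: "x \<in>. A" and w: "\<And>l. l < d ==> w l \<in>. Y" for x w
 proof -
  have "con D Y (b x) (\<Oplus>\<^bsub>tm D Y\<^esub>l\<in>{..<d}. pt D Y (u l) (w l)) = (\<Oplus>\<^sub>Y l\<in>{..<d}. con D Y (b x) (pt D Y (u l) (w l)))"
   using pt_in[OF D(1) Y] u w D(2) by (intro lin_finsum[OF lin_con[OF D(1) Y b[OF x]] TY.modl Y.modl]) auto
  also have "... = (\<Oplus>\<^sub>Y l\<in>{..<d}. v l x \<odot>\<^sub>Y w l)"
   using vc[OF _ x] w u D(2) by (intro Y.finsum_cong') (auto simp: con_pt[OF D(1) Y b[OF x]] bu[OF x])
  finally show ?thesis .
 qed
 have conF: "con D Y (b x) (?F z) = f x" if x: "x \<in>. A" for x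
 proof -
  have "con D Y (b x) (?F z) = (\<Oplus>\<^sub>Y l\<in>{..<d}. v l x \<odot>\<^sub>Y f (u l))"
   unfolding zf[OF Y ghom_lin[OF f]] by (rule sum[OF x ghom_in[OF f u]])
  also have "... = (\<Oplus>\<^sub>Y l\<in>{..<d}. f (v l x \<odot>\<^sub>A u l))"
   using vc[OF _ x] u ghom_in[OF f] by (intro Y.finsum_cong') (auto simp: lin_smult[OF ghom_lin[OF f]])
  also have "... = f (\<Oplus>\<^sub>A l\<in>{..<d}. v l x \<odot>\<^sub>A u l)"
   using vc[OF _ x] u by (intro lin_finsum[OF ghom_lin[OF f] A.modl Y.modl, symmetric]) auto
  also have "(\<Oplus>\<^sub>A l\<in>{..<d}. v l x \<odot>\<^sub>A u l) = x" using db x unfolding dual_basis_def by metis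
  finally show ?thesis .
 qed
 have nn: "(\<Oplus>\<^bsub>tm D Y\<^esub>i\<in>{..<p}. act (tm D Y) (g\<^sub>0 [^]\<^sub>G i) n) \<noteq> ?F z" if n: "n \<in>. (tm D Y)" for n
 proof
  assume e: "(\<Oplus>\<^bsub>tm D Y\<^esub>i\<in>{..<p}. act (tm D Y) (g\<^sub>0 [^]\<^sub>G i) n) = ?F z"
  let ?h = "\<lambda>x. con D Y (b x) n"
  have lh: "lin K A Y ?h" using b b' D(2) by (intro lin_con_param[OF D(1) Y A.modl _ _ n]) auto
  have "f x = Tr A Y ?h x" if x: "x \<in>. A" for x
  proof -
   have ac: "con D Y (b x) (act (tm D Y) g n) = act Y g (?h (act A (invG g) x))" if g: "g \<in>. G" for g
    using con_act[OF D(1) Y b[OF x] g n] con_cong[OF D(1) Y b _ n, of "act A (invG g) x" "\<lambda>y. b x (act D g y)"]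
     br[OF g x] D(2) act_in[OF kA _ x] g by simp
   have "?F z = (\<Oplus>\<^bsub>tm D Y\<^esub>g\<in>carrier G. act (tm D Y) g n)"
    using finsum_G[OF TY.abelian_monoid_axioms act_in[OF kT _ n]] e by simp
   hence "f x = con D Y (b x) (\<Oplus>\<^bsub>tm D Y\<^esub>g\<in>carrier G. act (tm D Y) g n)" using conF[OF x] by simp
   also have "... = (\<Oplus>\<^sub>Y g\<in>carrier G. con D Y (b x) (act (tm D Y) g n))"
    using act_in[OF kT _ n] by (intro lin_finsum[OF lin_con[OF D(1) Y b[OF x]] TY.modl Y.modl]) auto
   also have "... = Tr A Y ?h x" unfolding Tr_def
    using ac lin_in[OF lin_Tr_term[OF kA kY lh] x] by (intro Y.finsum_cong') auto
   finally show ?thesis .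
  qed
  hence "\<forall>x\<in>carrier A. f x = \<zero>\<^sub>Y \<oplus>\<^sub>Y Tr A Y ?h x" using lin_in[OF lin_Tr[OF kA kY lh]] by simp
  thus False using nz lh by (auto simp: steq_def)
 qed
 show thesis by (rule that[OF D(1) z nn]) assumption+
qed

text \<open>Contraction along q is q \<otimes> id followed by contraction of the unit, which acts as
  the left unitor; a strong monoidal functor gives information on this factored form.\<close>

lemma con_factor:
 assumes V: "V \<in> Md" and T: "T \<in> Md" and q: "ghm V U q"
 shows "cls (tm V T) T (con V T (\<lambda>x. eps (q x))) = cls (tm U T) T (con U T eps) \<bullet>\<^sub>St (cls V U q \<boxdot>\<^sub>St idm St T)"
  "ghm (tm V T) T (con V T (\<lambda>x. eps (q x)))"
proof -
 note UT = tm_Md[OF U_Md T] and VT = tm_Md[OF V T] and fe = functional_eps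
 have e: "functional K V (\<lambda>x. eps (q x))" by (rule lin_comp[OF ghom_lin[OF q] fe])
 have gc: "ghm (tm X T) T (con X T \<xi>)"
  if X: "X \<in> Md" and \<xi>: "functional K X \<xi>" and inv: "\<And>g x. g \<in>. G ==> x \<in>. X ==> \<xi> (act X g x) = \<xi> x" for X \<xi>
 proof (rule ghomI[OF lin_con[OF X T \<xi>]])
  fix g z assume g: "g \<in>. G" and z: "z \<in>. (tm X T)"
  show "con X T \<xi> (act (tm X T) g z) = act T g (con X T \<xi> z)"
   using con_act[OF X T \<xi> g z] con_cong[OF X T \<xi> inv[OF g] z] by simp
 qed
 have gU: "ghm (tm U T) T (con U T eps)" by (rule gc[OF U_Md fe]) (simp add: U_act)
 show gV: "ghm (tm V T) T (con V T (\<lambda>x. eps (q x)))"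
  by (rule gc[OF V e]) (simp add: ghom_act[OF q] U_act ghom_in[OF q])
 let ?t = "tmap V U T T q (\<lambda>x. x)"
 note gt = ghom_tmap[OF V U_Md T T q ghom_id]
 have "cls V U q \<boxdot>\<^sub>St idm St T = cls (tm V T) (tm U T) ?t"
  unfolding idm_cls[OF T] by (rule tmo_cls[OF V U_Md T T q ghom_id gt]) (rule tmap_pt[OF V U_Md T T ghom_lin[OF q] lin_id])
 moreover have "con U T eps (?t z) = con V T (\<lambda>x. eps (q x)) z" if z: "z \<in>. (tm V T)" for z
 proof (rule tensor_ext[OF V T Md_mod[OF T] lin_comp[OF ghom_lin[OF gt] ghom_lin[OF gU]] ghom_lin[OF gV] _ z])
  fix x y assume x: "x \<in>. V" and y: "y \<in>. T"
  show "con U T eps (?t (pt V T x y)) = con V T (\<lambda>x. eps (q x)) (pt V T x y)"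
   using tmap_pt[OF V U_Md T T ghom_lin[OF q] lin_id x y] con_pt[OF U_Md T fe ghom_in[OF q x] y] con_pt[OF V T e x y] by simp
 qed
 ultimately show "cls (tm V T) T (con V T (\<lambda>x. eps (q x))) = cls (tm U T) T (con U T eps) \<bullet>\<^sub>St (cls V U q \<boxdot>\<^sub>St idm St T)"
  using cmp_cls[OF VT UT T gt gU] cls_cong[OF VT T gV, of "\<lambda>z. con U T eps (?t z)"] by simp
qed

text \<open>The right inverse sends y to \<open>pt U T e\<^sub>0 y\<close>.\<close>

lemma con_unit_split_epi:
 assumes T: "T \<in> Md" shows "split_epi St (tm U T) T (cls (tm U T) T (con U T eps))"
  "ghm (tm U T) T (con U T eps)"
proof -
 interpret T: module K T by (rule Md_mod[OF T])
 note UT = tm_Md[OF U_Md T]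
 show g: "ghm (tm U T) T (con U T eps)" using con_factor(2)[OF U_Md T ghom_id] by simp
 have l: "lin K T (tm U T) (pt U T e\<^sub>0)" by (rule bilD(1)[OF pt_bil[OF U_Md T] e0_in])
 have gi: "ghm T (tm U T) (pt U T e\<^sub>0)"
  by (rule ghomI[OF l]) (use pt_act[OF U_Md T _ e0_in] U_act e0_in in simp)
 have "cls (tm U T) T (con U T eps) \<bullet>\<^sub>St cls T (tm U T) (pt U T e\<^sub>0) = cls T T (\<lambda>y. y)"
  unfolding cmp_cls[OF T UT T gi g]
  by (rule cls_cong[OF T T ghom_id]) (simp add: con_pt[OF U_Md T functional_eps e0_in])
 thus "split_epi St (tm U T) T (cls (tm U T) T (con U T eps))"
  unfolding split_epi_def idm_cls[OF T] using cls_mor[OF UT T g] cls_mor[OF T UT gi] by blast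
qed

lemma tmo_mor:
 assumes "X \<in> Md" "X' \<in> Md" "Y \<in> Md" "Y' \<in> Md" "m \<in> Mor St X X'" "n \<in> Mor St Y Y'"
 shows "m \<boxdot>\<^sub>St n \<in> Mor St (tm X Y) (tm X' Y')"
proof -
 obtain f where f: "ghm X X' f" "m = cls X X' f" by (rule morE[OF assms(1,2,5)]) (rule that)
 obtain g where g: "ghm Y Y' g" "n = cls Y Y' g" by (rule morE[OF assms(3,4,6)]) (rule that)
 note t = ghom_tmap[OF assms(1-4) f(1) g(1)]
 have "m \<boxdot>\<^sub>St n = cls (tm X Y) (tm X' Y') (tmap X X' Y Y' f g)" unfolding f(2) g(2)
  by (rule tmo_cls[OF assms(1-4) f(1) g(1) t]) (rule tmap_pt[OF assms(1-4) ghom_lin[OF f(1)] ghom_lin[OF g(1)]])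
 thus ?thesis using cls_mor[OF tm_Md[OF assms(1,3)] tm_Md[OF assms(2,4)] t] by simp
qed

text \<open>Uniqueness in the universal property of the coproduct: f and zero agree stably on all
  summands.\<close>

lemma zero_restrict_blocks:
 assumes D: "dsum X I A inc prj" and Y: "Y \<in> Md" and f: "ghm X Y f"
  and z: "\<And>i. i \<in> I ==> steq (A i) Y (\<lambda>x. f (inc i x)) (\<lambda>x. \<zero>\<^sub>Y)"
 shows "steq X Y f (\<lambda>x. \<zero>\<^sub>Y)"
proof -
 note d = dsumD[OF D]
 note g0 = ghom_zero[OF Md_kmod[OF Y]]
 have "\<exists>!h. h \<in> Mor St X Y \<and> (\<forall>i\<in>I. h \<bullet>\<^sub>St cls (A i) X (inc i) = cls (A i) Y (\<lambda>x. \<zero>\<^sub>Y))"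
  using dsum_coproduct[OF D] Y cls_mor[OF d(3) Y g0] unfolding is_coproduct_def by auto
 moreover have "cls X Y f \<bullet>\<^sub>St cls (A i) X (inc i) = cls (A i) Y (\<lambda>x. \<zero>\<^sub>Y)" if i: "i \<in> I" for i
  using cmp_cls[OF d(3)[OF i] d(2) Y d(4)[OF i] f] cls_eq_iff[OF d(3)[OF i] Y ghom_comp[OF d(4)[OF i] f] g0] z[OF i] by simp
 moreover have "cls X Y (\<lambda>x. \<zero>\<^sub>Y) \<bullet>\<^sub>St cls (A i) X (inc i) = cls (A i) Y (\<lambda>x. \<zero>\<^sub>Y)" if i: "i \<in> I" for i
  by (rule cmp_cls[OF d(3)[OF i] d(2) Y d(4)[OF i] g0])
 ultimately have "cls X Y f = cls X Y (\<lambda>x. \<zero>\<^sub>Y)"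
  using cls_mor[OF d(2) Y f] cls_mor[OF d(2) Y g0] by blast
 thus ?thesis using cls_eq_iff[OF d(2) Y f g0] by simp
qed

context
 fixes \<S> :: "('s, 't, 'z) ttcat_scheme" and F
 assumes \<S>: "big_tt_category TYPE('u) \<S>" and F: "tt_functor St \<S> F"
begin

interpretation S: big_tt_category "TYPE('u)" \<S> by (rule \<S>)

private lemma Fa: "additive_functor St \<S> F" and Fe: "exact_functor St \<S> F" and Fm: "strong_symmetric_monoidal_functor St \<S> F"
 using F by (simp_all add: tt_functor_def exact_functor_def)

private lemmas Fd = additive_functorD[OF Fa, simplified]

private lemma tob: "X \<in> Ob St ==> Y \<in> Ob St ==> X \<boxtimes>\<^sub>St Y \<in> Ob St" using tm_Md by simp

private lemma tmo: "X \<in> Ob St ==> X' \<in> Ob St ==> Y \<in> Ob St ==> f \<in> Mor St X X' ==>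
   f \<boxdot>\<^sub>St idm St Y \<in> Mor St (X \<boxtimes>\<^sub>St Y) (X' \<boxtimes>\<^sub>St Y)"
 "X \<in> Ob St ==> Y \<in> Ob St ==> Y' \<in> Ob St ==> f \<in> Mor St Y Y' ==>
   idm St X \<boxdot>\<^sub>St f \<in> Mor St (X \<boxtimes>\<^sub>St Y) (X \<boxtimes>\<^sub>St Y')"
 using tmo_mor preadditive_category.idm_closed[OF preadditive_Stab] by simp_all

private lemmas ctx = preadditive_Stab S.preadditive_category_axioms S.symmetric_monoidal_axioms Fa Fm tob tmo

private lemma F_zero: "X \<in> Md ==> Y \<in> Md ==> fmo F (cls X Y (\<lambda>x. \<zero>\<^sub>Y)) = zerom \<S> (fob F X) (fob F Y)"
 using additive_functor_zero[OF Fa preadditive_Stab S.preadditive_category_axioms, of X Y] by (simp add: zerom_cls)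

text \<open>Used contrapositively: if F is nonzero, then no invariant that is not a norm can be
  killed.\<close>

lemma unit_not_killed:
 assumes N: "N \<in> Md" and v: "v \<in>. N" "\<And>g. g \<in>. G ==> act N g v = v"
  and nn: "\<And>n. n \<in>. N ==> (\<Oplus>\<^sub>N i\<in>{..<p}. act N (g\<^sub>0 [^]\<^sub>G i) n) \<noteq> v"
  and Fv: "fmo F (cls U N (\<lambda>x. eps x \<odot>\<^sub>N v)) = zerom \<S> (fob F U) (fob F N)" and X: "X \<in> Md"
 shows "zero_object \<S> (fob F X)"
proof -
 obtain V i q s g where V: "V \<in> Md" "ghm V U q" "functional K V s"
  "\<And>x. x \<in>. V ==> s (act V g\<^sub>0 x) = s x \<oplus>\<^sub>K eps (q x)"
  and g: "susp G K U \<in> Md" "ghm U V i" "ghm N (susp G K U) g"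
  and tri: "(U, V, U, cls U V i, cls V U q, cls U (susp G K U) (\<lambda>x. g (eps x \<odot>\<^sub>N v))) \<in> tri St"
  by (rule unit_triangle[OF N v nn]) (assumption+, rule that, assumption+)
 note gv = ghom_unit[OF N v]
 have sS: "sho St U = susp G K U" by (simp add: Stab_def)
 note FU = Fd(1)[OF U_Md] and FS = Fd(1)[OF g(1)]
 have "\<exists>\<phi>. (\<forall>X\<in>Ob St. iso_mor \<S> (fob F (sho St X)) (sho \<S> (fob F X)) (\<phi> X)) \<and>
   (\<forall>X Y Z f g h. (X, Y, Z, f, g, h) \<in> tri St -->
    (fob F X, fob F Y, fob F Z, fmo F f, fmo F g, \<phi> X \<bullet>\<^sub>\<S> fmo F h) \<in> tri \<S>)"
  using Fe unfolding exact_functor_def by (elim exE conjE) (rule exI, rule conjI, assumption+)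
 then obtain \<Phi> where \<Phi>: "\<forall>X\<in>Ob St. iso_mor \<S> (fob F (sho St X)) (sho \<S> (fob F X)) (\<Phi> X)"
  "\<forall>X Y Z f g h. (X, Y, Z, f, g, h) \<in> tri St -->
    (fob F X, fob F Y, fob F Z, fmo F f, fmo F g, \<Phi> X \<bullet>\<^sub>\<S> fmo F h) \<in> tri \<S>" by (elim exE conjE)
 define \<phi> where "\<phi> = \<Phi> U"
 have \<phi>: "iso_mor \<S> (fob F (susp G K U)) (sho \<S> (fob F U)) \<phi>"
  "(fob F U, fob F V, fob F U, fmo F (cls U V i), fmo F (cls V U q),
   \<phi> \<bullet>\<^sub>\<S> fmo F (cls U (susp G K U) (\<lambda>x. g (eps x \<odot>\<^sub>N v)))) \<in> tri \<S>"
  using \<Phi>(1) \<Phi>(2)[rule_format, OF tri] U_Md sS by (auto simp: \<phi>_def)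
 have \<phi>m: "\<phi> \<in> Mor \<S> (fob F (susp G K U)) (sho \<S> (fob F U))" using \<phi>(1) by (auto simp: iso_mor_def inverse_mors_def)
 have "additive_functor \<S> \<S> (shift_functor \<S>)" using S.shift_equivalence by (simp add: equivalence_functor_def)
 from additive_functorD(1)[OF this FU] have \<Sigma>: "sho \<S> (fob F U) \<in> Ob \<S>" by (simp add: shift_functor_def)
 \<comment> \<open>The connecting map of the triangle of V factors through v, so F kills it.\<close>
 have "fmo F (cls U (susp G K U) (\<lambda>x. g (eps x \<odot>\<^sub>N v))) =
   fmo F (cls N (susp G K U) g) \<bullet>\<^sub>\<S> fmo F (cls U N (\<lambda>x. eps x \<odot>\<^sub>N v))"
  using Fd(4)[OF U_Md N g(1) cls_mor[OF U_Md N gv] cls_mor[OF N g(1) g(3)]] cmp_cls[OF U_Md N g(1) gv g(3)] by simp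
 also have "... = zerom \<S> (fob F U) (fob F (susp G K U))"
  unfolding Fv by (rule S.cmp_zero_right[OF FU Fd(1)[OF N] FS Fd(3)[OF N g(1) cls_mor[OF N g(1) g(3)]]])
 finally have "\<phi> \<bullet>\<^sub>\<S> fmo F (cls U (susp G K U) (\<lambda>x. g (eps x \<odot>\<^sub>N v))) = zerom \<S> (fob F U) (sho \<S> (fob F U))"
  using S.cmp_zero_right[OF FU FS \<Sigma> \<phi>m] by simp
 hence Fq: "split_epi \<S> (fob F V) (fob F U) (fmo F (cls V U q))" using \<phi>(2) S.triangle_split_epi by simp
 let ?c = "conpow V (\<lambda>x. eps (q x))"
 note T = tpow_Md[OF V(1)]
 have gc: "ghm (tpow V n) U (?c n)" for n by (rule conpow_stably_zero(1)[OF V])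
 \<comment> \<open>One more factor adds q \<otimes> id, which F sends to a split epimorphism, and
   the contraction of the unit, which splits already before F.\<close>
 have split: "split_epi \<S> (fob F (tpow V n)) (fob F U) (fmo F (cls (tpow V n) U (?c n)))" for n
 proof (induction n)
  case 0
  have "cls (tpow V 0) U (?c 0) = idm St U" unfolding idm_cls[OF U_Md] using cls_cong[OF U_Md U_Md ghom_id, of "?c 0"] by simp
  moreover have "split_epi \<S> (fob F U) (fob F U) (idm \<S> (fob F U))"
   using S.idm_closed[OF FU] S.idm_left[OF FU FU S.idm_closed[OF FU]] by (auto simp: split_epi_def)
  ultimately show ?case using Fd(2)[OF U_Md] by (simp only: tpow.simps)
 next
  case (Suc n)
  let ?T = "tpow V n"
  note VT = tm_Md[OF V(1) T[of n]] and UT = tm_Md[OF U_Md T[of n]]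
  note cf = con_factor[OF V(1) T[of n] V(2)] and cu = con_unit_split_epi[OF T[of n]]
  note qm = cls_mor[OF V(1) U_Md V(2)]
  have qT: "cls V U q \<boxdot>\<^sub>St idm St ?T \<in> Mor St (tm V ?T) (tm U ?T)" using tmo(1)[of V U ?T] V(1) U_Md T qm by simp
  have 1: "split_epi \<S> (fob F (tm V ?T)) (fob F (tm U ?T)) (fmo F (cls V U q \<boxdot>\<^sub>St idm St ?T))"
   using functor_split_epi_tensor[OF ctx, of V U ?T "cls V U q"] V(1) U_Md T qm Fq by simp
  have 2: "split_epi \<S> (fob F (tm U ?T)) (fob F ?T) (fmo F (cls (tm U ?T) ?T (con U ?T eps)))"
  proof -
   obtain r where r: "r \<in> Mor St ?T (tm U ?T)" "cls (tm U ?T) ?T (con U ?T eps) \<bullet>\<^sub>St r = idm St ?T"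
    using cu(1) by (auto simp: split_epi_def)
   note m = cls_mor[OF UT T cu(2)]
   show ?thesis unfolding split_epi_def
    using Fd(3)[OF UT T m] Fd(3)[OF T UT r(1)] Fd(4)[OF T UT T r(1) m] r(2) Fd(2)[OF T] by auto
  qed
  have "fmo F (cls (tm V ?T) ?T (con V ?T (\<lambda>x. eps (q x)))) =
    fmo F (cls (tm U ?T) ?T (con U ?T eps)) \<bullet>\<^sub>\<S> fmo F (cls V U q \<boxdot>\<^sub>St idm St ?T)"
   unfolding cf(1) by (rule Fd(4)[OF VT UT T qT cls_mor[OF UT T cu(2)]])
  hence 3: "split_epi \<S> (fob F (tm V ?T)) (fob F ?T) (fmo F (cls (tm V ?T) ?T (con V ?T (\<lambda>x. eps (q x)))))"
   using S.split_epi_comp[OF Fd(1)[OF VT] Fd(1)[OF UT] Fd(1)[OF T] 1 2] by simp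
  have cS: "?c (Suc n) = (\<lambda>z. ?c n (con V ?T (\<lambda>x. eps (q x)) z))" by (rule ext) (simp only: conpow.simps)
  have "cls (tpow V (Suc n)) U (?c (Suc n)) = cls ?T U (?c n) \<bullet>\<^sub>St cls (tm V ?T) ?T (con V ?T (\<lambda>x. eps (q x)))"
   unfolding cmp_cls[OF VT T U_Md cf(2) gc] cS by (simp only: tpow.simps)
  hence "fmo F (cls (tpow V (Suc n)) U (?c (Suc n))) =
    fmo F (cls ?T U (?c n)) \<bullet>\<^sub>\<S> fmo F (cls (tm V ?T) ?T (con V ?T (\<lambda>x. eps (q x))))"
   using Fd(4)[OF VT T U_Md cls_mor[OF VT T cf(2)] cls_mor[OF T U_Md gc]] by simp
  thus ?case using S.split_epi_comp[OF Fd(1)[OF VT] Fd(1)[OF T] FU 3 Suc] by (simp only: tpow.simps)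
 qed
 \<comment> \<open>At n = p - 1 the split epimorphism is zero, so the identity of F U is zero; the
   comparison of units carries this to the unit of the target.\<close>
 have "cls (tpow V (p - 1)) U (?c (p - 1)) = cls (tpow V (p - 1)) U (\<lambda>x. \<zero>\<^sub>U)"
  using conpow_stably_zero(2)[OF V] cls_eq_iff[OF T U_Md gc ghom_zero[OF Md_kmod[OF U_Md]]] by simp
 hence "split_epi \<S> (fob F (tpow V (p - 1))) (fob F U) (zerom \<S> (fob F (tpow V (p - 1))) (fob F U))"
  using split[of "p - 1"] F_zero[OF T U_Md] by simp
 hence z: "idm \<S> (fob F U) = zerom \<S> (fob F U) (fob F U)" by (rule S.split_epi_zero[OF Fd(1)[OF T] FU])
 obtain \<upsilon> where "iso_mor \<S> (unt \<S>) (fob F U) \<upsilon>"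
  using Fm unfolding strong_symmetric_monoidal_functor_def by auto
 then obtain \<upsilon>' where \<upsilon>: "\<upsilon> \<in> Mor \<S> (unt \<S>) (fob F U)" "\<upsilon>' \<in> Mor \<S> (fob F U) (unt \<S>)" "\<upsilon>' \<bullet>\<^sub>\<S> \<upsilon> = idm \<S> (unt \<S>)"
  by (auto simp: iso_mor_def inverse_mors_def)
 note u = S.unt_closed
 have "\<upsilon> = zerom \<S> (unt \<S>) (fob F U)" using S.idm_left[OF u FU \<upsilon>(1)] z S.cmp_zero_left[OF u FU FU \<upsilon>(1)] by simp
 hence "idm \<S> (unt \<S>) = zerom \<S> (unt \<S>) (unt \<S>)" using \<upsilon>(3) S.cmp_zero_right[OF u FU u \<upsilon>(2)] by simp
 thus ?thesis using Fd(1)[OF X] by (rule S.zero_of_unit_zero)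
qed

theorem tt_functor_faithful:
 assumes nz: "nonzero_functor St \<S> F" shows "faithful_functor St F" unfolding faithful_functor_def
proof (intro ballI inj_onI)
 fix X Y m m' assume "X \<in> Ob St" "Y \<in> Ob St" and m: "m \<in> Mor St X Y" "m' \<in> Mor St X Y" and eq: "fmo F m = fmo F m'"
 hence X: "X \<in> Md" and Y: "Y \<in> Md" by simp_all
 interpret Y: module K Y by (rule Md_mod[OF Y])
 note kY = Md_kmod[OF Y] and FX = Fd(1)[OF X] and FY = Fd(1)[OF Y]
 obtain f where f: "ghm X Y f" "m = cls X Y f" by (rule morE[OF X Y m(1)]) (rule that)
 obtain f' where f': "ghm X Y f'" "m' = cls X Y f'" by (rule morE[OF X Y m(2)]) (rule that)
 let ?d = "\<lambda>x. f x \<ominus>\<^sub>Y f' x"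
 note dg = ghom_diff[OF kY f(1) f'(1)]
 note dm = cls_mor[OF X Y dg]
 have sum: "(f x \<ominus>\<^sub>Y f' x) \<oplus>\<^sub>Y f' x = f x" if "x \<in>. X" for x
  by (rule Y.minus_add_cancel[OF ghom_in[OF f(1) that] ghom_in[OF f'(1) that]])
 \<comment> \<open>Additivity reduces faithfulness to the difference of two representatives, which F
   kills.\<close>
 have "addm St (cls X Y ?d) m' = m"
  unfolding f(2) f'(2) addm_cls[OF X Y dg f'(1)] by (rule cls_cong[OF X Y f(1)]) (rule sum[symmetric])
 hence "addm \<S> (fmo F (cls X Y ?d)) (fmo F m') = fmo F m'" using Fd(5)[OF X Y dm m(2)] eq by simp
 hence Fd0: "fmo F (cls X Y ?d) = zerom \<S> (fob F X) (fob F Y)"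
 proof -
  interpret H: comm_group "hom_group \<S> (fob F X) (fob F Y)" by (rule S.comm_group_hom[OF FX FY])
  assume "addm \<S> (fmo F (cls X Y ?d)) (fmo F m') = fmo F m'"
  thus ?thesis using H.r_cancel_one[of "fmo F m'" "fmo F (cls X Y ?d)"] Fd(3)[OF X Y dm] Fd(3)[OF X Y m(2)]
   by (simp add: hom_group_simps)
 qed
 obtain I :: "'u set" and A inc prj where D: "dsum X I A inc prj" and A: "\<And>i. i \<in> I ==> block (A i)"
  by (rule block_decomposition[OF X]) (rule that)
 note d = dsumD[OF D]
 \<comment> \<open>Restricting to a block provides the finite dual basis that the passage to the
   dual requires.\<close>
 have "steq (A i) Y (\<lambda>x. ?d (inc i x)) (\<lambda>x. \<zero>\<^sub>Y)" if i: "i \<in> I" for i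
 proof (rule ccontr)
  assume nst: "\<not> steq (A i) Y (\<lambda>x. ?d (inc i x)) (\<lambda>x. \<zero>\<^sub>Y)"
  note Ai = d(3)[OF i] and hg = ghom_comp[OF d(4)[OF i] dg]
  let ?h = "\<lambda>x. ?d (inc i x)"
  note hm = cls_mor[OF Ai Y hg]
  have "fmo F (cls (A i) Y ?h) = fmo F (cls X Y ?d) \<bullet>\<^sub>\<S> fmo F (cls (A i) X (inc i))"
   using Fd(4)[OF Ai X Y cls_mor[OF Ai X d(4)[OF i]] dm] cmp_cls[OF Ai X Y d(4)[OF i] dg] by simp
  hence Fh: "fmo F (cls (A i) Y ?h) = zerom \<S> (fob F (A i)) (fob F Y)"
   using Fd0 S.cmp_zero_left[OF Fd(1)[OF Ai] FX FY Fd(3)[OF Ai X cls_mor[OF Ai X d(4)[OF i]]]] by simp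
  obtain n u v where db: "dual_basis (A i) n u v" using A[OF i] by (auto simp: block_def)
  obtain E z where E: "E \<in> Md" and z: "z \<in>. (tm E (A i))" "\<And>g. g \<in>. G ==> act (tm E (A i)) g z = z"
   and nn: "\<And>n. n \<in>. (tm E Y) ==>
    (\<Oplus>\<^bsub>tm E Y\<^esub>i\<in>{..<p}. act (tm E Y) (g\<^sub>0 [^]\<^sub>G i) n) \<noteq> tmap E E (A i) Y (\<lambda>x. x) ?h z"
   by (rule invariant_not_norm[OF Ai db Y hg nst]) (rule that)
  let ?t = "tmap E E (A i) Y (\<lambda>x. x) ?h"
  note EA = tm_Md[OF E Ai] and EY = tm_Md[OF E Y] and gt = ghom_tmap[OF E E Ai Y ghom_id hg]
  note tz = ghom_in[OF gt z(1)]
  have tfix: "act (tm E Y) g (?t z) = ?t z" if "g \<in>. G" for g using ghom_act[OF gt that z(1)] z(2)[OF that] by simp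
  have tc: "idm St E \<boxdot>\<^sub>St cls (A i) Y ?h = cls (tm E (A i)) (tm E Y) ?t" unfolding idm_cls[OF E]
   by (rule tmo_cls[OF E E Ai Y ghom_id hg gt]) (rule tmap_pt[OF E E Ai Y lin_id ghom_lin[OF hg]])
  have "additive_functor \<S> \<S> (ltensor \<S> (fob F E))"
   using S.ltensor_exact[OF Fd(1)[OF E]] by (simp add: exact_functor_def)
  from functor_zero_tensor[OF ctx this, of "A i" Y "cls (A i) Y ?h"]
  have Ft: "fmo F (cls (tm E (A i)) (tm E Y) ?t) = zerom \<S> (fob F (tm E (A i))) (fob F (tm E Y))"
   using E Ai Y hm Fh tc by simp
  note gz = ghom_unit[OF EA z]
  \<comment> \<open>The invariant \<open>?t z\<close> is the image of z under E \<otimes>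
    \<open>?h\<close>, so the map that it defines on the unit factors through a map killed by
    F.\<close>
  have "cls U (tm E Y) (\<lambda>x. eps x \<odot>\<^bsub>tm E Y\<^esub> ?t z) = cls U (tm E Y) (\<lambda>x. ?t (eps x \<odot>\<^bsub>tm E (A i)\<^esub> z))"
   by (rule cls_cong[OF U_Md EY ghom_comp[OF gz gt]], assumption) (rule lin_smult[OF ghom_lin[OF gt] eps_closed z(1)])
  also have "... = cls (tm E (A i)) (tm E Y) ?t \<bullet>\<^sub>St cls U (tm E (A i)) (\<lambda>x. eps x \<odot>\<^bsub>tm E (A i)\<^esub> z)"
   by (rule cmp_cls[OF U_Md EA EY gz gt, symmetric])
  finally have "fmo F (cls U (tm E Y) (\<lambda>x. eps x \<odot>\<^bsub>tm E Y\<^esub> ?t z)) = zerom \<S> (fob F U) (fob F (tm E Y))"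
   using Fd(4)[OF U_Md EA EY cls_mor[OF U_Md EA gz] cls_mor[OF EA EY gt]] Ft
    S.cmp_zero_left[OF Fd(1)[OF U_Md] Fd(1)[OF EA] Fd(1)[OF EY] Fd(3)[OF U_Md EA cls_mor[OF U_Md EA gz]]] by simp
  from unit_not_killed[OF EY tz tfix nn this] show False using nz by (auto simp: nonzero_functor_def)
 qed
 hence "steq X Y ?d (\<lambda>x. \<zero>\<^sub>Y)" by (rule zero_restrict_blocks[OF D Y dg])
 hence "steq X Y (\<lambda>x. ?d x \<oplus>\<^sub>Y f' x) (\<lambda>x. \<zero>\<^sub>Y \<oplus>\<^sub>Y f' x)"
  by (rule steq_plus[OF X Y ghom_zero[OF kY] f'(1) _ steq_refl[OF X Y f'(1)]])
 then obtain h where "lin K X Y h" "\<And>x. x \<in>. X ==> ?d x \<oplus>\<^sub>Y f' x = \<zero>\<^sub>Y \<oplus>\<^sub>Y f' x \<oplus>\<^sub>Y Tr X Y h x"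
  by (auto simp: steq_def)
 hence "steq X Y f f'" using sum ghom_in[OF f'(1)] by (auto simp: steq_def)
 thus "m = m'" using cls_eq_iff[OF X Y f(1) f'(1)] f(2) f'(2) by simp
qed

end

end

theorem proposition5p1:
  fixes p :: nat
    and G :: "('g, 'w) monoid_scheme"
    and K :: "('k, 'x) ring_scheme"
    and \<F> :: "(('g, 'k, 'u) gmod, ('g, 'k, 'u) stab_mor) ttcat"
  assumes "prime p"
    and "group G" and "cyclic_group G" and "order G = p"
    and "field K" and "ring_char K = p"
    and "universe_type TYPE('u)" and "small TYPE('u) (carrier K)"
    and \<F>_def: "\<F> = Stab G K"
  shows "(\<forall>M\<in>Ob \<F>. \<exists>(I :: 'u set) c \<iota>. small TYPE('u) I \<and>
            (\<forall>i\<in>I. compact_object TYPE('u) \<F> (c i)) \<and> is_coproduct \<F> I c M \<iota>) \<and>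
         (\<forall>x. compact_object TYPE('u) \<F> x \<and> \<not> zero_object \<F> x \<longrightarrow> faithful_functor \<F> (ltensor \<F> x)) \<and>
         (\<forall>(\<S> :: ('s, 't, 'z) ttcat_scheme) F.
            big_tt_category TYPE('u) \<S> \<and> tt_functor \<F> \<S> F \<and>
            preserves_coproducts TYPE('u) \<F> \<S> F \<and> nonzero_functor \<F> \<S> F
            \<longrightarrow> faithful_functor \<F> F) \<and>
         (\<forall>M\<in>Ob \<F>. pure_injective TYPE('u) \<F> M) \<and>
         (\<forall>M. indecomposable \<F> M \<longrightarrow> endofinite TYPE('u) \<F> M)"
proof -
  interpret G: group G by fact
  \<comment> \<open>The order of an infinite group is 0, so a prime order forces finiteness.\<close>
  have "finite (carrier G)" using assms(1,4) prime_gt_0_nat by (auto simp: order_def intro: card_ge_0_finite)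
  moreover obtain g\<^sub>0 where "g\<^sub>0 \<in> carrier G" "carrier G = range (\<lambda>n :: int. g\<^sub>0 [^]\<^sub>G n)"
    using assms(3) G.cyclic_group by blast
  ultimately interpret cyc G K "undefined :: 'u" p g\<^sub>0
    using assms by (intro cyc.intro stab.intro galg.intro galg_axioms.intro stab_axioms.intro cyc_axioms.intro) simp_all
  show ?thesis unfolding \<F>_def
  proof (intro conjI allI impI ballI; (elim conjE)?)
    fix M assume "M \<in> Ob St"
    thus "\<exists>(I :: 'u set) c \<iota>. small TYPE('u) I \<and> (\<forall>i\<in>I. compact_object TYPE('u) St (c i)) \<and> is_coproduct St I c M \<iota>"
      using coproduct_of_compacts by simp
  next
    fix x assume "compact_object TYPE('u) St x" "\<not> zero_object St x"
    thus "faithful_functor St (ltensor St x)" using ltensor_faithful by (simp add: compact_object_def)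
  next
    fix \<S> :: "('s, 't, 'z) ttcat_scheme" and F
    assume "big_tt_category TYPE('u) \<S>" "tt_functor St \<S> F" "nonzero_functor St \<S> F"
    thus "faithful_functor St F" by (rule tt_functor_faithful)
  next
    fix M assume "M \<in> Ob St"
    thus "pure_injective TYPE('u) St M" using pure_injective_all by simp
  next
    fix M assume "indecomposable St M"
    thus "endofinite TYPE('u) St M" by (rule indecomposable_endofinite)
  qed
qed

end
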